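(* Let $q\in(0,1)$. There is an isomorphism of left $\mathcal{O}(\mathbb{C}P_q^2)$-modules $$\mathcal{O}(SU_q(3)/\mathbb{T}^2)\;\cong\;\mathcal{O}(SU_q(3))\,\Box_{\mathcal{O}(U_q(2))}\,\mathcal{O}(\mathbb{C}P_q^1).$$
   Context: All algebras are unital, associative, over $\mathbb{C}$; $\otimes=\otimes_{\mathbb{C}}$; $q\in(0,1)$. **$SU_q(3)$.** $C(SU_q(3))$ is the universal $C^*$-algebra generated by $u_{ij}$, $i,j=1,2,3$, such that the matrix $\mathbf{u}=(u_{ij})$ is unitary and $\sum_{i_1,i_2,i_3=1}^3E_{i_1i_2i_3}u_{j_1i_1}u_{j_2i_2}u_{j_3i_3}=E_{j_1j_2j_3}$ for all $j_1,j_2,j_3\in\{1,2,3\}$, where $E_{i_1i_2i_3}=(-q)^{I(i_1,i_2,i_3)}$ if $i_1,i_2,i_3$ are distinct ($I$ = number of inversions) and $0$ otherwise. The following relations also hold: $u_{ij}u_{ik}=qu_{ik}u_{ij}$ and $u_{ji}u_{ki}=qu_{ki}u_{ji}$ for $j<k$; $u_{ij}u_{km}=u_{km}u_{ij}$ for $i<k$, $j>m$; $u_{ij}u_{km}-u_{km}u_{ij}=(q-q^{-1})u_{im}u_{kj}$ for $i<k$, $j<m$. $\mathcal{O}(SU_q(3))$ is the subalgebra generated by the $u_{ij}$; it is a Hopf $*$-algebra with $\Delta(u_{ij})=\sum_k u_{ik}\otimes u_{kj}$, $\varepsilon(u_{ij})=\delta_{ij}$, $S(u_{ij})=u_{ji}^*$.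 **$U_q(2)$.** $\mathcal{O}(U_q(2))$ is the $*$-algebra generated by a central unitary $u$ and by $\alpha,\gamma$ subject to $\alpha\gamma=q\gamma\alpha$, $\gamma\gamma^*=\gamma^*\gamma$, $\alpha\gamma^*=q\gamma^*\alpha$, $\alpha^*\alpha+\gamma\gamma^*=1$, $\alpha\alpha^*+q^2\gamma\gamma^*=1$. Put $$\mathbf{v}=(v_{ij})=\begin{pmatrix}u&0&0\\0&\alpha&-q\gamma^*u^*\\0&\gamma&\alpha^*u^*\end{pmatrix}.$$ It is a Hopf $*$-algebra with $\Delta(v_{ij})=\sum_kv_{ik}\otimes v_{kj}$, $\varepsilon(v_{ij})=\delta_{ij}$, $S(v_{ij})=v_{ji}^*$. The assignment $\pi(u_{ij})=v_{ij}$ defines a Hopf $*$-algebra epimorphism $\pi:\mathcal{O}(SU_q(3))\to\mathcal{O}(U_q(2))$. **Torus coactions.** $\mathcal{O}(\mathbb{T}^2)$ is the Hopf $*$-algebra of Laurent polynomials in unitary group-like $U_1,U_2$. Hopf $*$-algebra epimorphisms $\hat\pi_0:\mathcal{O}(SU_q(3))\to\mathcal{O}(\mathbb{T}^2)$ and $\hat\pi_1:\mathcal{O}(U_q(2))\to\mathcal{O}(\mathbb{T}^2)$ send $\mathbf{u}$, respectively $\mathbf{v}$, to $\mathrm{diag}(U_1,U_2,U_1^*U_2^* )$. Set $\hat\mu=(\mathrm{id}\otimes\hat\pi_0)\circ\Delta$ on $\mathcal{O}(SU_q(3))$ and $\hat\nu=(\mathrm{id}\otimes\hat\pi_1)\circ\Delta$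 on $\mathcal{O}(U_q(2))$. **The quantum spaces.** $\mathcal{O}(SU_q(3)/\mathbb{T}^2)=\{f\in\mathcal{O}(SU_q(3)):\hat\mu(f)=f\otimes1\}$ (quantum flag manifold). $\mathcal{O}(\mathbb{C}P_q^1)=\{a\in\mathcal{O}(U_q(2)):\hat\nu(a)=a\otimes1\}$, the unital $*$-subalgebra generated by $\gamma\gamma^*$ and $\alpha\gamma^*$. $\mathcal{O}(\mathbb{C}P_q^2)$ is the subalgebra of those elements of the $*$-algebra $\mathcal{O}(S^5_q)$ generated by $u_{11},u_{21},u_{31}$ that are fixed by the circle action $u_{j1}\mapsto zu_{j1}$, $z\in\mathbb{T}$; it is a subalgebra of $\mathcal{O}(SU_q(3)/\mathbb{T}^2)$, and equals the algebra of coinvariants of the right coaction $\varrho=(\mathrm{id}\otimes\pi)\circ\Delta:\mathcal{O}(SU_q(3))\to\mathcal{O}(SU_q(3))\otimes\mathcal{O}(U_q(2))$, i.e. $\{b:\varrho(b)=b\otimes 1\}$. **Cotensor product.** For a right $H$-comodule $(V,\varrho_V)$ and a left $H$-comodule $(W,\lambda_W)$ over a Hopf algebra $H$, $V\Box_HW=\{x\in V\otimes W:(\varrho_V\otimes\mathrm{id})(x)=(\mathrm{id}\otimes\lambda_W)(x)\}$. Here $\mathcal{O}(SU_q(3))$ is a right $\mathcal{O}(U_q(2))$-comodule via $\varrho$, and $\mathcal{O}(\mathbb{C}P_q^1)$ is a left $\mathcal{O}(U_q(2))$-comodule via the restriction of $\Delta_{U_q(2)}$ (it is a left coideal subalgebra: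 $\Delta(\mathcal{O}(\mathbb{C}P_q^1))\subseteq\mathcal{O}(U_q(2))\otimes\mathcal{O}(\mathbb{C}P_q^1)$). $\mathcal{O}(\mathbb{C}P_q^2)$ acts on $\mathcal{O}(SU_q(3)/\mathbb{T}^2)$ by left multiplication and on the cotensor product by left multiplication on the first tensor factor. *)

theory Defs
  imports Complex_Main "HOL-Library.Poly_Mapping" "HOL-Library.Product_Plus" "HOL-Library.Countable"
    "HOL-Algebra.Module" "HOL-Algebra.QuotRing"
begin

section \<open>Complex star-algebras\<close>

record 'a star_alg = "(complex, 'a) module" +
  star :: "'a \<Rightarrow> 'a"

text \<open>Linear maps and unital star-homomorphisms. They are made extensional (undefined outside the
  carrier), so that a map determined on generators is unique and can be picked by a definite
  description.\<close>

definition linear_maps :: "('a, 'm) star_alg_scheme \<Rightarrow> ('b, 'n) star_alg_scheme \<Rightarrow> ('a \<Rightarrow> 'b) set" where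
  "linear_maps V W = {f \<in> carrier V \<rightarrow>\<^sub>E carrier W.
     (\<forall>x\<in>carrier V. \<forall>y\<in>carrier V. f (x \<oplus>\<^bsub>V\<^esub> y) = f x \<oplus>\<^bsub>W\<^esub> f y) \<and>
     (\<forall>c. \<forall>x\<in>carrier V. f (c \<odot>\<^bsub>V\<^esub> x) = c \<odot>\<^bsub>W\<^esub> f x)}"

definition star_homs :: "('a, 'm) star_alg_scheme \<Rightarrow> ('b, 'n) star_alg_scheme \<Rightarrow> ('a \<Rightarrow> 'b) set" where
  "star_homs A B = {f \<in> linear_maps A B. f \<in> ring_hom A B \<and>
     (\<forall>x\<in>carrier A. f (star A x) = star B (f x))}"

inductive_set alg_gen :: "('a, 'm) star_alg_scheme \<Rightarrow> 'a set \<Rightarrow> 'a set"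
  for A (structure) and S where
  gen: "x \<in> S \<Longrightarrow> x \<in> alg_gen A S"
| one: "\<one> \<in> alg_gen A S"
| add: "x \<in> alg_gen A S \<Longrightarrow> y \<in> alg_gen A S \<Longrightarrow> x \<oplus> y \<in> alg_gen A S"
| mult: "x \<in> alg_gen A S \<Longrightarrow> y \<in> alg_gen A S \<Longrightarrow> x \<otimes> y \<in> alg_gen A S"
| smult: "x \<in> alg_gen A S \<Longrightarrow> c \<odot> x \<in> alg_gen A S"

definition star_alg_gen :: "('a, 'm) star_alg_scheme \<Rightarrow> 'a set \<Rightarrow> 'a set" where
  "star_alg_gen A S = alg_gen A (S \<union> star A ` S)"

text \<open>The quotient by a two-sided ideal \<open>I\<close> with \<open>star A ` I = I\<close>.\<close>

definition star_quot :: "('a, 'm) star_alg_scheme \<Rightarrow> 'a set \<Rightarrow> 'a set star_alg" where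
  "star_quot A I = \<lparr>carrier = carrier (A Quot I), mult = mult (A Quot I), one = one (A Quot I),
     zero = zero (A Quot I), add = add (A Quot I),
     smult = (\<lambda>c X. \<Union>x\<in>X. I +>\<^bsub>A\<^esub> (c \<odot>\<^bsub>A\<^esub> x)),
     star = (\<lambda>X. star A ` X)\<rparr>"

text \<open>The star-algebra of a monoid (written additively) with an involutive
  anti-automorphism \<open>invol\<close>.\<close>

definition monoid_star_alg :: "('m \<Rightarrow> 'm) \<Rightarrow> ('m::monoid_add \<Rightarrow>\<^sub>0 complex) star_alg" where
  "monoid_star_alg invol = \<lparr>carrier = UNIV, mult = (*), one = 1, zero = 0, add = (+),
     smult = (\<lambda>c p. Poly_Mapping.single 0 c * p),
     star = (\<lambda>p. \<Sum>m\<in>Poly_Mapping.keys p.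
                 Poly_Mapping.single (invol m) (cnj (Poly_Mapping.lookup p m)))\<rparr>"


section \<open>Free star-algebras and presentations\<close>

text \<open>The letter \<open>(g, False)\<close> is the generator \<open>g\<close>, and \<open>(g, True)\<close> is its adjoint.\<close>

datatype 'g star_word = Word (letters: "('g \<times> bool) list")

instantiation star_word :: (type) monoid_add
begin
definition zero_star_word :: "'a star_word" where "0 = Word []"
definition plus_star_word :: "'a star_word \<Rightarrow> 'a star_word \<Rightarrow> 'a star_word" where
  "v + w = Word (letters v @ letters w)"
instance by standard (auto simp: zero_star_word_def plus_star_word_def)
end

type_synonym 'g free = "'g star_word \<Rightarrow>\<^sub>0 complex"

definition word_star :: "'g star_word \<Rightarrow> 'g star_word" where
  "word_star w = Word (rev (map (\<lambda>(g, b). (g, \<not> b)) (letters w)))"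

definition free_alg :: "'g free star_alg" where
  "free_alg = monoid_star_alg word_star"

definition gen :: "'g \<Rightarrow> 'g free" where
  "gen g = Poly_Mapping.single (Word [(g, False)]) 1"

definition gen_star :: "'g \<Rightarrow> 'g free" where
  "gen_star g = Poly_Mapping.single (Word [(g, True)]) 1"

definition const :: "complex \<Rightarrow> 'g free" where
  "const c = Poly_Mapping.single 0 c"

text \<open>The universal star-algebra with relations \<open>r = 0\<close> for \<open>r \<in> R\<close>.\<close>

definition presented_alg :: "'g free set \<Rightarrow> 'g free set star_alg" where
  "presented_alg R = star_quot free_alg (Idl\<^bsub>free_alg\<^esub> (R \<union> star free_alg ` R))"


section \<open>Universal C*-algebras\<close>

text \<open>The Hilbert space is the space of square summable sequences; an operator on it is a function
  whose values outside \<open>ell2\<close> are irrelevant.\<close>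

definition ell2 :: "(nat \<Rightarrow> complex) set" where
  "ell2 = {x. summable (\<lambda>n. (cmod (x n))\<^sup>2)}"

definition ell2_inner :: "(nat \<Rightarrow> complex) \<Rightarrow> (nat \<Rightarrow> complex) \<Rightarrow> complex" where
  "ell2_inner x y = suminf (\<lambda>n. cnj (x n) * y n)"

definition ell2_norm :: "(nat \<Rightarrow> complex) \<Rightarrow> real" where
  "ell2_norm x = sqrt (suminf (\<lambda>n. (cmod (x n))\<^sup>2))"

definition bounded_op :: "((nat \<Rightarrow> complex) \<Rightarrow> (nat \<Rightarrow> complex)) \<Rightarrow> bool" where
  "bounded_op T \<longleftrightarrow> (\<forall>x\<in>ell2. T x \<in> ell2) \<and>
     (\<forall>x\<in>ell2. \<forall>y\<in>ell2. T (\<lambda>n. x n + y n) = (\<lambda>n. T x n + T y n)) \<and>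
     (\<forall>c. \<forall>x\<in>ell2. T (\<lambda>n. c * x n) = (\<lambda>n. c * T x n)) \<and>
     (\<exists>C. \<forall>x\<in>ell2. ell2_norm (T x) \<le> C * ell2_norm x)"

text \<open>A star-representation of the free star-algebra by bounded operators, given by the images of
  all letters.\<close>

definition star_rep :: "('g \<times> bool \<Rightarrow> (nat \<Rightarrow> complex) \<Rightarrow> (nat \<Rightarrow> complex)) \<Rightarrow> bool" where
  "star_rep \<sigma> \<longleftrightarrow> (\<forall>l. bounded_op (\<sigma> l)) \<and>
     (\<forall>g. \<forall>x\<in>ell2. \<forall>y\<in>ell2. ell2_inner (\<sigma> (g, False) x) y = ell2_inner x (\<sigma> (g, True) y))"

definition rep_eval ::
  "('g \<times> bool \<Rightarrow> (nat \<Rightarrow> complex) \<Rightarrow> (nat \<Rightarrow> complex)) \<Rightarrow> 'g free \<Rightarrow> (nat \<Rightarrow> complex) \<Rightarrow> (nat \<Rightarrow> complex)" where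
  "rep_eval \<sigma> p x = (\<lambda>n. \<Sum>w\<in>Poly_Mapping.keys p. Poly_Mapping.lookup p w * foldr \<sigma> (letters w) x n)"

text \<open>The universal C*-algebra with relations \<open>R\<close> is the completion of the free star-algebra, modulo
  the kernel below, in the norm \<open>p \<mapsto> sup \<parallel>\<sigma>(p)\<parallel>\<close>, where \<open>\<sigma>\<close> runs over the Hilbert space
  representations satisfying \<open>R\<close>. Here there are countably many generators, so cyclic
  representations are separable and, after countable amplification, act on \<open>ell2\<close>; hence \<open>ell2\<close>
  suffices. The quotient \<open>cstar_dense R\<close> is the dense star-subalgebra generated by the generators.\<close>

definition cstar_kernel :: "'g::countable free set \<Rightarrow> 'g free set" where
  "cstar_kernel R = {p. \<forall>\<sigma>. star_rep \<sigma> \<and> (\<forall>r\<in>R. \<forall>x\<in>ell2. rep_eval \<sigma> r x = (\<lambda>n. 0)) \<longrightarrow>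
     (\<forall>x\<in>ell2. rep_eval \<sigma> p x = (\<lambda>n. 0))}"

definition cstar_dense :: "'g::countable free set \<Rightarrow> 'g free set star_alg" where
  "cstar_dense R = star_quot free_alg (cstar_kernel R)"


section \<open>Tensor products\<close>

text \<open>\<open>V \<otimes> W\<close> is the free complex vector space on pairs, modulo the span \<open>tensor_null\<close> of the
  bilinearity relations.\<close>

definition cscale :: "complex \<Rightarrow> ('k \<Rightarrow>\<^sub>0 complex) \<Rightarrow> ('k \<Rightarrow>\<^sub>0 complex)" where
  "cscale c p = Poly_Mapping.map ((*) c) p"

definition tensor_free :: "('a, 'm) star_alg_scheme \<Rightarrow> ('b, 'n) star_alg_scheme \<Rightarrow> ('a \<times> 'b \<Rightarrow>\<^sub>0 complex) set" where
  "tensor_free V W = {p. Poly_Mapping.keys p \<subseteq> carrier V \<times> carrier W}"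

inductive_set tensor_null ::
  "('a, 'm) star_alg_scheme \<Rightarrow> ('b, 'n) star_alg_scheme \<Rightarrow> ('a \<times> 'b \<Rightarrow>\<^sub>0 complex) set"
  for V W where
  zero: "0 \<in> tensor_null V W"
| add: "p \<in> tensor_null V W \<Longrightarrow> r \<in> tensor_null V W \<Longrightarrow> p + r \<in> tensor_null V W"
| scale: "p \<in> tensor_null V W \<Longrightarrow> cscale c p \<in> tensor_null V W"
| add_left: "x \<in> carrier V \<Longrightarrow> x' \<in> carrier V \<Longrightarrow> y \<in> carrier W \<Longrightarrow>
    Poly_Mapping.single (x \<oplus>\<^bsub>V\<^esub> x', y) 1 - Poly_Mapping.single (x, y) 1
      - Poly_Mapping.single (x', y) 1 \<in> tensor_null V W"
| add_right: "x \<in> carrier V \<Longrightarrow> y \<in> carrier W \<Longrightarrow> y' \<in> carrier W \<Longrightarrow>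
    Poly_Mapping.single (x, y \<oplus>\<^bsub>W\<^esub> y') 1 - Poly_Mapping.single (x, y) 1
      - Poly_Mapping.single (x, y') 1 \<in> tensor_null V W"
| scale_left: "x \<in> carrier V \<Longrightarrow> y \<in> carrier W \<Longrightarrow>
    Poly_Mapping.single (c \<odot>\<^bsub>V\<^esub> x, y) 1 - Poly_Mapping.single (x, y) c \<in> tensor_null V W"
| scale_right: "x \<in> carrier V \<Longrightarrow> y \<in> carrier W \<Longrightarrow>
    Poly_Mapping.single (x, c \<odot>\<^bsub>W\<^esub> y) 1 - Poly_Mapping.single (x, y) c \<in> tensor_null V W"

definition tensor_class ::
  "('a, 'm) star_alg_scheme \<Rightarrow> ('b, 'n) star_alg_scheme \<Rightarrow> ('a \<times> 'b \<Rightarrow>\<^sub>0 complex) \<Rightarrow> ('a \<times> 'b \<Rightarrow>\<^sub>0 complex) set" where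
  "tensor_class V W p = {p + n | n. n \<in> tensor_null V W}"

definition pure_tensor ::
  "('a, 'm) star_alg_scheme \<Rightarrow> ('b, 'n) star_alg_scheme \<Rightarrow> 'a \<Rightarrow> 'b \<Rightarrow> ('a \<times> 'b \<Rightarrow>\<^sub>0 complex) set" where
  "pure_tensor V W x y = tensor_class V W (Poly_Mapping.single (x, y) 1)"

text \<open>The tensor product of star-algebras: \<open>(x \<otimes> y)(x' \<otimes> y') = xx' \<otimes> yy'\<close> and
  \<open>(x \<otimes> y)\<^sup>* = x\<^sup>* \<otimes> y\<^sup>*\<close>.\<close>

definition tensor ::
  "('a, 'm) star_alg_scheme \<Rightarrow> ('b, 'n) star_alg_scheme \<Rightarrow> ('a \<times> 'b \<Rightarrow>\<^sub>0 complex) set star_alg" where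
  "tensor V W = \<lparr>carrier = tensor_class V W ` tensor_free V W,
     mult = (\<lambda>X Y. \<Union>p\<in>X. \<Union>r\<in>Y. tensor_class V W
       (\<Sum>s\<in>Poly_Mapping.keys p. \<Sum>t\<in>Poly_Mapping.keys r.
          Poly_Mapping.single (fst s \<otimes>\<^bsub>V\<^esub> fst t, snd s \<otimes>\<^bsub>W\<^esub> snd t)
            (Poly_Mapping.lookup p s * Poly_Mapping.lookup r t))),
     one = pure_tensor V W \<one>\<^bsub>V\<^esub> \<one>\<^bsub>W\<^esub>,
     zero = tensor_class V W 0,
     add = (\<lambda>X Y. \<Union>p\<in>X. \<Union>r\<in>Y. tensor_class V W (p + r)),
     smult = (\<lambda>c X. \<Union>p\<in>X. tensor_class V W (cscale c p)),
     star = (\<lambda>X. \<Union>p\<in>X. tensor_class V W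
       (\<Sum>s\<in>Poly_Mapping.keys p. Poly_Mapping.single (star V (fst s), star W (snd s))
          (cnj (Poly_Mapping.lookup p s))))\<rparr>"

text \<open>The linear map \<open>f \<otimes> g : V \<otimes> W \<rightarrow> V' \<otimes> W'\<close>.\<close>

definition tensor_map ::
  "('a, 'm) star_alg_scheme \<Rightarrow> ('b, 'n) star_alg_scheme \<Rightarrow> ('c, 'k) star_alg_scheme \<Rightarrow> ('d, 'l) star_alg_scheme \<Rightarrow>
   ('a \<Rightarrow> 'c) \<Rightarrow> ('b \<Rightarrow> 'd) \<Rightarrow> ('a \<times> 'b \<Rightarrow>\<^sub>0 complex) set \<Rightarrow> ('c \<times> 'd \<Rightarrow>\<^sub>0 complex) set" where
  "tensor_map V W V' W' f g = (THE h. h \<in> linear_maps (tensor V W) (tensor V' W') \<and>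
     (\<forall>x\<in>carrier V. \<forall>y\<in>carrier W. h (pure_tensor V W x y) = pure_tensor V' W' (f x) (g y)))"

text \<open>The canonical map \<open>(V \<otimes> W) \<otimes> Z \<rightarrow> V \<otimes> (W \<otimes> Z)\<close>.\<close>

definition tensor_assoc ::
  "('a, 'm) star_alg_scheme \<Rightarrow> ('b, 'n) star_alg_scheme \<Rightarrow> ('c, 'k) star_alg_scheme \<Rightarrow>
   (('a \<times> 'b \<Rightarrow>\<^sub>0 complex) set \<times> 'c \<Rightarrow>\<^sub>0 complex) set \<Rightarrow> ('a \<times> ('b \<times> 'c \<Rightarrow>\<^sub>0 complex) set \<Rightarrow>\<^sub>0 complex) set" where
  "tensor_assoc V W Z = (THE h. h \<in> linear_maps (tensor (tensor V W) Z) (tensor V (tensor W Z)) \<and>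
     (\<forall>x\<in>carrier V. \<forall>y\<in>carrier W. \<forall>z\<in>carrier Z.
        h (pure_tensor (tensor V W) Z (pure_tensor V W x y) z) = pure_tensor V (tensor W Z) x (pure_tensor W Z y z)))"

text \<open>The cotensor product of a right \<open>H\<close>-comodule \<open>(V, \<rho>)\<close> and a left \<open>H\<close>-comodule \<open>(W, \<kappa>)\<close>.\<close>

definition cotensor ::
  "('a, 'm) star_alg_scheme \<Rightarrow> ('a \<Rightarrow> ('a \<times> 'h \<Rightarrow>\<^sub>0 complex) set) \<Rightarrow> ('h, 'k) star_alg_scheme \<Rightarrow>
   ('b, 'n) star_alg_scheme \<Rightarrow> ('b \<Rightarrow> ('h \<times> 'b \<Rightarrow>\<^sub>0 complex) set) \<Rightarrow> ('a \<times> 'b \<Rightarrow>\<^sub>0 complex) set set" where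
  "cotensor V \<rho> H W \<kappa> = {X \<in> carrier (tensor V W).
     tensor_assoc V H W (tensor_map V W (tensor V H) W \<rho> (\<lambda>y. y) X)
       = tensor_map V W V (tensor H W) (\<lambda>x. x) \<kappa> X}"


section \<open>The quantum group SU_q(3)\<close>

datatype idx = I1 | I2 | I3

lemma UNIV_idx: "UNIV = {I1, I2, I3}"
  using idx.exhaust by auto

instance idx :: finite
  by standard (simp add: UNIV_idx)

fun idx_pos :: "idx \<Rightarrow> nat" where
  "idx_pos I1 = 1" | "idx_pos I2 = 2" | "idx_pos I3 = 3"

definition inversions :: "idx \<Rightarrow> idx \<Rightarrow> idx \<Rightarrow> nat" where
  "inversions a b c = of_bool (idx_pos a > idx_pos b) + of_bool (idx_pos a > idx_pos c) + of_bool (idx_pos b > idx_pos c)"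

definition E_sym :: "real \<Rightarrow> idx \<Rightarrow> idx \<Rightarrow> idx \<Rightarrow> complex" where
  "E_sym q a b c = (if distinct [a, b, c] then (- of_real q) ^ inversions a b c else 0)"

type_synonym su_gen = "idx \<times> idx"

instance idx :: countable
proof (rule countable_classI[of idx_pos])
  show "x = y" if "idx_pos x = idx_pos y" for x y
    using that by (cases x; cases y) simp_all
qed

definition SU_relations :: "real \<Rightarrow> su_gen free set" where
  "SU_relations q =
     {(\<Sum>k\<in>UNIV. gen (i, k) * gen_star (j, k)) - const (of_bool (i = j)) | i j. True} \<union>
     {(\<Sum>k\<in>UNIV. gen_star (k, i) * gen (k, j)) - const (of_bool (i = j)) | i j. True} \<union>
     {(\<Sum>a\<in>UNIV. \<Sum>b\<in>UNIV. \<Sum>c\<in>UNIV. const (E_sym q a b c) * gen (i, a) * gen (j, b) * gen (k, c))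
        - const (E_sym q i j k) | i j k. True}"

definition su_u :: "real \<Rightarrow> idx \<Rightarrow> idx \<Rightarrow> su_gen free set" where
  "su_u q i j = cstar_kernel (SU_relations q) +>\<^bsub>free_alg\<^esub> gen (i, j)"

text \<open>The subalgebra of the universal C*-algebra generated by the \<open>su_u q i j\<close>. It is closed under the
  star, as the relations express the adjoint of each \<open>su_u q i j\<close> as a polynomial in the generators.\<close>

definition SU :: "real \<Rightarrow> su_gen free set star_alg" where
  "SU q = (let C = cstar_dense (SU_relations q)
           in C\<lparr>carrier := alg_gen C {su_u q i j | i j. True}\<rparr>)"

definition Delta_SU :: "real \<Rightarrow> su_gen free set \<Rightarrow> (su_gen free set \<times> su_gen free set \<Rightarrow>\<^sub>0 complex) set" where
  "Delta_SU q = (THE f. f \<in> star_homs (SU q) (tensor (SU q) (SU q)) \<and>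
     (\<forall>i j. f (su_u q i j) = (\<Oplus>\<^bsub>tensor (SU q) (SU q)\<^esub>k\<in>UNIV. pure_tensor (SU q) (SU q) (su_u q i k) (su_u q k j))))"


section \<open>The quantum group U_q(2)\<close>

datatype uq2_gen = Uu | Alpha | Gamma

definition U2_relations :: "real \<Rightarrow> uq2_gen free set" where
  "U2_relations q =
    (let u = gen Uu; us = gen_star Uu; \<alpha> = gen Alpha; \<alpha>s = gen_star Alpha;
         \<gamma> = gen Gamma; \<gamma>s = gen_star Gamma; q' = const (of_real q)
     in {u * us - 1, us * u - 1,
         u * \<alpha> - \<alpha> * u, u * \<alpha>s - \<alpha>s * u, u * \<gamma> - \<gamma> * u, u * \<gamma>s - \<gamma>s * u,
         \<alpha> * \<gamma> - q' * \<gamma> * \<alpha>, \<gamma> * \<gamma>s - \<gamma>s * \<gamma>, \<alpha> * \<gamma>s - q' * \<gamma>s * \<alpha>,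
         \<alpha>s * \<alpha> + \<gamma> * \<gamma>s - 1, \<alpha> * \<alpha>s + q' * q' * \<gamma> * \<gamma>s - 1})"

definition U2 :: "real \<Rightarrow> uq2_gen free set star_alg" where
  "U2 q = presented_alg (U2_relations q)"

fun v_free :: "real \<Rightarrow> idx \<Rightarrow> idx \<Rightarrow> uq2_gen free" where
  "v_free q I1 I1 = gen Uu"
| "v_free q I2 I2 = gen Alpha"
| "v_free q I2 I3 = const (- of_real q) * gen_star Gamma * gen_star Uu"
| "v_free q I3 I2 = gen Gamma"
| "v_free q I3 I3 = gen_star Alpha * gen_star Uu"
| "v_free q _ _ = 0"

definition u2_v :: "real \<Rightarrow> idx \<Rightarrow> idx \<Rightarrow> uq2_gen free set" where
  "u2_v q i j = Idl\<^bsub>free_alg\<^esub> (U2_relations q \<union> star free_alg ` U2_relations q) +>\<^bsub>free_alg\<^esub> v_free q i j"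

definition Delta_U2 :: "real \<Rightarrow> uq2_gen free set \<Rightarrow> (uq2_gen free set \<times> uq2_gen free set \<Rightarrow>\<^sub>0 complex) set" where
  "Delta_U2 q = (THE f. f \<in> star_homs (U2 q) (tensor (U2 q) (U2 q)) \<and>
     (\<forall>i j. f (u2_v q i j) = (\<Oplus>\<^bsub>tensor (U2 q) (U2 q)\<^esub>k\<in>UNIV. pure_tensor (U2 q) (U2 q) (u2_v q i k) (u2_v q k j))))"

definition proj :: "real \<Rightarrow> su_gen free set \<Rightarrow> uq2_gen free set" where
  "proj q = (THE f. f \<in> star_homs (SU q) (U2 q) \<and> (\<forall>i j. f (su_u q i j) = u2_v q i j))"

text \<open>The right coaction \<open>\<rho> = (id \<otimes> proj) \<circ> Delta_SU\<close> of \<open>U2 q\<close> on \<open>SU q\<close>.\<close>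

definition rho :: "real \<Rightarrow> su_gen free set \<Rightarrow> (su_gen free set \<times> uq2_gen free set \<Rightarrow>\<^sub>0 complex) set" where
  "rho q x = tensor_map (SU q) (SU q) (SU q) (U2 q) (\<lambda>y. y) (proj q) (Delta_SU q x)"


section \<open>Torus coactions and quantum spaces\<close>

text \<open>Laurent polynomials in two variables.\<close>

definition torus :: "(int \<times> int \<Rightarrow>\<^sub>0 complex) star_alg" where
  "torus = monoid_star_alg uminus"

fun torus_diag :: "idx \<Rightarrow> idx \<Rightarrow> (int \<times> int \<Rightarrow>\<^sub>0 complex)" where
  "torus_diag I1 I1 = Poly_Mapping.single (1, 0) 1"
| "torus_diag I2 I2 = Poly_Mapping.single (0, 1) 1"
| "torus_diag I3 I3 = Poly_Mapping.single (-1, -1) 1"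
| "torus_diag _ _ = 0"

definition pi0 :: "real \<Rightarrow> su_gen free set \<Rightarrow> (int \<times> int \<Rightarrow>\<^sub>0 complex)" where
  "pi0 q = (THE f. f \<in> star_homs (SU q) torus \<and> (\<forall>i j. f (su_u q i j) = torus_diag i j))"

definition pi1 :: "real \<Rightarrow> uq2_gen free set \<Rightarrow> (int \<times> int \<Rightarrow>\<^sub>0 complex)" where
  "pi1 q = (THE f. f \<in> star_homs (U2 q) torus \<and> (\<forall>i j. f (u2_v q i j) = torus_diag i j))"

definition mu :: "real \<Rightarrow> su_gen free set \<Rightarrow> (su_gen free set \<times> (int \<times> int \<Rightarrow>\<^sub>0 complex) \<Rightarrow>\<^sub>0 complex) set" where
  "mu q x = tensor_map (SU q) (SU q) (SU q) torus (\<lambda>y. y) (pi0 q) (Delta_SU q x)"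

definition nu :: "real \<Rightarrow> uq2_gen free set \<Rightarrow> (uq2_gen free set \<times> (int \<times> int \<Rightarrow>\<^sub>0 complex) \<Rightarrow>\<^sub>0 complex) set" where
  "nu q x = tensor_map (U2 q) (U2 q) (U2 q) torus (\<lambda>y. y) (pi1 q) (Delta_U2 q x)"

definition flag :: "real \<Rightarrow> su_gen free set star_alg" where
  "flag q = (SU q)\<lparr>carrier := {f \<in> carrier (SU q). mu q f = pure_tensor (SU q) torus f \<one>\<^bsub>torus\<^esub>}\<rparr>"

definition CP1 :: "real \<Rightarrow> uq2_gen free set star_alg" where
  "CP1 q = (U2 q)\<lparr>carrier := {a \<in> carrier (U2 q). nu q a = pure_tensor (U2 q) torus a \<one>\<^bsub>torus\<^esub>}\<rparr>"

text \<open>The left coaction of \<open>U2 q\<close> on \<open>CP1 q\<close>: the restriction of \<open>Delta_U2 q\<close>, viewed as a map into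
  \<open>tensor (U2 q) (CP1 q)\<close> through the canonical injection into \<open>tensor (U2 q) (U2 q)\<close>.\<close>

definition CP1_coaction :: "real \<Rightarrow> uq2_gen free set \<Rightarrow> (uq2_gen free set \<times> uq2_gen free set \<Rightarrow>\<^sub>0 complex) set" where
  "CP1_coaction q a = (THE X. X \<in> carrier (tensor (U2 q) (CP1 q)) \<and>
     tensor_map (U2 q) (CP1 q) (U2 q) (U2 q) (\<lambda>y. y) (\<lambda>y. y) X = Delta_U2 q a)"

definition S5 :: "real \<Rightarrow> su_gen free set star_alg" where
  "S5 q = (SU q)\<lparr>carrier := star_alg_gen (SU q) {su_u q j I1 | j. True}\<rparr>"

definition circle_action :: "real \<Rightarrow> complex \<Rightarrow> su_gen free set \<Rightarrow> su_gen free set" where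
  "circle_action q z = (THE f. f \<in> star_homs (S5 q) (S5 q) \<and>
     (\<forall>j. f (su_u q j I1) = z \<odot>\<^bsub>S5 q\<^esub> su_u q j I1))"

definition CP2 :: "real \<Rightarrow> su_gen free set star_alg" where
  "CP2 q = (SU q)\<lparr>carrier := {b \<in> carrier (S5 q). \<forall>z. cmod z = 1 \<longrightarrow> circle_action q z b = b}\<rparr>"

definition SU_cotensor_CP1 :: "real \<Rightarrow> (su_gen free set \<times> uq2_gen free set \<Rightarrow>\<^sub>0 complex) set star_alg" where
  "SU_cotensor_CP1 q = (tensor (SU q) (CP1 q))
     \<lparr>carrier := cotensor (SU q) (rho q) (U2 q) (CP1 q) (CP1_coaction q)\<rparr>"

definition flag_act :: "real \<Rightarrow> su_gen free set \<Rightarrow> su_gen free set \<Rightarrow> su_gen free set" where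
  "flag_act q b f = b \<otimes>\<^bsub>SU q\<^esub> f"

definition cotensor_act :: "real \<Rightarrow> su_gen free set \<Rightarrow>
  (su_gen free set \<times> uq2_gen free set \<Rightarrow>\<^sub>0 complex) set \<Rightarrow> (su_gen free set \<times> uq2_gen free set \<Rightarrow>\<^sub>0 complex) set" where
  "cotensor_act q b = tensor_map (SU q) (CP1 q) (SU q) (CP1 q) (\<lambda>a. b \<otimes>\<^bsub>SU q\<^esub> a) (\<lambda>y. y)"


section \<open>Left modules over noncommutative rings\<close>

locale left_module = R?: ring R + M?: abelian_group M
  for R :: "('r, 'm) ring_scheme" (structure) and M :: "('a, 'n) ring_scheme" (structure) +
  fixes act :: "'r \<Rightarrow> 'a \<Rightarrow> 'a"
  assumes act_closed: "r \<in> carrier R \<Longrightarrow> x \<in> carrier M \<Longrightarrow> act r x \<in> carrier M"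
    and act_add_left: "r \<in> carrier R \<Longrightarrow> s \<in> carrier R \<Longrightarrow> x \<in> carrier M \<Longrightarrow>
      act (r \<oplus>\<^bsub>R\<^esub> s) x = act r x \<oplus>\<^bsub>M\<^esub> act s x"
    and act_add_right: "r \<in> carrier R \<Longrightarrow> x \<in> carrier M \<Longrightarrow> y \<in> carrier M \<Longrightarrow>
      act r (x \<oplus>\<^bsub>M\<^esub> y) = act r x \<oplus>\<^bsub>M\<^esub> act r y"
    and act_mult: "r \<in> carrier R \<Longrightarrow> s \<in> carrier R \<Longrightarrow> x \<in> carrier M \<Longrightarrow>
      act (r \<otimes>\<^bsub>R\<^esub> s) x = act r (act s x)"
    and act_one: "x \<in> carrier M \<Longrightarrow> act \<one>\<^bsub>R\<^esub> x = x"

definition left_module_iso ::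
  "('r, 'm) ring_scheme \<Rightarrow> ('a, 'n) ring_scheme \<Rightarrow> ('r \<Rightarrow> 'a \<Rightarrow> 'a) \<Rightarrow>
   ('b, 'k) ring_scheme \<Rightarrow> ('r \<Rightarrow> 'b \<Rightarrow> 'b) \<Rightarrow> ('a \<Rightarrow> 'b) \<Rightarrow> bool" where
  "left_module_iso R M actM N actN \<phi> \<longleftrightarrow>
     left_module R M actM \<and> left_module R N actN \<and> bij_betw \<phi> (carrier M) (carrier N) \<and>
     (\<forall>x\<in>carrier M. \<forall>y\<in>carrier M. \<phi> (x \<oplus>\<^bsub>M\<^esub> y) = \<phi> x \<oplus>\<^bsub>N\<^esub> \<phi> y) \<and>
     (\<forall>r\<in>carrier R. \<forall>x\<in>carrier M. \<phi> (actM r x) = actN r (\<phi> x))"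

end

theory Submission
  imports Defs "HOL-Analysis.Infinite_Sum"
begin

text \<open>Write \<open>A\<close>, \<open>H\<close>, \<open>C\<close> and \<open>T\<close> for the algebras of the quantum groups \<open>SU_q(3)\<close> and \<open>U_q(2)\<close>, of the quantum
  projective line and of the torus. The isomorphism is the coaction \<open>\<rho>\<close> itself, and its inverse is
  \<open>id \<otimes> \<epsilon>\<close>. The torus coaction factors through the coaction of \<open>U_q(2)\<close>, that is
  \<open>\<mu> = (id \<otimes> \<pi>\<^sub>1) \<circ> \<rho>\<close>, and therefore \<open>(id \<otimes> \<nu>) \<circ> \<rho> = (\<rho> \<otimes> id) \<circ> \<mu>\<close> (\<open>rho_nu\<close>). For an
  element \<open>f\<close> of the flag algebra this says that \<open>\<rho>(f)\<close> is invariant under the torus in its second leg,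
  so it lies in \<open>A \<otimes> C\<close> (\<open>tI_tE\<close>), and coassociativity puts it into the cotensor product. Conversely,
  an element \<open>X\<close> of the cotensor product satisfies \<open>X = \<rho>((id \<otimes> \<epsilon>) X)\<close> (\<open>rho_flag_inv\<close>), and
  \<open>(id \<otimes> \<epsilon>) X\<close> belongs to the flag algebra because \<open>\<pi>\<^sub>1\<close> restricts to \<open>\<epsilon>\<close> on \<open>C\<close> (\<open>pi1_C\<close>). The map is
  linear over the algebra of the quantum projective plane because \<open>\<rho>(b) = b \<otimes> 1\<close> for its elements
  \<open>b\<close> (\<open>CP2_D\<close>), so that \<open>\<rho>(b f) = (b \<otimes> 1) \<rho>(f)\<close>.

  Most of the work is in showing that the maps just named exist. The algebra \<open>A\<close> sits in a universal
  C*-algebra, so a star-homomorphism out of \<open>A\<close> must vanish on every polynomial in the generators that is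
  annihilated by all Hilbert space representations of the relations; it is not enough to check the
  relations. For the comultiplication, two representations on \<open>ell2\<close> are combined into one on the Hilbert
  space tensor product, identified with \<open>ell2\<close> by a pairing of the indices; products of matrix coefficients
  of the two factors separate the points of \<open>A \<otimes> A\<close>, so an element of the kernel is sent to zero
  (\<open>tensor_separating\<close>, \<open>delta_free_kernel\<close>). For the projection \<open>A \<rightarrow> H\<close>, the target is a purely algebraic
  quotient of a free algebra, and one needs that \<open>H\<close> has enough Hilbert space representations. Ordered
  monomials span \<open>H\<close> (\<open>u2_span_all\<close>). In the weighted shift representations, indexed by two complex numbers
  of modulus one, the matrix entries of these monomials along a diagonal are distinct characters of a
  semigroup up to a common factor, and distinct characters are linearly independent (\<open>U2_separated\<close>).

  Two further points need an argument. The coaction on \<open>C\<close> is defined as a preimage under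
  \<open>H \<otimes> C \<rightarrow> H \<otimes> H\<close>; the projection \<open>expect\<close> of \<open>H\<close> onto its subspace \<open>C\<close> of torus weight zero splits
  this inclusion. The quantum projective plane is defined by invariance under a circle action, while its
  coinvariance under \<open>\<rho>\<close> is what is used. The algebra of the quantum sphere is spanned by elements with \<open>\<rho>(b) = b \<otimes> u\<^sup>k\<close>, on which \<open>z\<close> acts by \<open>z\<^sup>k\<close>; averaging over the \<open>N\<close>-th
  roots of unity for large \<open>N\<close> removes all components with \<open>k \<noteq> 0\<close> (\<open>orbit_sum_span\<close>).\<close>

section \<open>Complex vector spaces and tensor products\<close>

text \<open>Spaces, algebras and tensor products share one record type, so that a vector space is a record of which
  only the additive group and the scalar multiplication matter.\<close>

locale complex_space = abelian_group V for V :: "('a, 'm) star_alg_scheme" (structure) +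
  assumes smult_closed [simp, intro]: "x \<in> carrier V \<Longrightarrow> c \<odot> x \<in> carrier V"
    and smult_add_scalar: "x \<in> carrier V \<Longrightarrow> (c + d) \<odot> x = c \<odot> x \<oplus> d \<odot> x"
    and smult_add: "x \<in> carrier V \<Longrightarrow> y \<in> carrier V \<Longrightarrow> c \<odot> (x \<oplus> y) = c \<odot> x \<oplus> c \<odot> y"
    and smult_smult [simp]: "x \<in> carrier V \<Longrightarrow> c \<odot> (d \<odot> x) = (c * d) \<odot> x"
    and smult_one [simp]: "x \<in> carrier V \<Longrightarrow> 1 \<odot> x = x"
begin

lemma smult_zero_scalar [simp]: "x \<in> carrier V \<Longrightarrow> 0 \<odot> x = \<zero>"
  using smult_add_scalar[of x 0 0] by (metis add.l_cancel_one' add_0 smult_closed)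

lemma smult_zero [simp]: "c \<odot> \<zero> = \<zero>"
  using smult_zero_scalar[of \<zero>] smult_smult[of \<zero> c 0] by simp

lemma smult_minus_one: "x \<in> carrier V \<Longrightarrow> (-1) \<odot> x = \<ominus> x"
  using smult_add_scalar[of x "-1" 1] by (simp add: minus_equality)

lemma diff_eq_zero_iff: "x \<in> carrier V \<Longrightarrow> y \<in> carrier V \<Longrightarrow> x \<ominus> y = \<zero> \<longleftrightarrow> x = y"
  using minus_equality[of x "\<ominus> y"] by (auto simp: minus_eq r_neg)

lemma smult_finsum: "f \<in> S \<rightarrow> carrier V \<Longrightarrow> c \<odot> (\<Oplus>i\<in>S. f i) = (\<Oplus>i\<in>S. c \<odot> f i)"
proof (induction S rule: infinite_finite_induct)
  case (insert x S)
  then have "f x \<in> carrier V" "f \<in> S \<rightarrow> carrier V" by auto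
  then show ?case using insert by (simp add: smult_add finsum_closed Pi_def)
qed auto

end

text \<open>Unlike the members of \<open>linear_maps\<close>, linear maps in this sense are not cut off outside the carrier, so they
  compose as plain functions.\<close>

definition linear_on ::
  "('a, 'm) star_alg_scheme \<Rightarrow> ('b, 'n) star_alg_scheme \<Rightarrow> ('a \<Rightarrow> 'b) \<Rightarrow> bool" where
  "linear_on V W f \<longleftrightarrow> f \<in> carrier V \<rightarrow> carrier W \<and>
     (\<forall>x\<in>carrier V. \<forall>y\<in>carrier V. f (x \<oplus>\<^bsub>V\<^esub> y) = f x \<oplus>\<^bsub>W\<^esub> f y) \<and>
     (\<forall>c. \<forall>x\<in>carrier V. f (c \<odot>\<^bsub>V\<^esub> x) = c \<odot>\<^bsub>W\<^esub> f x)"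

lemma linear_maps_iff: "f \<in> linear_maps V W \<longleftrightarrow> linear_on V W f \<and> f \<in> extensional (carrier V)"
  unfolding linear_maps_def linear_on_def PiE_def by auto

lemma linear_on_closed: "linear_on V W f \<Longrightarrow> x \<in> carrier V \<Longrightarrow> f x \<in> carrier W"
  and linear_on_add: "linear_on V W f \<Longrightarrow> x \<in> carrier V \<Longrightarrow> y \<in> carrier V \<Longrightarrow>
    f (x \<oplus>\<^bsub>V\<^esub> y) = f x \<oplus>\<^bsub>W\<^esub> f y"
  and linear_on_smult: "linear_on V W f \<Longrightarrow> x \<in> carrier V \<Longrightarrow> f (c \<odot>\<^bsub>V\<^esub> x) = c \<odot>\<^bsub>W\<^esub> f x"
  unfolding linear_on_def by blast+

lemma linear_on_zero:
  assumes "linear_on V W f" "complex_space V" "complex_space W"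
  shows "f \<zero>\<^bsub>V\<^esub> = \<zero>\<^bsub>W\<^esub>"
proof -
  interpret V: complex_space V by fact
  interpret W: complex_space W by fact
  have "f (0 \<odot>\<^bsub>V\<^esub> \<zero>\<^bsub>V\<^esub>) = 0 \<odot>\<^bsub>W\<^esub> f \<zero>\<^bsub>V\<^esub>"
    by (rule linear_on_smult[OF assms(1) V.zero_closed])
  then show ?thesis using linear_on_closed[OF assms(1) V.zero_closed] by simp
qed

lemma linear_on_finsum:
  assumes f: "linear_on V W f" "complex_space V" "complex_space W" and g: "g \<in> S \<rightarrow> carrier V"
  shows "f (\<Oplus>\<^bsub>V\<^esub>i\<in>S. g i) = (\<Oplus>\<^bsub>W\<^esub>i\<in>S. f (g i))"
proof -
  interpret V: complex_space V by fact
  interpret W: complex_space W by fact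
  show ?thesis using g
  proof (induction S rule: infinite_finite_induct)
    case (insert x S)
    then have "g x \<in> carrier V" "g \<in> S \<rightarrow> carrier V" by auto
    moreover have "(\<lambda>i. f (g i)) \<in> insert x S \<rightarrow> carrier W"
      using insert linear_on_closed[OF f(1)] by auto
    ultimately show ?case using insert
      by (simp add: V.finsum_closed linear_on_add[OF f(1)])
  qed (auto simp: linear_on_zero[OF f])
qed

lemma linear_onI:
  assumes "\<And>x. x \<in> carrier V \<Longrightarrow> f x \<in> carrier W"
    "\<And>x y. x \<in> carrier V \<Longrightarrow> y \<in> carrier V \<Longrightarrow> f (x \<oplus>\<^bsub>V\<^esub> y) = f x \<oplus>\<^bsub>W\<^esub> f y"
    "\<And>c x. x \<in> carrier V \<Longrightarrow> f (c \<odot>\<^bsub>V\<^esub> x) = c \<odot>\<^bsub>W\<^esub> f x"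
  shows "linear_on V W f"
  using assms unfolding linear_on_def by simp

lemma linear_on_comp:
  assumes f: "linear_on V W f" and g: "linear_on W Z g"
  shows "linear_on V Z (\<lambda>x. g (f x))"
  by (rule linear_onI) (simp_all add: linear_on_closed[OF f] linear_on_closed[OF g] linear_on_add[OF f]
      linear_on_add[OF g] linear_on_smult[OF f] linear_on_smult[OF g])

lemma linear_on_id: "linear_on V V (\<lambda>x. x)"
  by (rule linear_onI) simp_all

lemma linear_on_cong:
  assumes V: "complex_space V" and fg: "\<And>x. x \<in> carrier V \<Longrightarrow> f x = g x" and f: "linear_on V W f"
  shows "linear_on V W g"
proof -
  interpret V: complex_space V by fact
  show ?thesis
    by (rule linear_onI) (simp_all add: fg[symmetric] linear_on_closed[OF f] linear_on_add[OF f] linear_on_smult[OF f])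
qed

lemma lookup_cscale [simp]: "Poly_Mapping.lookup (cscale c p) s = c * Poly_Mapping.lookup p s"
  unfolding cscale_def by (simp add: Poly_Mapping.map.rep_eq when_def)

lemma keys_cscale: "Poly_Mapping.keys (cscale c p) \<subseteq> Poly_Mapping.keys p"
  by (auto simp: in_keys_iff)

lemma cscale_zero [simp]: "cscale c 0 = 0" "cscale 0 p = 0"
  and cscale_single [simp]: "cscale c (Poly_Mapping.single s d) = Poly_Mapping.single s (c * d)"
  and cscale_add: "cscale c (p + r) = cscale c p + cscale c r"
  and cscale_add_scalar: "cscale (c + d) p = cscale c p + cscale d p"
  and cscale_cscale: "cscale c (cscale d p) = cscale (c * d) p"
  and cscale_one [simp]: "cscale 1 p = p"
  and cscale_minus_one: "cscale (-1) p = - p"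
  and cscale_diff: "cscale c (p - r) = cscale c p - cscale c r"
  by (rule poly_mapping_eqI; simp add: lookup_add lookup_minus lookup_single when_def algebra_simps)+

lemma poly_mapping_keys_induct [consumes 1, case_names zero single add]:
  fixes p :: "'k \<Rightarrow>\<^sub>0 'c::comm_monoid_add"
  assumes "Poly_Mapping.keys p \<subseteq> K"
    and 0: "P 0" and s: "\<And>s c. s \<in> K \<Longrightarrow> P (Poly_Mapping.single s c)"
    and a: "\<And>p r. P p \<Longrightarrow> P r \<Longrightarrow> Poly_Mapping.keys p \<subseteq> K \<Longrightarrow> Poly_Mapping.keys r \<subseteq> K \<Longrightarrow> P (p + r)"
  shows "P p"
proof -
  have dec: "p = (\<Sum>k\<in>Poly_Mapping.keys p. Poly_Mapping.single k (Poly_Mapping.lookup p k))"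
    by (rule poly_mapping_eqI)
      (simp add: lookup_sum lookup_single when_def in_keys_iff)
  have "P (\<Sum>k\<in>S. Poly_Mapping.single k (Poly_Mapping.lookup p k)) \<and>
     Poly_Mapping.keys (\<Sum>k\<in>S. Poly_Mapping.single k (Poly_Mapping.lookup p k)) \<subseteq> K"
    if "finite S" "S \<subseteq> K" for S
    using that
  proof (induction S rule: finite_induct)
    case (insert k S)
    have "Poly_Mapping.keys (Poly_Mapping.single k (Poly_Mapping.lookup p k)) \<subseteq> K"
      using insert by auto
    then show ?case using insert
      using Poly_Mapping.keys_add[of "Poly_Mapping.single k (Poly_Mapping.lookup p k)"
         "\<Sum>k\<in>S. Poly_Mapping.single k (Poly_Mapping.lookup p k)"]
      by (auto intro!: a s)
  qed (auto simp: 0)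
  then show ?thesis using dec assms(1) by (metis finite_keys)
qed

definition lincomb :: "('a, 'm) star_alg_scheme \<Rightarrow> ('k \<Rightarrow> 'a) \<Rightarrow> ('k \<Rightarrow>\<^sub>0 complex) \<Rightarrow> 'a" where
  "lincomb V \<beta> p = (\<Oplus>\<^bsub>V\<^esub>s\<in>Poly_Mapping.keys p. Poly_Mapping.lookup p s \<odot>\<^bsub>V\<^esub> \<beta> s)"

context complex_space
begin

lemma lincomb_superset:
  assumes "finite S" "Poly_Mapping.keys p \<subseteq> S" "\<beta> \<in> S \<rightarrow> carrier V"
  shows "lincomb V \<beta> p = (\<Oplus>s\<in>S. Poly_Mapping.lookup p s \<odot> \<beta> s)"
  unfolding lincomb_def
  by (rule add.finprod_mono_neutral_cong_left) (use assms in \<open>auto simp: in_keys_iff Pi_iff\<close>)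

lemma lincomb_closed: "\<beta> \<in> Poly_Mapping.keys p \<rightarrow> carrier V \<Longrightarrow> lincomb V \<beta> p \<in> carrier V"
  unfolding lincomb_def by (auto intro!: finsum_closed)

lemma lincomb_zero [simp]: "lincomb V \<beta> 0 = \<zero>"
  unfolding lincomb_def by simp

lemma lincomb_single: "\<beta> s \<in> carrier V \<Longrightarrow> lincomb V \<beta> (Poly_Mapping.single s c) = c \<odot> \<beta> s"
  using lincomb_superset[of "{s}" "Poly_Mapping.single s c" \<beta>] by (simp add: lookup_single)

lemma lincomb_add:
  assumes "\<beta> \<in> K \<rightarrow> carrier V" "Poly_Mapping.keys p \<subseteq> K" "Poly_Mapping.keys r \<subseteq> K"
  shows "lincomb V \<beta> (p + r) = lincomb V \<beta> p \<oplus> lincomb V \<beta> r"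
proof -
  let ?S = "Poly_Mapping.keys p \<union> Poly_Mapping.keys r"
  have S: "finite ?S" "Poly_Mapping.keys (p + r) \<subseteq> ?S" "\<beta> \<in> ?S \<rightarrow> carrier V"
    using Poly_Mapping.keys_add[of p r] assms by auto
  have "lincomb V \<beta> (p + r) = (\<Oplus>s\<in>?S. Poly_Mapping.lookup p s \<odot> \<beta> s \<oplus> Poly_Mapping.lookup r s \<odot> \<beta> s)"
    unfolding lincomb_superset[OF S] using S(3)
    by (intro finsum_cong') (auto simp: lookup_add smult_add_scalar Pi_iff)
  also have "\<dots> = (\<Oplus>s\<in>?S. Poly_Mapping.lookup p s \<odot> \<beta> s) \<oplus> (\<Oplus>s\<in>?S. Poly_Mapping.lookup r s \<odot> \<beta> s)"
    using S(3) by (intro finsum_addf) (auto simp: Pi_iff)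
  also have "\<dots> = lincomb V \<beta> p \<oplus> lincomb V \<beta> r"
    using lincomb_superset[OF S(1) _ S(3)] by simp
  finally show ?thesis .
qed

lemma lincomb_cscale:
  assumes "\<beta> \<in> Poly_Mapping.keys p \<rightarrow> carrier V"
  shows "lincomb V \<beta> (cscale c p) = c \<odot> lincomb V \<beta> p"
proof -
  have "lincomb V \<beta> (cscale c p) = (\<Oplus>s\<in>Poly_Mapping.keys p. c \<odot> (Poly_Mapping.lookup p s \<odot> \<beta> s))"
    unfolding lincomb_superset[OF finite_keys keys_cscale assms] using assms
    by (intro finsum_cong') (auto simp: Pi_iff)
  then show ?thesis unfolding lincomb_def using assms by (subst smult_finsum) (auto simp: Pi_iff)
qed

end

subsection \<open>The tensor product\<close>

definition bilinear_on ::
  "('a, 'm) star_alg_scheme \<Rightarrow> ('b, 'n) star_alg_scheme \<Rightarrow> ('c, 'k) star_alg_scheme \<Rightarrow> ('a \<Rightarrow> 'b \<Rightarrow> 'c) \<Rightarrow> bool" where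
  "bilinear_on V W Z \<beta> \<longleftrightarrow> (\<forall>y\<in>carrier W. linear_on V Z (\<lambda>x. \<beta> x y)) \<and> (\<forall>x\<in>carrier V. linear_on W Z (\<beta> x))"

lemma tensor_null_uminus: "p \<in> tensor_null V W \<Longrightarrow> - p \<in> tensor_null V W"
  using tensor_null.scale[of p V W "-1"] by (simp add: cscale_minus_one)

lemma tensor_null_diff: "p \<in> tensor_null V W \<Longrightarrow> r \<in> tensor_null V W \<Longrightarrow> p - r \<in> tensor_null V W"
  using tensor_null.add[of p V W "- r"] tensor_null_uminus by fastforce

text \<open>The cosets of \<open>tensor_null\<close> are handled through this criterion; the operations on the tensor
  product, which are unions over representatives, are then computed on one representative.\<close>

lemma tensor_class_eq_iff: "tensor_class V W p = tensor_class V W r \<longleftrightarrow> p - r \<in> tensor_null V W"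
proof
  assume "tensor_class V W p = tensor_class V W r"
  moreover have "p \<in> tensor_class V W p"
    unfolding tensor_class_def using tensor_null.zero[of V W] by force
  ultimately obtain n where "p = r + n" "n \<in> tensor_null V W"
    unfolding tensor_class_def by auto
  then show "p - r \<in> tensor_null V W" by simp
next
  assume pr: "p - r \<in> tensor_null V W"
  have "p + n = r + ((p - r) + n)" "r + n = p + (n - (p - r))" for n by simp_all
  then show "tensor_class V W p = tensor_class V W r"
    unfolding tensor_class_def using pr tensor_null.add tensor_null_diff by blast
qed

lemma tensor_class_self: "p \<in> tensor_class V W p"
  unfolding tensor_class_def using tensor_null.zero[of V W] by force

lemma tensor_class_mem: "r \<in> tensor_class V W p \<longleftrightarrow> tensor_class V W r = tensor_class V W p"
proof
  assume "r \<in> tensor_class V W p"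
  then show "tensor_class V W r = tensor_class V W p"
    unfolding tensor_class_eq_iff unfolding tensor_class_def by auto
next
  assume "tensor_class V W r = tensor_class V W p"
  then show "r \<in> tensor_class V W p" using tensor_class_self by metis
qed

lemma UN_tensor_class:
  assumes "\<And>r. r \<in> tensor_class V W p \<Longrightarrow> G r = Z"
  shows "(\<Union>r\<in>tensor_class V W p. G r) = Z"
proof -
  have "tensor_class V W p \<noteq> {}" using tensor_class_self[of p V W] by auto
  then show ?thesis using assms by (rule SUP_eq_const)
qed

lemma tensor_add_class: "tensor_class V W p \<oplus>\<^bsub>tensor V W\<^esub> tensor_class V W r = tensor_class V W (p + r)"
proof -
  have *: "tensor_class V W (p' + r') = tensor_class V W (p + r)"
    if "p' \<in> tensor_class V W p" "r' \<in> tensor_class V W r" for p' r'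
    using that unfolding tensor_class_mem tensor_class_eq_iff
    using tensor_null.add[of "p' - p" V W "r' - r"] by (simp add: algebra_simps)
  have "(\<Union>p'\<in>tensor_class V W p. \<Union>r'\<in>tensor_class V W r. tensor_class V W (p' + r')) = tensor_class V W (p + r)"
    by (intro UN_tensor_class *)
  then show ?thesis unfolding tensor_def by simp
qed

lemma tensor_smult_class: "c \<odot>\<^bsub>tensor V W\<^esub> tensor_class V W p = tensor_class V W (cscale c p)"
proof -
  have *: "tensor_class V W (cscale c p') = tensor_class V W (cscale c p)"
    if "p' \<in> tensor_class V W p" for p'
    using that unfolding tensor_class_mem tensor_class_eq_iff
    using tensor_null.scale[of "p' - p" V W c] by (simp add: cscale_diff)
  have "(\<Union>p'\<in>tensor_class V W p. tensor_class V W (cscale c p')) = tensor_class V W (cscale c p)"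
    by (rule UN_tensor_class) (rule *)
  then show ?thesis unfolding tensor_def by simp
qed

lemma tensor_zero_class: "\<zero>\<^bsub>tensor V W\<^esub> = tensor_class V W 0"
  unfolding tensor_def by simp

lemma tensor_carrierE:
  assumes "X \<in> carrier (tensor V W)"
  obtains p where "X = tensor_class V W p" "Poly_Mapping.keys p \<subseteq> carrier V \<times> carrier W"
  using assms unfolding tensor_def tensor_free_def by auto

lemma tensor_class_closed: "Poly_Mapping.keys p \<subseteq> carrier V \<times> carrier W \<Longrightarrow> tensor_class V W p \<in> carrier (tensor V W)"
  unfolding tensor_def tensor_free_def by auto

lemma complex_spaceI:
  fixes V :: "('a, 'm) star_alg_scheme" (structure)
  assumes "\<And>x y. x \<in> carrier V \<Longrightarrow> y \<in> carrier V \<Longrightarrow> x \<oplus> y \<in> carrier V"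
    and "\<zero> \<in> carrier V"
    and "\<And>x y z. x \<in> carrier V \<Longrightarrow> y \<in> carrier V \<Longrightarrow> z \<in> carrier V \<Longrightarrow> (x \<oplus> y) \<oplus> z = x \<oplus> (y \<oplus> z)"
    and "\<And>x y. x \<in> carrier V \<Longrightarrow> y \<in> carrier V \<Longrightarrow> x \<oplus> y = y \<oplus> x"
    and "\<And>x. x \<in> carrier V \<Longrightarrow> \<zero> \<oplus> x = x"
    and smc: "\<And>c x. x \<in> carrier V \<Longrightarrow> c \<odot> x \<in> carrier V"
    and neg: "\<And>x. x \<in> carrier V \<Longrightarrow> (-1) \<odot> x \<oplus> x = \<zero>"
    and sm: "\<And>c d x. x \<in> carrier V \<Longrightarrow> (c + d) \<odot> x = c \<odot> x \<oplus> d \<odot> x"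
      "\<And>c x y. x \<in> carrier V \<Longrightarrow> y \<in> carrier V \<Longrightarrow> c \<odot> (x \<oplus> y) = c \<odot> x \<oplus> c \<odot> y"
      "\<And>c d x. x \<in> carrier V \<Longrightarrow> c \<odot> (d \<odot> x) = (c * d) \<odot> x"
      "\<And>x. x \<in> carrier V \<Longrightarrow> 1 \<odot> x = x"
  shows "complex_space V"
proof (rule complex_space.intro)
  show "abelian_group V"
  proof (rule abelian_groupI)
    show "\<exists>y\<in>carrier V. y \<oplus> x = \<zero>" if "x \<in> carrier V" for x
      using that by (intro bexI[of _ "(-1) \<odot> x"] neg smc)
  qed (rule assms(1-5); assumption)+
  show "complex_space_axioms V"
    by (rule complex_space_axioms.intro) (simp_all add: smc sm)
qed

lemma complex_space_tensor: "complex_space (tensor V W)"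
proof (rule complex_spaceI)
  fix X assume "X \<in> carrier (tensor V W)"
  then obtain p where p: "X = tensor_class V W p" "Poly_Mapping.keys p \<subseteq> carrier V \<times> carrier W" by (rule tensor_carrierE)
  show "c \<odot>\<^bsub>tensor V W\<^esub> X \<in> carrier (tensor V W)" for c
    using p keys_cscale[of c p] by (auto simp: tensor_smult_class intro!: tensor_class_closed)
  show "\<zero>\<^bsub>tensor V W\<^esub> \<oplus>\<^bsub>tensor V W\<^esub> X = X" "(-1) \<odot>\<^bsub>tensor V W\<^esub> X \<oplus>\<^bsub>tensor V W\<^esub> X = \<zero>\<^bsub>tensor V W\<^esub>"
    "(c + d) \<odot>\<^bsub>tensor V W\<^esub> X = c \<odot>\<^bsub>tensor V W\<^esub> X \<oplus>\<^bsub>tensor V W\<^esub> d \<odot>\<^bsub>tensor V W\<^esub> X"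
    "c \<odot>\<^bsub>tensor V W\<^esub> (d \<odot>\<^bsub>tensor V W\<^esub> X) = (c * d) \<odot>\<^bsub>tensor V W\<^esub> X"
    "1 \<odot>\<^bsub>tensor V W\<^esub> X = X" for c d
    by (simp_all add: p tensor_add_class tensor_zero_class tensor_smult_class cscale_minus_one
        cscale_add_scalar cscale_cscale)
  fix Y assume "Y \<in> carrier (tensor V W)"
  then obtain r where r: "Y = tensor_class V W r" "Poly_Mapping.keys r \<subseteq> carrier V \<times> carrier W" by (rule tensor_carrierE)
  show "X \<oplus>\<^bsub>tensor V W\<^esub> Y \<in> carrier (tensor V W)"
    using p r Poly_Mapping.keys_add[of p r] by (auto simp: tensor_add_class intro!: tensor_class_closed)
  show "X \<oplus>\<^bsub>tensor V W\<^esub> Y = Y \<oplus>\<^bsub>tensor V W\<^esub> X"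
    "c \<odot>\<^bsub>tensor V W\<^esub> (X \<oplus>\<^bsub>tensor V W\<^esub> Y) = c \<odot>\<^bsub>tensor V W\<^esub> X \<oplus>\<^bsub>tensor V W\<^esub> c \<odot>\<^bsub>tensor V W\<^esub> Y" for c
    by (simp_all add: p r tensor_add_class tensor_smult_class cscale_add add.commute)
  fix Z assume "Z \<in> carrier (tensor V W)"
  then obtain s where s: "Z = tensor_class V W s" "Poly_Mapping.keys s \<subseteq> carrier V \<times> carrier W" by (rule tensor_carrierE)
  show "(X \<oplus>\<^bsub>tensor V W\<^esub> Y) \<oplus>\<^bsub>tensor V W\<^esub> Z = X \<oplus>\<^bsub>tensor V W\<^esub> (Y \<oplus>\<^bsub>tensor V W\<^esub> Z)"
    by (simp add: p r s tensor_add_class add.assoc)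
next
  show "\<zero>\<^bsub>tensor V W\<^esub> \<in> carrier (tensor V W)"
    unfolding tensor_zero_class by (intro tensor_class_closed) simp
qed

lemma pure_tensor_closed [simp]:
  "x \<in> carrier V \<Longrightarrow> y \<in> carrier W \<Longrightarrow> pure_tensor V W x y \<in> carrier (tensor V W)"
  unfolding pure_tensor_def by (intro tensor_class_closed) simp

lemma bilinear_pure_tensor: "bilinear_on V W (tensor V W) (pure_tensor V W)"
proof -
  have [simp]: "\<lbrakk>x \<in> carrier V; x' \<in> carrier V; y \<in> carrier W\<rbrakk> \<Longrightarrow>
     pure_tensor V W (x \<oplus>\<^bsub>V\<^esub> x') y = pure_tensor V W x y \<oplus>\<^bsub>tensor V W\<^esub> pure_tensor V W x' y" for x x' y
    using tensor_null.add_left unfolding pure_tensor_def tensor_add_class tensor_class_eq_iff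
    by (fastforce simp: algebra_simps)
  have [simp]: "\<lbrakk>x \<in> carrier V; y' \<in> carrier W; y \<in> carrier W\<rbrakk> \<Longrightarrow>
     pure_tensor V W x (y \<oplus>\<^bsub>W\<^esub> y') = pure_tensor V W x y \<oplus>\<^bsub>tensor V W\<^esub> pure_tensor V W x y'" for x y y'
    using tensor_null.add_right unfolding pure_tensor_def tensor_add_class tensor_class_eq_iff
    by (fastforce simp: algebra_simps)
  have [simp]: "\<lbrakk>x \<in> carrier V; y \<in> carrier W\<rbrakk> \<Longrightarrow>
     pure_tensor V W (c \<odot>\<^bsub>V\<^esub> x) y = c \<odot>\<^bsub>tensor V W\<^esub> pure_tensor V W x y" for c x y
    using tensor_null.scale_left unfolding pure_tensor_def tensor_smult_class tensor_class_eq_iff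
    by fastforce
  have [simp]: "\<lbrakk>x \<in> carrier V; y \<in> carrier W\<rbrakk> \<Longrightarrow>
     pure_tensor V W x (c \<odot>\<^bsub>W\<^esub> y) = c \<odot>\<^bsub>tensor V W\<^esub> pure_tensor V W x y" for c x y
    using tensor_null.scale_right unfolding pure_tensor_def tensor_smult_class tensor_class_eq_iff
    by fastforce
  show ?thesis unfolding bilinear_on_def by (intro conjI ballI linear_onI) simp_all
qed

lemma bilinear_onD:
  assumes "bilinear_on V W Z \<beta>"
  shows "y \<in> carrier W \<Longrightarrow> linear_on V Z (\<lambda>x. \<beta> x y)" "x \<in> carrier V \<Longrightarrow> linear_on W Z (\<beta> x)"
  using assms unfolding bilinear_on_def by simp_all

lemma bilinear_on_simps:
  assumes "bilinear_on V W Z \<beta>"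
  shows "x \<in> carrier V \<Longrightarrow> y \<in> carrier W \<Longrightarrow> \<beta> x y \<in> carrier Z"
    "x \<in> carrier V \<Longrightarrow> x' \<in> carrier V \<Longrightarrow> y \<in> carrier W \<Longrightarrow> \<beta> (x \<oplus>\<^bsub>V\<^esub> x') y = \<beta> x y \<oplus>\<^bsub>Z\<^esub> \<beta> x' y"
    "x \<in> carrier V \<Longrightarrow> y \<in> carrier W \<Longrightarrow> y' \<in> carrier W \<Longrightarrow> \<beta> x (y \<oplus>\<^bsub>W\<^esub> y') = \<beta> x y \<oplus>\<^bsub>Z\<^esub> \<beta> x y'"
    "x \<in> carrier V \<Longrightarrow> y \<in> carrier W \<Longrightarrow> \<beta> (c \<odot>\<^bsub>V\<^esub> x) y = c \<odot>\<^bsub>Z\<^esub> \<beta> x y"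
    "x \<in> carrier V \<Longrightarrow> y \<in> carrier W \<Longrightarrow> \<beta> x (c \<odot>\<^bsub>W\<^esub> y) = c \<odot>\<^bsub>Z\<^esub> \<beta> x y"
  by (simp_all add: linear_on_closed[OF bilinear_onD(1)[OF assms]] linear_on_add[OF bilinear_onD(1)[OF assms]]
      linear_on_add[OF bilinear_onD(2)[OF assms]] linear_on_smult[OF bilinear_onD(1)[OF assms]]
      linear_on_smult[OF bilinear_onD(2)[OF assms]])

lemmas pure_tensor_simps = bilinear_on_simps[OF bilinear_pure_tensor]

text \<open>Scalars are absorbed into the first factor, so that sums of pure tensors already exhaust the space.\<close>

lemma tensor_induct [consumes 3, case_names pure add]:
  assumes X: "X \<in> carrier (tensor V W)" and V: "complex_space V" "complex_space W"
    and pure: "\<And>x y. x \<in> carrier V \<Longrightarrow> y \<in> carrier W \<Longrightarrow> P (pure_tensor V W x y)"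
    and add: "\<And>X Y. X \<in> carrier (tensor V W) \<Longrightarrow> Y \<in> carrier (tensor V W) \<Longrightarrow> P X \<Longrightarrow> P Y \<Longrightarrow> P (X \<oplus>\<^bsub>tensor V W\<^esub> Y)"
  shows "P X"
proof -
  interpret V: complex_space V by fact
  interpret W: complex_space W by fact
  interpret T: complex_space "tensor V W" by (rule complex_space_tensor)
  obtain p where p: "X = tensor_class V W p" "Poly_Mapping.keys p \<subseteq> carrier V \<times> carrier W"
    using X by (rule tensor_carrierE)
  from p(2) have "P (tensor_class V W p)"
  proof (induction p rule: poly_mapping_keys_induct)
    case zero
    have "pure_tensor V W (0 \<odot>\<^bsub>V\<^esub> \<zero>\<^bsub>V\<^esub>) \<zero>\<^bsub>W\<^esub> = \<zero>\<^bsub>tensor V W\<^esub>"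
      by (subst pure_tensor_simps(4)) simp_all
    then have "pure_tensor V W (0 \<odot>\<^bsub>V\<^esub> \<zero>\<^bsub>V\<^esub>) \<zero>\<^bsub>W\<^esub> = tensor_class V W 0"
      by (simp add: tensor_zero_class)
    then show ?case using pure[of "0 \<odot>\<^bsub>V\<^esub> \<zero>\<^bsub>V\<^esub>" "\<zero>\<^bsub>W\<^esub>"] by simp
  next
    case (single s c)
    then have "pure_tensor V W (c \<odot>\<^bsub>V\<^esub> fst s) (snd s) = tensor_class V W (Poly_Mapping.single s c)"
      by (subst pure_tensor_simps(4)) (auto simp: pure_tensor_def tensor_smult_class)
    then show ?case using pure[of "c \<odot>\<^bsub>V\<^esub> fst s" "snd s"] single by auto
  next
    case (add p r)
    then show ?case
      using assms(5)[of "tensor_class V W p" "tensor_class V W r"]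
      by (simp add: tensor_add_class tensor_class_closed)
  qed
  then show ?thesis using p by simp
qed

lemma linear_on_tensor_eqI:
  assumes "linear_on (tensor V W) Z f" "linear_on (tensor V W) Z g" "complex_space V" "complex_space W"
    and "\<And>x y. x \<in> carrier V \<Longrightarrow> y \<in> carrier W \<Longrightarrow> f (pure_tensor V W x y) = g (pure_tensor V W x y)"
    and "X \<in> carrier (tensor V W)"
  shows "f X = g X"
  using assms(6,3,4)
proof (induction X rule: tensor_induct)
qed (simp_all add: assms(5) linear_on_add[OF assms(1)] linear_on_add[OF assms(2)])

definition tensor_lift ::
  "('a, 'm) star_alg_scheme \<Rightarrow> ('b, 'n) star_alg_scheme \<Rightarrow> ('c, 'k) star_alg_scheme \<Rightarrow> ('a \<Rightarrow> 'b \<Rightarrow> 'c) \<Rightarrow>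
   ('a \<times> 'b \<Rightarrow>\<^sub>0 complex) set \<Rightarrow> 'c" where
  "tensor_lift V W Z \<beta> = (THE h. h \<in> linear_maps (tensor V W) Z \<and>
     (\<forall>x\<in>carrier V. \<forall>y\<in>carrier W. h (pure_tensor V W x y) = \<beta> x y))"

text \<open>The linear extension of \<open>\<beta>\<close> to formal combinations of pairs kills the bilinearity relations, hence
  descends to cosets. A representative is chosen with keys in the carriers, because the extension is only
  additive there.\<close>

lemma tensor_universal:
  assumes V: "complex_space V" "complex_space W" "complex_space Z" and b: "bilinear_on V W Z \<beta>"
  shows "\<exists>!h. h \<in> linear_maps (tensor V W) Z \<and>
     (\<forall>x\<in>carrier V. \<forall>y\<in>carrier W. h (pure_tensor V W x y) = \<beta> x y)"
proof -
  interpret V: complex_space V by fact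
  interpret W: complex_space W by fact
  interpret Z: complex_space Z by fact
  interpret T: complex_space "tensor V W" by (rule complex_space_tensor)
  let ?K = "carrier V \<times> carrier W"
  let ?b = "\<lambda>s. \<beta> (fst s) (snd s)"
  let ?l = "lincomb Z ?b"
  note bs = bilinear_on_simps[OF b]
  have bK: "?b \<in> ?K \<rightarrow> carrier Z" using bs(1) by auto
  have ladd: "?l (p + r) = ?l p \<oplus>\<^bsub>Z\<^esub> ?l r" if "Poly_Mapping.keys p \<subseteq> ?K" "Poly_Mapping.keys r \<subseteq> ?K" for p r
    using Z.lincomb_add[OF bK] that by blast
  have lsc: "?l (cscale c p) = c \<odot>\<^bsub>Z\<^esub> ?l p" if "Poly_Mapping.keys p \<subseteq> ?K" for c p
    using bK that by (intro Z.lincomb_cscale) auto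
  have lsi: "?l (Poly_Mapping.single (x, y) c) = c \<odot>\<^bsub>Z\<^esub> \<beta> x y" if "x \<in> carrier V" "y \<in> carrier W" for x y c
    using Z.lincomb_single[of ?b "(x, y)"] bs(1) that by simp
  have lcl: "?l p \<in> carrier Z" if "Poly_Mapping.keys p \<subseteq> ?K" for p
    using bK that by (intro Z.lincomb_closed) auto
  have ldiff: "?l (p - r) = ?l p \<ominus>\<^bsub>Z\<^esub> ?l r" if "Poly_Mapping.keys p \<subseteq> ?K" "Poly_Mapping.keys r \<subseteq> ?K" for p r
  proof -
    have k: "Poly_Mapping.keys (cscale (-1) r) \<subseteq> ?K"
      using that keys_cscale[of "-1" r] by blast
    have "p - r = p + cscale (-1) r" by (simp add: cscale_minus_one)
    then have "?l (p - r) = ?l p \<oplus>\<^bsub>Z\<^esub> ?l (cscale (-1) r)" using ladd[OF that(1) k] by (simp only:)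
    then show ?thesis using that
      by (simp add: lsc Z.smult_minus_one lcl Z.minus_eq)
  qed
  have kd: "Poly_Mapping.keys (p - r) \<subseteq> ?K" if "Poly_Mapping.keys p \<subseteq> ?K" "Poly_Mapping.keys r \<subseteq> ?K"
    for p r :: "_ \<Rightarrow>\<^sub>0 complex" using that keys_diff[of p r] by blast
  have ks: "Poly_Mapping.keys (Poly_Mapping.single (x, y) c) \<subseteq> ?K" if "x \<in> carrier V" "y \<in> carrier W"
    for x y and c :: complex using that by simp
  have cancel: "(a \<oplus>\<^bsub>Z\<^esub> b) \<ominus>\<^bsub>Z\<^esub> a \<ominus>\<^bsub>Z\<^esub> b = \<zero>\<^bsub>Z\<^esub>" if "a \<in> carrier Z" "b \<in> carrier Z" for a b
    using that by (subst Z.a_comm[of a b]) (simp_all add: Z.minus_eq Z.a_assoc Z.r_neg Z.r_neg2)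
  have null: "Poly_Mapping.keys n \<subseteq> ?K \<and> ?l n = \<zero>\<^bsub>Z\<^esub>" if "n \<in> tensor_null V W" for n
    using that
  proof (induction n rule: tensor_null.induct)
    case (add p r)
    then show ?case using Poly_Mapping.keys_add[of p r] by (auto simp: ladd)
  next
    case (scale p c)
    then show ?case using keys_cscale[of c p] by (auto simp: lsc)
  next
    case (add_left x x' y)
    then show ?case
      by (intro conjI kd ks) (simp_all add: ldiff lsi kd bs ks cancel)
  next
    case (add_right x y y')
    then show ?case
      by (intro conjI kd ks) (simp_all add: ldiff lsi kd bs ks cancel)
  next
    case (scale_left x y c)
    then show ?case
      by (intro conjI kd ks) (simp_all add: ldiff lsi kd bs ks Z.minus_eq Z.r_neg)
  next
    case (scale_right x y c)
    then show ?case
      by (intro conjI kd ks) (simp_all add: ldiff lsi kd bs ks Z.minus_eq Z.r_neg)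
  qed simp
  define h where "h = (\<lambda>X\<in>carrier (tensor V W). ?l (SOME p. p \<in> X \<and> Poly_Mapping.keys p \<subseteq> ?K))"
  have h: "h (tensor_class V W p) = ?l p" if p: "Poly_Mapping.keys p \<subseteq> ?K" for p
  proof -
    let ?r = "SOME r. r \<in> tensor_class V W p \<and> Poly_Mapping.keys r \<subseteq> ?K"
    have r: "?r \<in> tensor_class V W p \<and> Poly_Mapping.keys ?r \<subseteq> ?K"
      by (rule someI[of _ p]) (use p tensor_class_self in auto)
    then have "?r - p \<in> tensor_null V W"
      by (simp add: tensor_class_mem tensor_class_eq_iff)
    then have "?l (?r - p) = \<zero>\<^bsub>Z\<^esub>" using null by auto
    then have "?l ((?r - p) + p) = \<zero>\<^bsub>Z\<^esub> \<oplus>\<^bsub>Z\<^esub> ?l p"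
      using r p kd by (subst ladd) auto
    then show ?thesis unfolding h_def using p tensor_class_closed[OF p] lcl[OF p] by simp
  qed
  have hl: "linear_on (tensor V W) Z h"
    unfolding linear_on_def
  proof (intro conjI ballI allI)
    show "h \<in> carrier (tensor V W) \<rightarrow> carrier Z"
      by (auto elim!: tensor_carrierE simp: h lcl)
    fix X assume "X \<in> carrier (tensor V W)"
    then obtain p where p: "X = tensor_class V W p" "Poly_Mapping.keys p \<subseteq> ?K" by (rule tensor_carrierE)
    show "h (c \<odot>\<^bsub>tensor V W\<^esub> X) = c \<odot>\<^bsub>Z\<^esub> h X" for c
      using p keys_cscale[of c p] by (auto simp: tensor_smult_class h lsc)
    fix Y assume "Y \<in> carrier (tensor V W)"
    then obtain r where r: "Y = tensor_class V W r" "Poly_Mapping.keys r \<subseteq> ?K" by (rule tensor_carrierE)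
    show "h (X \<oplus>\<^bsub>tensor V W\<^esub> Y) = h X \<oplus>\<^bsub>Z\<^esub> h Y"
      using p r Poly_Mapping.keys_add[of p r]
      by (simp add: tensor_add_class h ladd subset_trans[of _ "_ \<union> _"])
  qed
  have hp: "h (pure_tensor V W x y) = \<beta> x y" if "x \<in> carrier V" "y \<in> carrier W" for x y
    unfolding pure_tensor_def using that by (simp add: h ks lsi bs)
  show ?thesis
  proof (rule ex1I[of _ h])
    show "h \<in> linear_maps (tensor V W) Z \<and> (\<forall>x\<in>carrier V. \<forall>y\<in>carrier W. h (pure_tensor V W x y) = \<beta> x y)"
      using hl hp unfolding linear_maps_iff h_def by auto
    fix g assume g: "g \<in> linear_maps (tensor V W) Z \<and> (\<forall>x\<in>carrier V. \<forall>y\<in>carrier W. g (pure_tensor V W x y) = \<beta> x y)"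
    show "g = h"
    proof (rule extensionalityI[of _ "carrier (tensor V W)"])
      show "g \<in> extensional (carrier (tensor V W))" using g by (simp add: linear_maps_iff)
      show "h \<in> extensional (carrier (tensor V W))" by (simp add: h_def)
      show "g X = h X" if "X \<in> carrier (tensor V W)" for X
        using linear_on_tensor_eqI[of V W Z g h X] g hl hp V that by (simp add: linear_maps_iff)
    qed
  qed
qed

lemma tensor_lift:
  assumes "complex_space V" "complex_space W" "complex_space Z" "bilinear_on V W Z \<beta>"
  shows tensor_lift_linear: "linear_on (tensor V W) Z (tensor_lift V W Z \<beta>)"
    and tensor_lift_pure: "x \<in> carrier V \<Longrightarrow> y \<in> carrier W \<Longrightarrow> tensor_lift V W Z \<beta> (pure_tensor V W x y) = \<beta> x y"
    and tensor_lift_ext: "tensor_lift V W Z \<beta> \<in> extensional (carrier (tensor V W))"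
proof -
  have "tensor_lift V W Z \<beta> \<in> linear_maps (tensor V W) Z \<and>
     (\<forall>x\<in>carrier V. \<forall>y\<in>carrier W. tensor_lift V W Z \<beta> (pure_tensor V W x y) = \<beta> x y)"
    unfolding tensor_lift_def by (rule theI'[OF tensor_universal[OF assms]])
  then show "linear_on (tensor V W) Z (tensor_lift V W Z \<beta>)"
    "x \<in> carrier V \<Longrightarrow> y \<in> carrier W \<Longrightarrow> tensor_lift V W Z \<beta> (pure_tensor V W x y) = \<beta> x y"
    "tensor_lift V W Z \<beta> \<in> extensional (carrier (tensor V W))"
    unfolding linear_maps_iff by simp_all
qed

lemma bilinear_on_comp:
  assumes b: "bilinear_on V' W' Z \<beta>" and f: "linear_on V V' f" and g: "linear_on W W' g"
  shows "bilinear_on V W Z (\<lambda>x y. \<beta> (f x) (g y))"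
  unfolding bilinear_on_def
  using linear_on_comp[OF f bilinear_onD(1)[OF b linear_on_closed[OF g]]]
    linear_on_comp[OF g bilinear_onD(2)[OF b linear_on_closed[OF f]]] by simp

lemma tensor_map_eq_lift: "tensor_map V W V' W' f g = tensor_lift V W (tensor V' W') (\<lambda>x y. pure_tensor V' W' (f x) (g y))"
  unfolding tensor_map_def tensor_lift_def ..

lemma tensor_map:
  assumes "complex_space V" "complex_space W" "linear_on V V' f" "linear_on W W' g"
  shows tensor_map_linear: "linear_on (tensor V W) (tensor V' W') (tensor_map V W V' W' f g)"
    and tensor_map_pure: "x \<in> carrier V \<Longrightarrow> y \<in> carrier W \<Longrightarrow>
      tensor_map V W V' W' f g (pure_tensor V W x y) = pure_tensor V' W' (f x) (g y)"
  unfolding tensor_map_eq_lift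
  using tensor_lift[OF assms(1,2) complex_space_tensor bilinear_on_comp[OF bilinear_pure_tensor assms(3,4)]]
  by auto

text \<open>Existence comes from lifting twice: for fixed \<open>z\<close> the map \<open>x \<otimes> y \<mapsto> x \<otimes> (y \<otimes> z)\<close> is a lift \<open>G z\<close>, which
  depends linearly on \<open>z\<close>.\<close>

lemma tensor_assoc:
  assumes V: "complex_space V" "complex_space W" "complex_space Z"
  shows tensor_assoc_linear: "linear_on (tensor (tensor V W) Z) (tensor V (tensor W Z)) (tensor_assoc V W Z)"
    and tensor_assoc_pure: "x \<in> carrier V \<Longrightarrow> y \<in> carrier W \<Longrightarrow> z \<in> carrier Z \<Longrightarrow>
      tensor_assoc V W Z (pure_tensor (tensor V W) Z (pure_tensor V W x y) z) = pure_tensor V (tensor W Z) x (pure_tensor W Z y z)"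
proof -
  interpret V: complex_space V by fact
  interpret W: complex_space W by fact
  interpret Z: complex_space Z by fact
  let ?VW = "tensor V W" and ?WZ = "tensor W Z" and ?T = "tensor V (tensor W Z)"
  interpret T: complex_space ?T by (rule complex_space_tensor)
  interpret VW: complex_space ?VW by (rule complex_space_tensor)
  have b1: "bilinear_on V W ?T (\<lambda>x y. pure_tensor V ?WZ x (pure_tensor W Z y z))" if "z \<in> carrier Z" for z
    by (intro bilinear_on_comp[OF bilinear_pure_tensor linear_on_id] bilinear_onD[OF bilinear_pure_tensor] that)
  define G where "G z = tensor_lift V W ?T (\<lambda>x y. pure_tensor V ?WZ x (pure_tensor W Z y z))" for z
  have G: "linear_on ?VW ?T (G z)" "\<And>x y. x \<in> carrier V \<Longrightarrow> y \<in> carrier W \<Longrightarrow>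
      G z (pure_tensor V W x y) = pure_tensor V ?WZ x (pure_tensor W Z y z)" if "z \<in> carrier Z" for z
    unfolding G_def using tensor_lift[OF V(1,2) complex_space_tensor b1[OF that]] by auto
  have "linear_on Z ?T (\<lambda>z. G z X)" if "X \<in> carrier ?VW" for X
    using that V(1,2)
  proof (induction X rule: tensor_induct)
    case (pure x y)
    have "linear_on Z ?T (\<lambda>z. pure_tensor V ?WZ x (pure_tensor W Z y z))"
      by (rule linear_on_comp[OF bilinear_onD(2)[OF bilinear_pure_tensor] bilinear_onD(2)[OF bilinear_pure_tensor]])
        (use pure in auto)
    then show ?case by (rule linear_on_cong[OF V(3), rotated]) (use pure G in auto)
  next
    case (add X Y)
    note lX = add(3) and lY = add(4)
    have "linear_on Z ?T (\<lambda>z. G z X \<oplus>\<^bsub>?T\<^esub> G z Y)"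
      by (rule linear_onI, goal_cases) (simp_all add: linear_on_add[OF lX] linear_on_add[OF lY] linear_on_smult[OF lX] linear_on_smult[OF lY]
          linear_on_closed[OF lX] linear_on_closed[OF lY] T.smult_add T.a_ac)
    then show ?case by (rule linear_on_cong[OF V(3), rotated]) (use add(1,2) in \<open>simp add: linear_on_add[OF G(1)]\<close>)
  qed
  then have b2: "bilinear_on ?VW Z ?T (\<lambda>X z. G z X)"
    unfolding bilinear_on_def using G(1) by simp
  note L = tensor_lift[OF complex_space_tensor V(3) complex_space_tensor b2]
  have "tensor_assoc V W Z = tensor_lift ?VW Z ?T (\<lambda>X z. G z X)"
    unfolding tensor_assoc_def
  proof (rule the_equality)
    show "tensor_lift ?VW Z ?T (\<lambda>X z. G z X) \<in> linear_maps (tensor ?VW Z) ?T \<and>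
     (\<forall>x\<in>carrier V. \<forall>y\<in>carrier W. \<forall>z\<in>carrier Z.
        tensor_lift ?VW Z ?T (\<lambda>X z. G z X) (pure_tensor ?VW Z (pure_tensor V W x y) z) = pure_tensor V ?WZ x (pure_tensor W Z y z))"
      using L G by (simp add: linear_maps_iff)
    fix h assume h: "h \<in> linear_maps (tensor ?VW Z) ?T \<and>
     (\<forall>x\<in>carrier V. \<forall>y\<in>carrier W. \<forall>z\<in>carrier Z.
        h (pure_tensor ?VW Z (pure_tensor V W x y) z) = pure_tensor V ?WZ x (pure_tensor W Z y z))"
    then have hl: "linear_on (tensor ?VW Z) ?T h" by (simp add: linear_maps_iff)
    have "h (pure_tensor ?VW Z X z) = G z X" if X: "X \<in> carrier ?VW" and z: "z \<in> carrier Z" for X z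
      using linear_on_tensor_eqI[OF linear_on_comp[OF bilinear_onD(1)[OF bilinear_pure_tensor z] hl] G(1)[OF z] V(1,2) _ X]
        h z G(2) by simp
    then have "h X = tensor_lift ?VW Z ?T (\<lambda>X z. G z X) X" if "X \<in> carrier (tensor ?VW Z)" for X
      using linear_on_tensor_eqI[OF hl L(1) complex_space_tensor V(3) _ that] L(2) by simp
    then show "h = tensor_lift ?VW Z ?T (\<lambda>X z. G z X)"
      by (intro extensionalityI[of _ "carrier (tensor ?VW Z)"]) (use h L in \<open>auto simp: linear_maps_iff\<close>)
  qed
  then show "linear_on (tensor ?VW Z) ?T (tensor_assoc V W Z)"
     "x \<in> carrier V \<Longrightarrow> y \<in> carrier W \<Longrightarrow> z \<in> carrier Z \<Longrightarrow>
      tensor_assoc V W Z (pure_tensor ?VW Z (pure_tensor V W x y) z) = pure_tensor V ?WZ x (pure_tensor W Z y z)"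
    using L G by auto
qed

lemma pure_zero_right:
  assumes "complex_space V" "complex_space W" "x \<in> carrier V" shows "pure_tensor V W x \<zero>\<^bsub>W\<^esub> = \<zero>\<^bsub>tensor V W\<^esub>"
  by (rule linear_on_zero[OF bilinear_onD(2)[OF bilinear_pure_tensor assms(3)] assms(2) complex_space_tensor])

lemma pure_zero_left:
  assumes "complex_space V" "complex_space W" "y \<in> carrier W" shows "pure_tensor V W \<zero>\<^bsub>V\<^esub> y = \<zero>\<^bsub>tensor V W\<^esub>"
  by (rule linear_on_zero[OF bilinear_onD(1)[OF bilinear_pure_tensor assms(3)] assms(1) complex_space_tensor])

section \<open>Star-algebras\<close>

locale star_algebra = complex_space A + ring A for A :: "('a, 'm) star_alg_scheme" (structure) +
  assumes smult_mult_left: "x \<in> carrier A \<Longrightarrow> y \<in> carrier A \<Longrightarrow> (c \<odot> x) \<otimes> y = c \<odot> (x \<otimes> y)"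
    and smult_mult_right: "x \<in> carrier A \<Longrightarrow> y \<in> carrier A \<Longrightarrow> x \<otimes> (c \<odot> y) = c \<odot> (x \<otimes> y)"
    and star_closed [simp, intro]: "x \<in> carrier A \<Longrightarrow> star A x \<in> carrier A"
    and star_add: "x \<in> carrier A \<Longrightarrow> y \<in> carrier A \<Longrightarrow> star A (x \<oplus> y) = star A x \<oplus> star A y"
    and star_smult: "x \<in> carrier A \<Longrightarrow> star A (c \<odot> x) = cnj c \<odot> star A x"
    and star_mult: "x \<in> carrier A \<Longrightarrow> y \<in> carrier A \<Longrightarrow> star A (x \<otimes> y) = star A y \<otimes> star A x"
    and star_star [simp]: "x \<in> carrier A \<Longrightarrow> star A (star A x) = x"
begin

lemma star_one [simp]: "star A \<one> = \<one>"
proof -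
  have "star A \<one> = star A \<one> \<otimes> star A (star A \<one>)" by simp
  also have "\<dots> = star A (star A \<one> \<otimes> \<one>)" by (subst star_mult) auto
  finally show ?thesis by simp
qed

lemma star_zero [simp]: "star A \<zero> = \<zero>"
  using star_smult[of \<zero> 0] by simp

lemma star_finsum: "f \<in> S \<rightarrow> carrier A \<Longrightarrow> star A (\<Oplus>i\<in>S. f i) = (\<Oplus>i\<in>S. star A (f i))"
proof (induction S rule: infinite_finite_induct)
  case (insert x S)
  then have "f x \<in> carrier A" "f \<in> S \<rightarrow> carrier A" by auto
  then show ?case using insert by (simp add: star_add finsum_closed Pi_def)
qed auto

lemma linear_on_mult_left: "b \<in> carrier A \<Longrightarrow> linear_on A A (\<lambda>x. b \<otimes> x)"
  by (rule linear_onI) (simp_all add: r_distr smult_mult_right)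

end

lemma star_algebraI:
  fixes A :: "('a, 'm) star_alg_scheme" (structure)
  assumes cs: "complex_space A"
    and mc: "\<And>x y. x \<in> carrier A \<Longrightarrow> y \<in> carrier A \<Longrightarrow> x \<otimes> y \<in> carrier A"
    and oc: "\<one> \<in> carrier A"
    and as: "\<And>x y z. x \<in> carrier A \<Longrightarrow> y \<in> carrier A \<Longrightarrow> z \<in> carrier A \<Longrightarrow> (x \<otimes> y) \<otimes> z = x \<otimes> (y \<otimes> z)"
    and lo: "\<And>x. x \<in> carrier A \<Longrightarrow> \<one> \<otimes> x = x"
    and ro: "\<And>x. x \<in> carrier A \<Longrightarrow> x \<otimes> \<one> = x"
    and ld: "\<And>x y z. x \<in> carrier A \<Longrightarrow> y \<in> carrier A \<Longrightarrow> z \<in> carrier A \<Longrightarrow> (x \<oplus> y) \<otimes> z = x \<otimes> z \<oplus> y \<otimes> z"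
    and rd: "\<And>x y z. x \<in> carrier A \<Longrightarrow> y \<in> carrier A \<Longrightarrow> z \<in> carrier A \<Longrightarrow> z \<otimes> (x \<oplus> y) = z \<otimes> x \<oplus> z \<otimes> y"
    and ax: "star_algebra_axioms A"
  shows "star_algebra A"
proof -
  interpret complex_space A by fact
  have "ring A"
  proof (rule ringI)
    show "abelian_group A" ..
    show "Group.monoid A" by (rule monoidI) (rule mc oc as lo ro; assumption)+
  qed (rule ld rd; assumption)+
  then show ?thesis using cs ax by (intro star_algebra.intro)
qed

definition star_hom :: "('a, 'm) star_alg_scheme \<Rightarrow> ('b, 'n) star_alg_scheme \<Rightarrow> ('a \<Rightarrow> 'b) \<Rightarrow> bool" where
  "star_hom A B f \<longleftrightarrow> linear_on A B f \<and>
     (\<forall>x\<in>carrier A. \<forall>y\<in>carrier A. f (x \<otimes>\<^bsub>A\<^esub> y) = f x \<otimes>\<^bsub>B\<^esub> f y) \<and>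
     f \<one>\<^bsub>A\<^esub> = \<one>\<^bsub>B\<^esub> \<and> (\<forall>x\<in>carrier A. f (star A x) = star B (f x))"

lemma star_homs_iff: "f \<in> star_homs A B \<longleftrightarrow> star_hom A B f \<and> f \<in> extensional (carrier A)"
proof -
  have "linear_on A B f \<Longrightarrow> f \<in> ring_hom A B \<longleftrightarrow>
     (\<forall>x\<in>carrier A. \<forall>y\<in>carrier A. f (x \<otimes>\<^bsub>A\<^esub> y) = f x \<otimes>\<^bsub>B\<^esub> f y) \<and> f \<one>\<^bsub>A\<^esub> = \<one>\<^bsub>B\<^esub>"
    unfolding ring_hom_def linear_on_def by (auto simp: Pi_iff)
  then show ?thesis unfolding star_homs_def star_hom_def linear_maps_iff by fast
qed

lemma star_hom_linear: "star_hom A B f \<Longrightarrow> linear_on A B f"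
  and star_hom_mult: "star_hom A B f \<Longrightarrow> x \<in> carrier A \<Longrightarrow> y \<in> carrier A \<Longrightarrow> f (x \<otimes>\<^bsub>A\<^esub> y) = f x \<otimes>\<^bsub>B\<^esub> f y"
  and star_hom_one: "star_hom A B f \<Longrightarrow> f \<one>\<^bsub>A\<^esub> = \<one>\<^bsub>B\<^esub>"
  and star_hom_star: "star_hom A B f \<Longrightarrow> x \<in> carrier A \<Longrightarrow> f (star A x) = star B (f x)"
  unfolding star_hom_def by simp_all

lemma star_homI:
  assumes "linear_on A B f" "\<And>x y. x \<in> carrier A \<Longrightarrow> y \<in> carrier A \<Longrightarrow> f (x \<otimes>\<^bsub>A\<^esub> y) = f x \<otimes>\<^bsub>B\<^esub> f y"
    "f \<one>\<^bsub>A\<^esub> = \<one>\<^bsub>B\<^esub>" "\<And>x. x \<in> carrier A \<Longrightarrow> f (star A x) = star B (f x)"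
  shows "star_hom A B f"
  using assms unfolding star_hom_def by simp

lemmas star_hom_closed = linear_on_closed[OF star_hom_linear]
  and star_hom_add = linear_on_add[OF star_hom_linear]
  and star_hom_smult = linear_on_smult[OF star_hom_linear]

lemma star_hom_id: "star_hom A A (\<lambda>x. x)"
  by (rule star_homI) (simp_all add: linear_on_id)

lemma star_hom_comp:
  assumes f: "star_hom A B f" and g: "star_hom B C g"
  shows "star_hom A C (\<lambda>x. g (f x))"
  by (rule star_homI)
    (simp_all add: linear_on_comp[OF star_hom_linear[OF f] star_hom_linear[OF g]] star_hom_closed[OF f]
      star_hom_mult[OF f] star_hom_mult[OF g] star_hom_one[OF f] star_hom_one[OF g] star_hom_star[OF f] star_hom_star[OF g])

lemma star_hom_restrict:
  assumes f: "star_hom A B f" and A: "star_algebra A"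
  shows "restrict f (carrier A) \<in> star_homs A B"
proof -
  interpret A: star_algebra A by fact
  have "linear_on A B (restrict f (carrier A))"
    by (rule linear_on_cong[OF A.complex_space_axioms _ star_hom_linear[OF f]]) simp
  then show ?thesis unfolding star_homs_iff
    by (intro conjI star_homI) (simp_all add: star_hom_mult[OF f] star_hom_one[OF f] star_hom_star[OF f])
qed

text \<open>The structure maps are definite descriptions of extensional star-homomorphisms. A description of this
  kind denotes as soon as some star-homomorphism satisfies the property and the property determines the values on the carrier.\<close>

lemma star_homs_the:
  assumes f: "star_hom A B f" and A: "star_algebra A" and P: "P (restrict f (carrier A))"
    and uniq: "\<And>g h. star_hom A B g \<Longrightarrow> star_hom A B h \<Longrightarrow> P g \<Longrightarrow> P h \<Longrightarrow> \<forall>x\<in>carrier A. g x = h x"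
  shows "star_hom A B (THE g. g \<in> star_homs A B \<and> P g) \<and> P (THE g. g \<in> star_homs A B \<and> P g)"
proof -
  have "\<exists>!g. g \<in> star_homs A B \<and> P g"
  proof (rule ex1I[of _ "restrict f (carrier A)"])
    show "restrict f (carrier A) \<in> star_homs A B \<and> P (restrict f (carrier A))"
      using star_hom_restrict[OF f A] P by simp
    fix g assume g: "g \<in> star_homs A B \<and> P g"
    have "\<forall>x\<in>carrier A. g x = restrict f (carrier A) x"
      using uniq[of g "restrict f (carrier A)"] g P star_hom_restrict[OF f A] by (simp add: star_homs_iff)
    then show "g = restrict f (carrier A)"
      using g by (intro extensionalityI[of _ "carrier A"]) (auto simp: star_homs_iff)
  qed
  from theI'[OF this] show ?thesis by (simp add: star_homs_iff)
qed

subsection \<open>The tensor product of star-algebras\<close>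

text \<open>The linear extension of a function on keys to formal linear combinations.\<close>

definition pm_extend :: "('k \<Rightarrow> ('l \<Rightarrow>\<^sub>0 complex)) \<Rightarrow> ('k \<Rightarrow>\<^sub>0 complex) \<Rightarrow> ('l \<Rightarrow>\<^sub>0 complex)" where
  "pm_extend f p = (\<Sum>s\<in>Poly_Mapping.keys p. cscale (Poly_Mapping.lookup p s) (f s))"

lemma pm_extend_superset:
  "finite S \<Longrightarrow> Poly_Mapping.keys p \<subseteq> S \<Longrightarrow> pm_extend f p = (\<Sum>s\<in>S. cscale (Poly_Mapping.lookup p s) (f s))"
  unfolding pm_extend_def by (rule sum.mono_neutral_left) (auto simp: in_keys_iff)

lemma pm_extend_add: "pm_extend f (p + r) = pm_extend f p + pm_extend f r"
proof -
  let ?S = "Poly_Mapping.keys p \<union> Poly_Mapping.keys r"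
  have S: "finite ?S" "Poly_Mapping.keys (p + r) \<subseteq> ?S" using Poly_Mapping.keys_add[of p r] by auto
  show ?thesis
    by (simp add: pm_extend_superset[OF S] pm_extend_superset[OF S(1)] lookup_add cscale_add_scalar sum.distrib)
qed

lemma cscale_sum: "cscale c (\<Sum>i\<in>S. f i) = (\<Sum>i\<in>S. cscale c (f i))"
  by (induction S rule: infinite_finite_induct) (simp_all add: cscale_add)

lemma pm_extend_cscale: "pm_extend f (cscale c p) = cscale c (pm_extend f p)"
  using pm_extend_superset[of "Poly_Mapping.keys p" "cscale c p" f, OF finite_keys keys_cscale]
  by (simp add: pm_extend_def cscale_sum cscale_cscale)

lemma pm_extend_zero [simp]: "pm_extend f 0 = 0"
  by (simp add: pm_extend_def)

lemma pm_extend_single [simp]: "pm_extend f (Poly_Mapping.single s c) = cscale c (f s)"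
  using pm_extend_superset[of "{s}" "Poly_Mapping.single s c" f] by simp

lemma pm_extend_uminus: "pm_extend f (- p) = - pm_extend f p"
  using pm_extend_cscale[of f "-1" p] by (simp add: cscale_minus_one)

lemma pm_extend_diff: "pm_extend f (p - r) = pm_extend f p - pm_extend f r"
  using pm_extend_add[of f p "- r"] by (simp add: pm_extend_uminus)

lemma pm_extend_add_fun: "pm_extend (\<lambda>s. f s + g s) p = pm_extend f p + pm_extend g p"
  by (simp add: pm_extend_def cscale_add sum.distrib)

lemma pm_extend_cscale_fun: "pm_extend (\<lambda>s. cscale c (f s)) p = cscale c (pm_extend f p)"
  by (simp add: pm_extend_def cscale_sum cscale_cscale mult.commute)

definition tensor_free_mult ::
  "('a, 'm) star_alg_scheme \<Rightarrow> ('b, 'n) star_alg_scheme \<Rightarrow> ('a \<times> 'b \<Rightarrow>\<^sub>0 complex) \<Rightarrow> ('a \<times> 'b \<Rightarrow>\<^sub>0 complex) \<Rightarrow> ('a \<times> 'b \<Rightarrow>\<^sub>0 complex)" where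
  "tensor_free_mult V W p r = pm_extend (\<lambda>s. pm_extend (\<lambda>t. Poly_Mapping.single (fst s \<otimes>\<^bsub>V\<^esub> fst t, snd s \<otimes>\<^bsub>W\<^esub> snd t) 1) r) p"

lemma tensor_free_mult_simps:
  "tensor_free_mult V W (p + p') r = tensor_free_mult V W p r + tensor_free_mult V W p' r"
  "tensor_free_mult V W p (r + r') = tensor_free_mult V W p r + tensor_free_mult V W p r'"
  "tensor_free_mult V W (p - p') r = tensor_free_mult V W p r - tensor_free_mult V W p' r"
  "tensor_free_mult V W p (r - r') = tensor_free_mult V W p r - tensor_free_mult V W p r'"
  "tensor_free_mult V W (cscale c p) r = cscale c (tensor_free_mult V W p r)"
  "tensor_free_mult V W p (cscale c r) = cscale c (tensor_free_mult V W p r)"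
  "tensor_free_mult V W 0 r = 0" "tensor_free_mult V W p 0 = 0"
  "tensor_free_mult V W (Poly_Mapping.single s c) (Poly_Mapping.single t d)
     = Poly_Mapping.single (fst s \<otimes>\<^bsub>V\<^esub> fst t, snd s \<otimes>\<^bsub>W\<^esub> snd t) (c * d)"
proof -
  show "tensor_free_mult V W p (r - r') = tensor_free_mult V W p r - tensor_free_mult V W p r'"
    unfolding tensor_free_mult_def pm_extend_diff
    by (simp add: pm_extend_def cscale_diff sum_subtractf)
  show "tensor_free_mult V W p 0 = 0"
    unfolding tensor_free_mult_def by (simp add: pm_extend_def)
qed (simp_all add: tensor_free_mult_def pm_extend_add pm_extend_add_fun pm_extend_diff pm_extend_cscale pm_extend_cscale_fun)

definition tensor_free_star ::
  "('a, 'm) star_alg_scheme \<Rightarrow> ('b, 'n) star_alg_scheme \<Rightarrow> ('a \<times> 'b \<Rightarrow>\<^sub>0 complex) \<Rightarrow> ('a \<times> 'b \<Rightarrow>\<^sub>0 complex)" where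
  "tensor_free_star V W p = (\<Sum>s\<in>Poly_Mapping.keys p. Poly_Mapping.single (star V (fst s), star W (snd s)) (cnj (Poly_Mapping.lookup p s)))"

lemma tensor_free_star_superset:
  "finite S \<Longrightarrow> Poly_Mapping.keys p \<subseteq> S \<Longrightarrow> tensor_free_star V W p =
    (\<Sum>s\<in>S. Poly_Mapping.single (star V (fst s), star W (snd s)) (cnj (Poly_Mapping.lookup p s)))"
  unfolding tensor_free_star_def by (rule sum.mono_neutral_left) (auto simp: in_keys_iff)

lemma tensor_free_star_simps:
  "tensor_free_star V W (p + r) = tensor_free_star V W p + tensor_free_star V W r"
  "tensor_free_star V W (cscale c p) = cscale (cnj c) (tensor_free_star V W p)"
  "tensor_free_star V W (p - r) = tensor_free_star V W p - tensor_free_star V W r"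
  "tensor_free_star V W 0 = 0"
  "tensor_free_star V W (Poly_Mapping.single s c) = Poly_Mapping.single (star V (fst s), star W (snd s)) (cnj c)"
proof -
  show add: "tensor_free_star V W (p + r) = tensor_free_star V W p + tensor_free_star V W r" for p r
  proof -
    let ?S = "Poly_Mapping.keys p \<union> Poly_Mapping.keys r"
    have S: "finite ?S" "Poly_Mapping.keys (p + r) \<subseteq> ?S" using Poly_Mapping.keys_add[of p r] by auto
    show ?thesis
      by (simp add: tensor_free_star_superset[OF S] tensor_free_star_superset[OF S(1)] lookup_add single_add sum.distrib)
  qed
  show sc: "tensor_free_star V W (cscale c p) = cscale (cnj c) (tensor_free_star V W p)" for c p
    using tensor_free_star_superset[of "Poly_Mapping.keys p" "cscale c p" V W, OF finite_keys keys_cscale]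
    by (simp add: tensor_free_star_def cscale_sum)
  show "tensor_free_star V W (p - r) = tensor_free_star V W p - tensor_free_star V W r"
    using add[of p "cscale (-1) r"] sc[of "-1" r] by (simp add: cscale_minus_one)
  show "tensor_free_star V W 0 = 0" by (simp add: tensor_free_star_def)
  show "tensor_free_star V W (Poly_Mapping.single s c) = Poly_Mapping.single (star V (fst s), star W (snd s)) (cnj c)"
    using tensor_free_star_superset[of "{s}" "Poly_Mapping.single s c" V W] by simp
qed

context
  fixes V :: "('a, 'm) star_alg_scheme" and W :: "('b, 'n) star_alg_scheme"
  assumes VW: "star_algebra V" "star_algebra W"
begin

interpretation V: star_algebra V by (rule VW)
interpretation W: star_algebra W by (rule VW)

lemma tensor_null_free: "n \<in> tensor_null V W \<Longrightarrow> Poly_Mapping.keys n \<subseteq> carrier V \<times> carrier W"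
proof (induction n rule: tensor_null.induct)
  case (add p r)
  then show ?case using Poly_Mapping.keys_add[of p r] by blast
next
  case (scale p c)
  then show ?case using keys_cscale[of c p] by blast
next
  case (add_left x x' y)
  then show ?case by (intro order_trans[OF keys_diff] Un_least) auto
next
  case (add_right x y y')
  then show ?case by (intro order_trans[OF keys_diff] Un_least) auto
next
  case (scale_left x y c)
  then show ?case by (intro order_trans[OF keys_diff] Un_least) auto
next
  case (scale_right x y c)
  then show ?case by (intro order_trans[OF keys_diff] Un_least) auto
qed simp

text \<open>Left and right multiplication by a pair respect each of the four bilinearity relations, since
  multiplication in the factors is bilinear; thus \<open>tensor_null\<close> is an ideal for the product on
  representatives.\<close>

lemma tensor_free_mult_null_left:
  assumes "n \<in> tensor_null V W" "Poly_Mapping.keys r \<subseteq> carrier V \<times> carrier W"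
  shows "tensor_free_mult V W n r \<in> tensor_null V W"
  using assms(2)
proof (induction r rule: poly_mapping_keys_induct)
  case (single t d)
  have *: "Poly_Mapping.single t d = cscale d (Poly_Mapping.single t 1)" by simp
  from single have t: "fst t \<in> carrier V" "snd t \<in> carrier W" by auto
  have "tensor_free_mult V W n (Poly_Mapping.single t 1) \<in> tensor_null V W"
    using assms(1)
  proof (induction n rule: tensor_null.induct)
    case (add_left x x' y)
    with t show ?case
      using tensor_null.add_left[of "x \<otimes>\<^bsub>V\<^esub> fst t" V "x' \<otimes>\<^bsub>V\<^esub> fst t" "y \<otimes>\<^bsub>W\<^esub> snd t" W]
      by (simp add: tensor_free_mult_simps V.l_distr)
  next
    case (add_right x y y')
    with t show ?case
      using tensor_null.add_right[of "x \<otimes>\<^bsub>V\<^esub> fst t" V "y \<otimes>\<^bsub>W\<^esub> snd t" W "y' \<otimes>\<^bsub>W\<^esub> snd t"]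
      by (simp add: tensor_free_mult_simps W.l_distr)
  next
    case (scale_left x y c)
    with t show ?case
      using tensor_null.scale_left[of "x \<otimes>\<^bsub>V\<^esub> fst t" V "y \<otimes>\<^bsub>W\<^esub> snd t" W c]
      by (simp add: tensor_free_mult_simps V.smult_mult_left)
  next
    case (scale_right x y c)
    with t show ?case
      using tensor_null.scale_right[of "x \<otimes>\<^bsub>V\<^esub> fst t" V "y \<otimes>\<^bsub>W\<^esub> snd t" W c]
      by (simp add: tensor_free_mult_simps W.smult_mult_left)
  qed (auto simp: tensor_free_mult_simps intro: tensor_null.intros)
  then show ?case unfolding * tensor_free_mult_simps(6) by (rule tensor_null.scale)
qed (auto simp: tensor_free_mult_simps intro: tensor_null.intros)

lemma tensor_free_mult_null_right:
  assumes "n \<in> tensor_null V W" "Poly_Mapping.keys r \<subseteq> carrier V \<times> carrier W"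
  shows "tensor_free_mult V W r n \<in> tensor_null V W"
  using assms(2)
proof (induction r rule: poly_mapping_keys_induct)
  case (single t d)
  have *: "Poly_Mapping.single t d = cscale d (Poly_Mapping.single t 1)" by simp
  from single have t: "fst t \<in> carrier V" "snd t \<in> carrier W" by auto
  have "tensor_free_mult V W (Poly_Mapping.single t 1) n \<in> tensor_null V W"
    using assms(1)
  proof (induction n rule: tensor_null.induct)
    case (add_left x x' y)
    with t show ?case
      using tensor_null.add_left[of "fst t \<otimes>\<^bsub>V\<^esub> x" V "fst t \<otimes>\<^bsub>V\<^esub> x'" "snd t \<otimes>\<^bsub>W\<^esub> y" W]
      by (simp add: tensor_free_mult_simps V.r_distr)
  next
    case (add_right x y y')
    with t show ?case
      using tensor_null.add_right[of "fst t \<otimes>\<^bsub>V\<^esub> x" V "snd t \<otimes>\<^bsub>W\<^esub> y" W "snd t \<otimes>\<^bsub>W\<^esub> y'"]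
      by (simp add: tensor_free_mult_simps W.r_distr)
  next
    case (scale_left x y c)
    with t show ?case
      using tensor_null.scale_left[of "fst t \<otimes>\<^bsub>V\<^esub> x" V "snd t \<otimes>\<^bsub>W\<^esub> y" W c]
      by (simp add: tensor_free_mult_simps V.smult_mult_right)
  next
    case (scale_right x y c)
    with t show ?case
      using tensor_null.scale_right[of "fst t \<otimes>\<^bsub>V\<^esub> x" V "snd t \<otimes>\<^bsub>W\<^esub> y" W c]
      by (simp add: tensor_free_mult_simps W.smult_mult_right)
  qed (auto simp: tensor_free_mult_simps intro: tensor_null.intros)
  then show ?case unfolding * tensor_free_mult_simps(5) by (rule tensor_null.scale)
qed (auto simp: tensor_free_mult_simps intro: tensor_null.intros)

lemma tensor_free_star_null: "n \<in> tensor_null V W \<Longrightarrow> tensor_free_star V W n \<in> tensor_null V W"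
proof (induction n rule: tensor_null.induct)
  case (add_left x x' y)
  then show ?case
    using tensor_null.add_left[of "star V x" V "star V x'" "star W y" W]
    by (simp add: tensor_free_star_simps V.star_add)
next
  case (add_right x y y')
  then show ?case
    using tensor_null.add_right[of "star V x" V "star W y" W "star W y'"]
    by (simp add: tensor_free_star_simps W.star_add)
next
  case (scale_left x y c)
  then show ?case
    using tensor_null.scale_left[of "star V x" V "star W y" W "cnj c"]
    by (simp add: tensor_free_star_simps V.star_smult)
next
  case (scale_right x y c)
  then show ?case
    using tensor_null.scale_right[of "star V x" V "star W y" W "cnj c"]
    by (simp add: tensor_free_star_simps W.star_smult)
qed (auto simp: tensor_free_star_simps intro: tensor_null.intros)

lemma tensor_mult_class:
  assumes p: "Poly_Mapping.keys p \<subseteq> carrier V \<times> carrier W" and r: "Poly_Mapping.keys r \<subseteq> carrier V \<times> carrier W"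
  shows "tensor_class V W p \<otimes>\<^bsub>tensor V W\<^esub> tensor_class V W r = tensor_class V W (tensor_free_mult V W p r)"
proof -
  have *: "tensor_class V W (tensor_free_mult V W p' r') = tensor_class V W (tensor_free_mult V W p r)"
    if "p' \<in> tensor_class V W p" "r' \<in> tensor_class V W r" for p' r'
  proof -
    have n: "p' - p \<in> tensor_null V W" "r' - r \<in> tensor_null V W"
      using that by (simp_all add: tensor_class_mem tensor_class_eq_iff)
    have "p' = (p' - p) + p" by simp
    then have p': "Poly_Mapping.keys p' \<subseteq> carrier V \<times> carrier W"
      using Poly_Mapping.keys_add[of "p' - p" p] tensor_null_free[OF n(1)] p by auto
    have "tensor_free_mult V W p' r' - tensor_free_mult V W p r
      = tensor_free_mult V W p' (r' - r) + tensor_free_mult V W (p' - p) r"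
      by (simp add: tensor_free_mult_simps)
    then show ?thesis unfolding tensor_class_eq_iff
      using tensor_free_mult_null_left[OF n(1) r] tensor_free_mult_null_right[OF n(2) p'] tensor_null.add by metis
  qed
  have "(\<Sum>s\<in>Poly_Mapping.keys p. \<Sum>t\<in>Poly_Mapping.keys r.
          Poly_Mapping.single (fst s \<otimes>\<^bsub>V\<^esub> fst t, snd s \<otimes>\<^bsub>W\<^esub> snd t)
            (Poly_Mapping.lookup p s * Poly_Mapping.lookup r t)) = tensor_free_mult V W p r" for p r
    by (simp add: tensor_free_mult_def pm_extend_def cscale_sum)
  moreover have "(\<Union>p'\<in>tensor_class V W p. \<Union>r'\<in>tensor_class V W r. tensor_class V W (tensor_free_mult V W p' r'))
      = tensor_class V W (tensor_free_mult V W p r)"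
    by (intro UN_tensor_class *)
  ultimately show ?thesis unfolding tensor_def by simp
qed

lemma tensor_star_class:
  "star (tensor V W) (tensor_class V W p) = tensor_class V W (tensor_free_star V W p)"
proof -
  have "tensor_class V W (tensor_free_star V W p') = tensor_class V W (tensor_free_star V W p)"
    if "p' \<in> tensor_class V W p" for p'
    using that tensor_free_star_null[of "p' - p"]
    by (simp add: tensor_class_mem tensor_class_eq_iff tensor_free_star_simps)
  then have "(\<Union>p'\<in>tensor_class V W p. tensor_class V W (tensor_free_star V W p')) = tensor_class V W (tensor_free_star V W p)"
    by (rule UN_tensor_class)
  then show ?thesis unfolding tensor_def by (simp add: tensor_free_star_def)
qed

lemma pure_tensor_mult:
  assumes "x \<in> carrier V" "x' \<in> carrier V" "y \<in> carrier W" "y' \<in> carrier W"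
  shows "pure_tensor V W x y \<otimes>\<^bsub>tensor V W\<^esub> pure_tensor V W x' y' = pure_tensor V W (x \<otimes>\<^bsub>V\<^esub> x') (y \<otimes>\<^bsub>W\<^esub> y')"
  unfolding pure_tensor_def using assms by (subst tensor_mult_class) (auto simp: tensor_free_mult_simps)

lemma pure_tensor_star:
  "star (tensor V W) (pure_tensor V W x y) = pure_tensor V W (star V x) (star W y)"
  unfolding pure_tensor_def by (simp add: tensor_star_class tensor_free_star_simps)

lemma tensor_one: "\<one>\<^bsub>tensor V W\<^esub> = pure_tensor V W \<one>\<^bsub>V\<^esub> \<one>\<^bsub>W\<^esub>"
  unfolding tensor_def by simp

lemma tensor_free_mult_keys:
  assumes "Poly_Mapping.keys p \<subseteq> carrier V \<times> carrier W" "Poly_Mapping.keys r \<subseteq> carrier V \<times> carrier W"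
  shows "Poly_Mapping.keys (tensor_free_mult V W p r) \<subseteq> carrier V \<times> carrier W"
  unfolding tensor_free_mult_def pm_extend_def
  by (intro order_trans[OF keys_sum] UN_least order_trans[OF keys_cscale]) (use assms in \<open>auto dest!: subsetD\<close>)

lemma tensor_free_star_keys:
  assumes "Poly_Mapping.keys p \<subseteq> carrier V \<times> carrier W"
  shows "Poly_Mapping.keys (tensor_free_star V W p) \<subseteq> carrier V \<times> carrier W"
  unfolding tensor_free_star_def
  by (intro order_trans[OF keys_sum] UN_least) (use assms in \<open>auto dest!: subsetD\<close>)

text \<open>The algebra laws are multilinear or conjugate linear, so they are reduced, one argument at a time, to
  pure tensors.\<close>

lemma star_algebra_tensor: "star_algebra (tensor V W)"
proof -
  let ?T = "tensor V W"
  interpret T: complex_space ?T by (rule complex_space_tensor)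
  note cs = V.complex_space_axioms W.complex_space_axioms
  have closed: "X \<otimes>\<^bsub>?T\<^esub> Y \<in> carrier ?T" if "X \<in> carrier ?T" "Y \<in> carrier ?T" for X Y
    using that by (elim tensor_carrierE) (simp add: tensor_mult_class tensor_class_closed tensor_free_mult_keys)
  have ld: "(X \<oplus>\<^bsub>?T\<^esub> Y) \<otimes>\<^bsub>?T\<^esub> Z = X \<otimes>\<^bsub>?T\<^esub> Z \<oplus>\<^bsub>?T\<^esub> Y \<otimes>\<^bsub>?T\<^esub> Z"
    and rd: "Z \<otimes>\<^bsub>?T\<^esub> (X \<oplus>\<^bsub>?T\<^esub> Y) = Z \<otimes>\<^bsub>?T\<^esub> X \<oplus>\<^bsub>?T\<^esub> Z \<otimes>\<^bsub>?T\<^esub> Y"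
    if XYZ: "X \<in> carrier ?T" "Y \<in> carrier ?T" "Z \<in> carrier ?T" for X Y Z
  proof -
    obtain p r s where prs: "X = tensor_class V W p" "Y = tensor_class V W r" "Z = tensor_class V W s"
      "Poly_Mapping.keys p \<subseteq> carrier V \<times> carrier W" "Poly_Mapping.keys r \<subseteq> carrier V \<times> carrier W"
      "Poly_Mapping.keys s \<subseteq> carrier V \<times> carrier W"
      using XYZ by (metis tensor_carrierE)
    have k: "Poly_Mapping.keys (p + r) \<subseteq> carrier V \<times> carrier W"
      using Poly_Mapping.keys_add[of p r] prs(4,5) by blast
    show "(X \<oplus>\<^bsub>?T\<^esub> Y) \<otimes>\<^bsub>?T\<^esub> Z = X \<otimes>\<^bsub>?T\<^esub> Z \<oplus>\<^bsub>?T\<^esub> Y \<otimes>\<^bsub>?T\<^esub> Z"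
      "Z \<otimes>\<^bsub>?T\<^esub> (X \<oplus>\<^bsub>?T\<^esub> Y) = Z \<otimes>\<^bsub>?T\<^esub> X \<oplus>\<^bsub>?T\<^esub> Z \<otimes>\<^bsub>?T\<^esub> Y"
      by (simp_all add: prs k tensor_add_class tensor_mult_class tensor_free_mult_simps)
  qed
  have sl: "(c \<odot>\<^bsub>?T\<^esub> X) \<otimes>\<^bsub>?T\<^esub> Y = c \<odot>\<^bsub>?T\<^esub> (X \<otimes>\<^bsub>?T\<^esub> Y)"
    and sr: "X \<otimes>\<^bsub>?T\<^esub> (c \<odot>\<^bsub>?T\<^esub> Y) = c \<odot>\<^bsub>?T\<^esub> (X \<otimes>\<^bsub>?T\<^esub> Y)"
    if XY: "X \<in> carrier ?T" "Y \<in> carrier ?T" for X Y c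
  proof -
    obtain p r where prs: "X = tensor_class V W p" "Y = tensor_class V W r"
      "Poly_Mapping.keys p \<subseteq> carrier V \<times> carrier W" "Poly_Mapping.keys r \<subseteq> carrier V \<times> carrier W"
      using XY by (metis tensor_carrierE)
    have k: "Poly_Mapping.keys (cscale c p) \<subseteq> carrier V \<times> carrier W" "Poly_Mapping.keys (cscale c r) \<subseteq> carrier V \<times> carrier W"
      using keys_cscale[of c p] keys_cscale[of c r] prs(3,4) by blast+
    show "(c \<odot>\<^bsub>?T\<^esub> X) \<otimes>\<^bsub>?T\<^esub> Y = c \<odot>\<^bsub>?T\<^esub> (X \<otimes>\<^bsub>?T\<^esub> Y)"
      "X \<otimes>\<^bsub>?T\<^esub> (c \<odot>\<^bsub>?T\<^esub> Y) = c \<odot>\<^bsub>?T\<^esub> (X \<otimes>\<^bsub>?T\<^esub> Y)"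
      by (simp_all add: prs k tensor_smult_class tensor_mult_class tensor_free_mult_simps)
  qed
  have stc: "star ?T X \<in> carrier ?T" if "X \<in> carrier ?T" for X
    using that by (elim tensor_carrierE) (simp add: tensor_star_class tensor_class_closed tensor_free_star_keys)
  have sta: "star ?T (X \<oplus>\<^bsub>?T\<^esub> Y) = star ?T X \<oplus>\<^bsub>?T\<^esub> star ?T Y" if "X \<in> carrier ?T" "Y \<in> carrier ?T" for X Y
    using that by (auto elim!: tensor_carrierE simp: tensor_star_class tensor_add_class tensor_free_star_simps)
  have sts: "star ?T (c \<odot>\<^bsub>?T\<^esub> X) = cnj c \<odot>\<^bsub>?T\<^esub> star ?T X" if "X \<in> carrier ?T" for X c
    using that by (auto elim!: tensor_carrierE simp: tensor_star_class tensor_smult_class tensor_free_star_simps)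
  have one: "\<one>\<^bsub>?T\<^esub> \<in> carrier ?T" by (simp add: tensor_one)
  have lo: "\<one>\<^bsub>?T\<^esub> \<otimes>\<^bsub>?T\<^esub> X = X" and ro: "X \<otimes>\<^bsub>?T\<^esub> \<one>\<^bsub>?T\<^esub> = X" and ss: "star ?T (star ?T X) = X"
    if "X \<in> carrier ?T" for X
    using that cs
    by (induction X rule: tensor_induct)
      (simp_all add: tensor_one pure_tensor_mult pure_tensor_star ld rd sta stc)
  have as2: "(pure_tensor V W x y \<otimes>\<^bsub>?T\<^esub> pure_tensor V W x' y') \<otimes>\<^bsub>?T\<^esub> Z = pure_tensor V W x y \<otimes>\<^bsub>?T\<^esub> (pure_tensor V W x' y' \<otimes>\<^bsub>?T\<^esub> Z)"
    if "x \<in> carrier V" "y \<in> carrier W" "x' \<in> carrier V" "y' \<in> carrier W" "Z \<in> carrier ?T" for x y x' y' Z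
    using that(5) cs
    by (induction Z rule: tensor_induct)
      (simp_all add: that pure_tensor_mult rd closed V.m_assoc W.m_assoc)
  have as1: "(pure_tensor V W x y \<otimes>\<^bsub>?T\<^esub> Y) \<otimes>\<^bsub>?T\<^esub> Z = pure_tensor V W x y \<otimes>\<^bsub>?T\<^esub> (Y \<otimes>\<^bsub>?T\<^esub> Z)"
    if "x \<in> carrier V" "y \<in> carrier W" "Y \<in> carrier ?T" "Z \<in> carrier ?T" for x y Y Z
    using that(3) cs
    by (induction Y rule: tensor_induct)
      (simp_all add: that as2 rd ld closed)
  have as: "(X \<otimes>\<^bsub>?T\<^esub> Y) \<otimes>\<^bsub>?T\<^esub> Z = X \<otimes>\<^bsub>?T\<^esub> (Y \<otimes>\<^bsub>?T\<^esub> Z)"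
    if "X \<in> carrier ?T" "Y \<in> carrier ?T" "Z \<in> carrier ?T" for X Y Z
    using that(1) cs
    by (induction X rule: tensor_induct)
      (simp_all add: that as1 ld closed)
  have sm1: "star ?T (pure_tensor V W x y \<otimes>\<^bsub>?T\<^esub> Y) = star ?T Y \<otimes>\<^bsub>?T\<^esub> star ?T (pure_tensor V W x y)"
    if "x \<in> carrier V" "y \<in> carrier W" "Y \<in> carrier ?T" for x y Y
    using that(3) cs
    by (induction Y rule: tensor_induct)
      (simp_all add: that sta stc rd ld closed pure_tensor_mult pure_tensor_star V.star_mult W.star_mult)
  have sm: "star ?T (X \<otimes>\<^bsub>?T\<^esub> Y) = star ?T Y \<otimes>\<^bsub>?T\<^esub> star ?T X"
    if "X \<in> carrier ?T" "Y \<in> carrier ?T" for X Y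
    using that(1) cs
    by (induction X rule: tensor_induct)
      (simp_all add: that sm1 sta stc rd ld closed)
  show ?thesis
    by (rule star_algebraI[OF T.complex_space_axioms closed one as lo ro ld rd])
      (assumption | rule star_algebra_axioms.intro sl sr stc sta sts sm ss)+
qed

end

text \<open>Multiplicativity and compatibility with the star need only be checked on pure tensors, again by
  linearity in each argument.\<close>

lemma star_hom_tensorI:
  assumes VW: "star_algebra V" "star_algebra W" "star_algebra Z" and f: "linear_on (tensor V W) Z f"
    and mult: "\<And>x x' y y'. x \<in> carrier V \<Longrightarrow> x' \<in> carrier V \<Longrightarrow> y \<in> carrier W \<Longrightarrow> y' \<in> carrier W \<Longrightarrow>
      f (pure_tensor V W (x \<otimes>\<^bsub>V\<^esub> x') (y \<otimes>\<^bsub>W\<^esub> y')) = f (pure_tensor V W x y) \<otimes>\<^bsub>Z\<^esub> f (pure_tensor V W x' y')"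
    and one: "f (pure_tensor V W \<one>\<^bsub>V\<^esub> \<one>\<^bsub>W\<^esub>) = \<one>\<^bsub>Z\<^esub>"
    and star: "\<And>x y. x \<in> carrier V \<Longrightarrow> y \<in> carrier W \<Longrightarrow> f (pure_tensor V W (star V x) (star W y)) = star Z (f (pure_tensor V W x y))"
  shows "star_hom (tensor V W) Z f"
proof -
  interpret V: star_algebra V by fact
  interpret W: star_algebra W by fact
  interpret Z: star_algebra Z by fact
  interpret T: star_algebra "tensor V W" by (rule star_algebra_tensor) fact+
  note fc = linear_on_closed[OF f] and fa = linear_on_add[OF f]
  note cs = V.complex_space_axioms W.complex_space_axioms
  have m1: "f (pure_tensor V W x y \<otimes>\<^bsub>tensor V W\<^esub> Y) = f (pure_tensor V W x y) \<otimes>\<^bsub>Z\<^esub> f Y"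
    if xy: "x \<in> carrier V" "y \<in> carrier W" and Y: "Y \<in> carrier (tensor V W)" for x y Y
    using Y cs by (induction Y rule: tensor_induct) (simp_all add: xy pure_tensor_mult VW mult T.r_distr fa fc Z.r_distr)
  show ?thesis
  proof (rule star_homI[OF f])
    show "f (X \<otimes>\<^bsub>tensor V W\<^esub> Y) = f X \<otimes>\<^bsub>Z\<^esub> f Y" if "X \<in> carrier (tensor V W)" and Y: "Y \<in> carrier (tensor V W)" for X Y
      using that(1) cs by (induction X rule: tensor_induct) (simp_all add: Y m1 T.l_distr fa fc Z.l_distr)
    show "f (star (tensor V W) X) = star Z (f X)" if "X \<in> carrier (tensor V W)" for X
      using that cs by (induction X rule: tensor_induct) (simp_all add: pure_tensor_star VW star T.star_add fa fc Z.star_add)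
    show "f \<one>\<^bsub>tensor V W\<^esub> = \<one>\<^bsub>Z\<^esub>" by (simp add: tensor_one[OF VW(1,2)] one)
  qed
qed

lemma star_hom_tensor_map:
  assumes VW: "star_algebra V" "star_algebra W" "star_algebra V'" "star_algebra W'"
    and f: "star_hom V V' f" and g: "star_hom W W' g"
  shows "star_hom (tensor V W) (tensor V' W') (tensor_map V W V' W' f g)"
proof -
  interpret V: star_algebra V by fact
  interpret W: star_algebra W by fact
  note L = tensor_map[OF V.complex_space_axioms W.complex_space_axioms star_hom_linear[OF f] star_hom_linear[OF g]]
  show ?thesis
    by (rule star_hom_tensorI[OF VW(1,2) star_algebra_tensor[OF VW(3,4)] L(1)])
     (simp_all add: L(2) pure_tensor_mult[OF VW(3,4)] pure_tensor_star[OF VW(3,4)] tensor_one[OF VW(3,4)]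
       star_hom_closed[OF f] star_hom_closed[OF g] star_hom_mult[OF f] star_hom_mult[OF g]
       star_hom_one[OF f] star_hom_one[OF g] star_hom_star[OF f] star_hom_star[OF g])
qed

lemma star_hom_tensor_assoc:
  assumes VW: "star_algebra V" "star_algebra W" "star_algebra Z"
  shows "star_hom (tensor (tensor V W) Z) (tensor V (tensor W Z)) (tensor_assoc V W Z)"
proof -
  interpret V: star_algebra V by fact
  interpret W: star_algebra W by fact
  interpret Z: star_algebra Z by fact
  note cs = V.complex_space_axioms W.complex_space_axioms Z.complex_space_axioms
  note VW1 = star_algebra_tensor[OF VW(1,2)] and WZ = star_algebra_tensor[OF VW(2,3)]
  note T = star_algebra_tensor[OF VW(1) WZ]
  interpret T: star_algebra "tensor V (tensor W Z)" by (rule T)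
  interpret VW: star_algebra "tensor V W" by (rule VW1)
  let ?a = "tensor_assoc V W Z" and ?p = "pure_tensor (tensor V W) Z"
  note a = tensor_assoc[OF cs]
  note al = a(1) and ap = a(2)
  note aa = linear_on_add[OF al] and ac = linear_on_closed[OF al]
  have add: "?a (?p (X \<oplus>\<^bsub>tensor V W\<^esub> Y) z) = ?a (?p X z) \<oplus>\<^bsub>tensor V (tensor W Z)\<^esub> ?a (?p Y z)"
    if "X \<in> carrier (tensor V W)" "Y \<in> carrier (tensor V W)" "z \<in> carrier Z" for X Y z
    using that by (simp add: pure_tensor_simps aa)
  have m1: "?a (?p (pure_tensor V W x y \<otimes>\<^bsub>tensor V W\<^esub> Y) (z \<otimes>\<^bsub>Z\<^esub> z')) = ?a (?p (pure_tensor V W x y) z) \<otimes>\<^bsub>tensor V (tensor W Z)\<^esub> ?a (?p Y z')"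
    if xy: "x \<in> carrier V" "y \<in> carrier W" "z \<in> carrier Z" "z' \<in> carrier Z" and Y: "Y \<in> carrier (tensor V W)" for x y Y z z'
    using Y cs(1,2)
    by (induction Y rule: tensor_induct)
      (simp_all add: xy ap pure_tensor_mult VW WZ VW.r_distr T.r_distr add ac)
  show ?thesis
  proof (rule star_hom_tensorI[OF VW1 VW(3) T al])
    show "?a (?p (X \<otimes>\<^bsub>tensor V W\<^esub> X') (z \<otimes>\<^bsub>Z\<^esub> z')) = ?a (?p X z) \<otimes>\<^bsub>tensor V (tensor W Z)\<^esub> ?a (?p X' z')"
      if "X \<in> carrier (tensor V W)" "X' \<in> carrier (tensor V W)" "z \<in> carrier Z" "z' \<in> carrier Z" for X X' z z'
      using that(1) cs(1,2)
      by (induction X rule: tensor_induct) (simp_all add: that m1 VW.l_distr T.l_distr add ac)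
    show "?a (?p (star (tensor V W) X) (star Z z)) = star (tensor V (tensor W Z)) (?a (?p X z))"
      if "X \<in> carrier (tensor V W)" "z \<in> carrier Z" for X z
      using that(1) cs(1,2)
      by (induction X rule: tensor_induct)
        (simp_all add: that ap pure_tensor_star VW WZ VW.star_add T.star_add add ac)
    show "?a (?p \<one>\<^bsub>tensor V W\<^esub> \<one>\<^bsub>Z\<^esub>) = \<one>\<^bsub>tensor V (tensor W Z)\<^esub>"
      by (simp add: tensor_one VW WZ ap)
  qed
qed

section \<open>Free star-algebras and their quotients\<close>

text \<open>The scalars as an algebra, so that functionals and characters are linear maps and star-homomorphisms.\<close>

definition complex_alg :: "complex star_alg" where
  "complex_alg = \<lparr>carrier = UNIV, monoid.mult = (*), one = 1, zero = 0, add = (+), smult = (*), star = cnj\<rparr>"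

lemma complex_alg_simps [simp]:
  "carrier complex_alg = UNIV" "monoid.mult complex_alg = (*)" "one complex_alg = 1" "zero complex_alg = 0"
  "add complex_alg = (+)" "smult complex_alg = (*)" "star complex_alg = cnj"
  unfolding complex_alg_def by simp_all

lemma star_algebra_complex: "star_algebra complex_alg"
  by (rule star_algebraI[OF complex_spaceI]; (unfold_locales)?) (simp_all add: algebra_simps)

lemma complex_space_complex: "complex_space complex_alg"
  using star_algebra_complex star_algebra.axioms(1) by blast

lemma finsum_complex: "finsum complex_alg f S = sum f S"
proof -
  interpret star_algebra complex_alg by (rule star_algebra_complex)
  show ?thesis by (induction S rule: infinite_finite_induct) simp_all
qed

lemma monoid_star_alg_simps [simp]:
  "carrier (monoid_star_alg i) = UNIV" "monoid.mult (monoid_star_alg i) = (*)" "one (monoid_star_alg i) = 1"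
  "zero (monoid_star_alg i) = 0" "add (monoid_star_alg i) = (+)" "smult (monoid_star_alg i) = cscale"
  unfolding monoid_star_alg_def
  by (simp_all add: fun_eq_iff cscale_def mult_map_scale_conv_mult)

lemma poly_mapping_induct [case_names zero single add]:
  fixes p :: "'k \<Rightarrow>\<^sub>0 'c::comm_monoid_add"
  assumes "P 0" "\<And>s c. P (Poly_Mapping.single s c)" "\<And>p r. P p \<Longrightarrow> P r \<Longrightarrow> P (p + r)"
  shows "P p"
  using poly_mapping_keys_induct[of p UNIV P] assms by simp

context
  fixes invol :: "'m::monoid_add \<Rightarrow> 'm"
  assumes invol: "\<And>m. invol (invol m) = m" "\<And>m n. invol (m + n) = invol n + invol m"
begin

lemma lookup_monoid_star:
  "Poly_Mapping.lookup (star (monoid_star_alg invol) p) m = cnj (Poly_Mapping.lookup p (invol m))"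
proof -
  have "Poly_Mapping.lookup (star (monoid_star_alg invol) p) m =
    (\<Sum>k\<in>Poly_Mapping.keys p. if k = invol m then cnj (Poly_Mapping.lookup p k) else 0)"
  proof -
    have "invol k = m \<longleftrightarrow> k = invol m" for k using invol(1) by metis
    then show ?thesis
      by (simp add: monoid_star_alg_def lookup_sum lookup_single when_def)
  qed
  also have "\<dots> = cnj (Poly_Mapping.lookup p (invol m))"
    by (simp add: in_keys_iff)
  finally show ?thesis .
qed

lemma monoid_star_single: "star (monoid_star_alg invol) (Poly_Mapping.single m c) = Poly_Mapping.single (invol m) (cnj c)"
  using invol(1) by (intro poly_mapping_eqI) (auto simp: lookup_monoid_star lookup_single when_def)

lemma star_algebra_monoid: "star_algebra (monoid_star_alg invol)"
proof -
  let ?s = "star (monoid_star_alg invol)"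
  have add: "?s (p + r) = ?s p + ?s r" for p r
    by (rule poly_mapping_eqI) (simp add: lookup_monoid_star lookup_add)
  have zero: "?s 0 = 0" by (rule poly_mapping_eqI) (simp add: lookup_monoid_star)
  have "?s (Poly_Mapping.single m c * r) = ?s r * ?s (Poly_Mapping.single m c)" for m c r
    by (induction r rule: poly_mapping_induct)
      (simp_all add: zero mult_single monoid_star_single invol(2) add distrib_left distrib_right mult.commute)
  then have mult: "?s (p * r) = ?s r * ?s p" for p r
    by (induction p rule: poly_mapping_induct) (simp_all add: zero add distrib_left distrib_right)
  have ml: "cscale c p * r = cscale c (p * r)" for c and p r :: "'m \<Rightarrow>\<^sub>0 complex"
    by (simp add: cscale_def mult_map_scale_conv_mult mult.assoc)
  have "Poly_Mapping.single m d * cscale c r = cscale c (Poly_Mapping.single m d * r)" for m d c and r :: "'m \<Rightarrow>\<^sub>0 complex"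
    by (induction r rule: poly_mapping_induct) (simp_all add: mult_single cscale_add distrib_left mult.left_commute)
  then have mr: "p * cscale c r = cscale c (p * r)" for c and p r :: "'m \<Rightarrow>\<^sub>0 complex"
    by (induction p rule: poly_mapping_induct) (simp_all add: cscale_add distrib_right)
  show ?thesis
  proof (rule star_algebraI[OF complex_spaceI])
    show "star_algebra_axioms (monoid_star_alg invol)"
      by unfold_locales
       (auto simp: ml mr add mult intro!: poly_mapping_eqI, auto simp: lookup_monoid_star invol)
  qed (simp_all add: algebra_simps cscale_add cscale_add_scalar cscale_cscale cscale_minus_one)
qed

end

lemma word_star_word_star: "word_star (word_star w) = w"
  unfolding word_star_def by (cases w) (simp add: rev_map comp_def case_prod_beta)

lemma word_star_plus: "word_star (v + w) = word_star w + word_star v"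
  unfolding word_star_def plus_star_word_def by simp

lemma word_star_simps: "word_star 0 = 0" "word_star (Word [(g, b)]) = Word [(g, \<not> b)]"
  unfolding word_star_def zero_star_word_def by simp_all

lemma free_alg_simps [simp]:
  "carrier free_alg = UNIV" "monoid.mult free_alg = (*)" "one free_alg = 1"
  "zero free_alg = 0" "add free_alg = (+)" "smult free_alg = cscale"
  unfolding free_alg_def by simp_all

lemma star_algebra_free: "star_algebra free_alg"
  unfolding free_alg_def by (rule star_algebra_monoid) (simp_all add: word_star_word_star word_star_plus)

lemma star_free_single: "star free_alg (Poly_Mapping.single w c) = Poly_Mapping.single (word_star w) (cnj c)"
  unfolding free_alg_def by (rule monoid_star_single) (simp_all add: word_star_word_star word_star_plus)

lemma star_free_simps:
  fixes p r :: "'g free"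
  shows "star free_alg (p + r) = star free_alg p + star free_alg r"
    "star free_alg (p * r) = star free_alg r * star free_alg p"
    "star free_alg (cscale c p) = cscale (cnj c) (star free_alg p)"
    "star free_alg (star free_alg p) = p"
    "star free_alg (0 :: 'g free) = 0" "star free_alg (1 :: 'g free) = 1"
    "star free_alg (p - r) = star free_alg p - star free_alg r"
    "cscale c p * r = cscale c (p * r)" "p * cscale c r = cscale c (p * r)"
proof -
  interpret star_algebra "free_alg :: 'g free star_alg" by (rule star_algebra_free)
  show "star free_alg (p + r) = star free_alg p + star free_alg r"
    "star free_alg (p * r) = star free_alg r * star free_alg p"
    "star free_alg (cscale c p) = cscale (cnj c) (star free_alg p)"
    "star free_alg (star free_alg p) = p"
    "star free_alg (0 :: 'g free) = 0" "star free_alg (1 :: 'g free) = 1"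
    "cscale c p * r = cscale c (p * r)" "p * cscale c r = cscale c (p * r)"
    using star_add star_mult star_smult star_star star_zero star_one smult_mult_left smult_mult_right by simp_all
  show "star free_alg (p - r) = star free_alg p - star free_alg r"
    using star_add[of p "cscale (-1) r"] star_smult[of r "-1"] by (simp add: cscale_minus_one)
qed

lemma star_free_gen [simp]: "star free_alg (gen g) = gen_star g" "star free_alg (gen_star g) = gen g"
  by (simp_all add: gen_def gen_star_def star_free_single word_star_simps)

lemma const_eq_cscale: "const c = cscale c 1"
  unfolding const_def cscale_def mult_map_scale_conv_mult by simp

lemma const_mult: "const c * p = cscale c p"
  unfolding const_def cscale_def mult_map_scale_conv_mult ..

lemma free_induct [case_names const gen gen_star add mult]:
  fixes p :: "'g free"
  assumes const: "\<And>c. P (const c)" and gen: "\<And>g. P (gen g)" and gen_star: "\<And>g. P (gen_star g)"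
    and add: "\<And>p r. P p \<Longrightarrow> P r \<Longrightarrow> P (p + r)" and mult: "\<And>p r. P p \<Longrightarrow> P r \<Longrightarrow> P (p * r)"
  shows "P p"
proof (induction p rule: poly_mapping_induct)
  case zero
  then show ?case using const[of 0] by (simp add: const_def)
next
  case (single w c)
  have "P (Poly_Mapping.single (Word ls) 1)" for ls
  proof (induction ls)
    case Nil
    then show ?case using const[of 1] by (simp add: const_def zero_star_word_def)
  next
    case (Cons l ls)
    have "Poly_Mapping.single (Word (l # ls)) (1::complex) = Poly_Mapping.single (Word [l]) 1 * Poly_Mapping.single (Word ls) 1"
      by (simp add: mult_single plus_star_word_def)
    moreover have "P (Poly_Mapping.single (Word [l]) 1)"
      using gen[of "fst l"] gen_star[of "fst l"] unfolding gen_def gen_star_def by (cases l; cases "snd l") auto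
    ultimately show ?case using Cons mult by simp
  qed
  from mult[OF const this[of "letters w"]] show ?case
    by (simp add: const_mult)
qed (rule add)

definition letter_val :: "('a, 'm) star_alg_scheme \<Rightarrow> ('g \<Rightarrow> 'a) \<Rightarrow> 'g \<times> bool \<Rightarrow> 'a" where
  "letter_val B a l = (if snd l then star B (a (fst l)) else a (fst l))"

definition word_val :: "('a, 'm) star_alg_scheme \<Rightarrow> ('g \<Rightarrow> 'a) \<Rightarrow> 'g star_word \<Rightarrow> 'a" where
  "word_val B a w = foldr (\<lambda>l x. letter_val B a l \<otimes>\<^bsub>B\<^esub> x) (letters w) \<one>\<^bsub>B\<^esub>"

definition free_lift :: "('a, 'm) star_alg_scheme \<Rightarrow> ('g \<Rightarrow> 'a) \<Rightarrow> 'g free \<Rightarrow> 'a" where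
  "free_lift B a = lincomb B (word_val B a)"

context star_algebra
begin

context
  fixes a :: "'g \<Rightarrow> 'a" assumes a: "\<And>g. a g \<in> carrier A"
begin

lemma letter_val_closed [simp]: "letter_val A a l \<in> carrier A"
  by (simp add: letter_val_def a)

lemma word_val_closed [simp]: "word_val A a w \<in> carrier A"
proof -
  have "foldr (\<lambda>l x. letter_val A a l \<otimes> x) ls \<one> \<in> carrier A" for ls
    by (induction ls) simp_all
  then show ?thesis unfolding word_val_def by simp
qed

lemma word_val_plus: "word_val A a (v + w) = word_val A a v \<otimes> word_val A a w"
proof -
  have "foldr (\<lambda>l x. letter_val A a l \<otimes> x) (ls @ letters w) \<one> =
     foldr (\<lambda>l x. letter_val A a l \<otimes> x) ls \<one> \<otimes> word_val A a w
     \<and> foldr (\<lambda>l x. letter_val A a l \<otimes> x) ls \<one> \<in> carrier A" for ls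
    by (induction ls) (auto simp: m_assoc word_val_def[symmetric])
  then show ?thesis by (simp add: word_val_def plus_star_word_def)
qed

lemma word_val_star: "word_val A a (word_star w) = star A (word_val A a w)"
proof -
  have "word_val A a (word_star (Word ls)) = star A (word_val A a (Word ls))" for ls
  proof (induction ls)
    case Nil
    then show ?case by (simp add: word_star_def word_val_def)
  next
    case (Cons l ls)
    have [simp]: "word_val A a (Word [l]) = letter_val A a l" for l
      by (simp add: word_val_def)
    have "Word (l # ls) = Word [l] + Word ls" by (simp add: plus_star_word_def)
    moreover have "letter_val A a (fst l, \<not> snd l) = star A (letter_val A a l)"
      by (simp add: letter_val_def a)
    moreover have "word_star (Word [l]) = Word [(fst l, \<not> snd l)]"
      by (cases l) (simp add: word_star_simps)
    ultimately show ?case using Cons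
      by (simp add: word_star_plus word_val_plus star_mult)
  qed
  from this[of "letters w"] show ?thesis by simp
qed

lemma free_lift_single: "free_lift A a (Poly_Mapping.single w c) = c \<odot> word_val A a w"
  unfolding free_lift_def by (rule lincomb_single) simp

lemma free_lift_zero [simp]: "free_lift A a 0 = \<zero>"
  unfolding free_lift_def by simp

lemma free_lift_closed [simp]: "free_lift A a p \<in> carrier A"
  unfolding free_lift_def by (rule lincomb_closed) simp

lemma free_lift_add: "free_lift A a (p + r) = free_lift A a p \<oplus> free_lift A a r"
  unfolding free_lift_def by (rule lincomb_add[of _ UNIV]) simp_all

lemma free_lift_mult: "free_lift A a (p * r) = free_lift A a p \<otimes> free_lift A a r"
proof -
  have "free_lift A a (Poly_Mapping.single w c * r) = free_lift A a (Poly_Mapping.single w c) \<otimes> free_lift A a r" for w c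
    by (induction r rule: poly_mapping_induct)
     (simp_all add: mult_single free_lift_single word_val_plus free_lift_add distrib_left r_distr smult_mult_left
       smult_mult_right mult.commute)
  then show ?thesis
    by (induction p rule: poly_mapping_induct) (simp_all add: free_lift_add distrib_right l_distr)
qed

lemma star_hom_free_lift: "star_hom free_alg A (free_lift A a)"
proof (rule star_homI[OF linear_onI])
  interpret F: star_algebra free_alg by (rule star_algebra_free)
  show "free_lift A a (c \<odot>\<^bsub>free_alg\<^esub> p) = c \<odot> free_lift A a p" for c p
    unfolding free_lift_def free_alg_simps by (rule lincomb_cscale) simp
  show "free_lift A a \<one>\<^bsub>free_alg\<^esub> = \<one>"
    using free_lift_single[of 0 1] by (simp add: word_val_def zero_star_word_def[symmetric])
      (simp add: zero_star_word_def)
  show "free_lift A a (star free_alg p) = star A (free_lift A a p)" for p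
    by (induction p rule: poly_mapping_induct)
     (simp_all add: star_free_simps star_free_single free_lift_single word_val_star star_smult free_lift_add star_add)
qed (simp_all add: free_lift_add free_lift_mult)

lemma free_lift_gen [simp]: "free_lift A a (gen g) = a g" "free_lift A a (gen_star g) = star A (a g)"
  by (simp_all add: gen_def gen_star_def free_lift_single word_val_def letter_val_def a)

end

end

lemma linear_on_free_diff:
  assumes "linear_on free_alg B f" "complex_space B"
  shows "f (p - r) = f p \<ominus>\<^bsub>B\<^esub> f r"
proof -
  interpret B: complex_space B by fact
  interpret F: star_algebra free_alg by (rule star_algebra_free)
  have [simp]: "f p \<in> carrier B" for p using linear_on_closed[OF assms(1)] by simp
  have "f (p - r) = f (p + cscale (-1) r)" by (simp add: cscale_minus_one)
  also have "\<dots> = f p \<oplus>\<^bsub>B\<^esub> (-1) \<odot>\<^bsub>B\<^esub> f r"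
    using linear_on_add[OF assms(1), of p "cscale (-1) r"] linear_on_smult[OF assms(1), of r "-1"] by simp
  finally show ?thesis by (simp add: B.smult_minus_one B.minus_eq)
qed

lemma star_hom_free_sum:
  assumes "linear_on free_alg B f" "complex_space B"
  shows "f (\<Sum>i\<in>S. g i) = (\<Oplus>\<^bsub>B\<^esub>i\<in>S. f (g i))"
proof -
  interpret F: star_algebra free_alg by (rule star_algebra_free)
  have "finsum free_alg g S = sum g S"
    by (induction S rule: infinite_finite_induct) simp_all
  then show ?thesis using linear_on_finsum[OF assms(1) F.complex_space_axioms assms(2), of g S] by simp
qed

lemma star_hom_const:
  assumes "star_hom free_alg B f"
  shows "f (const c) = c \<odot>\<^bsub>B\<^esub> \<one>\<^bsub>B\<^esub>"
  using star_hom_smult[OF assms, of 1 c] star_hom_one[OF assms] by (simp add: const_eq_cscale)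

lemma free_star_hom_eqI:
  assumes f: "star_hom free_alg B f" and g: "star_hom free_alg B g" and eq: "\<And>x. f (gen x) = g (gen x)"
  shows "f p = g p"
proof (induction p rule: free_induct)
  case (gen_star x)
  show ?case using star_hom_star[OF f, of "gen x"] star_hom_star[OF g, of "gen x"] eq[of x] by simp
next
  case (mult p r)
  then show ?case using star_hom_mult[OF f, of p r] star_hom_mult[OF g, of p r] by simp
next
  case (add p r)
  then show ?case using star_hom_add[OF f, of p r] star_hom_add[OF g, of p r] by simp
qed (simp_all add: eq star_hom_const[OF f] star_hom_const[OF g])

subsection \<open>Quotients\<close>

text \<open>Both the relation ideal of a presentation and the kernel of all representations are of this kind, so the
  quotients are treated uniformly.\<close>

definition star_ideal :: "'g free set \<Rightarrow> bool" where
  "star_ideal I \<longleftrightarrow> 0 \<in> I \<and> (\<forall>p\<in>I. \<forall>r\<in>I. p + r \<in> I) \<and> (\<forall>p\<in>I. \<forall>s. s * p \<in> I \<and> p * s \<in> I) \<and>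
     (\<forall>p\<in>I. star free_alg p \<in> I)"

lemma ideal_freeI:
  fixes I :: "'a free set"
  assumes "0 \<in> I" "\<And>p r. p \<in> I \<Longrightarrow> r \<in> I \<Longrightarrow> p + r \<in> I" "\<And>p s. p \<in> I \<Longrightarrow> s * p \<in> I" "\<And>p s. p \<in> I \<Longrightarrow> p * s \<in> I"
  shows "ideal I free_alg"
proof -
  interpret F: star_algebra "free_alg :: 'a free star_alg" by (rule star_algebra_free)
  have neg: "- p \<in> I" if "p \<in> I" for p using assms(3)[OF that, of "-1"] by simp
  have inv: "\<ominus>\<^bsub>free_alg\<^esub> p = - p" for p :: "'a free" by (rule F.minus_equality) simp_all
  show ?thesis
  proof (rule idealI)
    show "subgroup I (add_monoid free_alg)"
      by (rule F.add.subgroupI) (use assms neg inv in \<open>auto simp: a_inv_def[symmetric]\<close>)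
  qed (use assms F.ring_axioms in simp_all)
qed

lemma ideal_freeD:
  assumes "ideal I free_alg"
  shows "0 \<in> I" "p \<in> I \<Longrightarrow> r \<in> I \<Longrightarrow> p + r \<in> I" "p \<in> I \<Longrightarrow> s * p \<in> I" "p \<in> I \<Longrightarrow> p * s \<in> I"
proof -
  interpret ideal I free_alg by fact
  show "0 \<in> I" "p \<in> I \<Longrightarrow> r \<in> I \<Longrightarrow> p + r \<in> I" "p \<in> I \<Longrightarrow> s * p \<in> I" "p \<in> I \<Longrightarrow> p * s \<in> I"
    using a_subset additive_subgroup.zero_closed[OF is_additive_subgroup]
      additive_subgroup.a_closed[OF is_additive_subgroup] I_l_closed I_r_closed by simp_all
qed

context
  fixes I :: "'g free set" assumes I: "star_ideal I"
begin

lemma star_idealD: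
  "0 \<in> I" "p \<in> I \<Longrightarrow> r \<in> I \<Longrightarrow> p + r \<in> I" "p \<in> I \<Longrightarrow> s * p \<in> I" "p \<in> I \<Longrightarrow> p * s \<in> I"
  "p \<in> I \<Longrightarrow> star free_alg p \<in> I" "p \<in> I \<Longrightarrow> - p \<in> I" "p \<in> I \<Longrightarrow> r \<in> I \<Longrightarrow> p - r \<in> I" "p \<in> I \<Longrightarrow> cscale c p \<in> I"
proof -
  show m: "p \<in> I \<Longrightarrow> s * p \<in> I" for p s using I unfolding star_ideal_def by blast
  show "p \<in> I \<Longrightarrow> - p \<in> I" for p using m[of p "-1"] by simp
  show "p \<in> I \<Longrightarrow> r \<in> I \<Longrightarrow> p - r \<in> I" using I m[of r "-1"] unfolding star_ideal_def by (metis add_uminus_conv_diff mult_minus1)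
  show "p \<in> I \<Longrightarrow> cscale c p \<in> I" using m[of p "const c"] by (simp add: const_mult)
qed (use I in \<open>auto simp: star_ideal_def\<close>)

lemma quot_class_mem: "r \<in> I +>\<^bsub>free_alg\<^esub> p \<longleftrightarrow> r - p \<in> I"
proof -
  have "(r = i + p) \<longleftrightarrow> (i = r - p)" for i by auto
  then show ?thesis unfolding a_r_coset_def r_coset_def by auto
qed

lemma quot_class_eq: "I +>\<^bsub>free_alg\<^esub> p = I +>\<^bsub>free_alg\<^esub> r \<longleftrightarrow> p - r \<in> I"
proof
  assume "I +>\<^bsub>free_alg\<^esub> p = I +>\<^bsub>free_alg\<^esub> r"
  moreover have "p \<in> I +>\<^bsub>free_alg\<^esub> p" by (simp add: quot_class_mem star_idealD)
  ultimately show "p - r \<in> I" by (simp add: quot_class_mem)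
next
  assume pr: "p - r \<in> I"
  show "I +>\<^bsub>free_alg\<^esub> p = I +>\<^bsub>free_alg\<^esub> r"
  proof (rule Set.set_eqI)
    fix s
    show "s \<in> I +>\<^bsub>free_alg\<^esub> p \<longleftrightarrow> s \<in> I +>\<^bsub>free_alg\<^esub> r"
      using star_idealD(7)[OF _ pr, of "s - r"] star_idealD(2)[OF _ pr, of "s - p"]
      by (auto simp: quot_class_mem)
  qed
qed

lemma ideal_of_star_ideal: "ideal I free_alg"
  by (rule ideal_freeI) (rule star_idealD; assumption?)+

lemma star_quot_simps:
  "carrier (star_quot free_alg I) = range (\<lambda>p. I +>\<^bsub>free_alg\<^esub> p)"
  "(I +>\<^bsub>free_alg\<^esub> p) \<otimes>\<^bsub>star_quot free_alg I\<^esub> (I +>\<^bsub>free_alg\<^esub> r) = I +>\<^bsub>free_alg\<^esub> (p * r)"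
  "(I +>\<^bsub>free_alg\<^esub> p) \<oplus>\<^bsub>star_quot free_alg I\<^esub> (I +>\<^bsub>free_alg\<^esub> r) = I +>\<^bsub>free_alg\<^esub> (p + r)"
  "\<one>\<^bsub>star_quot free_alg I\<^esub> = I +>\<^bsub>free_alg\<^esub> 1"
  "\<zero>\<^bsub>star_quot free_alg I\<^esub> = I +>\<^bsub>free_alg\<^esub> 0"
  "c \<odot>\<^bsub>star_quot free_alg I\<^esub> (I +>\<^bsub>free_alg\<^esub> p) = I +>\<^bsub>free_alg\<^esub> (cscale c p)"
  "star (star_quot free_alg I) (I +>\<^bsub>free_alg\<^esub> p) = I +>\<^bsub>free_alg\<^esub> (star free_alg p)"
proof -
  interpret ideal I free_alg by (rule ideal_of_star_ideal)
  show "carrier (star_quot free_alg I) = range (\<lambda>p. I +>\<^bsub>free_alg\<^esub> p)"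
    by (auto simp: star_quot_def FactRing_def A_RCOSETS_def RCOSETS_def a_r_coset_def)
  show "(I +>\<^bsub>free_alg\<^esub> p) \<otimes>\<^bsub>star_quot free_alg I\<^esub> (I +>\<^bsub>free_alg\<^esub> r) = I +>\<^bsub>free_alg\<^esub> (p * r)"
    using rcoset_mult_add[of p r] by (simp add: star_quot_def FactRing_def)
  show "(I +>\<^bsub>free_alg\<^esub> p) \<oplus>\<^bsub>star_quot free_alg I\<^esub> (I +>\<^bsub>free_alg\<^esub> r) = I +>\<^bsub>free_alg\<^esub> (p + r)"
    using a_rcos_sum[of p r] by (simp add: star_quot_def FactRing_def)
  show "\<one>\<^bsub>star_quot free_alg I\<^esub> = I +>\<^bsub>free_alg\<^esub> 1"
    by (simp add: star_quot_def FactRing_def)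
  show "\<zero>\<^bsub>star_quot free_alg I\<^esub> = I +>\<^bsub>free_alg\<^esub> 0"
    by (auto simp add: star_quot_def FactRing_def quot_class_mem)
  have sc: "I +>\<^bsub>free_alg\<^esub> cscale c r = I +>\<^bsub>free_alg\<^esub> cscale c p" if "r \<in> I +>\<^bsub>free_alg\<^esub> p" for r
    using that star_idealD(8)[of "r - p" c] by (simp add: quot_class_mem quot_class_eq cscale_diff)
  have p: "p \<in> I +>\<^bsub>free_alg\<^esub> p" by (simp add: quot_class_mem star_idealD)
  have "(\<Union>x\<in>I +>\<^bsub>free_alg\<^esub> p. I +>\<^bsub>free_alg\<^esub> cscale c x) = I +>\<^bsub>free_alg\<^esub> cscale c p"
  proof (rule SUP_eq_const)
    show "I +>\<^bsub>free_alg\<^esub> p \<noteq> {}" using p by blast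
  qed (rule sc)
  then show "c \<odot>\<^bsub>star_quot free_alg I\<^esub> (I +>\<^bsub>free_alg\<^esub> p) = I +>\<^bsub>free_alg\<^esub> (cscale c p)"
    by (simp add: star_quot_def)
  have "star free_alg ` (I +>\<^bsub>free_alg\<^esub> p) = I +>\<^bsub>free_alg\<^esub> (star free_alg p)"
  proof (intro equalityI subsetI)
    fix r assume "r \<in> star free_alg ` (I +>\<^bsub>free_alg\<^esub> p)"
    then show "r \<in> I +>\<^bsub>free_alg\<^esub> (star free_alg p)"
      using star_idealD(5) by (auto simp: quot_class_mem star_free_simps(7)[symmetric])
  next
    fix r assume "r \<in> I +>\<^bsub>free_alg\<^esub> (star free_alg p)"
    then have "star free_alg (r - star free_alg p) \<in> I" using star_idealD(5) by (simp add: quot_class_mem)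
    then have "star free_alg r \<in> I +>\<^bsub>free_alg\<^esub> p" by (simp add: quot_class_mem star_free_simps)
    then show "r \<in> star free_alg ` (I +>\<^bsub>free_alg\<^esub> p)" using star_free_simps(4) by (metis imageI)
  qed
  then show "star (star_quot free_alg I) (I +>\<^bsub>free_alg\<^esub> p) = I +>\<^bsub>free_alg\<^esub> (star free_alg p)"
    by (simp add: star_quot_def)
qed

lemma star_algebra_quot: "star_algebra (star_quot free_alg I)"
proof (rule star_algebraI[OF complex_spaceI])
  show "star_algebra_axioms (star_quot free_alg I)"
    by (unfold_locales; clarsimp simp: star_quot_simps star_free_simps)
qed (clarsimp simp: star_quot_simps algebra_simps cscale_add cscale_add_scalar cscale_cscale cscale_minus_one)+

lemma star_hom_quot_class: "star_hom free_alg (star_quot free_alg I) (\<lambda>p. I +>\<^bsub>free_alg\<^esub> p)"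
  by (rule star_homI[OF linear_onI]) (simp_all add: star_quot_simps)

text \<open>Stated for linear maps and not only for star-homomorphisms, because matrix coefficients of representations
  also have to descend to the quotient.\<close>

lemma linear_quot_lift:
  assumes f: "linear_on free_alg B f" and B: "complex_space B" and ker: "\<And>p. p \<in> I \<Longrightarrow> f p = \<zero>\<^bsub>B\<^esub>"
  shows "\<exists>g. linear_on (star_quot free_alg I) B g \<and> (\<forall>p. g (I +>\<^bsub>free_alg\<^esub> p) = f p)"
proof -
  interpret B: complex_space B by fact
  define g where "g X = f (SOME p. p \<in> X)" for X
  have fc: "f p \<in> carrier B" for p using linear_on_closed[OF f] by simp
  have g: "g (I +>\<^bsub>free_alg\<^esub> p) = f p" for p
  proof -
    let ?r = "SOME r. r \<in> I +>\<^bsub>free_alg\<^esub> p"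
    have "?r \<in> I +>\<^bsub>free_alg\<^esub> p" by (rule someI[of _ p]) (simp add: quot_class_mem star_idealD)
    then have "f (?r - p) = \<zero>\<^bsub>B\<^esub>" using ker by (simp add: quot_class_mem)
    then have "f ((?r - p) + p) = \<zero>\<^bsub>B\<^esub> \<oplus>\<^bsub>B\<^esub> f p"
      using linear_on_add[OF f, of "?r - p" p] by simp
    then show ?thesis unfolding g_def using fc by simp
  qed
  have "linear_on (star_quot free_alg I) B g"
    using linear_on_add[OF f] linear_on_smult[OF f] fc
    by (intro linear_onI; clarsimp simp: star_quot_simps g)
  then show ?thesis using g by blast
qed

lemma star_hom_quot_lift:
  assumes f: "star_hom free_alg B f" and B: "star_algebra B" and ker: "\<And>p. p \<in> I \<Longrightarrow> f p = \<zero>\<^bsub>B\<^esub>"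
  shows "\<exists>g. star_hom (star_quot free_alg I) B g \<and> (\<forall>p. g (I +>\<^bsub>free_alg\<^esub> p) = f p)"
proof -
  interpret B: star_algebra B by fact
  obtain g where g: "linear_on (star_quot free_alg I) B g" "\<And>p. g (I +>\<^bsub>free_alg\<^esub> p) = f p"
    using linear_quot_lift[OF star_hom_linear[OF f] B.complex_space_axioms ker] by blast
  have "star_hom (star_quot free_alg I) B g"
    using star_hom_mult[OF f] star_hom_one[OF f] star_hom_star[OF f]
    by (intro star_homI g(1); clarsimp simp: star_quot_simps g(2))
  then show ?thesis using g(2) by blast
qed

end

lemma ideal_kernel:
  assumes f: "star_hom free_alg B f" and B: "star_algebra B"
  shows "ideal {p. f p = \<zero>\<^bsub>B\<^esub>} free_alg"
proof -
  interpret B: star_algebra B by fact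
  interpret F: star_algebra free_alg by (rule star_algebra_free)
  have "f 0 = \<zero>\<^bsub>B\<^esub>"
    using linear_on_zero[OF star_hom_linear[OF f] F.complex_space_axioms B.complex_space_axioms] by simp
  then show ?thesis
    using star_hom_add[OF f] star_hom_mult[OF f] star_hom_closed[OF f] by (intro ideal_freeI) simp_all
qed

definition relation_ideal :: "'g free set \<Rightarrow> 'g free set" where
  "relation_ideal R = Idl\<^bsub>free_alg\<^esub> (R \<union> star free_alg ` R)"

lemma presented_alg_eq: "presented_alg R = star_quot free_alg (relation_ideal R)"
  unfolding presented_alg_def relation_ideal_def ..

lemma relation_ideal_minimal:
  assumes "ideal J free_alg" "R \<subseteq> J" "star free_alg ` R \<subseteq> J"
  shows "relation_ideal R \<subseteq> J"
proof -
  interpret F: star_algebra free_alg by (rule star_algebra_free)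
  show ?thesis unfolding relation_ideal_def using assms by (intro F.genideal_minimal) auto
qed

lemma relation_ideal_self: "r \<in> R \<Longrightarrow> r \<in> relation_ideal R" "r \<in> R \<Longrightarrow> star free_alg r \<in> relation_ideal R"
proof -
  interpret F: star_algebra free_alg by (rule star_algebra_free)
  show "r \<in> R \<Longrightarrow> r \<in> relation_ideal R" "r \<in> R \<Longrightarrow> star free_alg r \<in> relation_ideal R"
    unfolding relation_ideal_def using F.genideal_self[of "R \<union> star free_alg ` R"] by auto
qed

text \<open>The relations are closed under the star, so the elements whose star again lies in the ideal form an
  ideal that contains them.\<close>

lemma star_ideal_relation_ideal: "star_ideal (relation_ideal R)"
proof -
  interpret F: star_algebra free_alg by (rule star_algebra_free)
  have id: "ideal (relation_ideal R) free_alg" unfolding relation_ideal_def by (rule F.genideal_ideal) simp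
  note D = ideal_freeD[OF id]
  let ?J = "{p. p \<in> relation_ideal R \<and> star free_alg p \<in> relation_ideal R}"
  have "ideal ?J free_alg"
    by (intro ideal_freeI) (auto simp: star_free_simps intro: D)
  then have "relation_ideal R \<subseteq> ?J"
    by (intro relation_ideal_minimal) (auto simp: star_free_simps intro: relation_ideal_self)
  then show ?thesis using D unfolding star_ideal_def by blast
qed

lemma star_hom_relation_ideal:
  assumes f: "star_hom free_alg B f" and B: "star_algebra B" and R: "\<And>r. r \<in> R \<Longrightarrow> f r = \<zero>\<^bsub>B\<^esub>"
  shows "p \<in> relation_ideal R \<Longrightarrow> f p = \<zero>\<^bsub>B\<^esub>"
proof -
  interpret B: star_algebra B by fact
  have "relation_ideal R \<subseteq> {p. f p = \<zero>\<^bsub>B\<^esub>}"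
    using star_hom_star[OF f] R by (intro relation_ideal_minimal ideal_kernel[OF f B]) auto
  then show "p \<in> relation_ideal R \<Longrightarrow> f p = \<zero>\<^bsub>B\<^esub>" by auto
qed

section \<open>Operators on square summable sequences\<close>

lemma cmod_add_sq_le: "(cmod (a + b))\<^sup>2 \<le> 2 * (cmod a)\<^sup>2 + 2 * (cmod b)\<^sup>2"
proof -
  have "(cmod (a + b))\<^sup>2 \<le> (cmod a + cmod b)\<^sup>2" by (intro power_mono norm_triangle_ineq) simp
  also have "\<dots> \<le> 2 * (cmod a)\<^sup>2 + 2 * (cmod b)\<^sup>2"
    using zero_le_power2[of "cmod a - cmod b"] by (simp add: power2_eq_square algebra_simps)
  finally show ?thesis .
qed

lemma ell2_add: assumes "x \<in> ell2" "y \<in> ell2" shows "(\<lambda>n. x n + y n) \<in> ell2"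
proof -
  have le: "norm ((cmod (x n + y n))\<^sup>2) \<le> 2 * (cmod (x n))\<^sup>2 + 2 * (cmod (y n))\<^sup>2" for n
    using cmod_add_sq_le[of "x n" "y n"] by simp
  have "summable (\<lambda>n. 2 * (cmod (x n))\<^sup>2 + 2 * (cmod (y n))\<^sup>2)"
    using assms by (intro summable_add summable_mult) (auto simp: ell2_def)
  from summable_comparison_test'[OF this le] show ?thesis unfolding ell2_def mem_Collect_eq .
qed

lemma ell2_scale: "x \<in> ell2 \<Longrightarrow> (\<lambda>n. c * x n) \<in> ell2"
  unfolding ell2_def by (simp add: norm_mult power_mult_distrib summable_mult)

lemma ell2_zero [simp]: "(\<lambda>n. 0) \<in> ell2"
  by (simp add: ell2_def)

lemma ell2_sum: "(\<And>i. i \<in> S \<Longrightarrow> f i \<in> ell2) \<Longrightarrow> (\<lambda>n. \<Sum>i\<in>S. f i n) \<in> ell2"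
  by (induction S rule: infinite_finite_induct) (auto intro: ell2_add)

definition basis_vec :: "nat \<Rightarrow> nat \<Rightarrow> complex" where
  "basis_vec k n = of_bool (n = k)"

lemma basis_vec_ell2 [simp]: "basis_vec k \<in> ell2"
proof -
  have "summable (\<lambda>n. (cmod (basis_vec k n))\<^sup>2)"
    by (rule summable_finite[of "{k}"]) (auto simp: basis_vec_def)
  then show ?thesis by (simp add: ell2_def)
qed

lemma ell2_inner_summable:
  assumes "x \<in> ell2" "y \<in> ell2"
  shows "summable (\<lambda>n. norm (cnj (x n) * y n))"
proof -
  have le: "norm (norm (cnj (x n) * y n)) \<le> (cmod (x n))\<^sup>2 + (cmod (y n))\<^sup>2" for n
  proof -
    have "2 * (cmod (x n) * cmod (y n)) \<le> (cmod (x n))\<^sup>2 + (cmod (y n))\<^sup>2"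
      using zero_le_power2[of "cmod (x n) - cmod (y n)"] by (simp add: power2_eq_square algebra_simps)
    moreover have "0 \<le> cmod (x n) * cmod (y n)" by simp
    moreover have "norm (norm (cnj (x n) * y n)) = cmod (x n) * cmod (y n)"
      by (simp add: norm_mult abs_mult)
    ultimately show ?thesis by linarith
  qed
  have "summable (\<lambda>n. (cmod (x n))\<^sup>2 + (cmod (y n))\<^sup>2)"
    using assms by (intro summable_add) (auto simp: ell2_def)
  from summable_comparison_test'[OF this le] show ?thesis .
qed

lemmas ell2_inner_summable' = ell2_inner_summable[THEN summable_norm_cancel]

lemma ell2_inner_simps:
  assumes "x \<in> ell2" "y \<in> ell2" "z \<in> ell2"
  shows "ell2_inner (\<lambda>n. x n + y n) z = ell2_inner x z + ell2_inner y z"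
    "ell2_inner z (\<lambda>n. x n + y n) = ell2_inner z x + ell2_inner z y"
    "ell2_inner (\<lambda>n. c * x n) z = cnj c * ell2_inner x z"
    "ell2_inner z (\<lambda>n. c * x n) = c * ell2_inner z x"
    "ell2_inner x y = cnj (ell2_inner y x)"
proof -
  note s = ell2_inner_summable'
  show "ell2_inner (\<lambda>n. x n + y n) z = ell2_inner x z + ell2_inner y z"
    unfolding ell2_inner_def using suminf_add[OF s[OF assms(1,3)] s[OF assms(2,3)]] by (simp add: algebra_simps)
  show "ell2_inner z (\<lambda>n. x n + y n) = ell2_inner z x + ell2_inner z y"
    unfolding ell2_inner_def using suminf_add[OF s[OF assms(3,1)] s[OF assms(3,2)]] by (simp add: algebra_simps)
  show "ell2_inner (\<lambda>n. c * x n) z = cnj c * ell2_inner x z"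
    unfolding ell2_inner_def using suminf_mult[OF s[OF assms(1,3)], of "cnj c"] by (simp add: algebra_simps)
  show "ell2_inner z (\<lambda>n. c * x n) = c * ell2_inner z x"
    unfolding ell2_inner_def using suminf_mult[OF s[OF assms(3,1)], of c] by (simp add: algebra_simps)
  have "(\<lambda>n. cnj (y n) * x n) sums ell2_inner y x"
    unfolding ell2_inner_def using s[OF assms(2,1)] by (rule summable_sums)
  then have "(\<lambda>n. cnj (cnj (y n) * x n)) sums cnj (ell2_inner y x)" by (subst sums_cnj)
  then show "ell2_inner x y = cnj (ell2_inner y x)"
    unfolding ell2_inner_def[of x y] by (simp add: sums_iff mult.commute)
qed

lemma ell2_inner_sum_left:
  "(\<And>i. i \<in> S \<Longrightarrow> f i \<in> ell2) \<Longrightarrow> z \<in> ell2 \<Longrightarrow> ell2_inner (\<lambda>n. \<Sum>i\<in>S. f i n) z = (\<Sum>i\<in>S. ell2_inner (f i) z)"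
  by (induction S rule: infinite_finite_induct) (auto simp: ell2_inner_simps(1-4) ell2_sum, simp_all add: ell2_inner_def)

lemma ell2_inner_sum_right:
  "(\<And>i. i \<in> S \<Longrightarrow> f i \<in> ell2) \<Longrightarrow> z \<in> ell2 \<Longrightarrow> ell2_inner z (\<lambda>n. \<Sum>i\<in>S. f i n) = (\<Sum>i\<in>S. ell2_inner z (f i))"
  by (induction S rule: infinite_finite_induct) (auto simp: ell2_inner_simps(1-4) ell2_sum, simp_all add: ell2_inner_def)

lemma ell2_inner_basis: "ell2_inner (basis_vec k) x = x k"
proof -
  have "(\<lambda>n. cnj (basis_vec k n) * x n) sums (\<Sum>n\<in>{k}. cnj (basis_vec k n) * x n)"
    by (rule sums_finite) (auto simp: basis_vec_def)
  then show ?thesis by (simp add: ell2_inner_def basis_vec_def sums_iff)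
qed

lemma ell2_inner_eq_zero: "(\<And>y. y \<in> ell2 \<Longrightarrow> ell2_inner y x = 0) \<Longrightarrow> x = (\<lambda>n. 0)"
  using ell2_inner_basis[of _ x] basis_vec_ell2 by (metis ext)

text \<open>The squared norm: boundedness is easier to handle without square roots.\<close>

definition ell2_sq :: "(nat \<Rightarrow> complex) \<Rightarrow> real" where
  "ell2_sq x = suminf (\<lambda>n. (cmod (x n))\<^sup>2)"

lemma ell2_sq_nonneg: "x \<in> ell2 \<Longrightarrow> 0 \<le> ell2_sq x"
  unfolding ell2_sq_def ell2_def by (auto intro: suminf_nonneg)

lemma ell2_sq_add: assumes "x \<in> ell2" "y \<in> ell2"
  shows "ell2_sq (\<lambda>n. x n + y n) \<le> 2 * ell2_sq x + 2 * ell2_sq y"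
proof -
  have s: "summable (\<lambda>n. (cmod (x n))\<^sup>2)" "summable (\<lambda>n. (cmod (y n))\<^sup>2)" "summable (\<lambda>n. (cmod (x n + y n))\<^sup>2)"
    using assms ell2_add[OF assms] by (simp_all add: ell2_def)
  note le = cmod_add_sq_le[of "x _" "y _"]
  have "ell2_sq (\<lambda>n. x n + y n) \<le> suminf (\<lambda>n. 2 * (cmod (x n))\<^sup>2 + 2 * (cmod (y n))\<^sup>2)"
    unfolding ell2_sq_def using s le by (intro suminf_le summable_add summable_mult) auto
  also have "\<dots> = 2 * ell2_sq x + 2 * ell2_sq y"
    unfolding ell2_sq_def using s by (simp add: suminf_add[symmetric] suminf_mult summable_mult)
  finally show ?thesis .
qed

lemma ell2_sq_scale: "x \<in> ell2 \<Longrightarrow> ell2_sq (\<lambda>n. c * x n) = (cmod c)\<^sup>2 * ell2_sq x"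
  unfolding ell2_sq_def by (simp add: norm_mult power_mult_distrib suminf_mult ell2_def)

lemma bounded_op_iff_sq:
  assumes "\<forall>x\<in>ell2. T x \<in> ell2"
  shows "(\<exists>C. \<forall>x\<in>ell2. ell2_norm (T x) \<le> C * ell2_norm x) \<longleftrightarrow> (\<exists>C\<ge>0. \<forall>x\<in>ell2. ell2_sq (T x) \<le> C * ell2_sq x)"
proof
  assume "\<exists>C. \<forall>x\<in>ell2. ell2_norm (T x) \<le> C * ell2_norm x"
  then obtain C where C: "\<And>x. x \<in> ell2 \<Longrightarrow> ell2_norm (T x) \<le> C * ell2_norm x" by blast
  have "ell2_sq (T x) \<le> C\<^sup>2 * ell2_sq x" if x: "x \<in> ell2" for x
  proof -
    have "sqrt (ell2_sq (T x)) \<le> C * sqrt (ell2_sq x)"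
      using C[OF x] by (simp add: ell2_norm_def ell2_sq_def)
    then have "(sqrt (ell2_sq (T x)))\<^sup>2 \<le> (C * sqrt (ell2_sq x))\<^sup>2"
      using x assms by (intro power_mono) (auto intro: ell2_sq_nonneg)
    then show ?thesis using x assms by (simp add: ell2_sq_nonneg power_mult_distrib)
  qed
  then show "\<exists>C\<ge>0. \<forall>x\<in>ell2. ell2_sq (T x) \<le> C * ell2_sq x" by (intro exI[of _ "C\<^sup>2"]) auto
next
  assume "\<exists>C\<ge>0. \<forall>x\<in>ell2. ell2_sq (T x) \<le> C * ell2_sq x"
  then obtain C where C: "C \<ge> 0" "\<And>x. x \<in> ell2 \<Longrightarrow> ell2_sq (T x) \<le> C * ell2_sq x" by blast
  have "ell2_norm (T x) \<le> sqrt C * ell2_norm x" if x: "x \<in> ell2" for x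
    using C(2)[OF x] by (simp add: ell2_norm_def ell2_sq_def[symmetric] real_sqrt_mult[symmetric])
  then show "\<exists>C. \<forall>x\<in>ell2. ell2_norm (T x) \<le> C * ell2_norm x" by blast
qed

lemma bounded_op_iff:
  "bounded_op T \<longleftrightarrow> (\<forall>x\<in>ell2. T x \<in> ell2) \<and>
     (\<forall>x\<in>ell2. \<forall>y\<in>ell2. T (\<lambda>n. x n + y n) = (\<lambda>n. T x n + T y n)) \<and>
     (\<forall>c. \<forall>x\<in>ell2. T (\<lambda>n. c * x n) = (\<lambda>n. c * T x n)) \<and>
     (\<exists>C\<ge>0. \<forall>x\<in>ell2. ell2_sq (T x) \<le> C * ell2_sq x)"
  unfolding bounded_op_def using bounded_op_iff_sq[of T] by blast

lemma bounded_opD: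
  assumes "bounded_op T"
  shows "x \<in> ell2 \<Longrightarrow> T x \<in> ell2" "x \<in> ell2 \<Longrightarrow> y \<in> ell2 \<Longrightarrow> T (\<lambda>n. x n + y n) = (\<lambda>n. T x n + T y n)"
    "x \<in> ell2 \<Longrightarrow> T (\<lambda>n. c * x n) = (\<lambda>n. c * T x n)" "T (\<lambda>n. 0) = (\<lambda>n. 0)"
proof -
  show sc: "x \<in> ell2 \<Longrightarrow> T (\<lambda>n. c * x n) = (\<lambda>n. c * T x n)" for x c
    using assms unfolding bounded_op_def by blast
  show "T (\<lambda>n. 0) = (\<lambda>n. 0)" using sc[of "\<lambda>n. 0" 0] by simp
qed (use assms in \<open>auto simp: bounded_op_def\<close>)

lemma bounded_op_id: "bounded_op (\<lambda>x. x)"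
  unfolding bounded_op_iff by (auto intro: exI[of _ 1])

lemma bounded_op_comp:
  assumes "bounded_op T" "bounded_op S" shows "bounded_op (\<lambda>x. T (S x))"
proof -
  obtain C where C: "C \<ge> 0" "\<And>x. x \<in> ell2 \<Longrightarrow> ell2_sq (T x) \<le> C * ell2_sq x"
    using assms(1) unfolding bounded_op_iff by blast
  obtain D where D: "D \<ge> 0" "\<And>x. x \<in> ell2 \<Longrightarrow> ell2_sq (S x) \<le> D * ell2_sq x"
    using assms(2) unfolding bounded_op_iff by blast
  have "ell2_sq (T (S x)) \<le> (C * D) * ell2_sq x" if x: "x \<in> ell2" for x
  proof -
    have "ell2_sq (T (S x)) \<le> C * ell2_sq (S x)" using C(2) bounded_opD(1)[OF assms(2) x] by blast
    also have "\<dots> \<le> C * (D * ell2_sq x)" using D(2)[OF x] C(1) by (rule mult_left_mono)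
    finally show ?thesis by (simp add: mult.assoc)
  qed
  then have "\<exists>C\<ge>0. \<forall>x\<in>ell2. ell2_sq (T (S x)) \<le> C * ell2_sq x"
    using C D by (intro exI[of _ "C * D"]) auto
  then show ?thesis unfolding bounded_op_iff
    by (simp add: bounded_opD[OF assms(1)] bounded_opD[OF assms(2)])
qed

lemma bounded_op_add:
  assumes "bounded_op T" "bounded_op S" shows "bounded_op (\<lambda>x n. T x n + S x n)"
proof -
  obtain C where C: "C \<ge> 0" "\<And>x. x \<in> ell2 \<Longrightarrow> ell2_sq (T x) \<le> C * ell2_sq x"
    using assms(1) unfolding bounded_op_iff by blast
  obtain D where D: "D \<ge> 0" "\<And>x. x \<in> ell2 \<Longrightarrow> ell2_sq (S x) \<le> D * ell2_sq x"
    using assms(2) unfolding bounded_op_iff by blast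
  have "ell2_sq (\<lambda>n. T x n + S x n) \<le> (2 * C + 2 * D) * ell2_sq x" if x: "x \<in> ell2" for x
    using ell2_sq_add[OF bounded_opD(1)[OF assms(1) x] bounded_opD(1)[OF assms(2) x]] C(2)[OF x] D(2)[OF x]
    by (simp add: algebra_simps)
  then have "\<exists>C\<ge>0. \<forall>x\<in>ell2. ell2_sq (\<lambda>n. T x n + S x n) \<le> C * ell2_sq x"
    using C D by (intro exI[of _ "2 * C + 2 * D"]) auto
  then show ?thesis unfolding bounded_op_iff
    by (simp add: bounded_opD[OF assms(1)] bounded_opD[OF assms(2)] ell2_add algebra_simps)
qed

lemma bounded_op_scale:
  assumes "bounded_op T" shows "bounded_op (\<lambda>x n. c * T x n)"
proof -
  obtain C where C: "C \<ge> 0" "\<And>x. x \<in> ell2 \<Longrightarrow> ell2_sq (T x) \<le> C * ell2_sq x"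
    using assms(1) unfolding bounded_op_iff by blast
  have "ell2_sq (\<lambda>n. c * T x n) \<le> ((cmod c)\<^sup>2 * C) * ell2_sq x" if x: "x \<in> ell2" for x
    using mult_left_mono[OF C(2)[OF x], of "(cmod c)\<^sup>2"] ell2_sq_scale[OF bounded_opD(1)[OF assms x], of c]
    by (simp add: algebra_simps)
  then have "\<exists>C\<ge>0. \<forall>x\<in>ell2. ell2_sq (\<lambda>n. c * T x n) \<le> C * ell2_sq x"
    using C by (intro exI[of _ "(cmod c)\<^sup>2 * C"]) auto
  then show ?thesis unfolding bounded_op_iff
    by (simp add: bounded_opD[OF assms(1)] ell2_scale algebra_simps)
qed

lemma bounded_op_zero: "bounded_op (\<lambda>x n. 0)"
  using bounded_op_scale[OF bounded_op_id, of 0] by simp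

lemma bounded_op_sum: "(\<And>i. i \<in> S \<Longrightarrow> bounded_op (f i)) \<Longrightarrow> bounded_op (\<lambda>x n. \<Sum>i\<in>S. f i x n)"
  by (induction S rule: infinite_finite_induct) (simp_all add: bounded_op_zero bounded_op_add)

subsection \<open>Evaluation of representations\<close>

lemma rep_eval_superset:
  "finite S \<Longrightarrow> Poly_Mapping.keys p \<subseteq> S \<Longrightarrow>
     rep_eval \<sigma> p x = (\<lambda>n. \<Sum>w\<in>S. Poly_Mapping.lookup p w * foldr \<sigma> (letters w) x n)"
  unfolding rep_eval_def by (intro ext sum.mono_neutral_left) (auto simp: in_keys_iff)

lemma rep_eval_single: "rep_eval \<sigma> (Poly_Mapping.single w c) x = (\<lambda>n. c * foldr \<sigma> (letters w) x n)"
  by (subst rep_eval_superset[of "{w}"]) auto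

lemma rep_eval_simps:
  "rep_eval \<sigma> (p + r) x = (\<lambda>n. rep_eval \<sigma> p x n + rep_eval \<sigma> r x n)"
  "rep_eval \<sigma> (cscale c p) x = (\<lambda>n. c * rep_eval \<sigma> p x n)"
  "rep_eval \<sigma> 0 x = (\<lambda>n. 0)" "rep_eval \<sigma> 1 x = x" "rep_eval \<sigma> (const c) x = (\<lambda>n. c * x n)"
  "rep_eval \<sigma> (gen g) x = \<sigma> (g, False) x" "rep_eval \<sigma> (gen_star g) x = \<sigma> (g, True) x"
  "rep_eval \<sigma> (p - r) x = (\<lambda>n. rep_eval \<sigma> p x n - rep_eval \<sigma> r x n)"
  "rep_eval \<sigma> (- p) x = (\<lambda>n. - rep_eval \<sigma> p x n)"
proof -
  have add: "rep_eval \<sigma> (p + r) x = (\<lambda>n. rep_eval \<sigma> p x n + rep_eval \<sigma> r x n)" for p r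
  proof -
    let ?S = "Poly_Mapping.keys p \<union> Poly_Mapping.keys r"
    have S: "finite ?S" "Poly_Mapping.keys (p + r) \<subseteq> ?S" using Poly_Mapping.keys_add[of p r] by auto
    show ?thesis
      by (simp add: rep_eval_superset[OF S] rep_eval_superset[OF S(1)] lookup_add distrib_right sum.distrib)
  qed
  have sc: "rep_eval \<sigma> (cscale c p) x = (\<lambda>n. c * rep_eval \<sigma> p x n)" for c p
    by (subst rep_eval_superset[OF finite_keys keys_cscale])
      (simp add: rep_eval_def sum_distrib_left mult.assoc)
  have um: "rep_eval \<sigma> (- p) x = (\<lambda>n. - rep_eval \<sigma> p x n)" for p
    using sc[of "-1" p] by (simp add: cscale_minus_one)
  show "rep_eval \<sigma> (p + r) x = (\<lambda>n. rep_eval \<sigma> p x n + rep_eval \<sigma> r x n)"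
    "rep_eval \<sigma> (cscale c p) x = (\<lambda>n. c * rep_eval \<sigma> p x n)"
    "rep_eval \<sigma> (- p) x = (\<lambda>n. - rep_eval \<sigma> p x n)" by fact+
  show "rep_eval \<sigma> (p - r) x = (\<lambda>n. rep_eval \<sigma> p x n - rep_eval \<sigma> r x n)"
    using add[of p "- r"] um[of r] by simp
  show "rep_eval \<sigma> 0 x = (\<lambda>n. 0)" by (simp add: rep_eval_def)
  have [simp]: "letters (0 :: 'a star_word) = []" by (simp add: zero_star_word_def)
  show "rep_eval \<sigma> (const c) x = (\<lambda>n. c * x n)" by (simp add: const_def rep_eval_single)
  show "rep_eval \<sigma> 1 x = x" unfolding single_one[symmetric] by (subst rep_eval_single) simp
  show "rep_eval \<sigma> (gen g) x = \<sigma> (g, False) x" "rep_eval \<sigma> (gen_star g) x = \<sigma> (g, True) x"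
    by (simp_all add: gen_def gen_star_def rep_eval_single)
qed

lemma rep_eval_sum: "rep_eval \<sigma> (\<Sum>i\<in>S. f i) x = (\<lambda>n. \<Sum>i\<in>S. rep_eval \<sigma> (f i) x n)"
  by (induction S rule: infinite_finite_induct) (simp_all add: rep_eval_simps)

context
  fixes \<sigma> :: "'g \<times> bool \<Rightarrow> (nat \<Rightarrow> complex) \<Rightarrow> (nat \<Rightarrow> complex)"
  assumes rep: "star_rep \<sigma>"
begin

lemma star_rep_letter: "bounded_op (\<sigma> l)"
  using rep unfolding star_rep_def by blast

lemma bounded_op_foldr: "bounded_op (foldr \<sigma> ls)"
proof (induction ls)
  case (Cons l ls)
  then show ?case using bounded_op_comp[OF star_rep_letter[of l] Cons] by (simp add: comp_def)
qed (use bounded_op_id in \<open>simp add: id_def\<close>)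

lemma bounded_op_rep_eval: "bounded_op (rep_eval \<sigma> p)"
  unfolding rep_eval_def[abs_def] by (intro bounded_op_sum bounded_op_scale bounded_op_foldr)

lemmas rep_eval_op = bounded_opD[OF bounded_op_rep_eval]

lemma rep_eval_mult:
  assumes x: "x \<in> ell2" shows "rep_eval \<sigma> (p * r) x = rep_eval \<sigma> p (rep_eval \<sigma> r x)"
proof -
  have [simp]: "letters (v + w) = letters v @ letters w" for v w :: "'g star_word"
    by (simp add: plus_star_word_def)
  note f = bounded_opD[OF bounded_op_foldr]
  have "rep_eval \<sigma> (Poly_Mapping.single w c * r) x = rep_eval \<sigma> (Poly_Mapping.single w c) (rep_eval \<sigma> r x)" for w c
  proof (induction r rule: poly_mapping_induct)
    case (add p r)
    then show ?case
      by (simp add: distrib_left rep_eval_simps rep_eval_op(2)[OF rep_eval_op(1)[OF x] rep_eval_op(1)[OF x]])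
  qed (simp_all add: rep_eval_simps mult_single rep_eval_single f x mult.assoc)
  then show ?thesis
    by (induction p rule: poly_mapping_induct) (simp_all add: rep_eval_simps distrib_right)
qed

text \<open>A representation intertwines the star of the free algebra with the adjoint; by induction over
  polynomials only the letters need to be considered.\<close>

lemma rep_eval_adjoint:
  "x \<in> ell2 \<Longrightarrow> y \<in> ell2 \<Longrightarrow> ell2_inner (rep_eval \<sigma> p x) y = ell2_inner x (rep_eval \<sigma> (star free_alg p) y)"
proof (induction p arbitrary: x y rule: free_induct)
  case (const c)
  have "star free_alg (const c) = (const (cnj c) :: 'g free)"
    by (simp add: const_eq_cscale star_free_simps)
  then show ?case using const by (simp add: rep_eval_simps ell2_inner_simps(1-4))
next
  case (gen g)
  then show ?case using rep unfolding star_rep_def by (simp add: rep_eval_simps)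
next
  case (gen_star g)
  have "ell2_inner (\<sigma> (g, True) x) y = cnj (ell2_inner y (\<sigma> (g, True) x))"
    using gen_star bounded_opD(1)[OF star_rep_letter] ell2_inner_simps(5) by blast
  also have "\<dots> = cnj (ell2_inner (\<sigma> (g, False) y) x)"
    using rep gen_star unfolding star_rep_def by simp
  also have "\<dots> = ell2_inner x (\<sigma> (g, False) y)"
    using gen_star bounded_opD(1)[OF star_rep_letter] ell2_inner_simps(5) by metis
  finally show ?case by (simp add: rep_eval_simps)
next
  case (add p r)
  then show ?case by (simp add: rep_eval_simps star_free_simps ell2_inner_simps(1-4) rep_eval_op)
next
  case (mult p r)
  then show ?case by (simp add: rep_eval_mult rep_eval_op star_free_simps)
qed

end

lemma free_lift_free_simps:
  fixes a :: "'h \<Rightarrow> 'g free"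
  shows "free_lift free_alg a (p + r) = free_lift free_alg a p + free_lift free_alg a r"
    "free_lift free_alg a (p * r) = free_lift free_alg a p * free_lift free_alg a r"
    "free_lift free_alg a (gen h) = a h" "free_lift free_alg a (gen_star h) = star free_alg (a h)"
    "free_lift free_alg a (const c) = const c" "star_hom free_alg free_alg (free_lift free_alg a)"
proof -
  interpret F: star_algebra "free_alg :: 'g free star_alg" by (rule star_algebra_free)
  show sh: "star_hom free_alg free_alg (free_lift free_alg a)" by (rule F.star_hom_free_lift) simp
  show "free_lift free_alg a (p + r) = free_lift free_alg a p + free_lift free_alg a r"
    "free_lift free_alg a (p * r) = free_lift free_alg a p * free_lift free_alg a r"
    "free_lift free_alg a (gen h) = a h" "free_lift free_alg a (gen_star h) = star free_alg (a h)"
    using F.free_lift_add[of a] F.free_lift_mult[of a] F.free_lift_gen[of a] by simp_all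
  show "free_lift free_alg a (const c) = const c"
    using star_hom_const[OF sh] by (simp add: const_eq_cscale)
qed

text \<open>A representation of one free algebra composed with the substitution of polynomials \<open>a\<close> for the generators of another.\<close>

definition pullback_rep ::
  "('g \<times> bool \<Rightarrow> (nat \<Rightarrow> complex) \<Rightarrow> (nat \<Rightarrow> complex)) \<Rightarrow> ('h \<Rightarrow> 'g free) \<Rightarrow> 'h \<times> bool \<Rightarrow> (nat \<Rightarrow> complex) \<Rightarrow> (nat \<Rightarrow> complex)" where
  "pullback_rep \<sigma> a l = rep_eval \<sigma> (if snd l then star free_alg (a (fst l)) else a (fst l))"

lemma star_rep_pullback: "star_rep \<sigma> \<Longrightarrow> star_rep (pullback_rep \<sigma> a)"
  unfolding star_rep_def[of "pullback_rep \<sigma> a"] pullback_rep_def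
  by (simp add: bounded_op_rep_eval rep_eval_adjoint)

lemma rep_eval_pullback:
  assumes "star_rep \<sigma>"
  shows "x \<in> ell2 \<Longrightarrow> rep_eval (pullback_rep \<sigma> a) p x = rep_eval \<sigma> (free_lift free_alg a p) x"
proof (induction p arbitrary: x rule: free_induct)
  case (mult p r)
  then show ?case using rep_eval_op(1)[OF assms]
    by (simp add: rep_eval_mult[OF star_rep_pullback[OF assms]] rep_eval_mult[OF assms] free_lift_free_simps)
qed (simp_all add: rep_eval_simps free_lift_free_simps, simp_all add: pullback_rep_def)

definition rep_kills :: "('g \<times> bool \<Rightarrow> (nat \<Rightarrow> complex) \<Rightarrow> (nat \<Rightarrow> complex)) \<Rightarrow> 'g free \<Rightarrow> bool" where
  "rep_kills \<sigma> p \<longleftrightarrow> (\<forall>x\<in>ell2. rep_eval \<sigma> p x = (\<lambda>n. 0))"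

text \<open>Closure under the star is where adjoints enter: if \<open>p\<close> acts as zero, then so does its adjoint.\<close>

lemma star_ideal_rep_kills:
  assumes rep: "star_rep \<sigma>" shows "star_ideal {p. rep_kills \<sigma> p}"
proof -
  note op = rep_eval_op[OF rep]
  have "rep_eval \<sigma> (star free_alg p) x = (\<lambda>n. 0)" if "rep_kills \<sigma> p" "x \<in> ell2" for p x
  proof (rule ell2_inner_eq_zero)
    fix y assume y: "y \<in> ell2"
    then have "ell2_inner (rep_eval \<sigma> p y) x = 0" using that by (simp add: rep_kills_def) (simp add: ell2_inner_def)
    then show "ell2_inner y (rep_eval \<sigma> (star free_alg p) x) = 0"
      using rep_eval_adjoint[OF rep y that(2)] by simp
  qed
  then show ?thesis unfolding star_ideal_def
    by (auto simp: rep_kills_def rep_eval_simps rep_eval_mult[OF rep] op)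
qed

lemma cstar_kernel_eq: "cstar_kernel R = {p. \<forall>\<sigma>. star_rep \<sigma> \<and> (\<forall>r\<in>R. rep_kills \<sigma> r) \<longrightarrow> rep_kills \<sigma> p}"
  unfolding cstar_kernel_def rep_kills_def by blast

lemma star_ideal_cstar_kernel: "star_ideal (cstar_kernel R)"
  using star_ideal_rep_kills unfolding star_ideal_def cstar_kernel_eq by (auto; blast)

lemma cstar_kernel_self: "r \<in> R \<Longrightarrow> r \<in> cstar_kernel R"
  unfolding cstar_kernel_eq by blast

lemma rep_kills_relation_ideal:
  assumes "star_rep \<sigma>" "\<And>r. r \<in> R \<Longrightarrow> rep_kills \<sigma> r" "p \<in> relation_ideal R"
  shows "rep_kills \<sigma> p"
proof -
  note I = star_ideal_rep_kills[OF assms(1)]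
  have "relation_ideal R \<subseteq> {p. rep_kills \<sigma> p}"
    using assms(2) star_idealD(5)[OF I] by (intro relation_ideal_minimal ideal_of_star_ideal[OF I]) auto
  then show ?thesis using assms(3) by auto
qed

subsection \<open>Amplification\<close>

text \<open>For a bijection \<open>e\<close>, a sequence \<open>z\<close> becomes a double sequence with rows \<open>z(e(i, \<cdot>))\<close>, and \<open>amplify e T\<close>
  applies \<open>T\<close> to every row. With the two pairings below this is \<open>T \<otimes> 1\<close> or \<open>1 \<otimes> T\<close>.\<close>

definition amplify :: "(nat \<times> nat \<Rightarrow> nat) \<Rightarrow> ((nat \<Rightarrow> complex) \<Rightarrow> (nat \<Rightarrow> complex)) \<Rightarrow> (nat \<Rightarrow> complex) \<Rightarrow> (nat \<Rightarrow> complex)" where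
  "amplify e T z k = (case inv_into UNIV e k of (i, j) \<Rightarrow> T (\<lambda>j'. z (e (i, j'))) j)"

lemma suminf_eq_infsum:
  fixes f :: "nat \<Rightarrow> 'a::banach" assumes "summable (\<lambda>n. norm (f n))"
  shows "suminf f = infsum f UNIV"
  using norm_summable_imp_has_sum[OF assms, of "suminf f"] assms
  by (simp add: infsumI summable_norm_cancel summable_sums)

lemma infsum_double:
  fixes f :: "nat \<Rightarrow> 'a::banach"
  assumes e: "bij e" and f: "f abs_summable_on (UNIV :: nat set)"
  shows "infsum f UNIV = infsum (\<lambda>i. infsum (\<lambda>j. f (e (i, j))) UNIV) UNIV"
proof -
  have s: "(\<lambda>p. f (e p)) summable_on (UNIV \<times> UNIV)"
    using summable_on_reindex_bij_betw[OF e, of f] abs_summable_summable[OF f] by simp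
  have "infsum f UNIV = infsum (\<lambda>p. f (e p)) (UNIV \<times> UNIV)"
    using infsum_reindex_bij_betw[OF e, of f] by simp
  also have "\<dots> = infsum (\<lambda>i. infsum (\<lambda>j. f (e (i, j))) UNIV) UNIV"
    using infsum_Sigma_banach[OF s] by simp
  finally show ?thesis .
qed

lemma ell2_iff_abs_summable: "x \<in> ell2 \<longleftrightarrow> (\<lambda>n. (cmod (x n))\<^sup>2) abs_summable_on UNIV"
  unfolding ell2_def using summable_on_UNIV_nonneg_real_iff[of "\<lambda>n. (cmod (x n))\<^sup>2"] by simp

lemma ell2_sq_infsum: "x \<in> ell2 \<Longrightarrow> ell2_sq x = infsum (\<lambda>n. (cmod (x n))\<^sup>2) UNIV"
  unfolding ell2_sq_def ell2_def by (intro suminf_eq_infsum) simp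

context
  fixes e :: "nat \<times> nat \<Rightarrow> nat" assumes e: "bij e"
begin

lemma inv_e [simp]: "inv_into UNIV e (e p) = p"
  using e by (simp add: bij_is_inj)

lemma e_inv [simp]: "e (inv_into UNIV e k) = k"
  using e by (simp add: bij_is_surj surj_f_inv_f)

lemma amplify_row: "(\<lambda>j. amplify e T z (e (i, j))) = T (\<lambda>j. z (e (i, j)))"
  by (simp add: amplify_def)

text \<open>Tonelli for the double sequence: its total mass is the sum of the masses of the rows.\<close>

lemma ell2_double:
  "z \<in> ell2 \<longleftrightarrow> (\<forall>i. (\<lambda>j. z (e (i, j))) \<in> ell2) \<and> (\<lambda>i. ell2_sq (\<lambda>j. z (e (i, j)))) summable_on UNIV"
proof -
  let ?f = "\<lambda>p. (cmod (z (e p)))\<^sup>2"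
  have "z \<in> ell2 \<longleftrightarrow> ?f abs_summable_on (UNIV \<times> UNIV)"
    unfolding ell2_iff_abs_summable
    using summable_on_reindex_bij_betw[OF e, of "\<lambda>n. norm ((cmod (z n))\<^sup>2)"] by simp
  also have "\<dots> \<longleftrightarrow> (\<forall>i. (\<lambda>j. z (e (i, j))) \<in> ell2) \<and>
      (\<lambda>i. infsum (\<lambda>j. norm (?f (i, j))) UNIV) abs_summable_on UNIV"
    unfolding abs_summable_on_Sigma_iff by (simp add: ell2_iff_abs_summable)
  also have "\<dots> \<longleftrightarrow> (\<forall>i. (\<lambda>j. z (e (i, j))) \<in> ell2) \<and> (\<lambda>i. ell2_sq (\<lambda>j. z (e (i, j)))) summable_on UNIV"
  proof (rule conj_cong[OF refl])
    assume r: "\<forall>i. (\<lambda>j. z (e (i, j))) \<in> ell2"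
    have "norm (infsum (\<lambda>j. norm (?f (i, j))) UNIV) = ell2_sq (\<lambda>j. z (e (i, j)))" for i
      using r ell2_sq_infsum[of "\<lambda>j. z (e (i, j))"] ell2_sq_nonneg[of "\<lambda>j. z (e (i, j))"] by simp
    then show "(\<lambda>i. infsum (\<lambda>j. norm (?f (i, j))) UNIV) abs_summable_on UNIV \<longleftrightarrow>
       (\<lambda>i. ell2_sq (\<lambda>j. z (e (i, j)))) summable_on UNIV" by simp
  qed
  finally show ?thesis .
qed

lemma ell2_row: "z \<in> ell2 \<Longrightarrow> (\<lambda>j. z (e (i, j))) \<in> ell2"
  using ell2_double by blast

lemma ell2_sq_double: "z \<in> ell2 \<Longrightarrow> ell2_sq z = infsum (\<lambda>i. ell2_sq (\<lambda>j. z (e (i, j)))) UNIV"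
  using infsum_double[OF e, of "\<lambda>n. (cmod (z n))\<^sup>2"]
  by (simp add: ell2_sq_infsum ell2_row) (simp add: ell2_iff_abs_summable)

lemma ell2_inner_double:
  assumes "z \<in> ell2" "w \<in> ell2"
  shows "ell2_inner z w = infsum (\<lambda>i. ell2_inner (\<lambda>j. z (e (i, j))) (\<lambda>j. w (e (i, j)))) UNIV"
proof -
  have i: "ell2_inner x y = infsum (\<lambda>n. cnj (x n) * y n) UNIV" if "x \<in> ell2" "y \<in> ell2" for x y
    unfolding ell2_inner_def by (intro suminf_eq_infsum ell2_inner_summable that)
  have "(\<lambda>n. cnj (z n) * w n) abs_summable_on UNIV"
    using ell2_inner_summable[OF assms] summable_on_UNIV_nonneg_real_iff[of "\<lambda>n. norm (cnj (z n) * w n)"] by simp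
  from infsum_double[OF e this] show ?thesis
    by (simp add: i assms ell2_row)
qed

lemma bounded_op_amplify:
  assumes T: "bounded_op T" shows "bounded_op (amplify e T)"
proof -
  note op = bounded_opD[OF T]
  obtain C where C: "C \<ge> 0" "\<And>x. x \<in> ell2 \<Longrightarrow> ell2_sq (T x) \<le> C * ell2_sq x"
    using T unfolding bounded_op_iff by blast
  have s: "(\<lambda>i. C * ell2_sq (\<lambda>j. z (e (i, j)))) summable_on UNIV" if "z \<in> ell2" for z
    using that ell2_double[of z] by (intro summable_on_cmult_right) auto
  have s2: "(\<lambda>i. ell2_sq (T (\<lambda>j. z (e (i, j))))) summable_on UNIV" if z: "z \<in> ell2" for z
    by (rule summable_on_comparison_test[OF s[OF z]]) (use C ell2_row[OF z] op(1) in \<open>auto intro: ell2_sq_nonneg\<close>)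
  have cl: "amplify e T z \<in> ell2" if z: "z \<in> ell2" for z
    unfolding ell2_double[of "amplify e T z"] amplify_row using s2[OF z] op(1) ell2_row[OF z] by simp
  have "ell2_sq (amplify e T z) \<le> C * ell2_sq z" if z: "z \<in> ell2" for z
  proof -
    have "ell2_sq (amplify e T z) = infsum (\<lambda>i. ell2_sq (T (\<lambda>j. z (e (i, j))))) UNIV"
      unfolding ell2_sq_double[OF cl[OF z]] amplify_row ..
    also have "\<dots> \<le> infsum (\<lambda>i. C * ell2_sq (\<lambda>j. z (e (i, j)))) UNIV"
      using s[OF z] s2[OF z] C(2) ell2_row[OF z] by (intro infsum_mono) auto
    also have "\<dots> = C * ell2_sq z"
      unfolding ell2_sq_double[OF z] by (rule infsum_cmult_right')
    finally show ?thesis .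
  qed
  then have "\<exists>C\<ge>0. \<forall>z\<in>ell2. ell2_sq (amplify e T z) \<le> C * ell2_sq z" using C(1) by blast
  moreover have "amplify e T (\<lambda>n. x n + y n) = (\<lambda>n. amplify e T x n + amplify e T y n)" if "x \<in> ell2" "y \<in> ell2" for x y
    by (rule ext) (simp add: amplify_def op ell2_row that split: prod.split)
  moreover have "amplify e T (\<lambda>n. c * x n) = (\<lambda>n. c * amplify e T x n)" if "x \<in> ell2" for c x
    by (rule ext) (simp add: amplify_def op ell2_row that split: prod.split)
  ultimately show ?thesis unfolding bounded_op_iff using cl by blast
qed

lemma amplify_adjoint:
  assumes T: "bounded_op T" "bounded_op S" and adj: "\<And>x y. x \<in> ell2 \<Longrightarrow> y \<in> ell2 \<Longrightarrow> ell2_inner (T x) y = ell2_inner x (S y)"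
    and "z \<in> ell2" "w \<in> ell2"
  shows "ell2_inner (amplify e T z) w = ell2_inner z (amplify e S w)"
  using assms(4,5)
  by (simp add: ell2_inner_double bounded_opD(1)[OF bounded_op_amplify] T amplify_row adj ell2_row)

end

text \<open>The elementary tensor of two sequences under the identification of \<open>ell2 \<otimes> ell2\<close> with \<open>ell2\<close>.\<close>

definition pure_vec :: "(nat \<Rightarrow> complex) \<Rightarrow> (nat \<Rightarrow> complex) \<Rightarrow> nat \<Rightarrow> complex" where
  "pure_vec x y k = (case prod_decode k of (i, j) \<Rightarrow> x i * y j)"

definition amp_left :: "((nat \<Rightarrow> complex) \<Rightarrow> (nat \<Rightarrow> complex)) \<Rightarrow> (nat \<Rightarrow> complex) \<Rightarrow> (nat \<Rightarrow> complex)" where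
  "amp_left = amplify (\<lambda>(j, i). prod_encode (i, j))"

definition amp_right :: "((nat \<Rightarrow> complex) \<Rightarrow> (nat \<Rightarrow> complex)) \<Rightarrow> (nat \<Rightarrow> complex) \<Rightarrow> (nat \<Rightarrow> complex)" where
  "amp_right = amplify prod_encode"

lemma bij_prod_encode_swap: "bij (\<lambda>(j, i). prod_encode (i, j))"
  and inv_prod_encode_swap: "inv_into UNIV (\<lambda>(j, i). prod_encode (i, j)) = (\<lambda>k. prod.swap (prod_decode k))"
proof -
  show b: "bij (\<lambda>(j, i). prod_encode (i, j))"
    by (rule bij_betwI[of _ _ _ "\<lambda>k. prod.swap (prod_decode k)"]) (auto simp: case_prod_beta)
  show "inv_into UNIV (\<lambda>(j, i). prod_encode (i, j)) = (\<lambda>k. prod.swap (prod_decode k))"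
    by (rule inv_equality) (auto simp: case_prod_beta)
qed

lemma inv_prod_encode: "inv_into UNIV prod_encode = prod_decode"
  by (rule inv_equality) simp_all

lemma amp_pure:
  assumes T: "bounded_op T" and xy: "x \<in> ell2" "y \<in> ell2"
  shows "amp_left T (pure_vec x y) = pure_vec (T x) y" "amp_right T (pure_vec x y) = pure_vec x (T y)"
proof -
  have l: "T (\<lambda>n. pure_vec x y (prod_encode (n, j))) = (\<lambda>n. y j * T x n)" for j
  proof -
    have "(\<lambda>n. pure_vec x y (prod_encode (n, j))) = (\<lambda>n. y j * x n)"
      by (simp add: pure_vec_def fun_eq_iff)
    then show ?thesis using bounded_opD(3)[OF T xy(1), of "y j"] by (simp only:)
  qed
  show "amp_left T (pure_vec x y) = pure_vec (T x) y"
    by (rule ext) (simp add: amp_left_def amplify_def inv_prod_encode_swap l, simp add: pure_vec_def split: prod.split)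
  have r: "T (\<lambda>n. pure_vec x y (prod_encode (i, n))) = (\<lambda>n. x i * T y n)" for i
  proof -
    have "(\<lambda>n. pure_vec x y (prod_encode (i, n))) = (\<lambda>n. x i * y n)"
      by (simp add: pure_vec_def fun_eq_iff)
    then show ?thesis using bounded_opD(3)[OF T xy(2), of "x i"] by (simp only:)
  qed
  show "amp_right T (pure_vec x y) = pure_vec x (T y)"
    by (rule ext) (simp add: amp_right_def amplify_def inv_prod_encode r, simp add: pure_vec_def split: prod.split)
qed

lemma bounded_op_amp: "bounded_op T \<Longrightarrow> bounded_op (amp_left T)" "bounded_op T \<Longrightarrow> bounded_op (amp_right T)"
  unfolding amp_left_def amp_right_def
  by (rule bounded_op_amplify[OF bij_prod_encode_swap], assumption, rule bounded_op_amplify[OF bij_prod_encode], assumption)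

lemma amp_adjoint:
  assumes "bounded_op T" "bounded_op S" "\<And>x y. x \<in> ell2 \<Longrightarrow> y \<in> ell2 \<Longrightarrow> ell2_inner (T x) y = ell2_inner x (S y)"
    and "z \<in> ell2" "w \<in> ell2"
  shows "ell2_inner (amp_left T z) w = ell2_inner z (amp_left S w)"
    "ell2_inner (amp_right T z) w = ell2_inner z (amp_right S w)"
  unfolding amp_left_def amp_right_def
  by (rule amplify_adjoint[OF bij_prod_encode_swap assms], assumption+)
    (rule amplify_adjoint[OF bij_prod_encode assms], assumption+)

lemma pure_vec_ell2:
  assumes "x \<in> ell2" "y \<in> ell2" shows "pure_vec x y \<in> ell2"
proof (rule iffD2[OF ell2_double[OF bij_prod_encode]], rule conjI)
  have r: "(\<lambda>j. pure_vec x y (prod_encode (i, j))) = (\<lambda>j. x i * y j)" for i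
    by (simp add: pure_vec_def)
  show "\<forall>i. (\<lambda>j. pure_vec x y (prod_encode (i, j))) \<in> ell2"
    unfolding r using assms(2) by (simp add: ell2_scale)
  have "(\<lambda>i. (cmod (x i))\<^sup>2 * ell2_sq y) summable_on UNIV"
    using assms(1) by (intro summable_on_cmult_left) (simp add: ell2_iff_abs_summable)
  then show "(\<lambda>i. ell2_sq (\<lambda>j. pure_vec x y (prod_encode (i, j)))) summable_on UNIV"
    unfolding r by (simp add: ell2_sq_scale[OF assms(2)])
qed

lemma basis_vec_pure: "basis_vec k = pure_vec (basis_vec (fst (prod_decode k))) (basis_vec (snd (prod_decode k)))"
proof (rule ext)
  fix n
  have "n = k \<longleftrightarrow> prod_decode n = prod_decode k" by (metis prod_decode_inverse)
  then show "basis_vec k n = pure_vec (basis_vec (fst (prod_decode k))) (basis_vec (snd (prod_decode k))) n"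
    by (auto simp: basis_vec_def pure_vec_def prod_eq_iff split: prod.split)
qed

text \<open>Elementary tensors include the standard basis. That \<open>p\<close> annihilates the basis does not immediately
  give that it annihilates \<open>ell2\<close>; passing to the adjoint avoids a continuity argument, since the entries
  of \<open>p\<^sup>* x\<close> are inner products with \<open>p\<close> applied to basis vectors.\<close>

lemma rep_kills_pure:
  assumes rep: "star_rep \<sigma>" and 0: "\<And>x y. x \<in> ell2 \<Longrightarrow> y \<in> ell2 \<Longrightarrow> rep_eval \<sigma> p (pure_vec x y) = (\<lambda>n. 0)"
  shows "rep_kills \<sigma> p"
proof -
  have b: "rep_eval \<sigma> p (basis_vec k) = (\<lambda>n. 0)" for k
    by (subst basis_vec_pure) (simp add: 0)
  have "rep_eval \<sigma> (star free_alg p) x = (\<lambda>n. 0)" if x: "x \<in> ell2" for x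
  proof
    fix k
    have "rep_eval \<sigma> (star free_alg p) x k = ell2_inner (rep_eval \<sigma> p (basis_vec k)) x"
      using rep_eval_adjoint[OF rep basis_vec_ell2 x, of p k] by (simp add: ell2_inner_basis)
    then show "rep_eval \<sigma> (star free_alg p) x k = 0" by (simp add: b) (simp add: ell2_inner_def)
  qed
  then have "rep_kills \<sigma> (star free_alg p)" by (simp add: rep_kills_def)
  then show ?thesis
    using star_idealD(5)[OF star_ideal_rep_kills[OF rep], of "star free_alg p"] by (simp add: star_free_simps)
qed

section \<open>Separating functionals on tensor products\<close>

definition separating :: "('a, 'm) star_alg_scheme \<Rightarrow> ('a \<Rightarrow> complex) set \<Rightarrow> bool" where
  "separating V \<Omega> \<longleftrightarrow> (\<forall>\<omega>\<in>\<Omega>. linear_on V complex_alg \<omega>) \<and>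
     (\<forall>x\<in>carrier V. (\<forall>\<omega>\<in>\<Omega>. \<omega> x = 0) \<longrightarrow> x = \<zero>\<^bsub>V\<^esub>)"

lemma bilinear_on_functional:
  assumes V: "complex_space V" "complex_space W" and w: "linear_on V complex_alg \<omega>"
  shows "bilinear_on V W W (\<lambda>x y. \<omega> x \<odot>\<^bsub>W\<^esub> y)"
proof -
  interpret V: complex_space V by fact
  interpret W: complex_space W by fact
  show ?thesis unfolding bilinear_on_def
    using linear_on_add[OF w] linear_on_smult[OF w]
    by (intro conjI ballI linear_onI) (simp_all add: W.smult_add_scalar W.smult_add mult.commute)
qed

lemma bilinear_on_functional2:
  assumes V: "complex_space V" "complex_space W" and w: "linear_on V complex_alg \<omega>" "linear_on W complex_alg \<omega>'"
  shows "bilinear_on V W complex_alg (\<lambda>x y. \<omega> x * \<omega>' y)"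
  unfolding bilinear_on_def using linear_on_add[OF w(1)] linear_on_smult[OF w(1)] linear_on_add[OF w(2)] linear_on_smult[OF w(2)]
  by (intro conjI ballI linear_onI) (simp_all add: algebra_simps)

text \<open>Eliminates the term \<open>j\<close> from a sum of values of a bilinear map when \<open>y j\<close> depends linearly on the other
  \<open>y i\<close>. It is used for the tensor product and for a functional applied to the first leg.\<close>

lemma bilinear_finsum:
  assumes V: "complex_space V" "complex_space W" "complex_space Z" and b: "bilinear_on V W Z \<beta>"
    and S: "finite S" "j \<in> S" and a: "a \<in> S \<rightarrow> carrier V" and y: "y \<in> S \<rightarrow> carrier W"
    and yj: "y j = (\<Oplus>\<^bsub>W\<^esub>i\<in>S - {j}. d i \<odot>\<^bsub>W\<^esub> y i)"
  shows "(\<Oplus>\<^bsub>Z\<^esub>i\<in>S. \<beta> (a i) (y i)) = (\<Oplus>\<^bsub>Z\<^esub>i\<in>S - {j}. \<beta> (a i \<oplus>\<^bsub>V\<^esub> d i \<odot>\<^bsub>V\<^esub> a j) (y i))"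
proof -
  interpret V: complex_space V by fact
  interpret W: complex_space W by fact
  interpret Z: complex_space Z by fact
  note bs = bilinear_on_simps[OF b]
  have aj: "a j \<in> carrier V" and ai: "\<And>i. i \<in> S \<Longrightarrow> a i \<in> carrier V" and yi: "\<And>i. i \<in> S \<Longrightarrow> y i \<in> carrier W"
    using a y S by auto
  have "(\<Oplus>\<^bsub>Z\<^esub>i\<in>S - {j}. \<beta> (a i \<oplus>\<^bsub>V\<^esub> d i \<odot>\<^bsub>V\<^esub> a j) (y i)) = (\<Oplus>\<^bsub>Z\<^esub>i\<in>S - {j}. \<beta> (a i) (y i) \<oplus>\<^bsub>Z\<^esub> \<beta> (a j) (d i \<odot>\<^bsub>W\<^esub> y i))"
    by (rule Z.finsum_cong') (auto simp: bs ai aj yi)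
  also have "\<dots> = (\<Oplus>\<^bsub>Z\<^esub>i\<in>S - {j}. \<beta> (a i) (y i)) \<oplus>\<^bsub>Z\<^esub> (\<Oplus>\<^bsub>Z\<^esub>i\<in>S - {j}. \<beta> (a j) (d i \<odot>\<^bsub>W\<^esub> y i))"
    by (rule Z.finsum_addf) (auto simp: bs ai aj yi)
  also have "(\<Oplus>\<^bsub>Z\<^esub>i\<in>S - {j}. \<beta> (a j) (d i \<odot>\<^bsub>W\<^esub> y i)) = \<beta> (a j) (y j)"
    unfolding yj by (rule linear_on_finsum[OF bilinear_onD(2)[OF b aj] V(2,3), symmetric]) (auto simp: yi)
  also have "(\<Oplus>\<^bsub>Z\<^esub>i\<in>S - {j}. \<beta> (a i) (y i)) \<oplus>\<^bsub>Z\<^esub> \<beta> (a j) (y j) = (\<Oplus>\<^bsub>Z\<^esub>i\<in>insert j (S - {j}). \<beta> (a i) (y i))"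
    using S by (subst Z.finsum_insert) (auto simp: bs ai aj yi Z.a_comm)
  also have "insert j (S - {j}) = S" using S by auto
  finally show ?thesis by simp
qed

text \<open>By induction on the number of terms. If the \<open>y i\<close> are linearly independent, then the hypothesis forces
  \<open>\<omega> (a i) = 0\<close> for all functionals, so every \<open>a i\<close> vanishes; otherwise one term is eliminated.\<close>

lemma tensor_sum_separated:
  assumes V: "complex_space V" "complex_space W" and sep: "separating V \<Omega>"
    and S: "finite S" "a \<in> S \<rightarrow> carrier V" "y \<in> S \<rightarrow> carrier W"
    and 0: "\<And>\<omega>. \<omega> \<in> \<Omega> \<Longrightarrow> (\<Oplus>\<^bsub>W\<^esub>i\<in>S. \<omega> (a i) \<odot>\<^bsub>W\<^esub> y i) = \<zero>\<^bsub>W\<^esub>"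
  shows "(\<Oplus>\<^bsub>tensor V W\<^esub>i\<in>S. pure_tensor V W (a i) (y i)) = \<zero>\<^bsub>tensor V W\<^esub>"
  using S 0
proof (induction "card S" arbitrary: S a rule: less_induct)
  case (less S)
  interpret V: complex_space V by fact
  interpret W: complex_space W by fact
  interpret T: complex_space "tensor V W" by (rule complex_space_tensor)
  have ai: "\<And>i. i \<in> S \<Longrightarrow> a i \<in> carrier V" and yi: "\<And>i. i \<in> S \<Longrightarrow> y i \<in> carrier W"
    using less.prems(2,3) by auto
  show ?case
  proof (cases "\<exists>c. (\<exists>j\<in>S. c j \<noteq> 0) \<and> (\<Oplus>\<^bsub>W\<^esub>i\<in>S. c i \<odot>\<^bsub>W\<^esub> y i) = \<zero>\<^bsub>W\<^esub>")
    case False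
    have "a i = \<zero>\<^bsub>V\<^esub>" if "i \<in> S" for i
    proof -
      have "\<omega> (a i) = 0" if w: "\<omega> \<in> \<Omega>" for \<omega>
      proof (rule ccontr)
        assume "\<omega> (a i) \<noteq> 0"
        then have "\<exists>c. (\<exists>j\<in>S. c j \<noteq> 0) \<and> (\<Oplus>\<^bsub>W\<^esub>i\<in>S. c i \<odot>\<^bsub>W\<^esub> y i) = \<zero>\<^bsub>W\<^esub>"
          using \<open>i \<in> S\<close> by (intro exI[of _ "\<lambda>i. \<omega> (a i)"] conjI bexI[of _ i] less.prems(4)[OF w])
        then show False using False by contradiction
      qed
      then show ?thesis using sep ai[OF that] unfolding separating_def by blast
    qed
    moreover have "pure_tensor V W \<zero>\<^bsub>V\<^esub> (y i) = \<zero>\<^bsub>tensor V W\<^esub>" if "i \<in> S" for i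
      using linear_on_zero[OF bilinear_onD(1)[OF bilinear_pure_tensor yi[OF that]] V(1) complex_space_tensor] .
    ultimately show ?thesis by (intro T.add.finprod_one_eqI) simp
  next
    case True
    then obtain c j where c: "j \<in> S" "c j \<noteq> 0" "(\<Oplus>\<^bsub>W\<^esub>i\<in>S. c i \<odot>\<^bsub>W\<^esub> y i) = \<zero>\<^bsub>W\<^esub>" by blast
    define d where "d i = - c i / c j" for i
    let ?S = "S - {j}"
    have fS: "finite ?S" "insert j ?S = S" "j \<notin> ?S" using c less.prems(1) by auto
    have yj: "y j = (\<Oplus>\<^bsub>W\<^esub>i\<in>?S. d i \<odot>\<^bsub>W\<^esub> y i)"
    proof -
      have cl: "(\<Oplus>\<^bsub>W\<^esub>i\<in>?S. c i \<odot>\<^bsub>W\<^esub> y i) \<in> carrier W" using yi by (auto intro!: W.finsum_closed)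
      have "c j \<odot>\<^bsub>W\<^esub> y j \<oplus>\<^bsub>W\<^esub> (\<Oplus>\<^bsub>W\<^esub>i\<in>?S. c i \<odot>\<^bsub>W\<^esub> y i) = (\<Oplus>\<^bsub>W\<^esub>i\<in>insert j ?S. c i \<odot>\<^bsub>W\<^esub> y i)"
        using fS yi c(1) by (subst W.finsum_insert) auto
      then have z: "c j \<odot>\<^bsub>W\<^esub> y j \<oplus>\<^bsub>W\<^esub> (\<Oplus>\<^bsub>W\<^esub>i\<in>?S. c i \<odot>\<^bsub>W\<^esub> y i) = \<zero>\<^bsub>W\<^esub>"
        using c(3) fS(2) by simp
      have "c j \<odot>\<^bsub>W\<^esub> y j = \<ominus>\<^bsub>W\<^esub> (\<Oplus>\<^bsub>W\<^esub>i\<in>?S. c i \<odot>\<^bsub>W\<^esub> y i)"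
        using W.minus_equality[OF z] cl yi[OF c(1)] by simp
      then have "(1 / c j) \<odot>\<^bsub>W\<^esub> (c j \<odot>\<^bsub>W\<^esub> y j) = (1 / c j) \<odot>\<^bsub>W\<^esub> ((-1) \<odot>\<^bsub>W\<^esub> (\<Oplus>\<^bsub>W\<^esub>i\<in>?S. c i \<odot>\<^bsub>W\<^esub> y i))"
        by (simp only: W.smult_minus_one[OF cl])
      then have "y j = (- 1 / c j) \<odot>\<^bsub>W\<^esub> (\<Oplus>\<^bsub>W\<^esub>i\<in>?S. c i \<odot>\<^bsub>W\<^esub> y i)"
        using c(1,2) cl yi by simp
      also have "\<dots> = (\<Oplus>\<^bsub>W\<^esub>i\<in>?S. (- 1 / c j) \<odot>\<^bsub>W\<^esub> (c i \<odot>\<^bsub>W\<^esub> y i))"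
        using yi by (intro W.smult_finsum) auto
      also have "\<dots> = (\<Oplus>\<^bsub>W\<^esub>i\<in>?S. d i \<odot>\<^bsub>W\<^esub> y i)"
        using yi by (intro W.finsum_cong') (auto simp: d_def)
      finally show ?thesis .
    qed
    let ?a = "\<lambda>i. a i \<oplus>\<^bsub>V\<^esub> d i \<odot>\<^bsub>V\<^esub> a j"
    have "(\<Oplus>\<^bsub>tensor V W\<^esub>i\<in>S. pure_tensor V W (a i) (y i)) = (\<Oplus>\<^bsub>tensor V W\<^esub>i\<in>?S. pure_tensor V W (?a i) (y i))"
      using bilinear_finsum[OF V complex_space_tensor bilinear_pure_tensor less.prems(1) c(1) less.prems(2,3) yj] .
    also have "\<dots> = \<zero>\<^bsub>tensor V W\<^esub>"
    proof (rule less.hyps)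
      show "card ?S < card S" using c(1) less.prems(1) by (rule card_Diff1_less[rotated])
      show "?a \<in> ?S \<rightarrow> carrier V" using ai c(1) by auto
      show "y \<in> ?S \<rightarrow> carrier W" using yi by auto
      fix \<omega> assume w: "\<omega> \<in> \<Omega>"
      then have wl: "linear_on V complex_alg \<omega>" using sep by (simp add: separating_def)
      show "(\<Oplus>\<^bsub>W\<^esub>i\<in>?S. \<omega> (?a i) \<odot>\<^bsub>W\<^esub> y i) = \<zero>\<^bsub>W\<^esub>"
        using bilinear_finsum[OF V(1,2,2) bilinear_on_functional[OF V wl] less.prems(1) c(1) less.prems(2,3) yj] less.prems(4)[OF w]
        by simp
    qed (use fS in simp)
    finally show ?thesis .
  qed
qed

lemma tensor_sumE:
  fixes V :: "('a, 'm) star_alg_scheme" and W :: "('b, 'n) star_alg_scheme"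
  assumes X: "X \<in> carrier (tensor V W)" and V: "complex_space V"
  obtains S :: "('a \<times> 'b) set" and a y where "finite S" "a \<in> S \<rightarrow> carrier V" "y \<in> S \<rightarrow> carrier W"
    "X = (\<Oplus>\<^bsub>tensor V W\<^esub>i\<in>S. pure_tensor V W (a i) (y i))"
proof -
  interpret V: complex_space V by fact
  interpret T: complex_space "tensor V W" by (rule complex_space_tensor)
  obtain p where p: "X = tensor_class V W p" "Poly_Mapping.keys p \<subseteq> carrier V \<times> carrier W"
    using X by (rule tensor_carrierE)
  let ?b = "\<lambda>s. pure_tensor V W (fst s) (snd s)"
  have b: "?b \<in> carrier V \<times> carrier W \<rightarrow> carrier (tensor V W)" by auto
  have "tensor_class V W p = lincomb (tensor V W) ?b p"
    using p(2)
  proof (induction p rule: poly_mapping_keys_induct)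
    case (single s c)
    then show ?case using T.lincomb_single[of ?b s c]
      by (auto simp: pure_tensor_def tensor_smult_class tensor_class_closed)
  next
    case (add p r)
    then show ?case using T.lincomb_add[OF b] by (simp add: tensor_add_class[symmetric])
  qed (simp add: tensor_zero_class)
  also have "\<dots> = (\<Oplus>\<^bsub>tensor V W\<^esub>s\<in>Poly_Mapping.keys p. pure_tensor V W (Poly_Mapping.lookup p s \<odot>\<^bsub>V\<^esub> fst s) (snd s))"
    unfolding lincomb_def using p(2) by (intro T.finsum_cong') (auto simp: pure_tensor_simps)
  finally show ?thesis
    using p by (intro that[of "Poly_Mapping.keys p" "\<lambda>s. Poly_Mapping.lookup p s \<odot>\<^bsub>V\<^esub> fst s" snd]) auto
qed

text \<open>Separates the first leg by \<open>\<Omega>\<close> and then the second by \<open>\<Omega>'\<close>.\<close>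

lemma tensor_separating:
  fixes V :: "('a, 'm) star_alg_scheme" and W :: "('b, 'n) star_alg_scheme"
  assumes V: "complex_space V" "complex_space W" and sep: "separating V \<Omega>" "separating W \<Omega>'"
    and X: "X \<in> carrier (tensor V W)"
    and 0: "\<And>\<omega> \<omega>'. \<omega> \<in> \<Omega> \<Longrightarrow> \<omega>' \<in> \<Omega>' \<Longrightarrow> tensor_lift V W complex_alg (\<lambda>x y. \<omega> x * \<omega>' y) X = 0"
  shows "X = \<zero>\<^bsub>tensor V W\<^esub>"
proof -
  interpret V: complex_space V by fact
  interpret W: complex_space W by fact
  obtain S :: "('a \<times> 'b) set" and a y where S: "finite S" "a \<in> S \<rightarrow> carrier V" "y \<in> S \<rightarrow> carrier W"
    "X = (\<Oplus>\<^bsub>tensor V W\<^esub>i\<in>S. pure_tensor V W (a i) (y i))"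
    using X V(1) by (rule tensor_sumE)
  have cl: "\<And>i. i \<in> S \<Longrightarrow> a i \<in> carrier V" "\<And>i. i \<in> S \<Longrightarrow> y i \<in> carrier W" using S by auto
  show ?thesis unfolding S(4)
  proof (rule tensor_sum_separated[OF V sep(1) S(1-3)])
    fix \<omega> assume w: "\<omega> \<in> \<Omega>"
    then have wl: "linear_on V complex_alg \<omega>" using sep by (simp add: separating_def)
    let ?z = "\<Oplus>\<^bsub>W\<^esub>i\<in>S. \<omega> (a i) \<odot>\<^bsub>W\<^esub> y i"
    have "?z \<in> carrier W" using cl by (auto intro!: W.finsum_closed)
    moreover have "\<omega>' ?z = 0" if w': "\<omega>' \<in> \<Omega>'" for \<omega>'
    proof -
      have wl': "linear_on W complex_alg \<omega>'" using sep(2) w' by (simp add: separating_def)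
      note L = tensor_lift[OF V complex_space_complex bilinear_on_functional2[OF V wl wl']]
      have "tensor_lift V W complex_alg (\<lambda>x y. \<omega> x * \<omega>' y) X = (\<Sum>i\<in>S. \<omega> (a i) * \<omega>' (y i))"
        unfolding S(4) using cl
        by (subst linear_on_finsum[OF L(1) complex_space_tensor complex_space_complex])
          (auto simp: finsum_complex L(2) intro!: sum.cong)
      moreover have "\<omega>' ?z = (\<Sum>i\<in>S. \<omega> (a i) * \<omega>' (y i))"
        using cl by (subst linear_on_finsum[OF wl' V(2) complex_space_complex])
          (auto simp: finsum_complex linear_on_smult[OF wl'] intro!: sum.cong)
      ultimately show ?thesis using 0[OF w w'] by simp
    qed
    ultimately show "?z = \<zero>\<^bsub>W\<^esub>" using sep(2) unfolding separating_def by blast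
  qed
qed

section \<open>Matrices satisfying the relations of the quantum special unitary group\<close>

context complex_space
begin

lemma finsum_swap:
  assumes "finite S" "finite T" "\<And>i j. i \<in> S \<Longrightarrow> j \<in> T \<Longrightarrow> f i j \<in> carrier V"
  shows "(\<Oplus>i\<in>S. \<Oplus>j\<in>T. f i j) = (\<Oplus>j\<in>T. \<Oplus>i\<in>S. f i j)"
  using assms(1,3)
proof (induction S rule: finite_induct)
  case (insert x S)
  have c: "(\<lambda>i. \<Oplus>j\<in>T. f i j) \<in> S \<rightarrow> carrier V" "(\<Oplus>j\<in>T. f x j) \<in> carrier V"
    using insert by (auto intro!: finsum_closed)
  have "(\<Oplus>i\<in>insert x S. \<Oplus>j\<in>T. f i j) = (\<Oplus>j\<in>T. f x j) \<oplus> (\<Oplus>j\<in>T. \<Oplus>i\<in>S. f i j)"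
    using insert c by simp
  also have "\<dots> = (\<Oplus>j\<in>T. f x j \<oplus> (\<Oplus>i\<in>S. f i j))"
    using insert by (subst finsum_addf) (auto intro!: finsum_closed)
  also have "\<dots> = (\<Oplus>j\<in>T. \<Oplus>i\<in>insert x S. f i j)"
    using insert by (intro finsum_cong') (auto intro!: finsum_closed)
  finally show ?case .
qed simp

lemma finsum_idx:
  assumes "\<And>i. f i \<in> carrier V"
  shows "(\<Oplus>i\<in>(UNIV::idx set). f i) = f I1 \<oplus> (f I2 \<oplus> f I3)"
  unfolding UNIV_idx using assms by simp

lemma finsum_idx_closed: "(\<And>i. f i \<in> carrier V) \<Longrightarrow> (\<Oplus>i\<in>(UNIV::idx set). f i) \<in> carrier V"
  by (auto intro: finsum_closed)

lemma finsum_delta: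
  assumes "\<And>i. f i \<in> carrier V"
  shows "(\<Oplus>i\<in>(UNIV::idx set). of_bool (j = i) \<odot> f i) = f j"
  using assms by (cases j) (simp_all add: finsum_idx)

text \<open>The triple sums of the determinant relation. Keeping the three summations together allows two such sums to be
  interchanged in one step.\<close>

definition finsum3 :: "(idx \<Rightarrow> idx \<Rightarrow> idx \<Rightarrow> 'a) \<Rightarrow> 'a" where
  "finsum3 f = (\<Oplus>a\<in>UNIV. \<Oplus>b\<in>UNIV. \<Oplus>c\<in>UNIV. f a b c)"

lemma finsum3_closed: "(\<And>a b c. f a b c \<in> carrier V) \<Longrightarrow> finsum3 f \<in> carrier V"
  unfolding finsum3_def by (intro finsum_idx_closed)

lemma finsum3_finsum:
  assumes "\<And>a b c (l::idx). f a b c l \<in> carrier V"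
  shows "finsum3 (\<lambda>a b c. \<Oplus>l\<in>UNIV. f a b c l) = (\<Oplus>l\<in>UNIV. finsum3 (\<lambda>a b c. f a b c l))"
proof -
  have s: "(\<Oplus>i\<in>UNIV. \<Oplus>l\<in>UNIV. g i l) = (\<Oplus>l\<in>UNIV. \<Oplus>i\<in>UNIV. g i l)" if "\<And>i l. g i l \<in> carrier V" for g :: "idx \<Rightarrow> idx \<Rightarrow> 'a"
    by (rule finsum_swap) (simp_all add: that)
  have c: "(\<Oplus>c\<in>UNIV. f a b c l) \<in> carrier V" "(\<Oplus>b\<in>UNIV. \<Oplus>c\<in>UNIV. f a b c l) \<in> carrier V" for a b l
    by (intro finsum_idx_closed assms)+
  show ?thesis unfolding finsum3_def
    by (subst s, rule assms, subst s, rule c, subst s, rule c, rule refl)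
qed

lemma finsum3_swap:
  assumes "\<And>a b c l m n. f a b c l m n \<in> carrier V"
  shows "finsum3 (\<lambda>a b c. finsum3 (f a b c)) = finsum3 (\<lambda>l m n. finsum3 (\<lambda>a b c. f a b c l m n))"
proof -
  have c: "(\<Oplus>n\<in>UNIV. f a b c l m n) \<in> carrier V" "(\<Oplus>m\<in>UNIV. \<Oplus>n\<in>UNIV. f a b c l m n) \<in> carrier V" for a b c l m
    by (intro finsum_idx_closed assms)+
  show ?thesis unfolding finsum3_def[of "\<lambda>l m n. finsum3 (\<lambda>a b c. f a b c l m n)"] finsum3_def[of "f _ _ _"]
    by (simp add: finsum3_finsum c assms)
qed

lemma finsum3_smult: "(\<And>a b c. f a b c \<in> carrier V) \<Longrightarrow> finsum3 (\<lambda>a b c. d \<odot> f a b c) = d \<odot> finsum3 f"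
  unfolding finsum3_def
  by (simp add: finsum_idx finsum_idx_closed smult_add)

lemma finsum3_E:
  assumes "\<And>a b c. f a b c \<in> carrier V"
  shows "finsum3 (\<lambda>a b c. E_sym q a b c \<odot> f a b c) =
    f I1 I2 I3 \<oplus> ((- of_real q) \<odot> f I1 I3 I2 \<oplus> ((- of_real q) \<odot> f I2 I1 I3 \<oplus> (of_real q ^ 2 \<odot> f I2 I3 I1 \<oplus>
      (of_real q ^ 2 \<odot> f I3 I1 I2 \<oplus> (- (of_real q ^ 3)) \<odot> f I3 I2 I1))))"
  unfolding finsum3_def using assms
  by (simp add: finsum_idx E_sym_def inversions_def a_ac power2_eq_square power3_eq_cube mult.assoc)

end

lemma linear_on_finsum3:
  assumes "linear_on V W h" "complex_space V" "complex_space W" "\<And>a b c. f a b c \<in> carrier V"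
  shows "h (complex_space.finsum3 V f) = complex_space.finsum3 W (\<lambda>a b c. h (f a b c))"
proof -
  interpret V: complex_space V by fact
  interpret W: complex_space W by fact
  have c: "(\<Oplus>\<^bsub>V\<^esub>c\<in>UNIV. f a b c) \<in> carrier V" "(\<Oplus>\<^bsub>V\<^esub>b\<in>UNIV. \<Oplus>\<^bsub>V\<^esub>c\<in>UNIV. f a b c) \<in> carrier V" for a b
    by (intro V.finsum_idx_closed assms)+
  show ?thesis unfolding V.finsum3_def W.finsum3_def
    by (simp add: linear_on_finsum[OF assms(1-3)] c assms(4))
qed

lemma pure_sum_right:
  assumes "complex_space V" "complex_space W" "x \<in> carrier V" "\<And>k. f k \<in> carrier W"
  shows "pure_tensor V W x (\<Oplus>\<^bsub>W\<^esub>k\<in>(UNIV::idx set). f k) = (\<Oplus>\<^bsub>tensor V W\<^esub>k\<in>UNIV. pure_tensor V W x (f k))"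
  using linear_on_finsum[OF bilinear_onD(2)[OF bilinear_pure_tensor assms(3)] assms(2) complex_space_tensor, of f UNIV] assms(4)
  by simp

lemma pure_sum_left:
  assumes "complex_space V" "complex_space W" "y \<in> carrier W" "\<And>k. f k \<in> carrier V"
  shows "pure_tensor V W (\<Oplus>\<^bsub>V\<^esub>k\<in>(UNIV::idx set). f k) y = (\<Oplus>\<^bsub>tensor V W\<^esub>k\<in>UNIV. pure_tensor V W (f k) y)"
  using linear_on_finsum[OF bilinear_onD(1)[OF bilinear_pure_tensor assms(3)] assms(1) complex_space_tensor, of f UNIV] assms(4)
  by simp

lemma linear_sum:
  assumes "linear_on V W h" "complex_space V" "complex_space W" "\<And>k. f k \<in> carrier V"
  shows "h (\<Oplus>\<^bsub>V\<^esub>k\<in>(UNIV::idx set). f k) = (\<Oplus>\<^bsub>W\<^esub>k\<in>UNIV. h (f k))"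
  using linear_on_finsum[OF assms(1-3), of f UNIV] assms(4) by simp

text \<open>The defining relations of \<open>SU_q(3)\<close> for a matrix over an arbitrary star-algebra.\<close>

definition su_matrix :: "real \<Rightarrow> ('a, 'm) star_alg_scheme \<Rightarrow> (idx \<Rightarrow> idx \<Rightarrow> 'a) \<Rightarrow> bool" where
  "su_matrix q B x \<longleftrightarrow> (\<forall>i j. x i j \<in> carrier B) \<and>
     (\<forall>i j. (\<Oplus>\<^bsub>B\<^esub>k\<in>UNIV. x i k \<otimes>\<^bsub>B\<^esub> star B (x j k)) = of_bool (i = j) \<odot>\<^bsub>B\<^esub> \<one>\<^bsub>B\<^esub>) \<and>
     (\<forall>i j. (\<Oplus>\<^bsub>B\<^esub>k\<in>UNIV. star B (x k i) \<otimes>\<^bsub>B\<^esub> x k j) = of_bool (i = j) \<odot>\<^bsub>B\<^esub> \<one>\<^bsub>B\<^esub>) \<and>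
     (\<forall>i j k. complex_space.finsum3 B (\<lambda>a b c. E_sym q a b c \<odot>\<^bsub>B\<^esub> (x i a \<otimes>\<^bsub>B\<^esub> (x j b \<otimes>\<^bsub>B\<^esub> x k c))) = E_sym q i j k \<odot>\<^bsub>B\<^esub> \<one>\<^bsub>B\<^esub>)"

lemma su_matrixD:
  assumes "su_matrix q B x"
  shows "x i j \<in> carrier B"
    "(\<Oplus>\<^bsub>B\<^esub>k\<in>UNIV. x i k \<otimes>\<^bsub>B\<^esub> star B (x j k)) = of_bool (i = j) \<odot>\<^bsub>B\<^esub> \<one>\<^bsub>B\<^esub>"
    "(\<Oplus>\<^bsub>B\<^esub>k\<in>UNIV. star B (x k i) \<otimes>\<^bsub>B\<^esub> x k j) = of_bool (i = j) \<odot>\<^bsub>B\<^esub> \<one>\<^bsub>B\<^esub>"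
    "complex_space.finsum3 B (\<lambda>a b c. E_sym q a b c \<odot>\<^bsub>B\<^esub> (x i a \<otimes>\<^bsub>B\<^esub> (x j b \<otimes>\<^bsub>B\<^esub> x k c))) = E_sym q i j k \<odot>\<^bsub>B\<^esub> \<one>\<^bsub>B\<^esub>"
  using assms unfolding su_matrix_def by blast+

lemma su_matrixI:
  assumes "\<And>i j. x i j \<in> carrier B"
    "\<And>i j. (\<Oplus>\<^bsub>B\<^esub>k\<in>UNIV. x i k \<otimes>\<^bsub>B\<^esub> star B (x j k)) = of_bool (i = j) \<odot>\<^bsub>B\<^esub> \<one>\<^bsub>B\<^esub>"
    "\<And>i j. (\<Oplus>\<^bsub>B\<^esub>k\<in>UNIV. star B (x k i) \<otimes>\<^bsub>B\<^esub> x k j) = of_bool (i = j) \<odot>\<^bsub>B\<^esub> \<one>\<^bsub>B\<^esub>"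
    "\<And>i j k. complex_space.finsum3 B (\<lambda>a b c. E_sym q a b c \<odot>\<^bsub>B\<^esub> (x i a \<otimes>\<^bsub>B\<^esub> (x j b \<otimes>\<^bsub>B\<^esub> x k c))) = E_sym q i j k \<odot>\<^bsub>B\<^esub> \<one>\<^bsub>B\<^esub>"
  shows "su_matrix q B x"
  unfolding su_matrix_def by (intro conjI allI assms)

text \<open>Replaces the presentation by equations in the target, so that candidate matrices can be tested without
  unfolding the free algebra.\<close>

lemma SU_relations_vanish_iff:
  assumes B: "star_algebra B" and f: "star_hom free_alg B f"
  shows "(\<forall>r\<in>SU_relations q. f r = \<zero>\<^bsub>B\<^esub>) \<longleftrightarrow> su_matrix q B (\<lambda>i j. f (gen (i, j)))"
proof -
  interpret B: star_algebra B by fact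
  have fc [simp]: "f p \<in> carrier B" for p using star_hom_closed[OF f] by simp
  note fsum = star_hom_free_sum[OF star_hom_linear[OF f] B.complex_space_axioms]
  note fdiff = linear_on_free_diff[OF star_hom_linear[OF f] B.complex_space_axioms]
  have fm: "f (p * r) = f p \<otimes>\<^bsub>B\<^esub> f r" for p r using star_hom_mult[OF f] by simp
  have fs: "f (gen_star g) = star B (f (gen g))" for g
    using star_hom_star[OF f, of "gen g"] by simp
  have fcs: "f (const c * p) = c \<odot>\<^bsub>B\<^esub> f p" for c p
    using star_hom_smult[OF f] by (simp add: const_mult)
  note diff0 = B.diff_eq_zero_iff
  have 1: "f ((\<Sum>k\<in>UNIV. gen (i, k) * gen_star (j, k)) - const (of_bool (i = j))) = \<zero>\<^bsub>B\<^esub> \<longleftrightarrow>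
    (\<Oplus>\<^bsub>B\<^esub>k\<in>UNIV. f (gen (i, k)) \<otimes>\<^bsub>B\<^esub> star B (f (gen (j, k)))) = of_bool (i = j) \<odot>\<^bsub>B\<^esub> \<one>\<^bsub>B\<^esub>" for i j
    unfolding fdiff fsum fm fs star_hom_const[OF f]
    by (rule diff0) (auto intro!: B.finsum_closed)
  have 2: "f ((\<Sum>k\<in>UNIV. gen_star (k, i) * gen (k, j)) - const (of_bool (i = j))) = \<zero>\<^bsub>B\<^esub> \<longleftrightarrow>
    (\<Oplus>\<^bsub>B\<^esub>k\<in>UNIV. star B (f (gen (k, i))) \<otimes>\<^bsub>B\<^esub> f (gen (k, j))) = of_bool (i = j) \<odot>\<^bsub>B\<^esub> \<one>\<^bsub>B\<^esub>" for i j
    unfolding fdiff fsum fm fs star_hom_const[OF f]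
    by (rule diff0) (auto intro!: B.finsum_closed)
  have 3: "f ((\<Sum>a\<in>UNIV. \<Sum>b\<in>UNIV. \<Sum>c\<in>UNIV. const (E_sym q a b c) * gen (i, a) * gen (j, b) * gen (k, c)) - const (E_sym q i j k)) = \<zero>\<^bsub>B\<^esub> \<longleftrightarrow>
     B.finsum3 (\<lambda>a b c. E_sym q a b c \<odot>\<^bsub>B\<^esub> (f (gen (i, a)) \<otimes>\<^bsub>B\<^esub> (f (gen (j, b)) \<otimes>\<^bsub>B\<^esub> f (gen (k, c))))) = E_sym q i j k \<odot>\<^bsub>B\<^esub> \<one>\<^bsub>B\<^esub>" for i j k
    unfolding fdiff fsum mult.assoc fcs
    unfolding fm star_hom_const[OF f] B.finsum3_def[symmetric]
    by (rule diff0) (auto intro!: B.finsum3_closed)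
  have "(\<forall>r\<in>SU_relations q. f r = \<zero>\<^bsub>B\<^esub>) \<longleftrightarrow>
    (\<forall>i j. f ((\<Sum>k\<in>UNIV. gen (i, k) * gen_star (j, k)) - const (of_bool (i = j))) = \<zero>\<^bsub>B\<^esub>) \<and>
    (\<forall>i j. f ((\<Sum>k\<in>UNIV. gen_star (k, i) * gen (k, j)) - const (of_bool (i = j))) = \<zero>\<^bsub>B\<^esub>) \<and>
    (\<forall>i j k. f ((\<Sum>a\<in>UNIV. \<Sum>b\<in>UNIV. \<Sum>c\<in>UNIV. const (E_sym q a b c) * gen (i, a) * gen (j, b) * gen (k, c)) - const (E_sym q i j k)) = \<zero>\<^bsub>B\<^esub>)"
    unfolding SU_relations_def by blast
  also have "\<dots> \<longleftrightarrow> su_matrix q B (\<lambda>i j. f (gen (i, j)))"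
    unfolding 1 2 3 su_matrix_def by simp
  finally show ?thesis .
qed

lemma (in star_algebra) finsum_mult_finsum:
  assumes "\<And>i. f i \<in> carrier A" "\<And>j. g j \<in> carrier A"
  shows "(\<Oplus>i\<in>(UNIV::idx set). f i) \<otimes> (\<Oplus>j\<in>(UNIV::idx set). g j) = (\<Oplus>i\<in>UNIV. \<Oplus>j\<in>UNIV. f i \<otimes> g j)"
proof -
  have "(\<Oplus>i\<in>(UNIV::idx set). f i) \<otimes> (\<Oplus>j\<in>(UNIV::idx set). g j) = (\<Oplus>i\<in>UNIV. f i \<otimes> (\<Oplus>j\<in>(UNIV::idx set). g j))"
    by (rule finsum_ldistr) (auto simp: assms finsum_idx_closed)
  also have "\<dots> = (\<Oplus>i\<in>UNIV. \<Oplus>j\<in>UNIV. f i \<otimes> g j)"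
    using assms by (simp add: finsum_rdistr)
  finally show ?thesis .
qed

lemma finsum_idx_swap:
  assumes "complex_space B" "\<And>i j. f i j \<in> carrier B"
  shows "(\<Oplus>\<^bsub>B\<^esub>i\<in>(UNIV::idx set). \<Oplus>\<^bsub>B\<^esub>j\<in>(UNIV::idx set). f i j) = (\<Oplus>\<^bsub>B\<^esub>j\<in>UNIV. \<Oplus>\<^bsub>B\<^esub>i\<in>UNIV. f i j)"
  by (rule complex_space.finsum_swap[OF assms(1)]) (simp_all add: assms)

text \<open>The matrix is the product of \<open>x\<close> and \<open>y\<close> with commuting legs. For the unitarity relations the
  inner sums collapse by unitarity of one factor and then of the other; in the determinant relation the \<open>y\<close>
  part turns the coefficient at the column indices into the coefficient at the intermediate indices, which is the
  form needed for the \<open>x\<close> part.\<close>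

lemma su_matrix_tensor:
  assumes AB: "star_algebra A" "star_algebra B" and x: "su_matrix q A x" and y: "su_matrix q B y"
  shows "su_matrix q (tensor A B) (\<lambda>i j. \<Oplus>\<^bsub>tensor A B\<^esub>k\<in>UNIV. pure_tensor A B (x i k) (y k j))"
proof -
  interpret A: star_algebra A by fact
  interpret B: star_algebra B by fact
  let ?T = "tensor A B"
  interpret T: star_algebra ?T by (rule star_algebra_tensor) fact+
  let ?p = "pure_tensor A B"
  note xc [simp] = su_matrixD(1)[OF x] and yc [simp] = su_matrixD(1)[OF y]
  note cs = A.complex_space_axioms B.complex_space_axioms T.complex_space_axioms
  have pl: "linear_on B ?T (?p a)" if "a \<in> carrier A" for a using bilinear_onD(2)[OF bilinear_pure_tensor that] .
  have pr: "linear_on A ?T (\<lambda>a. ?p a b)" if "b \<in> carrier B" for b using bilinear_onD(1)[OF bilinear_pure_tensor that] .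
  note suml = pure_sum_right[OF cs(1,2)] and sumr = pure_sum_left[OF cs(1,2)]
  note pm = pure_tensor_mult[OF AB] and ps = pure_tensor_star[OF AB] and po = tensor_one[OF AB]
  define U where "U i j = (\<Oplus>\<^bsub>?T\<^esub>k\<in>UNIV. ?p (x i k) (y k j))" for i j
  have Uc: "U i j \<in> carrier ?T" for i j unfolding U_def by (intro T.finsum_idx_closed) simp
  have Us: "star ?T (U i j) = (\<Oplus>\<^bsub>?T\<^esub>k\<in>UNIV. ?p (star A (x i k)) (star B (y k j)))" for i j
    unfolding U_def by (subst T.star_finsum) (auto simp: ps)
  have "su_matrix q ?T U"
  proof (rule su_matrixI)
    fix i j
    show "U i j \<in> carrier ?T" by (rule Uc)
    have "(\<Oplus>\<^bsub>?T\<^esub>k\<in>UNIV. U i k \<otimes>\<^bsub>?T\<^esub> star ?T (U j k)) =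
      (\<Oplus>\<^bsub>?T\<^esub>k\<in>UNIV. \<Oplus>\<^bsub>?T\<^esub>l\<in>UNIV. \<Oplus>\<^bsub>?T\<^esub>m\<in>UNIV. ?p (x i l \<otimes>\<^bsub>A\<^esub> star A (x j m)) (y l k \<otimes>\<^bsub>B\<^esub> star B (y m k)))"
      unfolding Us unfolding U_def by (subst T.finsum_mult_finsum) (simp_all add: pm)
    also have "\<dots> = (\<Oplus>\<^bsub>?T\<^esub>l\<in>UNIV. \<Oplus>\<^bsub>?T\<^esub>m\<in>UNIV. \<Oplus>\<^bsub>?T\<^esub>k\<in>UNIV. ?p (x i l \<otimes>\<^bsub>A\<^esub> star A (x j m)) (y l k \<otimes>\<^bsub>B\<^esub> star B (y m k)))"
      by (subst finsum_idx_swap[OF cs(3)]) (simp_all add: T.finsum_idx_closed finsum_idx_swap[OF cs(3), of "\<lambda>k m. ?p (x i _ \<otimes>\<^bsub>A\<^esub> star A (x j m)) (y _ k \<otimes>\<^bsub>B\<^esub> star B (y m k))"])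
    also have "\<dots> = (\<Oplus>\<^bsub>?T\<^esub>l\<in>UNIV. \<Oplus>\<^bsub>?T\<^esub>m\<in>UNIV. of_bool (l = m) \<odot>\<^bsub>?T\<^esub> ?p (x i l \<otimes>\<^bsub>A\<^esub> star A (x j m)) \<one>\<^bsub>B\<^esub>)"
      by (simp add: suml[symmetric] su_matrixD(2)[OF y] pure_tensor_simps)
    also have "\<dots> = (\<Oplus>\<^bsub>?T\<^esub>l\<in>UNIV. ?p (x i l \<otimes>\<^bsub>A\<^esub> star A (x j l)) \<one>\<^bsub>B\<^esub>)"
      by (simp add: T.finsum_delta)
    also have "\<dots> = of_bool (i = j) \<odot>\<^bsub>?T\<^esub> \<one>\<^bsub>?T\<^esub>"
      by (simp add: sumr[symmetric] su_matrixD(2)[OF x] pure_tensor_simps po)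
    finally show "(\<Oplus>\<^bsub>?T\<^esub>k\<in>UNIV. U i k \<otimes>\<^bsub>?T\<^esub> star ?T (U j k)) = of_bool (i = j) \<odot>\<^bsub>?T\<^esub> \<one>\<^bsub>?T\<^esub>" .
    have "(\<Oplus>\<^bsub>?T\<^esub>k\<in>UNIV. star ?T (U k i) \<otimes>\<^bsub>?T\<^esub> U k j) =
      (\<Oplus>\<^bsub>?T\<^esub>k\<in>UNIV. \<Oplus>\<^bsub>?T\<^esub>l\<in>UNIV. \<Oplus>\<^bsub>?T\<^esub>m\<in>UNIV. ?p (star A (x k l) \<otimes>\<^bsub>A\<^esub> x k m) (star B (y l i) \<otimes>\<^bsub>B\<^esub> y m j))"
      unfolding Us unfolding U_def by (subst T.finsum_mult_finsum) (simp_all add: pm)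
    also have "\<dots> = (\<Oplus>\<^bsub>?T\<^esub>l\<in>UNIV. \<Oplus>\<^bsub>?T\<^esub>m\<in>UNIV. \<Oplus>\<^bsub>?T\<^esub>k\<in>UNIV. ?p (star A (x k l) \<otimes>\<^bsub>A\<^esub> x k m) (star B (y l i) \<otimes>\<^bsub>B\<^esub> y m j))"
      by (subst finsum_idx_swap[OF cs(3)]) (simp_all add: T.finsum_idx_closed finsum_idx_swap[OF cs(3), of "\<lambda>k m. ?p (star A (x k _) \<otimes>\<^bsub>A\<^esub> x k m) (star B (y _ i) \<otimes>\<^bsub>B\<^esub> y m j)"])
    also have "\<dots> = (\<Oplus>\<^bsub>?T\<^esub>l\<in>UNIV. \<Oplus>\<^bsub>?T\<^esub>m\<in>UNIV. of_bool (l = m) \<odot>\<^bsub>?T\<^esub> ?p \<one>\<^bsub>A\<^esub> (star B (y l i) \<otimes>\<^bsub>B\<^esub> y m j))"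
      by (simp add: sumr[symmetric] su_matrixD(3)[OF x] pure_tensor_simps)
    also have "\<dots> = (\<Oplus>\<^bsub>?T\<^esub>l\<in>UNIV. ?p \<one>\<^bsub>A\<^esub> (star B (y l i) \<otimes>\<^bsub>B\<^esub> y l j))"
      by (simp add: T.finsum_delta)
    also have "\<dots> = of_bool (i = j) \<odot>\<^bsub>?T\<^esub> \<one>\<^bsub>?T\<^esub>"
      by (simp add: suml[symmetric] su_matrixD(3)[OF y] pure_tensor_simps po)
    finally show "(\<Oplus>\<^bsub>?T\<^esub>k\<in>UNIV. star ?T (U k i) \<otimes>\<^bsub>?T\<^esub> U k j) = of_bool (i = j) \<odot>\<^bsub>?T\<^esub> \<one>\<^bsub>?T\<^esub>" .
    fix k
    define P where "P l m n = x i l \<otimes>\<^bsub>A\<^esub> (x j m \<otimes>\<^bsub>A\<^esub> x k n)" for l m n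
    define Q where "Q l m n a b c = y l a \<otimes>\<^bsub>B\<^esub> (y m b \<otimes>\<^bsub>B\<^esub> y n c)" for l m n a b c
    have PQ [simp]: "P l m n \<in> carrier A" "Q l m n a b c \<in> carrier B" for l m n a b c
      by (simp_all add: P_def Q_def)
    have U3: "U i a \<otimes>\<^bsub>?T\<^esub> (U j b \<otimes>\<^bsub>?T\<^esub> U k c) = T.finsum3 (\<lambda>l m n. ?p (P l m n) (Q l m n a b c))" for a b c
      unfolding U_def T.finsum3_def
      by (simp add: T.finsum_mult_finsum T.finsum_idx_closed pm P_def Q_def)
       (simp add: T.finsum_ldistr T.finsum_rdistr T.finsum_idx_closed pm)
    have "T.finsum3 (\<lambda>a b c. E_sym q a b c \<odot>\<^bsub>?T\<^esub> (U i a \<otimes>\<^bsub>?T\<^esub> (U j b \<otimes>\<^bsub>?T\<^esub> U k c)))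
      = T.finsum3 (\<lambda>a b c. T.finsum3 (\<lambda>l m n. E_sym q a b c \<odot>\<^bsub>?T\<^esub> ?p (P l m n) (Q l m n a b c)))"
      by (simp add: U3 T.finsum3_smult)
    also have "\<dots> = T.finsum3 (\<lambda>l m n. T.finsum3 (\<lambda>a b c. E_sym q a b c \<odot>\<^bsub>?T\<^esub> ?p (P l m n) (Q l m n a b c)))"
      by (rule T.finsum3_swap) simp
    also have "\<dots> = T.finsum3 (\<lambda>l m n. ?p (P l m n) (B.finsum3 (\<lambda>a b c. E_sym q a b c \<odot>\<^bsub>B\<^esub> Q l m n a b c)))"
      by (simp add: linear_on_finsum3[OF pl cs(2,3)] pure_tensor_simps)
    also have "\<dots> = T.finsum3 (\<lambda>l m n. ?p (E_sym q l m n \<odot>\<^bsub>A\<^esub> P l m n) \<one>\<^bsub>B\<^esub>)"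
      unfolding Q_def su_matrixD(4)[OF y] by (simp add: pure_tensor_simps)
    also have "\<dots> = ?p (A.finsum3 (\<lambda>l m n. E_sym q l m n \<odot>\<^bsub>A\<^esub> P l m n)) \<one>\<^bsub>B\<^esub>"
      by (simp add: linear_on_finsum3[OF pr cs(1,3)])
    also have "\<dots> = E_sym q i j k \<odot>\<^bsub>?T\<^esub> \<one>\<^bsub>?T\<^esub>"
      unfolding P_def su_matrixD(4)[OF x] by (simp add: pure_tensor_simps po)
    finally show "T.finsum3 (\<lambda>a b c. E_sym q a b c \<odot>\<^bsub>?T\<^esub> (U i a \<otimes>\<^bsub>?T\<^esub> (U j b \<otimes>\<^bsub>?T\<^esub> U k c))) = E_sym q i j k \<odot>\<^bsub>?T\<^esub> \<one>\<^bsub>?T\<^esub>" .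
  qed
  then show ?thesis unfolding U_def[abs_def] .
qed

text \<open>The quantum Cramer rule. Multiplying the determinant relation by the adjoint of a column and summing
  cancels the first factor by unitarity, which expresses adjoints as quadratic polynomials in the
  entries.\<close>

lemma su_matrix_adjoint:
  assumes B: "star_algebra B" and x: "su_matrix q B x"
  shows "(\<Oplus>\<^bsub>B\<^esub>b\<in>UNIV. \<Oplus>\<^bsub>B\<^esub>c\<in>UNIV. E_sym q d b c \<odot>\<^bsub>B\<^esub> (x j b \<otimes>\<^bsub>B\<^esub> x k c)) =
    (\<Oplus>\<^bsub>B\<^esub>i\<in>UNIV. E_sym q i j k \<odot>\<^bsub>B\<^esub> star B (x i d))"
proof -
  interpret B: star_algebra B by fact
  note xc [simp] = su_matrixD(1)[OF x] and cs = B.complex_space_axioms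
  have "(\<Oplus>\<^bsub>B\<^esub>i\<in>UNIV. E_sym q i j k \<odot>\<^bsub>B\<^esub> star B (x i d)) =
     (\<Oplus>\<^bsub>B\<^esub>i\<in>UNIV. star B (x i d) \<otimes>\<^bsub>B\<^esub> (E_sym q i j k \<odot>\<^bsub>B\<^esub> \<one>\<^bsub>B\<^esub>))"
    by (simp add: B.smult_mult_right)
  also have "\<dots> = (\<Oplus>\<^bsub>B\<^esub>i\<in>UNIV. B.finsum3 (\<lambda>a b c. star B (x i d) \<otimes>\<^bsub>B\<^esub> (E_sym q a b c \<odot>\<^bsub>B\<^esub> (x i a \<otimes>\<^bsub>B\<^esub> (x j b \<otimes>\<^bsub>B\<^esub> x k c)))))"
    unfolding su_matrixD(4)[OF x, symmetric]
    by (simp add: linear_on_finsum3[OF B.linear_on_mult_left cs cs])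
  also have "\<dots> = B.finsum3 (\<lambda>a b c. \<Oplus>\<^bsub>B\<^esub>i\<in>UNIV. star B (x i d) \<otimes>\<^bsub>B\<^esub> (E_sym q a b c \<odot>\<^bsub>B\<^esub> (x i a \<otimes>\<^bsub>B\<^esub> (x j b \<otimes>\<^bsub>B\<^esub> x k c))))"
    by (rule B.finsum3_finsum[symmetric]) simp
  also have "\<dots> = B.finsum3 (\<lambda>a b c. (\<Oplus>\<^bsub>B\<^esub>i\<in>UNIV. star B (x i d) \<otimes>\<^bsub>B\<^esub> x i a) \<otimes>\<^bsub>B\<^esub> (E_sym q a b c \<odot>\<^bsub>B\<^esub> (x j b \<otimes>\<^bsub>B\<^esub> x k c)))"
    by (simp add: B.finsum_ldistr B.m_assoc B.smult_mult_right B.smult_finsum)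
  also have "\<dots> = B.finsum3 (\<lambda>a b c. of_bool (d = a) \<odot>\<^bsub>B\<^esub> (E_sym q a b c \<odot>\<^bsub>B\<^esub> (x j b \<otimes>\<^bsub>B\<^esub> x k c)))"
    unfolding su_matrixD(3)[OF x] by (simp add: B.smult_mult_left)
  also have "\<dots> = (\<Oplus>\<^bsub>B\<^esub>a\<in>UNIV. of_bool (d = a) \<odot>\<^bsub>B\<^esub> (\<Oplus>\<^bsub>B\<^esub>b\<in>UNIV. \<Oplus>\<^bsub>B\<^esub>c\<in>UNIV. E_sym q a b c \<odot>\<^bsub>B\<^esub> (x j b \<otimes>\<^bsub>B\<^esub> x k c)))"
    unfolding B.finsum3_def by (simp add: B.smult_finsum B.finsum_idx_closed del: B.smult_smult)
  also have "\<dots> = (\<Oplus>\<^bsub>B\<^esub>b\<in>UNIV. \<Oplus>\<^bsub>B\<^esub>c\<in>UNIV. E_sym q d b c \<odot>\<^bsub>B\<^esub> (x j b \<otimes>\<^bsub>B\<^esub> x k c))"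
    by (simp add: B.finsum_delta B.finsum_idx_closed)
  finally show ?thesis ..
qed

section \<open>The algebra of the quantum unitary group\<close>

text \<open>The defining relations of \<open>U_q(2)\<close> for elements \<open>u\<close>, \<open>a\<close>, \<open>c\<close> in the roles of \<open>u\<close>, \<open>\<alpha>\<close>, \<open>\<gamma>\<close>.\<close>

definition u2_triple :: "real \<Rightarrow> ('a, 'm) star_alg_scheme \<Rightarrow> 'a \<Rightarrow> 'a \<Rightarrow> 'a \<Rightarrow> bool" where
  "u2_triple q B u a c \<longleftrightarrow> u \<in> carrier B \<and> a \<in> carrier B \<and> c \<in> carrier B \<and>
     u \<otimes>\<^bsub>B\<^esub> star B u = \<one>\<^bsub>B\<^esub> \<and> star B u \<otimes>\<^bsub>B\<^esub> u = \<one>\<^bsub>B\<^esub> \<and>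
     u \<otimes>\<^bsub>B\<^esub> a = a \<otimes>\<^bsub>B\<^esub> u \<and> u \<otimes>\<^bsub>B\<^esub> star B a = star B a \<otimes>\<^bsub>B\<^esub> u \<and>
     u \<otimes>\<^bsub>B\<^esub> c = c \<otimes>\<^bsub>B\<^esub> u \<and> u \<otimes>\<^bsub>B\<^esub> star B c = star B c \<otimes>\<^bsub>B\<^esub> u \<and>
     a \<otimes>\<^bsub>B\<^esub> c = of_real q \<odot>\<^bsub>B\<^esub> (c \<otimes>\<^bsub>B\<^esub> a) \<and> c \<otimes>\<^bsub>B\<^esub> star B c = star B c \<otimes>\<^bsub>B\<^esub> c \<and>
     a \<otimes>\<^bsub>B\<^esub> star B c = of_real q \<odot>\<^bsub>B\<^esub> (star B c \<otimes>\<^bsub>B\<^esub> a) \<and>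
     star B a \<otimes>\<^bsub>B\<^esub> a \<oplus>\<^bsub>B\<^esub> c \<otimes>\<^bsub>B\<^esub> star B c = \<one>\<^bsub>B\<^esub> \<and>
     a \<otimes>\<^bsub>B\<^esub> star B a \<oplus>\<^bsub>B\<^esub> (of_real q)\<^sup>2 \<odot>\<^bsub>B\<^esub> (c \<otimes>\<^bsub>B\<^esub> star B c) = \<one>\<^bsub>B\<^esub>"

lemma U2_relations_vanish_iff:
  assumes B: "star_algebra B" and f: "star_hom free_alg B f"
  shows "(\<forall>r\<in>U2_relations q. f r = \<zero>\<^bsub>B\<^esub>) \<longleftrightarrow> u2_triple q B (f (gen Uu)) (f (gen Alpha)) (f (gen Gamma))"
proof -
  interpret B: star_algebra B by fact
  have fc [simp]: "f p \<in> carrier B" for p using star_hom_closed[OF f] by simp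
  note fdiff = linear_on_free_diff[OF star_hom_linear[OF f] B.complex_space_axioms]
  have fm: "f (p * r) = f p \<otimes>\<^bsub>B\<^esub> f r" and fa: "f (p + r) = f p \<oplus>\<^bsub>B\<^esub> f r" for p r
    using star_hom_mult[OF f] star_hom_add[OF f] by simp_all
  have f1: "f 1 = \<one>\<^bsub>B\<^esub>" using star_hom_one[OF f] by simp
  have fs: "f (gen_star g) = star B (f (gen g))" for g
    using star_hom_star[OF f, of "gen g"] by simp
  have fcs: "f (const c * p) = c \<odot>\<^bsub>B\<^esub> f p" for c p
    using star_hom_smult[OF f] by (simp add: const_mult)
  note diff0 = B.diff_eq_zero_iff
  show ?thesis
    unfolding U2_relations_def Let_def ball_simps u2_triple_def mult.assoc
    by (simp add: fdiff fa fcs) (simp add: fm fs f1 fcs diff0 power2_eq_square)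
qed

text \<open>The fundamental matrix of \<open>U_q(2)\<close> formed from such elements.\<close>

definition u2_matrix :: "real \<Rightarrow> ('a, 'm) star_alg_scheme \<Rightarrow> 'a \<Rightarrow> 'a \<Rightarrow> 'a \<Rightarrow> idx \<Rightarrow> idx \<Rightarrow> 'a" where
  "u2_matrix q B u a c i j = (case (i, j) of
     (I1, I1) \<Rightarrow> u
   | (I2, I2) \<Rightarrow> a
   | (I2, I3) \<Rightarrow> (- of_real q) \<odot>\<^bsub>B\<^esub> (star B c \<otimes>\<^bsub>B\<^esub> star B u)
   | (I3, I2) \<Rightarrow> c
   | (I3, I3) \<Rightarrow> star B a \<otimes>\<^bsub>B\<^esub> star B u
   | _ \<Rightarrow> \<zero>\<^bsub>B\<^esub>)"

lemma u2_matrix_simps [simp]: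
  "u2_matrix q B u a c I1 I1 = u" "u2_matrix q B u a c I2 I2 = a"
  "u2_matrix q B u a c I2 I3 = (- of_real q) \<odot>\<^bsub>B\<^esub> (star B c \<otimes>\<^bsub>B\<^esub> star B u)"
  "u2_matrix q B u a c I3 I2 = c" "u2_matrix q B u a c I3 I3 = star B a \<otimes>\<^bsub>B\<^esub> star B u"
  "u2_matrix q B u a c I1 I2 = \<zero>\<^bsub>B\<^esub>" "u2_matrix q B u a c I1 I3 = \<zero>\<^bsub>B\<^esub>"
  "u2_matrix q B u a c I2 I1 = \<zero>\<^bsub>B\<^esub>" "u2_matrix q B u a c I3 I1 = \<zero>\<^bsub>B\<^esub>"
  by (simp_all add: u2_matrix_def)

context
  fixes q :: real and B :: "('a, 'm) star_alg_scheme" (structure) and u a c :: 'a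
  assumes B: "star_algebra B" and t: "u2_triple q B u a c" and q: "q \<noteq> 0"
begin

interpretation star_algebra B by (rule B)

lemma u2_closed [simp]: "u \<in> carrier B" "a \<in> carrier B" "c \<in> carrier B"
  using t unfolding u2_triple_def by blast+

lemma u2_rels:
  "u \<otimes> star B u = \<one>" "star B u \<otimes> u = \<one>" "u \<otimes> a = a \<otimes> u" "u \<otimes> star B a = star B a \<otimes> u"
  "u \<otimes> c = c \<otimes> u" "u \<otimes> star B c = star B c \<otimes> u"
  "a \<otimes> c = of_real q \<odot> (c \<otimes> a)" "c \<otimes> star B c = star B c \<otimes> c"
  "a \<otimes> star B c = of_real q \<odot> (star B c \<otimes> a)"
  "star B a \<otimes> a \<oplus> c \<otimes> star B c = \<one>" "a \<otimes> star B a \<oplus> (of_real q)\<^sup>2 \<odot> (c \<otimes> star B c) = \<one>"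
  using t unfolding u2_triple_def by blast+

lemma u2_star_rels:
  "c \<otimes> star B a = of_real q \<odot> (star B a \<otimes> c)" "star B c \<otimes> star B a = of_real q \<odot> (star B a \<otimes> star B c)"
  using arg_cong[OF u2_rels(7), of "star B"] arg_cong[OF u2_rels(9), of "star B"]
  by (simp_all add: star_mult star_smult)

lemma u2_assoc_cancel:
  "x \<in> carrier B \<Longrightarrow> u \<otimes> (star B u \<otimes> x) = x" "x \<in> carrier B \<Longrightarrow> star B u \<otimes> (u \<otimes> x) = x"
  by (simp_all add: m_assoc[symmetric] u2_rels)

lemma u2_central_star:
  assumes "x \<in> carrier B" "u \<otimes> x = x \<otimes> u" shows "star B u \<otimes> x = x \<otimes> star B u"
proof -
  have "star B u \<otimes> x = star B u \<otimes> (x \<otimes> (u \<otimes> star B u))" using assms by (simp add: u2_rels)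
  also have "\<dots> = star B u \<otimes> ((x \<otimes> u) \<otimes> star B u)" using assms(1) by (simp add: m_assoc)
  also have "\<dots> = star B u \<otimes> ((u \<otimes> x) \<otimes> star B u)" by (simp only: assms(2))
  also have "\<dots> = x \<otimes> star B u" using assms(1) by (simp add: m_assoc u2_assoc_cancel)
  finally show ?thesis .
qed

text \<open>Rewriting rules that move \<open>u\<close> and its adjoint to the left.\<close>

lemma u2_comm:
  "a \<otimes> u = u \<otimes> a" "star B a \<otimes> u = u \<otimes> star B a" "c \<otimes> u = u \<otimes> c" "star B c \<otimes> u = u \<otimes> star B c"
  "a \<otimes> star B u = star B u \<otimes> a" "star B a \<otimes> star B u = star B u \<otimes> star B a"
  "c \<otimes> star B u = star B u \<otimes> c" "star B c \<otimes> star B u = star B u \<otimes> star B c"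
  by (simp_all add: u2_rels u2_central_star)

lemma u2_comm_assoc:
  assumes x: "x \<in> carrier B"
  shows "a \<otimes> (u \<otimes> x) = u \<otimes> (a \<otimes> x)" "star B a \<otimes> (u \<otimes> x) = u \<otimes> (star B a \<otimes> x)"
  "c \<otimes> (u \<otimes> x) = u \<otimes> (c \<otimes> x)" "star B c \<otimes> (u \<otimes> x) = u \<otimes> (star B c \<otimes> x)"
  "a \<otimes> (star B u \<otimes> x) = star B u \<otimes> (a \<otimes> x)" "star B a \<otimes> (star B u \<otimes> x) = star B u \<otimes> (star B a \<otimes> x)"
  "c \<otimes> (star B u \<otimes> x) = star B u \<otimes> (c \<otimes> x)" "star B c \<otimes> (star B u \<otimes> x) = star B u \<otimes> (star B c \<otimes> x)"
  using x by (simp_all add: m_assoc[symmetric] u2_comm)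

lemmas u2_normal = m_assoc star_mult star_smult smult_mult_left smult_mult_right u2_comm u2_comm_assoc u2_assoc_cancel
  u2_rels(1,2)

lemma u2_matrix_closed [simp]: "u2_matrix q B u a c i j \<in> carrier B"
  by (cases i; cases j) simp_all

lemma add_neg_cancel: "x \<in> carrier B \<Longrightarrow> (- d) \<odot> x \<oplus> d \<odot> x = \<zero>" "x \<in> carrier B \<Longrightarrow> d \<odot> x \<oplus> (- d) \<odot> x = \<zero>"
  by (simp_all add: smult_add_scalar[symmetric])

text \<open>The quantum determinant of the \<open>2 \<times> 2\<close> block \<open>w\<close> is the inverse of \<open>u\<close>: pulling the adjoint of \<open>u\<close> to the left leaves, in each
  case, one of the two sphere relations or a \<open>q\<close>-commutation.\<close>

lemma u2_block_det:
  defines "w \<equiv> u2_matrix q B u a c"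
  assumes "i \<noteq> I1" "j \<noteq> I1"
  shows "w i I2 \<otimes> w j I3 \<oplus> (- of_real q) \<odot> (w i I3 \<otimes> w j I2) = (if i = j then 0 else if i = I2 then 1 else - of_real q) \<odot> star B u"
proof -
  have 23: "a \<otimes> (star B a \<otimes> star B u) \<oplus> (- of_real q) \<odot> ((- of_real q) \<odot> (star B c \<otimes> star B u) \<otimes> c) = star B u"
  proof -
    have "a \<otimes> (star B a \<otimes> star B u) \<oplus> (- of_real q) \<odot> ((- of_real q) \<odot> (star B c \<otimes> star B u) \<otimes> c)
      = star B u \<otimes> (a \<otimes> star B a \<oplus> (of_real q)\<^sup>2 \<odot> (c \<otimes> star B c))"
      by (simp add: u2_normal r_distr u2_rels(8) power2_eq_square)
    then show ?thesis by (simp add: u2_rels(11))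
  qed
  have 32: "c \<otimes> ((- of_real q) \<odot> (star B c \<otimes> star B u)) \<oplus> (- of_real q) \<odot> (star B a \<otimes> star B u \<otimes> a) = (- of_real q) \<odot> star B u"
  proof -
    have "c \<otimes> ((- of_real q) \<odot> (star B c \<otimes> star B u)) \<oplus> (- of_real q) \<odot> (star B a \<otimes> star B u \<otimes> a)
      = (- of_real q) \<odot> (star B u \<otimes> (star B a \<otimes> a \<oplus> c \<otimes> star B c))"
      by (simp add: u2_normal r_distr smult_add a_comm)
    then show ?thesis by (simp add: u2_rels(10))
  qed
  have 22: "a \<otimes> ((- of_real q) \<odot> (star B c \<otimes> star B u)) \<oplus> (- of_real q) \<odot> ((- of_real q) \<odot> (star B c \<otimes> star B u) \<otimes> a) = \<zero>"
    by (simp add: u2_normal u2_rels(9) add_neg_cancel)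
  have 33: "c \<otimes> (star B a \<otimes> star B u) \<oplus> (- of_real q) \<odot> (star B a \<otimes> star B u \<otimes> c) = \<zero>"
    by (simp add: u2_normal u2_star_rels add_neg_cancel)
  show ?thesis unfolding w_def using assms(2,3)
    by (cases i; cases j) (simp_all add: 22 23 32 33)
qed

lemma u_central_matrix: "u2_matrix q B u a c i j \<otimes> u = u \<otimes> u2_matrix q B u a c i j"
  by (cases i; cases j) (simp_all add: u2_normal)

text \<open>In the determinant relation only terms with exactly one factor from the corner \<open>u\<close> survive. As
  \<open>u\<close> is central it can be moved to the end, where it cancels the determinant of the block.\<close>

lemma su_matrix_u2_matrix: "su_matrix q B (u2_matrix q B u a c)"
proof (rule su_matrixI)
  let ?w = "u2_matrix q B u a c"
  fix i j
  show "?w i j \<in> carrier B" by simp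
  show "(\<Oplus>k\<in>UNIV. ?w i k \<otimes> star B (?w j k)) = of_bool (i = j) \<odot> \<one>"
    using u2_rels(10,11)
    by (cases i; cases j) (simp_all add: finsum_idx u2_normal u2_rels(7,8,9) u2_star_rels add_neg_cancel
      power2_eq_square a_comm)
  show "(\<Oplus>k\<in>UNIV. star B (?w k i) \<otimes> ?w k j) = of_bool (i = j) \<odot> \<one>"
    using u2_rels(10,11)
    by (cases i; cases j) (simp_all add: finsum_idx u2_normal u2_rels(7,8,9) u2_star_rels add_neg_cancel
      power2_eq_square a_comm)
  fix k
  have first: "?w i I2 \<otimes> (?w j I3 \<otimes> u) \<oplus> (- of_real q) \<odot> (?w i I3 \<otimes> (?w j I2 \<otimes> u)) = (if i = j then 0 else if i = I2 then 1 else - of_real q) \<odot> \<one>"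
    if "i \<noteq> I1" "j \<noteq> I1" for i j
  proof -
    have "?w i I2 \<otimes> (?w j I3 \<otimes> u) \<oplus> (- of_real q) \<odot> (?w i I3 \<otimes> (?w j I2 \<otimes> u)) =
      (?w i I2 \<otimes> ?w j I3 \<oplus> (- of_real q) \<odot> (?w i I3 \<otimes> ?w j I2)) \<otimes> u"
      by (simp add: l_distr smult_mult_left m_assoc)
    then show ?thesis unfolding u2_block_det[OF that] by (simp add: smult_mult_left u2_rels)
  qed
  have uw: "u \<otimes> ?w i j = ?w i j \<otimes> u" for i j by (simp add: u_central_matrix)
  have uw2: "u \<otimes> (?w i j \<otimes> x) = ?w i j \<otimes> (u \<otimes> x)" if "x \<in> carrier B" for i j x
    using that by (simp add: m_assoc[symmetric] uw)
  have z: "i \<noteq> I1 \<Longrightarrow> ?w i I1 = \<zero>" "i \<noteq> I1 \<Longrightarrow> ?w I1 i = \<zero>" for i by (cases i; simp)+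
  have "finsum3 (\<lambda>l m n. E_sym q l m n \<odot> (?w i l \<otimes> (?w j m \<otimes> ?w k n))) = E_sym q i j k \<odot> \<one>"
  proof -
    consider "i = I1" "j \<noteq> I1" "k \<noteq> I1" | "i \<noteq> I1" "j = I1" "k \<noteq> I1" | "i \<noteq> I1" "j \<noteq> I1" "k = I1"
      | "i = I1 \<and> j = I1 \<or> i = I1 \<and> k = I1 \<or> j = I1 \<and> k = I1" | "i \<noteq> I1" "j \<noteq> I1" "k \<noteq> I1" by blast
    then show ?thesis
    proof cases
      case 1
      have "finsum3 (\<lambda>l m n. E_sym q l m n \<odot> (?w i l \<otimes> (?w j m \<otimes> ?w k n))) =
        ?w j I2 \<otimes> (?w k I3 \<otimes> u) \<oplus> (- of_real q) \<odot> (?w j I3 \<otimes> (?w k I2 \<otimes> u))"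
        using 1 by (simp add: finsum3_E z uw2 uw)
      then show ?thesis unfolding first[OF 1(2,3)] using 1
        by (cases j; cases k) (simp_all add: E_sym_def inversions_def)
    next
      case 2
      have "finsum3 (\<lambda>l m n. E_sym q l m n \<odot> (?w i l \<otimes> (?w j m \<otimes> ?w k n))) =
        (- of_real q) \<odot> (?w i I2 \<otimes> (?w k I3 \<otimes> u)) \<oplus> (- of_real q) \<odot> ((- of_real q) \<odot> (?w i I3 \<otimes> (?w k I2 \<otimes> u)))"
        using 2 by (simp add: finsum3_E z uw2 uw power2_eq_square)
      also have "\<dots> = (- of_real q) \<odot> ((if i = k then 0 else if i = I2 then 1 else - of_real q) \<odot> \<one>)"
        unfolding first[OF 2(1,3), symmetric] by (simp add: smult_add)
      finally show ?thesis using 2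
        by (cases i; cases k) (simp_all add: E_sym_def inversions_def power2_eq_square)
    next
      case 3
      have "finsum3 (\<lambda>l m n. E_sym q l m n \<odot> (?w i l \<otimes> (?w j m \<otimes> ?w k n))) =
        (of_real q)\<^sup>2 \<odot> (?w i I2 \<otimes> (?w j I3 \<otimes> u)) \<oplus> (of_real q)\<^sup>2 \<odot> ((- of_real q) \<odot> (?w i I3 \<otimes> (?w j I2 \<otimes> u)))"
        using 3 by (simp add: finsum3_E z power2_eq_square power3_eq_cube)
      also have "\<dots> = (of_real q)\<^sup>2 \<odot> ((if i = j then 0 else if i = I2 then 1 else - of_real q) \<odot> \<one>)"
        unfolding first[OF 3(1,2), symmetric] by (simp add: smult_add)
      finally show ?thesis using 3
        by (cases i; cases j) (simp_all add: E_sym_def inversions_def power2_eq_square power3_eq_cube mult.assoc)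
    next
      case 4
      then have "E_sym q i j k = 0" by (auto simp: E_sym_def)
      then show ?thesis using 4 by (auto simp: finsum3_E z)
    next
      case 5
      then have "E_sym q i j k = 0" by (cases i; cases j; cases k) (simp_all add: E_sym_def)
      then show ?thesis using 5 by (simp add: finsum3_E z)
    qed
  qed
  then show "finsum3 (\<lambda>l m n. E_sym q l m n \<odot> (?w i l \<otimes> (?w j m \<otimes> ?w k n))) = E_sym q i j k \<odot> \<one>" .
qed

end

text \<open>Conversely, a block diagonal matrix satisfying the relations of the quantum special unitary group
  comes from a triple satisfying the relations of the quantum unitary group: the Cramer rule gives the
  centrality of \<open>u\<close> and the second column of the block, and unitarity gives the rest.\<close>

lemma u2_triple_of_block:
  assumes B: "star_algebra B" and x: "su_matrix q B x" and q: "q \<noteq> 0"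
    and z: "x I1 I2 = \<zero>\<^bsub>B\<^esub>" "x I1 I3 = \<zero>\<^bsub>B\<^esub>" "x I2 I1 = \<zero>\<^bsub>B\<^esub>" "x I3 I1 = \<zero>\<^bsub>B\<^esub>"
  shows "u2_triple q B (x I1 I1) (x I2 I2) (x I3 I2)"
    and "x = u2_matrix q B (x I1 I1) (x I2 I2) (x I3 I2)"
proof -
  interpret star_algebra B by (rule B)
  define u a b c d where "u = x I1 I1" and "a = x I2 I2" and "b = x I2 I3" and "c = x I3 I2" and "d = x I3 I3"
  note xc = su_matrixD(1)[OF x]
  have cl [simp]: "u \<in> carrier B" "a \<in> carrier B" "b \<in> carrier B" "c \<in> carrier B" "d \<in> carrier B"
    by (simp_all add: u_def a_def b_def c_def d_def xc)
  let ?q = "complex_of_real q"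
  let ?m = "\<lambda>x y. x \<otimes>\<^bsub>B\<^esub> y"
  have cancel: "e \<odot>\<^bsub>B\<^esub> y = e \<odot>\<^bsub>B\<^esub> y' \<longleftrightarrow> y = y'" if "e \<noteq> 0" "y \<in> carrier B" "y' \<in> carrier B" for e y y'
  proof
    assume "e \<odot>\<^bsub>B\<^esub> y = e \<odot>\<^bsub>B\<^esub> y'"
    then have "(1 / e) \<odot>\<^bsub>B\<^esub> (e \<odot>\<^bsub>B\<^esub> y) = (1 / e) \<odot>\<^bsub>B\<^esub> (e \<odot>\<^bsub>B\<^esub> y')" by simp
    then show "y = y'" using that by simp
  qed simp
  note adj = su_matrix_adjoint[OF B x]
  note adj_simps = finsum_idx E_sym_def inversions_def z xc u_def[symmetric] a_def[symmetric] b_def[symmetric]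
    c_def[symmetric] d_def[symmetric] power2_eq_square power3_eq_cube mult.assoc
  have sa: "star B a = ?m u d" "star B a = ?m d u"
    using adj[of I2 I1 I3] adj[of I2 I3 I1] q by (simp_all add: adj_simps cancel)
  have sb: "(- ?q) \<odot>\<^bsub>B\<^esub> star B b = ?q * ?q \<odot>\<^bsub>B\<^esub> ?m u c" "?q * ?q \<odot>\<^bsub>B\<^esub> star B b = (- (?q * ?q * ?q)) \<odot>\<^bsub>B\<^esub> ?m c u"
    using adj[of I3 I1 I3] adj[of I3 I3 I1] by (simp_all add: adj_simps)
  have sc: "?q * ?q \<odot>\<^bsub>B\<^esub> star B c = (- ?q) \<odot>\<^bsub>B\<^esub> ?m u b" "(- (?q * ?q * ?q)) \<odot>\<^bsub>B\<^esub> star B c = ?q * ?q \<odot>\<^bsub>B\<^esub> ?m b u"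
    using adj[of I2 I1 I2] adj[of I2 I2 I1] by (simp_all add: adj_simps)
  have sd: "star B d = ?m u a" "star B d = ?m a u"
    using adj[of I3 I1 I2] adj[of I3 I2 I1] q by (simp_all add: adj_simps cancel)
  have mult: "e \<odot>\<^bsub>B\<^esub> y = f \<odot>\<^bsub>B\<^esub> y' \<Longrightarrow> (g * e) \<odot>\<^bsub>B\<^esub> y = (g * f) \<odot>\<^bsub>B\<^esub> y'" if "y \<in> carrier B" "y' \<in> carrier B" for e f g y y'
    using that smult_smult by metis
  have sb1: "star B b = (- ?q) \<odot>\<^bsub>B\<^esub> ?m u c" "star B b = (- ?q) \<odot>\<^bsub>B\<^esub> ?m c u"
    using mult[OF _ _ sb(1), of "- 1 / ?q"] mult[OF _ _ sb(2), of "1 / (?q * ?q)"] q by simp_all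
  have sc1: "?m u b = (- ?q) \<odot>\<^bsub>B\<^esub> star B c" "?m b u = (- ?q) \<odot>\<^bsub>B\<^esub> star B c"
    using mult[OF _ _ sc(1), of "- 1 / ?q"] mult[OF _ _ sc(2), of "1 / (?q * ?q)"] q by simp_all
  have uu: "?m u (star B u) = \<one>\<^bsub>B\<^esub>" "?m (star B u) u = \<one>\<^bsub>B\<^esub>"
    using su_matrixD(2)[OF x, of I1 I1] su_matrixD(3)[OF x, of I1 I1] by (simp_all add: adj_simps)
  have ass: "?m u (?m (star B u) y) = y" "?m (star B u) (?m u y) = y" "?m (?m y u) (star B u) = y" "?m (?m y (star B u)) u = y" if "y \<in> carrier B" for y
    using that uu by (simp_all add: m_assoc[symmetric]) (simp_all add: m_assoc)
  have ua: "?m u a = ?m a u" using sd by simp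
  have uc: "?m u c = ?m c u" using sb1 q by (simp add: cancel)
  have usa: "?m u (star B a) = ?m (star B a) u" using sa by (simp add: m_assoc)
  have usc: "?m u (star B c) = ?m (star B c) u"
  proof -
    have "(- ?q) \<odot>\<^bsub>B\<^esub> ?m u (star B c) = ?m u (?m b u)" by (simp add: sc1 smult_mult_right)
    also have "\<dots> = ?m (?m u b) u" by (simp add: m_assoc)
    also have "\<dots> = (- ?q) \<odot>\<^bsub>B\<^esub> ?m (star B c) u" by (simp add: sc1 smult_mult_left)
    finally show ?thesis using q by (simp add: cancel)
  qed
  have d: "d = ?m (star B a) (star B u)" using sa(2) ass(3)[of d] by simp
  have b: "b = (- ?q) \<odot>\<^bsub>B\<^esub> ?m (star B c) (star B u)"
    using sc1(2) ass(3)[of b] by (simp add: smult_mult_left)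
  have bs: "star B b = (- ?q) \<odot>\<^bsub>B\<^esub> ?m u c" by (rule sb1)
  have ds: "star B d = ?m u a" by (rule sd)
  have move: "y \<in> carrier B \<Longrightarrow> ?m (?m y (star B u)) (?m u w) = ?m y w" if "w \<in> carrier B" for y w
    using that by (simp add: m_assoc ass)
  have eq0: "y = y'" if "y \<in> carrier B" "y' \<in> carrier B" "y \<oplus>\<^bsub>B\<^esub> (- 1) \<odot>\<^bsub>B\<^esub> y' = \<zero>\<^bsub>B\<^esub>" for y y'
  proof -
    have "y \<oplus>\<^bsub>B\<^esub> \<ominus>\<^bsub>B\<^esub> y' = \<zero>\<^bsub>B\<^esub>" using that by (simp add: smult_minus_one)
    then show ?thesis using minus_equality[of y "\<ominus>\<^bsub>B\<^esub> y'"] that by simp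
  qed
  have acs: "?m a (star B c) = ?q \<odot>\<^bsub>B\<^esub> ?m (star B c) a"
  proof (rule eq0)
    have "?m a (star B c) \<oplus>\<^bsub>B\<^esub> ?m b (star B d) = \<zero>\<^bsub>B\<^esub>"
      using su_matrixD(2)[OF x, of I2 I3] by (simp add: adj_simps)
    moreover have "?m b (star B d) = (- 1) \<odot>\<^bsub>B\<^esub> (?q \<odot>\<^bsub>B\<^esub> ?m (star B c) a)"
      unfolding ds b by (simp add: smult_mult_left move)
    ultimately show "?m a (star B c) \<oplus>\<^bsub>B\<^esub> (- 1) \<odot>\<^bsub>B\<^esub> (?q \<odot>\<^bsub>B\<^esub> ?m (star B c) a) = \<zero>\<^bsub>B\<^esub>" by simp
  qed simp_all
  have csas: "?m (star B c) (star B a) = ?q \<odot>\<^bsub>B\<^esub> ?m (star B a) (star B c)"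
  proof (rule eq0)
    have e: "?m (star B a) b \<oplus>\<^bsub>B\<^esub> ?m (star B c) d = \<zero>\<^bsub>B\<^esub>"
      using su_matrixD(3)[OF x, of I2 I3] by (simp add: adj_simps)
    have "?m (?m (star B c) (star B a) \<oplus>\<^bsub>B\<^esub> (- 1) \<odot>\<^bsub>B\<^esub> (?q \<odot>\<^bsub>B\<^esub> ?m (star B a) (star B c))) (star B u) = ?m (star B a) b \<oplus>\<^bsub>B\<^esub> ?m (star B c) d"
      unfolding b d by (simp add: l_distr smult_mult_left smult_mult_right m_assoc a_comm)
    then have "?m (?m (?m (star B c) (star B a) \<oplus>\<^bsub>B\<^esub> (- 1) \<odot>\<^bsub>B\<^esub> (?q \<odot>\<^bsub>B\<^esub> ?m (star B a) (star B c))) (star B u)) u = \<zero>\<^bsub>B\<^esub>"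
      unfolding e by simp
    then show "?m (star B c) (star B a) \<oplus>\<^bsub>B\<^esub> (- 1) \<odot>\<^bsub>B\<^esub> (?q \<odot>\<^bsub>B\<^esub> ?m (star B a) (star B c)) = \<zero>\<^bsub>B\<^esub>"
      by (subst (asm) ass(4)) simp_all
  qed simp_all
  have ac: "?m a c = ?q \<odot>\<^bsub>B\<^esub> ?m c a"
    using arg_cong[OF csas, of "star B"] by (simp add: star_mult star_smult)
  have dd: "?m d (star B d) = ?m (star B a) a" unfolding ds unfolding d by (simp add: move)
  have bb: "?m b (star B b) = ?q\<^sup>2 \<odot>\<^bsub>B\<^esub> ?m (star B c) c"
    unfolding bs unfolding b by (simp add: smult_mult_left smult_mult_right move power2_eq_square)
  have r1: "?m c (star B c) \<oplus>\<^bsub>B\<^esub> ?m (star B a) a = \<one>\<^bsub>B\<^esub>"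
    using su_matrixD(2)[OF x, of I3 I3] by (simp add: adj_simps dd)
  have r2: "?m (star B a) a \<oplus>\<^bsub>B\<^esub> ?m (star B c) c = \<one>\<^bsub>B\<^esub>"
    using su_matrixD(3)[OF x, of I2 I2] by (simp add: adj_simps)
  have r3: "?m a (star B a) \<oplus>\<^bsub>B\<^esub> ?q\<^sup>2 \<odot>\<^bsub>B\<^esub> ?m (star B c) c = \<one>\<^bsub>B\<^esub>"
    using su_matrixD(2)[OF x, of I2 I2] bb by (simp add: adj_simps)
  have ccs: "?m c (star B c) = ?m (star B c) c"
  proof -
    have "?m (star B a) a \<oplus>\<^bsub>B\<^esub> ?m c (star B c) = ?m (star B a) a \<oplus>\<^bsub>B\<^esub> ?m (star B c) c"
      using r1 r2 by (simp add: a_comm)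
    from arg_cong[OF this, of "\<lambda>z. \<ominus>\<^bsub>B\<^esub> ?m (star B a) a \<oplus>\<^bsub>B\<^esub> z"] show ?thesis by (simp add: r_neg1)
  qed
  show "u2_triple q B (x I1 I1) (x I2 I2) (x I3 I2)"
    unfolding u_def[symmetric] a_def[symmetric] c_def[symmetric] u2_triple_def
    using uu ua usa uc usc ac ccs acs r1 r3 by (simp add: a_comm)
  show "x = u2_matrix q B (x I1 I1) (x I2 I2) (x I3 I2)"
  proof (intro ext)
    fix i j
    show "x i j = u2_matrix q B (x I1 I1) (x I2 I2) (x I3 I2) i j"
      using b d by (cases i; cases j) (simp_all add: z u_def a_def b_def c_def d_def)
  qed
qed

lemma u2_matrix_star_hom:
  assumes A: "star_algebra A" and B: "star_algebra B" and f: "star_hom A B f" and c: "u \<in> carrier A" "a \<in> carrier A" "c \<in> carrier A"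
  shows "f (u2_matrix q A u a c i j) = u2_matrix q B (f u) (f a) (f c) i j"
proof -
  interpret A: star_algebra A by fact
  have "f \<zero>\<^bsub>A\<^esub> = \<zero>\<^bsub>B\<^esub>"
    using linear_on_zero[OF star_hom_linear[OF f]] A B by (simp add: star_algebra.axioms(1))
  then show ?thesis using c
    by (cases i; cases j) (simp_all add: star_hom_smult[OF f] star_hom_mult[OF f] star_hom_star[OF f])
qed

subsection \<open>The presented algebra\<close>

definition u2_cls :: "real \<Rightarrow> uq2_gen free \<Rightarrow> uq2_gen free set" where
  "u2_cls q p = relation_ideal (U2_relations q) +>\<^bsub>free_alg\<^esub> p"

lemma U2_eq: "U2 q = star_quot free_alg (relation_ideal (U2_relations q))"
  unfolding U2_def presented_alg_eq ..

lemma star_algebra_U2: "star_algebra (U2 q)"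
  unfolding U2_eq by (rule star_algebra_quot[OF star_ideal_relation_ideal])

lemma star_hom_u2_cls: "star_hom free_alg (U2 q) (u2_cls q)"
  unfolding U2_eq u2_cls_def[abs_def] by (rule star_hom_quot_class[OF star_ideal_relation_ideal])

lemma carrier_U2: "carrier (U2 q) = range (u2_cls q)"
  unfolding U2_eq u2_cls_def[abs_def] by (rule star_quot_simps(1)[OF star_ideal_relation_ideal])

lemma u2_cls_zero: "p \<in> relation_ideal (U2_relations q) \<Longrightarrow> u2_cls q p = \<zero>\<^bsub>U2 q\<^esub>"
  unfolding U2_eq u2_cls_def star_quot_simps(5)[OF star_ideal_relation_ideal]
  by (simp add: quot_class_eq[OF star_ideal_relation_ideal])

lemma u2_cls_eq_iff: "u2_cls q p = u2_cls q r \<longleftrightarrow> p - r \<in> relation_ideal (U2_relations q)"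
  unfolding u2_cls_def by (rule quot_class_eq[OF star_ideal_relation_ideal])

lemma u2_triple_U2: "u2_triple q (U2 q) (u2_cls q (gen Uu)) (u2_cls q (gen Alpha)) (u2_cls q (gen Gamma))"
  using U2_relations_vanish_iff[OF star_algebra_U2 star_hom_u2_cls, of q] u2_cls_zero relation_ideal_self(1) by blast

lemma u2_v_eq: "u2_v q i j = u2_cls q (v_free q i j)"
  unfolding u2_v_def u2_cls_def relation_ideal_def ..

lemma u2_v_matrix: "u2_v q = u2_matrix q (U2 q) (u2_cls q (gen Uu)) (u2_cls q (gen Alpha)) (u2_cls q (gen Gamma))"
proof (intro ext)
  fix i j
  note f = star_hom_u2_cls[of q]
  have z: "u2_cls q 0 = \<zero>\<^bsub>U2 q\<^esub>" using star_idealD(1)[OF star_ideal_relation_ideal] by (rule u2_cls_zero)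
  have s: "u2_cls q (gen_star g) = star (U2 q) (u2_cls q (gen g))" for g
    using star_hom_star[OF f, of "gen g"] by simp
  have cm: "u2_cls q (const c * p) = c \<odot>\<^bsub>U2 q\<^esub> u2_cls q p" for c p
    using star_hom_smult[OF f, of p c] by (simp add: const_mult)
  have m: "u2_cls q (p * r) = u2_cls q p \<otimes>\<^bsub>U2 q\<^esub> u2_cls q r" for p r
    using star_hom_mult[OF f, of p r] by simp
  show "u2_v q i j = u2_matrix q (U2 q) (u2_cls q (gen Uu)) (u2_cls q (gen Alpha)) (u2_cls q (gen Gamma)) i j"
    unfolding u2_v_eq by (cases i; cases j) (simp_all add: z mult.assoc cm, simp_all add: m s)
qed

text \<open>The universal property in the form in which it is applied below: a triple satisfying the
  relations gives a star-homomorphism, and its values are read off from the fundamental matrix.\<close>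

lemma U2_universal:
  assumes B: "star_algebra B" and t: "u2_triple q B u a c"
  shows "\<exists>f. star_hom (U2 q) B f \<and> (\<forall>i j. f (u2_v q i j) = u2_matrix q B u a c i j)"
proof -
  interpret B: star_algebra B by fact
  have cl: "u \<in> carrier B" "a \<in> carrier B" "c \<in> carrier B" using t unfolding u2_triple_def by blast+
  let ?g = "case_uq2_gen u a c"
  have gc: "?g x \<in> carrier B" for x using cl by (cases x) simp_all
  note L = B.star_hom_free_lift[of ?g, OF gc] and Lg = B.free_lift_gen[of ?g, OF gc]
  have "\<forall>r\<in>U2_relations q. free_lift B ?g r = \<zero>\<^bsub>B\<^esub>"
    unfolding U2_relations_vanish_iff[OF B L] by (simp add: Lg t)
  then have "p \<in> relation_ideal (U2_relations q) \<Longrightarrow> free_lift B ?g p = \<zero>\<^bsub>B\<^esub>" for p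
    using star_hom_relation_ideal[OF L B] by blast
  then obtain f where f: "star_hom (U2 q) B f" "\<And>p. f (u2_cls q p) = free_lift B ?g p"
    using star_hom_quot_lift[OF star_ideal_relation_ideal L B] unfolding U2_eq u2_cls_def by blast
  have "f (u2_v q i j) = u2_matrix q B u a c i j" for i j
    unfolding u2_v_matrix
    using u2_matrix_star_hom[OF star_algebra_U2 B f(1)] by (simp add: carrier_U2 f(2) Lg)
  then show ?thesis using f(1) by blast
qed

lemma U2_star_hom_eqI:
  assumes f: "star_hom (U2 q) B f" and g: "star_hom (U2 q) B g" and eq: "\<And>i j. f (u2_v q i j) = g (u2_v q i j)"
    and x: "x \<in> carrier (U2 q)"
  shows "f x = g x"
proof -
  obtain p where p: "x = u2_cls q p" using x unfolding carrier_U2 by auto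
  have "f (u2_cls q p) = g (u2_cls q p)"
  proof (rule free_star_hom_eqI[OF star_hom_comp[OF star_hom_u2_cls f] star_hom_comp[OF star_hom_u2_cls g]])
    show "f (u2_cls q (gen y)) = g (u2_cls q (gen y))" for y
      using eq[of I1 I1] eq[of I2 I2] eq[of I3 I2] by (cases y) (simp_all add: u2_v_matrix)
  qed
  then show ?thesis using p by simp
qed

lemma U2_star_hom_the:
  assumes f: "star_hom (U2 q) B f" "\<And>i j. f (u2_v q i j) = x i j"
  shows "star_hom (U2 q) B (THE g. g \<in> star_homs (U2 q) B \<and> (\<forall>i j. g (u2_v q i j) = x i j)) \<and>
    (\<forall>i j. (THE g. g \<in> star_homs (U2 q) B \<and> (\<forall>i j. g (u2_v q i j) = x i j)) (u2_v q i j) = x i j)"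
proof (rule star_homs_the[OF f(1) star_algebra_U2])
  have "u2_v q i j \<in> carrier (U2 q)" for i j by (simp add: u2_v_eq carrier_U2)
  then show "\<forall>i j. restrict f (carrier (U2 q)) (u2_v q i j) = x i j" by (simp add: f(2))
  show "\<forall>y\<in>carrier (U2 q). g y = h y" if "star_hom (U2 q) B g" "star_hom (U2 q) B h"
    "\<forall>i j. g (u2_v q i j) = x i j" "\<forall>i j. h (u2_v q i j) = x i j" for g h
    using U2_star_hom_eqI[OF that(1,2)] that(3,4) by simp
qed

section \<open>The algebra of the quantum special unitary group\<close>

text \<open>A coordinate of the vector \<open>X x\<close> as a functional of the coset \<open>X\<close>, where \<open>X\<close> acts through the representation \<open>\<sigma>\<close>.\<close>

definition rep_fun :: "('g \<times> bool \<Rightarrow> (nat \<Rightarrow> complex) \<Rightarrow> (nat \<Rightarrow> complex)) \<Rightarrow> (nat \<Rightarrow> complex) \<Rightarrow> nat \<Rightarrow> 'g free set \<Rightarrow> complex" where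
  "rep_fun \<sigma> x n X = rep_eval \<sigma> (SOME p. p \<in> X) x n"

lemma rep_fun_class:
  assumes I: "star_ideal I" and k: "\<And>p. p \<in> I \<Longrightarrow> rep_kills \<sigma> p" and x: "x \<in> ell2"
  shows "rep_fun \<sigma> x n (I +>\<^bsub>free_alg\<^esub> p) = rep_eval \<sigma> p x n"
proof -
  let ?r = "SOME r. r \<in> I +>\<^bsub>free_alg\<^esub> p"
  have "?r \<in> I +>\<^bsub>free_alg\<^esub> p" by (rule someI[of _ p]) (simp add: quot_class_mem[OF I] star_idealD(1)[OF I])
  then have "rep_kills \<sigma> (?r - p)" using k by (simp add: quot_class_mem[OF I])
  then have "rep_eval \<sigma> (?r - p) x = (\<lambda>n. 0)" using x by (simp add: rep_kills_def)
  then have "rep_eval \<sigma> ?r x n - rep_eval \<sigma> p x n = 0" by (simp add: rep_eval_simps fun_eq_iff)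
  then show ?thesis unfolding rep_fun_def by simp
qed

lemma linear_rep_fun:
  assumes I: "star_ideal I" and k: "\<And>p. p \<in> I \<Longrightarrow> rep_kills \<sigma> p" and x: "x \<in> ell2"
  shows "linear_on (star_quot free_alg I) complex_alg (rep_fun \<sigma> x n)"
  by (rule linear_onI; clarsimp simp: star_quot_simps[OF I] rep_fun_class[OF I k x] rep_eval_simps)

definition su_cls :: "real \<Rightarrow> su_gen free \<Rightarrow> su_gen free set" where
  "su_cls q p = cstar_kernel (SU_relations q) +>\<^bsub>free_alg\<^esub> p"

lemma cstar_dense_SU: "cstar_dense (SU_relations q) = star_quot free_alg (cstar_kernel (SU_relations q))"
  unfolding cstar_dense_def ..

lemma su_u_eq: "su_u q i j = su_cls q (gen (i, j))"
  unfolding su_u_def su_cls_def ..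

lemma star_algebra_dense: "star_algebra (cstar_dense (SU_relations q))"
  unfolding cstar_dense_SU by (rule star_algebra_quot[OF star_ideal_cstar_kernel])

lemma star_hom_su_cls_dense: "star_hom free_alg (cstar_dense (SU_relations q)) (su_cls q)"
  unfolding cstar_dense_SU su_cls_def[abs_def] by (rule star_hom_quot_class[OF star_ideal_cstar_kernel])

lemma su_cls_zero_dense: "p \<in> cstar_kernel (SU_relations q) \<Longrightarrow> su_cls q p = \<zero>\<^bsub>cstar_dense (SU_relations q)\<^esub>"
  unfolding cstar_dense_SU su_cls_def star_quot_simps(5)[OF star_ideal_cstar_kernel]
  by (simp add: quot_class_eq[OF star_ideal_cstar_kernel])

lemma su_matrix_dense: "su_matrix q (cstar_dense (SU_relations q)) (su_u q)"
  using SU_relations_vanish_iff[OF star_algebra_dense star_hom_su_cls_dense, of q q]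
    su_cls_zero_dense cstar_kernel_self unfolding su_u_eq[abs_def] by blast

text \<open>The Cramer rule applies with rows \<open>j\<close>, \<open>k\<close> different from \<open>i\<close>: the sum over \<open>l\<close> on its right side then reduces to the single
  term \<open>l = i\<close>, so the adjoints of the generators are polynomials in the generators.\<close>

lemma alg_gen_su_u:
  assumes q: "q \<noteq> 0"
  shows "alg_gen (cstar_dense (SU_relations q)) {su_u q i j | i j. True} = carrier (cstar_dense (SU_relations q))"
proof -
  let ?C = "cstar_dense (SU_relations q)" and ?x = "su_u q"
  interpret C: star_algebra ?C by (rule star_algebra_dense)
  let ?G = "alg_gen ?C {su_u q i j | i j. True}"
  note x = su_matrix_dense[of q] and f = star_hom_su_cls_dense[of q]
  note xc = su_matrixD(1)[OF x]
  have xG: "?x i j \<in> ?G" for i j by (rule alg_gen.gen) blast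
  have sub: "?G \<subseteq> carrier ?C"
  proof
    fix y assume "y \<in> ?G" then show "y \<in> carrier ?C"
      by (induction rule: alg_gen.induct) (auto simp: xc)
  qed
  have sumG: "(\<Oplus>\<^bsub>?C\<^esub>i\<in>(UNIV::idx set). g i) \<in> ?G" if "\<And>i. g i \<in> ?G" for g
  proof -
    have "(\<Oplus>\<^bsub>?C\<^esub>i\<in>UNIV. g i) = g I1 \<oplus>\<^bsub>?C\<^esub> (g I2 \<oplus>\<^bsub>?C\<^esub> g I3)"
      by (rule C.finsum_idx) (rule subsetD[OF sub that])
    then show ?thesis using alg_gen.add[OF that alg_gen.add[OF that that]] by (simp only:)
  qed
  have star: "star ?C (?x i d) \<in> ?G" for i d
  proof -
    have all_idx: "(\<forall>l. P l) \<longleftrightarrow> P I1 \<and> P I2 \<and> P I3" for P by (metis idx.exhaust)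
    have "\<exists>j k. distinct [i, j, k] \<and> (\<forall>l. l \<noteq> i \<longrightarrow> E_sym q l j k = 0)"
    proof (cases i)
      case I1
      then show ?thesis by (intro exI[of _ I2] exI[of _ I3]) (simp add: all_idx E_sym_def)
    next
      case I2
      then show ?thesis by (intro exI[of _ I1] exI[of _ I3]) (simp add: all_idx E_sym_def)
    next
      case I3
      then show ?thesis by (intro exI[of _ I1] exI[of _ I2]) (simp add: all_idx E_sym_def)
    qed
    then obtain j k where jk: "distinct [i, j, k]" "\<And>l. l \<noteq> i \<Longrightarrow> E_sym q l j k = 0" by blast
    have "(\<Oplus>\<^bsub>?C\<^esub>b\<in>UNIV. \<Oplus>\<^bsub>?C\<^esub>c\<in>UNIV. E_sym q d b c \<odot>\<^bsub>?C\<^esub> (?x j b \<otimes>\<^bsub>?C\<^esub> ?x k c)) \<in> ?G"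
      by (intro sumG alg_gen.smult alg_gen.mult xG)
    also have "(\<Oplus>\<^bsub>?C\<^esub>b\<in>UNIV. \<Oplus>\<^bsub>?C\<^esub>c\<in>UNIV. E_sym q d b c \<odot>\<^bsub>?C\<^esub> (?x j b \<otimes>\<^bsub>?C\<^esub> ?x k c)) =
      (\<Oplus>\<^bsub>?C\<^esub>l\<in>UNIV. E_sym q l j k \<odot>\<^bsub>?C\<^esub> star ?C (?x l d))"
      by (rule su_matrix_adjoint[OF star_algebra_dense x])
    also have "\<dots> = (\<Oplus>\<^bsub>?C\<^esub>l\<in>UNIV. of_bool (i = l) \<odot>\<^bsub>?C\<^esub> (E_sym q l j k \<odot>\<^bsub>?C\<^esub> star ?C (?x l d)))"
    proof -
      have "E_sym q l j k \<odot>\<^bsub>?C\<^esub> star ?C (?x l d) = of_bool (i = l) \<odot>\<^bsub>?C\<^esub> (E_sym q l j k \<odot>\<^bsub>?C\<^esub> star ?C (?x l d))" for l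
        using jk(2)[of l] by (cases "i = l") (auto simp: xc)
      then show ?thesis by simp
    qed
    also have "\<dots> = E_sym q i j k \<odot>\<^bsub>?C\<^esub> star ?C (?x i d)"
      by (rule C.finsum_delta) (simp add: xc)
    finally have "E_sym q i j k \<odot>\<^bsub>?C\<^esub> star ?C (?x i d) \<in> ?G" .
    then have "(1 / E_sym q i j k) \<odot>\<^bsub>?C\<^esub> (E_sym q i j k \<odot>\<^bsub>?C\<^esub> star ?C (?x i d)) \<in> ?G" by (rule alg_gen.smult)
    moreover have "E_sym q i j k \<noteq> 0" using jk(1) q by (simp add: E_sym_def)
    ultimately show ?thesis by (simp add: xc)
  qed
  have "su_cls q p \<in> ?G" for p
  proof (induction p rule: free_induct)
    case (const c)
    show ?case using star_hom_const[OF f, of c] alg_gen.smult[OF alg_gen.one, of ?C c] by simp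
  next
    case (gen g)
    show ?case using xG[of "fst g" "snd g"] by (simp add: su_u_eq)
  next
    case (gen_star g)
    show ?case using star[of "fst g" "snd g"] star_hom_star[OF f, of "gen g"] by (simp add: su_u_eq)
  next
    case (add p r)
    have "su_cls q (p + r) = su_cls q p \<oplus>\<^bsub>?C\<^esub> su_cls q r" using star_hom_add[OF f, of p r] by simp
    then show ?case using alg_gen.add[OF add] by (simp only:)
  next
    case (mult p r)
    have "su_cls q (p * r) = su_cls q p \<otimes>\<^bsub>?C\<^esub> su_cls q r" using star_hom_mult[OF f, of p r] by simp
    then show ?case using alg_gen.mult[OF mult] by (simp only:)
  qed
  then have "range (su_cls q) \<subseteq> ?G" by (rule image_subsetI)
  moreover have "carrier ?C = range (su_cls q)"
    unfolding cstar_dense_SU su_cls_def[abs_def] by (rule star_quot_simps(1)[OF star_ideal_cstar_kernel])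
  ultimately show ?thesis using sub by (simp only: subset_antisym)
qed

context
  fixes q :: real assumes q: "q \<noteq> 0"
begin

lemma SU_eq: "SU q = star_quot free_alg (cstar_kernel (SU_relations q))"
  unfolding SU_def Let_def alg_gen_su_u[OF q]
  unfolding cstar_dense_SU by simp

lemma SU_eq_dense: "SU q = cstar_dense (SU_relations q)"
  unfolding SU_eq cstar_dense_SU ..

lemma star_algebra_SU: "star_algebra (SU q)"
  unfolding SU_eq_dense by (rule star_algebra_dense)

lemma star_hom_su_cls: "star_hom free_alg (SU q) (su_cls q)"
  unfolding SU_eq_dense by (rule star_hom_su_cls_dense)

lemma su_matrix_SU: "su_matrix q (SU q) (su_u q)"
  unfolding SU_eq_dense by (rule su_matrix_dense)

lemma carrier_SU: "carrier (SU q) = range (su_cls q)"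
  unfolding SU_eq su_cls_def[abs_def] by (rule star_quot_simps(1)[OF star_ideal_cstar_kernel])

lemma SU_star_hom_eqI:
  assumes f: "star_hom (SU q) B f" and g: "star_hom (SU q) B g" and eq: "\<And>i j. f (su_u q i j) = g (su_u q i j)"
    and x: "x \<in> carrier (SU q)"
  shows "f x = g x"
proof -
  obtain p where p: "x = su_cls q p" using x unfolding carrier_SU by auto
  have "f (su_cls q p) = g (su_cls q p)"
  proof (rule free_star_hom_eqI[OF star_hom_comp[OF star_hom_su_cls f] star_hom_comp[OF star_hom_su_cls g]])
    show "f (su_cls q (gen y)) = g (su_cls q (gen y))" for y
      using eq[of "fst y" "snd y"] by (simp add: su_u_eq)
  qed
  then show ?thesis using p by simp
qed

lemma SU_star_hom_the:
  assumes f: "star_hom (SU q) B f" "\<And>i j. f (su_u q i j) = x i j"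
  shows "star_hom (SU q) B (THE g. g \<in> star_homs (SU q) B \<and> (\<forall>i j. g (su_u q i j) = x i j)) \<and>
    (\<forall>i j. (THE g. g \<in> star_homs (SU q) B \<and> (\<forall>i j. g (su_u q i j) = x i j)) (su_u q i j) = x i j)"
proof (rule star_homs_the[OF f(1) star_algebra_SU])
  show "\<forall>i j. restrict f (carrier (SU q)) (su_u q i j) = x i j"
    using su_matrixD(1)[OF su_matrix_SU] by (simp add: f(2))
  show "\<forall>y\<in>carrier (SU q). g y = h y" if "star_hom (SU q) B g" "star_hom (SU q) B h"
    "\<forall>i j. g (su_u q i j) = x i j" "\<forall>i j. h (su_u q i j) = x i j" for g h
    using SU_star_hom_eqI[OF that(1,2)] that(3,4) by simp
qed

text \<open>These functionals separate the points of \<open>SU q\<close> by the very definition of the kernel.\<close>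

definition su_functionals :: "(su_gen free set \<Rightarrow> complex) set" where
  "su_functionals = {rep_fun \<sigma> x n | \<sigma> x n. star_rep \<sigma> \<and> (\<forall>r\<in>SU_relations q. rep_kills \<sigma> r) \<and> x \<in> ell2}"

lemma kernel_rep_kills:
  "star_rep \<sigma> \<Longrightarrow> \<forall>r\<in>SU_relations q. rep_kills \<sigma> r \<Longrightarrow> p \<in> cstar_kernel (SU_relations q) \<Longrightarrow> rep_kills \<sigma> p"
  unfolding cstar_kernel_eq by blast

lemma rep_fun_su_cls:
  assumes "star_rep \<sigma>" "\<forall>r\<in>SU_relations q. rep_kills \<sigma> r" "x \<in> ell2"
  shows "rep_fun \<sigma> x n (su_cls q p) = rep_eval \<sigma> p x n"
  unfolding su_cls_def by (rule rep_fun_class[OF star_ideal_cstar_kernel kernel_rep_kills[OF assms(1,2)] assms(3)])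

lemma linear_rep_fun_SU:
  assumes "star_rep \<sigma>" "\<forall>r\<in>SU_relations q. rep_kills \<sigma> r" "x \<in> ell2"
  shows "linear_on (SU q) complex_alg (rep_fun \<sigma> x n)"
  unfolding SU_eq by (rule linear_rep_fun[OF star_ideal_cstar_kernel kernel_rep_kills[OF assms(1,2)] assms(3)])

lemma separating_su_functionals: "separating (SU q) su_functionals"
  unfolding separating_def
proof (intro conjI ballI impI)
  show "linear_on (SU q) complex_alg \<omega>" if "\<omega> \<in> su_functionals" for \<omega>
    using that linear_rep_fun_SU unfolding su_functionals_def by blast
  fix X assume X: "X \<in> carrier (SU q)" "\<forall>\<omega>\<in>su_functionals. \<omega> X = 0"
  obtain p where p: "X = su_cls q p" using X(1) unfolding carrier_SU by auto
  have "rep_kills \<sigma> p" if s: "star_rep \<sigma>" "\<forall>r\<in>SU_relations q. rep_kills \<sigma> r" for \<sigma>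
    unfolding rep_kills_def
  proof (intro ballI ext)
    fix x :: "nat \<Rightarrow> complex" and n assume x: "x \<in> ell2"
    have "rep_fun \<sigma> x n \<in> su_functionals" unfolding su_functionals_def using s x by blast
    then have "rep_fun \<sigma> x n X = 0" using X(2) by blast
    then show "rep_eval \<sigma> p x n = 0" unfolding p rep_fun_su_cls[OF s x] .
  qed
  then have "p \<in> cstar_kernel (SU_relations q)" unfolding cstar_kernel_eq by blast
  then show "X = \<zero>\<^bsub>SU q\<^esub>" unfolding p SU_eq_dense by (rule su_cls_zero_dense)
qed

end

subsection \<open>The comultiplication\<close>

text \<open>The convolution of two representations: the generator \<open>u_ij\<close> acts by \<open>\<Sum>\<^sub>k \<sigma>(u_ik) \<otimes> \<tau>(u_kj)\<close>.\<close>

definition tensor_rep ::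
  "(su_gen \<times> bool \<Rightarrow> (nat \<Rightarrow> complex) \<Rightarrow> (nat \<Rightarrow> complex)) \<Rightarrow> (su_gen \<times> bool \<Rightarrow> (nat \<Rightarrow> complex) \<Rightarrow> (nat \<Rightarrow> complex)) \<Rightarrow>
   su_gen \<times> bool \<Rightarrow> (nat \<Rightarrow> complex) \<Rightarrow> (nat \<Rightarrow> complex)" where
  "tensor_rep \<sigma> \<tau> l z = (\<lambda>n. \<Sum>k\<in>UNIV. let s = \<sigma> ((fst (fst l), k), snd l); t = \<tau> ((k, snd (fst l)), snd l)
     in (if snd l then amp_right t (amp_left s z) n else amp_left s (amp_right t z) n))"

lemma tensor_rep_simps:
  "tensor_rep \<sigma> \<tau> ((i, j), False) = (\<lambda>z n. \<Sum>k\<in>UNIV. amp_left (\<sigma> ((i, k), False)) (amp_right (\<tau> ((k, j), False)) z) n)"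
  "tensor_rep \<sigma> \<tau> ((i, j), True) = (\<lambda>z n. \<Sum>k\<in>UNIV. amp_right (\<tau> ((k, j), True)) (amp_left (\<sigma> ((i, k), True)) z) n)"
  by (simp_all add: tensor_rep_def[abs_def])

lemma star_rep_tensor_rep:
  assumes s: "star_rep \<sigma>" and t: "star_rep \<tau>" shows "star_rep (tensor_rep \<sigma> \<tau>)"
  unfolding star_rep_def
proof (intro conjI allI ballI)
  note sb = star_rep_letter[OF s] and tb = star_rep_letter[OF t]
  note sl = bounded_op_amp(1)[OF sb] and tr = bounded_op_amp(2)[OF tb]
  show "bounded_op (tensor_rep \<sigma> \<tau> l)" for l
  proof -
    obtain i j b where "l = ((i, j), b)" by (metis prod.exhaust)
    then show ?thesis
      by (cases b) (auto simp: tensor_rep_simps intro!: bounded_op_sum bounded_op_comp[OF sl tr] bounded_op_comp[OF tr sl])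
  qed
  fix g :: su_gen and x y :: "nat \<Rightarrow> complex" assume xy: "x \<in> ell2" "y \<in> ell2"
  obtain i j where g: "g = (i, j)" by (metis prod.exhaust)
  have sa: "ell2_inner (amp_left (\<sigma> (h, False)) z) w = ell2_inner z (amp_left (\<sigma> (h, True)) w)" if "z \<in> ell2" "w \<in> ell2" for h z w
    by (rule amp_adjoint(1)[OF sb sb _ that]) (use s in \<open>unfold star_rep_def, blast\<close>)
  have ta: "ell2_inner (amp_right (\<tau> (h, False)) z) w = ell2_inner z (amp_right (\<tau> (h, True)) w)" if "z \<in> ell2" "w \<in> ell2" for h z w
    by (rule amp_adjoint(2)[OF tb tb _ that]) (use t in \<open>unfold star_rep_def, blast\<close>)
  note cl = bounded_opD(1)[OF sl] bounded_opD(1)[OF tr]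
  show "ell2_inner (tensor_rep \<sigma> \<tau> (g, False) x) y = ell2_inner x (tensor_rep \<sigma> \<tau> (g, True) y)"
    unfolding g tensor_rep_simps
    by (subst ell2_inner_sum_left, simp_all add: cl xy)
      (subst ell2_inner_sum_right, simp_all add: cl xy sa ta)
qed

context
  fixes q :: real assumes q: "q \<noteq> 0"
begin

interpretation A: star_algebra "SU q" by (rule star_algebra_SU[OF q])
interpretation T: star_algebra "tensor (SU q) (SU q)" by (rule star_algebra_tensor[OF star_algebra_SU[OF q] star_algebra_SU[OF q]])

text \<open>The comultiplication before passing to the quotient on the left.\<close>

definition delta_free :: "su_gen free \<Rightarrow> (su_gen free set \<times> su_gen free set \<Rightarrow>\<^sub>0 complex) set" where
  "delta_free = free_lift (tensor (SU q) (SU q))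
     (\<lambda>g. \<Oplus>\<^bsub>tensor (SU q) (SU q)\<^esub>k\<in>UNIV. pure_tensor (SU q) (SU q) (su_u q (fst g) k) (su_u q k (snd g)))"

lemma su_u_closed [simp]: "su_u q i j \<in> carrier (SU q)"
  using su_matrixD(1)[OF su_matrix_SU[OF q]] .

lemma star_hom_delta_free: "star_hom free_alg (tensor (SU q) (SU q)) delta_free"
  and delta_free_gen: "delta_free (gen (i, j)) = (\<Oplus>\<^bsub>tensor (SU q) (SU q)\<^esub>k\<in>UNIV. pure_tensor (SU q) (SU q) (su_u q i k) (su_u q k j))"
  and delta_free_gen_star: "delta_free (gen_star (i, j)) = (\<Oplus>\<^bsub>tensor (SU q) (SU q)\<^esub>k\<in>UNIV. pure_tensor (SU q) (SU q) (star (SU q) (su_u q i k)) (star (SU q) (su_u q k j)))"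
proof -
  let ?g = "\<lambda>g. \<Oplus>\<^bsub>tensor (SU q) (SU q)\<^esub>k\<in>UNIV. pure_tensor (SU q) (SU q) (su_u q (fst g) k) (su_u q k (snd g))"
  have c: "?g g \<in> carrier (tensor (SU q) (SU q))" for g by (intro T.finsum_idx_closed) simp
  show "star_hom free_alg (tensor (SU q) (SU q)) delta_free"
    unfolding delta_free_def by (rule T.star_hom_free_lift[of ?g, OF c])
  show "delta_free (gen (i, j)) = (\<Oplus>\<^bsub>tensor (SU q) (SU q)\<^esub>k\<in>UNIV. pure_tensor (SU q) (SU q) (su_u q i k) (su_u q k j))"
    unfolding delta_free_def using T.free_lift_gen(1)[of ?g "(i, j)", OF c] by simp
  show "delta_free (gen_star (i, j)) = (\<Oplus>\<^bsub>tensor (SU q) (SU q)\<^esub>k\<in>UNIV. pure_tensor (SU q) (SU q) (star (SU q) (su_u q i k)) (star (SU q) (su_u q k j)))"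
    unfolding delta_free_def using T.free_lift_gen(2)[of ?g "(i, j)", OF c]
    by (simp add: T.star_finsum pure_tensor_star[OF star_algebra_SU[OF q] star_algebra_SU[OF q]])
qed

lemma delta_free_relations: "r \<in> SU_relations q \<Longrightarrow> delta_free r = \<zero>\<^bsub>tensor (SU q) (SU q)\<^esub>"
proof -
  note A = star_algebra_SU[OF q]
  have "su_matrix q (tensor (SU q) (SU q)) (\<lambda>i j. delta_free (gen (i, j)))"
    unfolding delta_free_gen by (rule su_matrix_tensor[OF A A su_matrix_SU[OF q] su_matrix_SU[OF q]])
  then show "r \<in> SU_relations q \<Longrightarrow> delta_free r = \<zero>\<^bsub>tensor (SU q) (SU q)\<^esub>"
    using SU_relations_vanish_iff[OF T.star_algebra_axioms star_hom_delta_free, of q] by blast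
qed

context
  fixes \<sigma> \<tau> :: "su_gen \<times> bool \<Rightarrow> (nat \<Rightarrow> complex) \<Rightarrow> (nat \<Rightarrow> complex)" and x y :: "nat \<Rightarrow> complex"
  assumes s: "star_rep \<sigma>" "\<forall>r\<in>SU_relations q. rep_kills \<sigma> r" and t: "star_rep \<tau>" "\<forall>r\<in>SU_relations q. rep_kills \<tau> r"
    and x: "x \<in> ell2" and y: "y \<in> ell2"
begin

text \<open>The vector \<open>X (x \<otimes> y)\<close>, where \<open>X\<close> acts through \<open>\<sigma> \<otimes> \<tau>\<close>.\<close>

definition tensor_vec :: "(su_gen free set \<times> su_gen free set \<Rightarrow>\<^sub>0 complex) set \<Rightarrow> nat \<Rightarrow> complex" where
  "tensor_vec X n = tensor_lift (SU q) (SU q) complex_alg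
     (\<lambda>a b. rep_fun \<sigma> x (fst (prod_decode n)) a * rep_fun \<tau> y (snd (prod_decode n)) b) X"

lemma linear_tensor_vec: "linear_on (tensor (SU q) (SU q)) complex_alg (\<lambda>X. tensor_vec X n)"
  and tensor_vec_pure: "tensor_vec (pure_tensor (SU q) (SU q) (su_cls q a) (su_cls q b)) = pure_vec (rep_eval \<sigma> a x) (rep_eval \<tau> b y)"
proof -
  note cs = A.complex_space_axioms
  note L = tensor_lift[OF cs cs complex_space_complex bilinear_on_functional2[OF cs cs linear_rep_fun_SU[OF q s x] linear_rep_fun_SU[OF q t y]]]
  show "linear_on (tensor (SU q) (SU q)) complex_alg (\<lambda>X. tensor_vec X n)"
    unfolding tensor_vec_def by (rule L(1))
  show "tensor_vec (pure_tensor (SU q) (SU q) (su_cls q a) (su_cls q b)) = pure_vec (rep_eval \<sigma> a x) (rep_eval \<tau> b y)"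
    by (rule ext) (simp add: tensor_vec_def L(2) carrier_SU[OF q] rep_fun_su_cls[OF q s x] rep_fun_su_cls[OF q t y] pure_vec_def case_prod_beta)
qed

lemma tensor_vec_simps:
  "X \<in> carrier (tensor (SU q) (SU q)) \<Longrightarrow> Y \<in> carrier (tensor (SU q) (SU q)) \<Longrightarrow>
     tensor_vec (X \<oplus>\<^bsub>tensor (SU q) (SU q)\<^esub> Y) = (\<lambda>n. tensor_vec X n + tensor_vec Y n)"
  "X \<in> carrier (tensor (SU q) (SU q)) \<Longrightarrow> tensor_vec (c \<odot>\<^bsub>tensor (SU q) (SU q)\<^esub> X) = (\<lambda>n. c * tensor_vec X n)"
  "tensor_vec \<zero>\<^bsub>tensor (SU q) (SU q)\<^esub> = (\<lambda>n. 0)"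
  using linear_on_add[OF linear_tensor_vec] linear_on_smult[OF linear_tensor_vec]
    linear_on_zero[OF linear_tensor_vec T.complex_space_axioms complex_space_complex] by (simp_all add: fun_eq_iff)

lemma tensor_vec_sum:
  "(\<And>k. f k \<in> carrier (tensor (SU q) (SU q))) \<Longrightarrow>
    tensor_vec (\<Oplus>\<^bsub>tensor (SU q) (SU q)\<^esub>k\<in>(UNIV::idx set). f k) = (\<lambda>n. \<Sum>k\<in>UNIV. tensor_vec (f k) n)"
  using linear_on_finsum[OF linear_tensor_vec T.complex_space_axioms complex_space_complex, of f UNIV]
  by (simp add: fun_eq_iff finsum_complex)

lemma tensor_vec_ell2:
  assumes "X \<in> carrier (tensor (SU q) (SU q))" shows "tensor_vec X \<in> ell2"
  using assms A.complex_space_axioms A.complex_space_axioms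
proof (induction X rule: tensor_induct)
  case (pure a b)
  then show ?case unfolding carrier_SU[OF q]
    by (auto simp: tensor_vec_pure rep_eval_op(1)[OF s(1)] rep_eval_op(1)[OF t(1)] x y pure_vec_ell2)
qed (simp add: tensor_vec_simps ell2_add)

lemma tensor_rep_letter:
  assumes X: "X \<in> carrier (tensor (SU q) (SU q))"
  shows "tensor_rep \<sigma> \<tau> ((i, j), False) (tensor_vec X) = tensor_vec (delta_free (gen (i, j)) \<otimes>\<^bsub>tensor (SU q) (SU q)\<^esub> X)"
    and "tensor_rep \<sigma> \<tau> ((i, j), True) (tensor_vec X) = tensor_vec (delta_free (gen_star (i, j)) \<otimes>\<^bsub>tensor (SU q) (SU q)\<^esub> X)"
proof -
  let ?T = "tensor (SU q) (SU q)"
  note A = star_algebra_SU[OF q]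
  note f = star_hom_su_cls[OF q]
  note sb = star_rep_letter[OF s(1)] and tb = star_rep_letter[OF t(1)]
  have dc: "delta_free p \<in> carrier ?T" for p using star_hom_closed[OF star_hom_delta_free] by simp
  note op = bounded_opD[OF star_rep_letter[OF star_rep_tensor_rep[OF s(1) t(1)]]]
  have m: "su_u q i k \<otimes>\<^bsub>SU q\<^esub> su_cls q a = su_cls q (gen (i, k) * a)"
    "star (SU q) (su_u q i k) \<otimes>\<^bsub>SU q\<^esub> su_cls q a = su_cls q (gen_star (i, k) * a)" for i k a
    using star_hom_mult[OF f, of "gen (i, k)" a] star_hom_mult[OF f, of "gen_star (i, k)" a] star_hom_star[OF f, of "gen (i, k)"]
    by (simp_all add: su_u_eq)
  have suc: "su_cls q a \<in> carrier (SU q)" for a by (simp add: carrier_SU[OF q])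
  have mm: "(\<Oplus>\<^bsub>?T\<^esub>k\<in>UNIV. pure_tensor (SU q) (SU q) (g k) (h k)) \<otimes>\<^bsub>?T\<^esub> pure_tensor (SU q) (SU q) (su_cls q a) (su_cls q b)
    = (\<Oplus>\<^bsub>?T\<^esub>k\<in>(UNIV::idx set). pure_tensor (SU q) (SU q) (g k \<otimes>\<^bsub>SU q\<^esub> su_cls q a) (h k \<otimes>\<^bsub>SU q\<^esub> su_cls q b))"
    if "\<And>k. g k \<in> carrier (SU q)" "\<And>k. h k \<in> carrier (SU q)" for g h a b
    using that by (subst T.finsum_ldistr) (auto simp: suc pure_tensor_mult[OF A A])
  note rm = rep_eval_mult[OF s(1) x] rep_eval_mult[OF t(1) y]
  note rc = rep_eval_op(1)[OF s(1) x] rep_eval_op(1)[OF t(1) y]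
  note ac = bounded_opD(1)[OF bounded_op_amp(1)[OF sb]] bounded_opD(1)[OF bounded_op_amp(2)[OF tb]]
  show "tensor_rep \<sigma> \<tau> ((i, j), False) (tensor_vec X) = tensor_vec (delta_free (gen (i, j)) \<otimes>\<^bsub>?T\<^esub> X)"
    using X A.complex_space_axioms A.complex_space_axioms
  proof (induction X rule: tensor_induct)
    case (pure a' b')
    then obtain a b where ab: "a' = su_cls q a" "b' = su_cls q b" unfolding carrier_SU[OF q] by auto
    show ?case unfolding ab delta_free_gen
      by (simp add: mm m tensor_vec_sum suc tensor_vec_pure rm rep_eval_simps tensor_rep_simps
        amp_pure[OF sb] amp_pure[OF tb] rc bounded_opD(1)[OF tb])
  next
    case (add X Y)
    then show ?case by (simp add: tensor_vec_simps tensor_vec_ell2 op T.r_distr dc)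
  qed
  show "tensor_rep \<sigma> \<tau> ((i, j), True) (tensor_vec X) = tensor_vec (delta_free (gen_star (i, j)) \<otimes>\<^bsub>?T\<^esub> X)"
    using X A.complex_space_axioms A.complex_space_axioms
  proof (induction X rule: tensor_induct)
    case (pure a' b')
    then obtain a b where ab: "a' = su_cls q a" "b' = su_cls q b" unfolding carrier_SU[OF q] by auto
    show ?case unfolding ab delta_free_gen_star
      by (simp add: mm m tensor_vec_sum suc tensor_vec_pure rm rep_eval_simps tensor_rep_simps
        amp_pure[OF sb] amp_pure[OF tb] rc bounded_opD(1)[OF sb])
  next
    case (add X Y)
    then show ?case by (simp add: tensor_vec_simps tensor_vec_ell2 op T.r_distr dc)
  qed
qed

text \<open>The representation \<open>tensor_rep \<sigma> \<tau>\<close> is \<open>\<sigma> \<otimes> \<tau>\<close> composed with the comultiplication. It is convenient to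
  compare the two on vectors of the form \<open>X (x \<otimes> y)\<close>, because this set of vectors is mapped to itself by the
  letters.\<close>

lemma rep_eval_tensor_rep:
  "X \<in> carrier (tensor (SU q) (SU q)) \<Longrightarrow>
    rep_eval (tensor_rep \<sigma> \<tau>) p (tensor_vec X) = tensor_vec (delta_free p \<otimes>\<^bsub>tensor (SU q) (SU q)\<^esub> X)"
proof (induction p arbitrary: X rule: free_induct)
  have dc [simp]: "delta_free p \<in> carrier (tensor (SU q) (SU q))" for p using star_hom_closed[OF star_hom_delta_free] by simp
  {
    case (const c)
    then show ?case
      by (simp add: rep_eval_simps star_hom_const[OF star_hom_delta_free] T.smult_mult_left tensor_vec_simps)
  next
    case (gen g)
    then show ?case using tensor_rep_letter(1)[of X "fst g" "snd g"] by (simp add: rep_eval_simps)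
  next
    case (gen_star g)
    then show ?case using tensor_rep_letter(2)[of X "fst g" "snd g"] by (simp add: rep_eval_simps)
  next
    case (add p r)
    have "delta_free (p + r) = delta_free p \<oplus>\<^bsub>tensor (SU q) (SU q)\<^esub> delta_free r"
      using star_hom_add[OF star_hom_delta_free, of p r] by simp
    then show ?case using add by (simp add: rep_eval_simps T.l_distr tensor_vec_simps)
  next
    case (mult p r)
    have "delta_free (p * r) = delta_free p \<otimes>\<^bsub>tensor (SU q) (SU q)\<^esub> delta_free r"
      using star_hom_mult[OF star_hom_delta_free, of p r] by simp
    then show ?case using mult
      by (simp add: rep_eval_mult[OF star_rep_tensor_rep[OF s(1) t(1)]] tensor_vec_ell2 T.m_assoc)
  }
qed

lemma rep_eval_tensor_rep_pure: "rep_eval (tensor_rep \<sigma> \<tau>) p (pure_vec x y) = tensor_vec (delta_free p)"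
proof -
  note A = star_algebra_SU[OF q]
  have 1: "\<one>\<^bsub>SU q\<^esub> = su_cls q 1" using star_hom_one[OF star_hom_su_cls[OF q]] by simp
  have "tensor_vec \<one>\<^bsub>tensor (SU q) (SU q)\<^esub> = pure_vec x y"
    unfolding tensor_one[OF A A] 1 by (simp add: tensor_vec_pure rep_eval_simps)
  then show ?thesis using rep_eval_tensor_rep[of "\<one>\<^bsub>tensor (SU q) (SU q)\<^esub>" p] star_hom_closed[OF star_hom_delta_free, of p] by simp
qed

end

text \<open>If \<open>p\<close> is annihilated by all representations, then in particular by \<open>tensor_rep \<sigma> \<tau>\<close>, whose matrix
  coefficients are the product functionals applied to the image of \<open>p\<close>; these separate the points of the
  tensor product.\<close>

lemma delta_free_kernel:
  assumes p: "p \<in> cstar_kernel (SU_relations q)"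
  shows "delta_free p = \<zero>\<^bsub>tensor (SU q) (SU q)\<^esub>"
proof (rule tensor_separating[OF A.complex_space_axioms A.complex_space_axioms separating_su_functionals[OF q] separating_su_functionals[OF q]])
  show "delta_free p \<in> carrier (tensor (SU q) (SU q))" using star_hom_closed[OF star_hom_delta_free] by simp
  fix \<omega> \<omega>' assume "\<omega> \<in> su_functionals q" "\<omega>' \<in> su_functionals q"
  then obtain \<sigma> x m \<tau> y n where s: "star_rep \<sigma>" "\<forall>r\<in>SU_relations q. rep_kills \<sigma> r" and t: "star_rep \<tau>" "\<forall>r\<in>SU_relations q. rep_kills \<tau> r"
    and x: "x \<in> ell2" and y: "y \<in> ell2" and w: "\<omega> = rep_fun \<sigma> x m" "\<omega>' = rep_fun \<tau> y n"
    unfolding su_functionals_def[OF q] by blast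
  have "\<forall>r\<in>SU_relations q. rep_kills (tensor_rep \<sigma> \<tau>) r"
  proof
    fix r assume r: "r \<in> SU_relations q"
    show "rep_kills (tensor_rep \<sigma> \<tau>) r"
    proof (rule rep_kills_pure[OF star_rep_tensor_rep[OF s(1) t(1)]])
      fix x y :: "nat \<Rightarrow> complex" assume xy: "x \<in> ell2" "y \<in> ell2"
      show "rep_eval (tensor_rep \<sigma> \<tau>) r (pure_vec x y) = (\<lambda>n. 0)"
        unfolding rep_eval_tensor_rep_pure[OF s t xy] delta_free_relations[OF r] tensor_vec_simps(3)[OF s t xy] ..
    qed
  qed
  then have "rep_kills (tensor_rep \<sigma> \<tau>) p"
    using p star_rep_tensor_rep[OF s(1) t(1)] unfolding cstar_kernel_eq by blast
  then have "rep_eval (tensor_rep \<sigma> \<tau>) p (pure_vec x y) (prod_encode (m, n)) = 0"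
    using pure_vec_ell2[OF x y] unfolding rep_kills_def by simp
  then show "tensor_lift (SU q) (SU q) complex_alg (\<lambda>a b. \<omega> a * \<omega>' b) (delta_free p) = 0"
    unfolding rep_eval_tensor_rep_pure[OF s t x y] tensor_vec_def[OF s t x y] w by simp
qed

lemma Delta_SU: "star_hom (SU q) (tensor (SU q) (SU q)) (Delta_SU q)"
  and Delta_SU_u: "Delta_SU q (su_u q i j) = (\<Oplus>\<^bsub>tensor (SU q) (SU q)\<^esub>k\<in>UNIV. pure_tensor (SU q) (SU q) (su_u q i k) (su_u q k j))"
proof -
  have "\<exists>f. star_hom (SU q) (tensor (SU q) (SU q)) f \<and> (\<forall>p. f (su_cls q p) = delta_free p)"
    by (rule star_hom_quot_lift[OF star_ideal_cstar_kernel[of "SU_relations q"] star_hom_delta_free T.star_algebra_axioms,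
      folded SU_eq[OF q] su_cls_def]) (rule delta_free_kernel)
  then obtain f where f: "star_hom (SU q) (tensor (SU q) (SU q)) f" and fd: "\<And>p. f (su_cls q p) = delta_free p" by blast
  have fu: "f (su_u q i j) = (\<Oplus>\<^bsub>tensor (SU q) (SU q)\<^esub>k\<in>UNIV. pure_tensor (SU q) (SU q) (su_u q i k) (su_u q k j))" for i j
    by (simp only: su_u_eq fd delta_free_gen)
  note the = SU_star_hom_the[OF q f fu, folded Delta_SU_def]
  show "star_hom (SU q) (tensor (SU q) (SU q)) (Delta_SU q)"
    "Delta_SU q (su_u q i j) = (\<Oplus>\<^bsub>tensor (SU q) (SU q)\<^esub>k\<in>UNIV. pure_tensor (SU q) (SU q) (su_u q i k) (su_u q k j))"
    using the by blast+
qed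

end

section \<open>Faithful representations of the quantum unitary group\<close>

subsection \<open>Ordered monomials span\<close>

text \<open>Integer powers of a unitary, written with the generator or its adjoint. For \<open>\<alpha>\<close>, which is not
  unitary, this is a notation for the last factor of an ordered monomial.\<close>

definition zpow :: "'g \<Rightarrow> int \<Rightarrow> 'g free" where
  "zpow g k = (if k \<ge> 0 then gen g ^ nat k else gen_star g ^ nat (- k))"

fun u2_mono :: "int \<times> nat \<times> nat \<times> int \<Rightarrow> uq2_gen free" where
  "u2_mono (k, a, b, m) = zpow Uu k * (gen Gamma ^ a * (gen_star Gamma ^ b * zpow Alpha m))"

context
  fixes q :: real assumes q: "q \<noteq> 0"
begin

text \<open>Equality in the quotient, written for representatives so that monomials can be rearranged by calculation.\<close>

definition u2_cong :: "uq2_gen free \<Rightarrow> uq2_gen free \<Rightarrow> bool" (infix "\<approx>" 50) where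
  "p \<approx> r \<longleftrightarrow> p - r \<in> relation_ideal (U2_relations q)"

lemma u2_cong_refl [simp]: "p \<approx> p"
  using star_idealD(1)[OF star_ideal_relation_ideal] by (simp add: u2_cong_def)

lemma u2_cong_sym: "p \<approx> r \<Longrightarrow> r \<approx> p"
  using star_idealD(6)[OF star_ideal_relation_ideal, of "p - r"] by (simp add: u2_cong_def)

lemma u2_cong_trans [trans]: "p \<approx> r \<Longrightarrow> r \<approx> s \<Longrightarrow> p \<approx> s"
  using star_idealD(2)[OF star_ideal_relation_ideal, of "p - r" _ "r - s"] by (simp add: u2_cong_def)

lemma u2_cong_eq_trans [trans]: "p = r \<Longrightarrow> r \<approx> s \<Longrightarrow> p \<approx> s" "p \<approx> r \<Longrightarrow> r = s \<Longrightarrow> p \<approx> s"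
  by simp_all

lemma u2_cong_add: "p \<approx> p' \<Longrightarrow> r \<approx> r' \<Longrightarrow> p + r \<approx> p' + r'"
  using star_idealD(2)[OF star_ideal_relation_ideal, of "p - p'" _ "r - r'"] by (simp add: u2_cong_def algebra_simps)

lemma u2_cong_mult: assumes "p \<approx> p'" "r \<approx> r'" shows "p * r \<approx> p' * r'"
proof -
  have "p * r - p' * r' = (p - p') * r + p' * (r - r')" by (simp add: algebra_simps)
  then show ?thesis using assms star_idealD(2,3,4)[OF star_ideal_relation_ideal] unfolding u2_cong_def by metis
qed

lemma u2_cong_left: "p \<approx> p' \<Longrightarrow> p * r \<approx> p' * r"
  and u2_cong_right: "r \<approx> r' \<Longrightarrow> p * r \<approx> p * r'"
  by (simp_all add: u2_cong_mult)

lemma u2_cong_cscale: "p \<approx> p' \<Longrightarrow> cscale c p \<approx> cscale c p'"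
  using star_idealD(8)[OF star_ideal_relation_ideal, of "p - p'"] by (simp add: u2_cong_def cscale_diff)

lemma u2_cong_star: "p \<approx> p' \<Longrightarrow> star free_alg p \<approx> star free_alg p'"
  using star_idealD(5)[OF star_ideal_relation_ideal, of "p - p'"] by (simp add: u2_cong_def star_free_simps)

abbreviation "U \<equiv> gen Uu" abbreviation "Us \<equiv> gen_star Uu" abbreviation "Al \<equiv> gen Alpha" abbreviation "As \<equiv> gen_star Alpha"
abbreviation "Ga \<equiv> gen Gamma" abbreviation "Gs \<equiv> gen_star Gamma"

lemma u2_cong_rels:
  "U * Us \<approx> 1" "Us * U \<approx> 1" "U * Al \<approx> Al * U" "U * As \<approx> As * U" "U * Ga \<approx> Ga * U" "U * Gs \<approx> Gs * U"
  "Al * Ga \<approx> cscale q (Ga * Al)" "Ga * Gs \<approx> Gs * Ga" "Al * Gs \<approx> cscale q (Gs * Al)"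
  "As * Al + Ga * Gs \<approx> 1" "Al * As + cscale (q * q) (Ga * Gs) \<approx> 1"
proof -
  have r: "r \<in> U2_relations q \<Longrightarrow> r \<in> relation_ideal (U2_relations q)" for r by (rule relation_ideal_self)
  show "U * Us \<approx> 1" "Us * U \<approx> 1" "U * Al \<approx> Al * U" "U * As \<approx> As * U" "U * Ga \<approx> Ga * U" "U * Gs \<approx> Gs * U"
  "Al * Ga \<approx> cscale q (Ga * Al)" "Ga * Gs \<approx> Gs * Ga" "Al * Gs \<approx> cscale q (Gs * Al)"
  "As * Al + Ga * Gs \<approx> 1" "Al * As + cscale (q * q) (Ga * Gs) \<approx> 1"
    unfolding u2_cong_def by (rule r; simp add: U2_relations_def Let_def const_mult star_free_simps cscale_cscale)+
qed

lemma u2_cong_star_rels: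
  "Al * Us \<approx> Us * Al" "As * Us \<approx> Us * As" "Ga * Us \<approx> Us * Ga" "Gs * Us \<approx> Us * Gs"
  "Ga * As \<approx> cscale q (As * Ga)" "Gs * As \<approx> cscale q (As * Gs)"
  using u2_cong_star[OF u2_cong_rels(3)] u2_cong_star[OF u2_cong_rels(4)] u2_cong_star[OF u2_cong_rels(5)]
    u2_cong_star[OF u2_cong_rels(6)] u2_cong_star[OF u2_cong_rels(7)] u2_cong_star[OF u2_cong_rels(9)]
  by (simp_all add: star_free_simps u2_cong_sym)

text \<open>Ordering a word requires moving a letter across powers of the other letters, one factor at a time.\<close>

lemma u2_cong_power:
  assumes xy: "x * y \<approx> cscale d (y * x)"
  shows "x * (y ^ n * r) \<approx> cscale (d ^ n) (y ^ n * (x * r))"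
proof (induction n)
  case (Suc n)
  have "x * (y ^ Suc n * r) = (x * y) * (y ^ n * r)" by (simp add: mult.assoc)
  also have "\<dots> \<approx> cscale d (y * x) * (y ^ n * r)" by (rule u2_cong_left[OF xy])
  also have "\<dots> = cscale d (y * (x * (y ^ n * r)))" by (simp add: star_free_simps mult.assoc)
  also have "\<dots> \<approx> cscale d (y * cscale (d ^ n) (y ^ n * (x * r)))" by (intro u2_cong_cscale u2_cong_right Suc)
  also have "\<dots> = cscale (d ^ Suc n) (y ^ Suc n * (x * r))" by (simp add: star_free_simps cscale_cscale mult.assoc)
  finally show ?case .
qed simp

lemma u2_cong_power_1: "x * y \<approx> y * x \<Longrightarrow> x * (y ^ n * r) \<approx> y ^ n * (x * r)"
  using u2_cong_power[of x y 1 n r] by simp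

lemma u2_cong_inverse: "x * y \<approx> cscale d (y * x) \<Longrightarrow> d \<noteq> 0 \<Longrightarrow> y * x \<approx> cscale (1 / d) (x * y)"
  using u2_cong_cscale[of "x * y" "cscale d (y * x)" "1 / d"] u2_cong_sym by (simp add: cscale_cscale)

lemma zpow_commute:
  assumes "x * U \<approx> U * x" "x * Us \<approx> Us * x"
  shows "x * (zpow Uu k * r) \<approx> zpow Uu k * (x * r)"
  unfolding zpow_def using u2_cong_power_1[OF assms(1)] u2_cong_power_1[OF assms(2)] by auto

definition u2_span :: "uq2_gen free \<Rightarrow> bool" where
  "u2_span p \<longleftrightarrow> (\<exists>r. p \<approx> pm_extend u2_mono r)"

lemma u2_span_cong: "p \<approx> p' \<Longrightarrow> u2_span p' \<Longrightarrow> u2_span p"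
  unfolding u2_span_def using u2_cong_trans by blast

lemma u2_span_add: "u2_span p \<Longrightarrow> u2_span p' \<Longrightarrow> u2_span (p + p')"
  unfolding u2_span_def using u2_cong_add pm_extend_add by metis

lemma u2_span_cscale: "u2_span p \<Longrightarrow> u2_span (cscale c p)"
  unfolding u2_span_def using u2_cong_cscale pm_extend_cscale by metis

lemma u2_span_mono: "u2_span (u2_mono s)"
proof -
  have "pm_extend u2_mono (Poly_Mapping.single s 1) = u2_mono s" by simp
  then show ?thesis unfolding u2_span_def by (metis u2_cong_refl)
qed

lemma zpow_step:
  assumes "gen g * gen_star g \<approx> 1" shows "gen g * zpow g k \<approx> zpow g (k + 1)"
proof (cases "k \<ge> 0")
  case True
  then have "nat (k + 1) = Suc (nat k)" by simp
  then show ?thesis using True by (simp add: zpow_def)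
next
  case False
  define n where "n = nat (- k) - 1"
  have n: "nat (- k) = Suc n" "nat (- (k + 1)) = n" using False by (simp_all add: n_def)
  have "gen g * zpow g k = (gen g * gen_star g) * gen_star g ^ n" using False by (simp add: zpow_def n mult.assoc)
  also have "\<dots> \<approx> 1 * gen_star g ^ n" by (rule u2_cong_left[OF assms])
  also have "\<dots> = zpow g (k + 1)"
    using False n by (cases "k = -1") (simp_all add: zpow_def)
  finally show ?thesis .
qed

lemma zpow_step_star:
  assumes "gen_star g * gen g \<approx> 1" shows "gen_star g * zpow g k \<approx> zpow g (k - 1)"
proof (cases "k \<le> 0")
  case True
  then have "nat (- (k - 1)) = Suc (nat (- k))" by simp
  then show ?thesis using True by (cases "k = 0") (simp_all add: zpow_def)
next
  case False
  define n where "n = nat k - 1"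
  have n: "nat k = Suc n" "nat (k - 1) = n" using False by (simp_all add: n_def)
  have "gen_star g * zpow g k = (gen_star g * gen g) * gen g ^ n" using False by (simp add: zpow_def n mult.assoc)
  also have "\<dots> \<approx> 1 * gen g ^ n" by (rule u2_cong_left[OF assms])
  also have "\<dots> = zpow g (k - 1)" using False n by (simp add: zpow_def)
  finally show ?thesis .
qed

lemma u2_span_gammas: "u2_span (zpow Uu k * (Ga ^ a * (Gs ^ b * (Ga * (Gs * zpow Alpha m)))))"
proof -
  have "Gs ^ b * (Ga * (Gs * zpow Alpha m)) \<approx> Ga * (Gs ^ b * (Gs * zpow Alpha m))"
    by (rule u2_cong_sym[OF u2_cong_power_1[OF u2_cong_rels(8)]])
  then have "zpow Uu k * (Ga ^ a * (Gs ^ b * (Ga * (Gs * zpow Alpha m)))) \<approx> zpow Uu k * (Ga ^ a * (Ga * (Gs ^ b * (Gs * zpow Alpha m))))"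
    by (intro u2_cong_right)
  also have "\<dots> = u2_mono (k, Suc a, Suc b, m)"
    by (simp add: mult.assoc[symmetric] power_Suc2 del: power_Suc)
  finally show ?thesis using u2_span_mono u2_span_cong by blast
qed

text \<open>A letter \<open>\<alpha>\<close> that meets a power of its adjoint is cancelled by a sphere relation at the price of
  a factor \<open>\<gamma> \<gamma>\<^sup>*\<close>, which is absorbed by the powers of \<open>\<gamma>\<close> and \<open>\<gamma>\<^sup>*\<close>.\<close>

lemma alpha_span:
  "u2_span (zpow Uu k * (Ga ^ a * (Gs ^ b * (Al * zpow Alpha m))))"
  "u2_span (zpow Uu k * (Ga ^ a * (Gs ^ b * (As * zpow Alpha m))))"
proof -
  let ?W = "\<lambda>x. zpow Uu k * (Ga ^ a * (Gs ^ b * x))"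
  have W: "x \<approx> y \<Longrightarrow> ?W x \<approx> ?W y" for x y by (intro u2_cong_right)
  have Wa: "?W (x + cscale c y) = ?W x + cscale c (?W y)" for x y c by (simp add: distrib_left star_free_simps)
  have m: "u2_span (?W (zpow Alpha m))" for m using u2_span_mono[of "(k, a, b, m)"] by simp
  show "u2_span (?W (Al * zpow Alpha m))"
  proof (cases "m \<ge> 0")
    case True
    then have "nat (m + 1) = Suc (nat m)" by simp
    then have "Al * zpow Alpha m = zpow Alpha (m + 1)" using True by (simp add: zpow_def)
    then show ?thesis using m by simp
  next
    case False
    define n where "n = nat (- m) - 1"
    have n: "nat (- m) = Suc n" "nat (- (m + 1)) = n" using False by (simp_all add: n_def)
    have z: "As ^ n = zpow Alpha (m + 1)" using False n by (cases "m = -1") (simp_all add: zpow_def)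
    have "Al * As = (Al * As + cscale (q * q) (Ga * Gs)) + cscale (- (q * q)) (Ga * Gs)"
      by (simp add: add.assoc cscale_add_scalar[symmetric])
    also have "\<dots> \<approx> 1 + cscale (- (q * q)) (Ga * Gs)" by (intro u2_cong_add u2_cong_rels u2_cong_refl)
    finally have "(Al * As) * As ^ n \<approx> (1 + cscale (- (q * q)) (Ga * Gs)) * As ^ n" by (rule u2_cong_left)
    then have "Al * zpow Alpha m \<approx> zpow Alpha (m + 1) + cscale (- (q * q)) (Ga * (Gs * zpow Alpha (m + 1)))"
      using False by (simp add: zpow_def[of _ m] n z[symmetric] mult.assoc distrib_right star_free_simps)
    from W[OF this] show ?thesis unfolding Wa
      by (rule u2_span_cong) (intro u2_span_add u2_span_cscale m u2_span_gammas)
  qed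
  show "u2_span (?W (As * zpow Alpha m))"
  proof (cases "m \<le> 0")
    case True
    then have "nat (- (m - 1)) = Suc (nat (- m))" by simp
    then have "As * zpow Alpha m = zpow Alpha (m - 1)" using True by (cases "m = 0") (simp_all add: zpow_def)
    then show ?thesis using m by simp
  next
    case False
    define n where "n = nat m - 1"
    have n: "nat m = Suc n" "nat (m - 1) = n" using False by (simp_all add: n_def)
    have z: "Al ^ n = zpow Alpha (m - 1)" using False n by (simp add: zpow_def)
    have "As * Al = (As * Al + Ga * Gs) + cscale (- 1) (Ga * Gs)"
      by (simp add: cscale_minus_one)
    also have "\<dots> \<approx> 1 + cscale (- 1) (Ga * Gs)" by (intro u2_cong_add u2_cong_rels u2_cong_refl)
    finally have "(As * Al) * Al ^ n \<approx> (1 + cscale (- 1) (Ga * Gs)) * Al ^ n" by (rule u2_cong_left)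
    then have "As * zpow Alpha m \<approx> zpow Alpha (m - 1) + cscale (- 1) (Ga * (Gs * zpow Alpha (m - 1)))"
      using False by (simp add: zpow_def[of _ m] n z[symmetric] mult.assoc distrib_right star_free_simps)
    from W[OF this] show ?thesis unfolding Wa
      by (rule u2_span_cong) (intro u2_span_add u2_span_cscale m u2_span_gammas)
  qed
qed

text \<open>Each letter is moved to the right until it reaches its own power.\<close>

lemma letter_mono_span: "u2_span (gen g * u2_mono s)" "u2_span (gen_star g * u2_mono s)"
proof -
  obtain k a b m where s: "s = (k, a, b, m)" by (metis prod.exhaust)
  let ?q = "complex_of_real q"
  have qq: "complex_of_real q \<noteq> 0" using q by simp
  note sym = u2_cong_sym
  let ?R = "Ga ^ a * (Gs ^ b * zpow Alpha m)"
  have al: "Al * (zpow Uu k * ?R) \<approx> cscale (?q ^ a * ?q ^ b) (zpow Uu k * (Ga ^ a * (Gs ^ b * (Al * zpow Alpha m))))"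
  proof -
    have "Al * (zpow Uu k * ?R) \<approx> zpow Uu k * (Al * ?R)"
      by (rule zpow_commute[OF sym[OF u2_cong_rels(3)] u2_cong_star_rels(1)])
    also have "\<dots> \<approx> zpow Uu k * cscale (?q ^ a) (Ga ^ a * (Al * (Gs ^ b * zpow Alpha m)))"
      by (intro u2_cong_right u2_cong_power u2_cong_rels)
    also have "\<dots> \<approx> zpow Uu k * cscale (?q ^ a) (Ga ^ a * cscale (?q ^ b) (Gs ^ b * (Al * zpow Alpha m)))"
      by (intro u2_cong_right u2_cong_cscale u2_cong_power u2_cong_rels)
    finally show ?thesis by (simp add: star_free_simps cscale_cscale)
  qed
  have as: "As * (zpow Uu k * ?R) \<approx> cscale ((1 / ?q) ^ a * (1 / ?q) ^ b) (zpow Uu k * (Ga ^ a * (Gs ^ b * (As * zpow Alpha m))))"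
  proof -
    have "As * (zpow Uu k * ?R) \<approx> zpow Uu k * (As * ?R)"
      by (rule zpow_commute[OF sym[OF u2_cong_rels(4)] u2_cong_star_rels(2)])
    also have "\<dots> \<approx> zpow Uu k * cscale ((1 / ?q) ^ a) (Ga ^ a * (As * (Gs ^ b * zpow Alpha m)))"
      by (intro u2_cong_right u2_cong_power u2_cong_inverse[OF u2_cong_star_rels(5) qq])
    also have "\<dots> \<approx> zpow Uu k * cscale ((1 / ?q) ^ a) (Ga ^ a * cscale ((1 / ?q) ^ b) (Gs ^ b * (As * zpow Alpha m)))"
      by (intro u2_cong_right u2_cong_cscale u2_cong_power u2_cong_inverse[OF u2_cong_star_rels(6) qq])
    finally show ?thesis by (simp add: star_free_simps cscale_cscale)
  qed
  have ga: "Ga * (zpow Uu k * ?R) \<approx> u2_mono (k, Suc a, b, m)"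
  proof -
    have "Ga * (zpow Uu k * ?R) \<approx> zpow Uu k * (Ga * ?R)"
      by (rule zpow_commute[OF sym[OF u2_cong_rels(5)] u2_cong_star_rels(3)])
    then show ?thesis by (simp add: mult.assoc)
  qed
  have gs: "Gs * (zpow Uu k * ?R) \<approx> u2_mono (k, a, Suc b, m)"
  proof -
    have "Gs * (zpow Uu k * ?R) \<approx> zpow Uu k * (Gs * ?R)"
      by (rule zpow_commute[OF sym[OF u2_cong_rels(6)] u2_cong_star_rels(4)])
    also have "\<dots> \<approx> zpow Uu k * (Ga ^ a * (Gs * (Gs ^ b * zpow Alpha m)))"
      by (intro u2_cong_right u2_cong_power_1 sym[OF u2_cong_rels(8)])
    finally show ?thesis by (simp add: mult.assoc)
  qed
  have u: "U * (zpow Uu k * ?R) \<approx> u2_mono (k + 1, a, b, m)" "Us * (zpow Uu k * ?R) \<approx> u2_mono (k - 1, a, b, m)"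
    using u2_cong_left[OF zpow_step[OF u2_cong_rels(1), of k], of ?R] u2_cong_left[OF zpow_step_star[OF u2_cong_rels(2), of k], of ?R]
    by (simp_all add: mult.assoc)
  note sp = u2_span_cong[OF al u2_span_cscale[OF alpha_span(1)]] u2_span_cong[OF as u2_span_cscale[OF alpha_span(2)]]
    u2_span_cong[OF ga u2_span_mono] u2_span_cong[OF gs u2_span_mono] u2_span_cong[OF u(1) u2_span_mono] u2_span_cong[OF u(2) u2_span_mono]
  show "u2_span (gen g * u2_mono s)" "u2_span (gen_star g * u2_mono s)"
    unfolding s u2_mono.simps by (cases g; simp only: sp)+
qed

lemma letter_span: assumes "u2_span p" shows "u2_span (gen g * p)" "u2_span (gen_star g * p)"
proof -
  obtain r where r: "p \<approx> pm_extend u2_mono r" using assms unfolding u2_span_def by blast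
  have z: "u2_span 0" unfolding u2_span_def by (rule exI[of _ 0]) simp
  have "u2_span (gen g * pm_extend u2_mono r) \<and> u2_span (gen_star g * pm_extend u2_mono r)"
  proof (induction r rule: poly_mapping_induct)
    case zero
    then show ?case using z by simp
  next
    case (single s c)
    then show ?case using letter_mono_span by (simp add: star_free_simps u2_span_cscale)
  next
    case (add r r')
    then show ?case by (simp add: pm_extend_add distrib_left u2_span_add)
  qed
  then show "u2_span (gen g * p)" "u2_span (gen_star g * p)"
    using u2_span_cong[OF u2_cong_right[OF r]] by blast+
qed

lemma u2_span_all: "u2_span p"
proof -
  have "u2_span r \<Longrightarrow> u2_span (p * r)" for r
  proof (induction p arbitrary: r rule: free_induct)
    case (const c)
    then show ?case by (simp add: const_mult u2_span_cscale)
  next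
    case (add p p')
    then show ?case by (simp add: distrib_right u2_span_add)
  next
    case (mult p p')
    then show ?case by (simp add: mult.assoc)
  qed (simp_all add: letter_span)
  moreover have "u2_span 1" using u2_span_mono[of "(0, 0, 0, 0)"] by (simp add: zpow_def)
  ultimately show ?thesis by (metis mult_1_right)
qed

end

subsection \<open>Weighted shift representations\<close>

definition shift_weight :: "real \<Rightarrow> nat \<Rightarrow> complex" where
  "shift_weight q n = of_real (sqrt (1 - q ^ (2 * n)))"

text \<open>The weighted shift representation of \<open>SU_q(2)\<close>, twisted by \<open>w\<close> and extended to \<open>U_q(2)\<close> by letting \<open>u\<close> act as the
  scalar \<open>z\<close>. In the last equation \<open>n - 1\<close> is harmless at \<open>n = 0\<close>, where the weight vanishes.\<close>

fun u2_rep :: "real \<Rightarrow> complex \<Rightarrow> complex \<Rightarrow> uq2_gen \<times> bool \<Rightarrow> (nat \<Rightarrow> complex) \<Rightarrow> (nat \<Rightarrow> complex)" where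
  "u2_rep q z w (Uu, b) x = (\<lambda>n. (if b then cnj z else z) * x n)"
| "u2_rep q z w (Gamma, b) x = (\<lambda>n. (if b then cnj w else w) * of_real q ^ n * x n)"
| "u2_rep q z w (Alpha, False) x = (\<lambda>n. shift_weight q (Suc n) * x (Suc n))"
| "u2_rep q z w (Alpha, True) x = (\<lambda>n. shift_weight q n * x (n - 1))"

lemma shift_weight_0 [simp]: "shift_weight q 0 = 0"
  by (simp add: shift_weight_def)

lemma ell2_diagonal:
  assumes d: "\<And>n. cmod (d n) \<le> 1"
  shows "bounded_op (\<lambda>x n. d n * x n)"
proof -
  have le: "(cmod (d n * x n))\<^sup>2 \<le> (cmod (x n))\<^sup>2" for n and x :: "nat \<Rightarrow> complex"
  proof -
    have "cmod (d n) * cmod (x n) \<le> 1 * cmod (x n)" by (rule mult_right_mono[OF d]) simp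
    then show ?thesis by (simp add: norm_mult power_mono)
  qed
  have cl: "(\<lambda>n. d n * x n) \<in> ell2" if "x \<in> ell2" for x
    unfolding ell2_def mem_Collect_eq
    by (rule summable_comparison_test'[of "\<lambda>n. (cmod (x n))\<^sup>2" 0]) (use that le in \<open>auto simp: ell2_def\<close>)
  have "ell2_sq (\<lambda>n. d n * x n) \<le> 1 * ell2_sq x" if "x \<in> ell2" for x
    unfolding ell2_sq_def mult_1 by (rule suminf_le[OF le]) (use cl[OF that] that in \<open>simp_all add: ell2_def\<close>)
  then have "\<exists>C\<ge>0. \<forall>x\<in>ell2. ell2_sq (\<lambda>n. d n * x n) \<le> C * ell2_sq x" by (intro exI[of _ 1]) auto
  then show ?thesis unfolding bounded_op_iff using cl by (auto simp: algebra_simps)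
qed

lemma bounded_op_backward: "bounded_op (\<lambda>x n. x (Suc n))"
proof -
  have cl: "(\<lambda>n. x (Suc n)) \<in> ell2" if "x \<in> ell2" for x
    using that unfolding ell2_def mem_Collect_eq by (subst summable_Suc_iff)
  have "ell2_sq (\<lambda>n. x (Suc n)) \<le> 1 * ell2_sq x" if "x \<in> ell2" for x
    using suminf_split_head[of "\<lambda>n. (cmod (x n))\<^sup>2"] that unfolding ell2_sq_def ell2_def by simp
  then have "\<exists>C\<ge>0. \<forall>x\<in>ell2. ell2_sq (\<lambda>n. x (Suc n)) \<le> C * ell2_sq x" by (intro exI[of _ 1]) auto
  then show ?thesis unfolding bounded_op_iff using cl by auto
qed

lemma bounded_op_forward: "bounded_op (\<lambda>x n. if n = 0 then 0 else x (n - 1))"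
proof -
  have cl: "(\<lambda>n. if n = 0 then 0 else x (n - 1)) \<in> ell2" if "x \<in> ell2" for x
    using that unfolding ell2_def mem_Collect_eq by (subst summable_Suc_iff[symmetric]) simp
  have "ell2_sq (\<lambda>n. if n = 0 then 0 else x (n - 1)) \<le> 1 * ell2_sq x" if "x \<in> ell2" for x
    using suminf_split_head[of "\<lambda>n. (cmod (if n = 0 then 0 else x (n - 1)))\<^sup>2"] cl[OF that] unfolding ell2_sq_def ell2_def
    by (simp add: algebra_simps)
  then have "\<exists>C\<ge>0. \<forall>x\<in>ell2. ell2_sq (\<lambda>n. if n = 0 then 0 else x (n - 1)) \<le> C * ell2_sq x" by (intro exI[of _ 1]) auto
  then show ?thesis unfolding bounded_op_iff using cl by (auto simp: fun_eq_iff)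
qed

context
  fixes q :: real assumes q: "0 < q" "q < 1"
begin

lemma shift_weight_le: "cmod (shift_weight q n) \<le> 1"
  and shift_weight_sq: "shift_weight q n * shift_weight q n = 1 - of_real q ^ (2 * n)"
  and shift_weight_pos: "n > 0 \<Longrightarrow> shift_weight q n \<noteq> 0"
  and cnj_shift_weight: "cnj (shift_weight q n) = shift_weight q n"
proof -
  have le: "q ^ (2 * n) \<le> 1" using q by (intro power_le_one) auto
  show "cmod (shift_weight q n) \<le> 1" using le q by (simp add: shift_weight_def)
  have "shift_weight q n * shift_weight q n = of_real (sqrt (1 - q ^ (2 * n)) * sqrt (1 - q ^ (2 * n)))"
    unfolding shift_weight_def by (simp only: of_real_mult)
  then show "shift_weight q n * shift_weight q n = 1 - of_real q ^ (2 * n)" using le by simp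
  show "cnj (shift_weight q n) = shift_weight q n" by (simp add: shift_weight_def)
  show "n > 0 \<Longrightarrow> shift_weight q n \<noteq> 0"
    using q power_strict_decreasing[of 0 "2 * n" q] by (simp add: shift_weight_def)
qed

lemma star_rep_u2_rep:
  assumes z: "cmod z = 1" and w: "cmod w = 1"
  shows "star_rep (u2_rep q z w)"
proof -
  have qn: "cmod (of_real q ^ n) \<le> 1" for n using q by (simp add: norm_power power_le_one)
  have b: "bounded_op (u2_rep q z w (g, b))" for g b
  proof (cases g)
    case Uu
    have "u2_rep q z w (Uu, b) = (\<lambda>x n. (if b then cnj z else z) * x n)" by (simp add: fun_eq_iff)
    moreover have "bounded_op (\<lambda>x n. (if b then cnj z else z) * x n)" by (rule ell2_diagonal) (simp add: z)
    ultimately show ?thesis using Uu by simp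
  next
    case Gamma
    have "cmod ((if b then cnj w else w) * of_real q ^ n) \<le> 1" for n
      using w qn[of n] by (simp add: norm_mult)
    from ell2_diagonal[OF this] have "bounded_op (\<lambda>x n. (if b then cnj w else w) * of_real q ^ n * x n)" .
    moreover have "u2_rep q z w (Gamma, b) = (\<lambda>x n. (if b then cnj w else w) * of_real q ^ n * x n)"
      by (simp add: fun_eq_iff)
    ultimately show ?thesis using Gamma by (simp only:)
  next
    case Alpha
    show ?thesis
    proof (cases b)
      case True
      have "bounded_op (\<lambda>x n. shift_weight q n * (if n = 0 then 0 else x (n - 1)))"
        by (rule bounded_op_comp[OF ell2_diagonal[OF shift_weight_le] bounded_op_forward])
      also have "(\<lambda>x n. shift_weight q n * (if n = 0 then 0 else x (n - 1))) = u2_rep q z w (g, b)"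
        using True Alpha by (auto simp: fun_eq_iff)
      finally show ?thesis .
    next
      case False
      have "bounded_op (\<lambda>x n. shift_weight q (Suc n) * x (Suc n))"
        by (rule bounded_op_comp[OF ell2_diagonal[OF shift_weight_le] bounded_op_backward])
      also have "(\<lambda>x n. shift_weight q (Suc n) * x (Suc n)) = u2_rep q z w (g, b)"
        using False Alpha by (auto simp: fun_eq_iff)
      finally show ?thesis .
    qed
  qed
  have "ell2_inner (u2_rep q z w (g, False) x) y = ell2_inner x (u2_rep q z w (g, True) y)" if xy: "x \<in> ell2" "y \<in> ell2" for g x y
  proof (cases g)
    case Alpha
    have cl: "u2_rep q z w (Alpha, True) y \<in> ell2" using b[of Alpha True] xy bounded_opD(1) by blast
    have "ell2_inner x (u2_rep q z w (Alpha, True) y) = suminf (\<lambda>n. cnj (x (Suc n)) * (shift_weight q (Suc n) * y n))"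
      unfolding ell2_inner_def using suminf_split_head[OF ell2_inner_summable'[OF xy(1) cl]] by simp
    then show ?thesis unfolding Alpha by (simp add: ell2_inner_def cnj_shift_weight mult_ac)
  qed (simp_all add: ell2_inner_def mult_ac)
  then show ?thesis unfolding star_rep_def using b by auto
qed

lemma u2_rep_relations:
  assumes z: "cmod z = 1" and w: "cmod w = 1" and r: "r \<in> relation_ideal (U2_relations q)"
  shows "rep_kills (u2_rep q z w) r"
proof (rule rep_kills_relation_ideal[OF star_rep_u2_rep[OF z w] _ r])
  note rep = star_rep_u2_rep[OF z w]
  have zz: "z * cnj z = 1" "cnj z * z = 1" "w * cnj w = 1" "cnj w * w = 1"
    using z w by (simp_all add: complex_norm_square[symmetric] mult.commute)
  have n1: "z * (cnj z * y) = y" "cnj z * (z * y) = y" for y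
    using zz by (simp_all add: mult.assoc[symmetric])
  have wq: "w * (of_real q ^ n * (cnj w * (of_real q ^ n * y))) = of_real q ^ (2 * n) * y" for n y
  proof -
    have "w * (of_real q ^ n * (cnj w * (of_real q ^ n * y))) = (w * cnj w) * (of_real q ^ n * of_real q ^ n) * y"
      by (simp add: mult_ac)
    then show ?thesis by (simp add: zz power_add[symmetric] mult_2)
  qed
  have s1: "shift_weight q n * (shift_weight q n * y) = y - of_real q ^ (2 * n) * y" for n y
    unfolding mult.assoc[symmetric] shift_weight_sq by (simp add: algebra_simps)
  have s2: "shift_weight q n * (shift_weight q (Suc (n - Suc 0)) * x (Suc (n - Suc 0))) = x n - of_real q ^ (2 * n) * x n"
    for n and x :: "nat \<Rightarrow> complex"
    by (cases n) (simp_all add: s1 del: mult_Suc_right)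
  fix r assume "r \<in> U2_relations q"
  then show "rep_kills (u2_rep q z w) r"
    unfolding U2_relations_def Let_def rep_kills_def
    apply (simp only: insert_iff empty_iff)
    apply (elim disjE; clarsimp simp: mult.assoc rep_eval_simps rep_eval_mult[OF rep])
              apply (simp_all only: u2_rep.simps if_True if_False n1 wq s1 s2 mult.assoc)
              apply (simp_all add: mult_ac fun_eq_iff)
    done
qed

lemma rep_eval_alpha_power:
  assumes z: "cmod z = 1" and w: "cmod w = 1" and x: "x \<in> ell2"
  shows "rep_eval (u2_rep q z w) (gen Alpha ^ j) x n = (\<Prod>i<j. shift_weight q (Suc (n + i))) * x (n + j)"
    and "rep_eval (u2_rep q z w) (gen_star Alpha ^ j) x n = (\<Prod>i<j. shift_weight q (n - i)) * x (n - j)"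
proof -
  note rep = star_rep_u2_rep[OF z w]
  show "rep_eval (u2_rep q z w) (gen Alpha ^ j) x n = (\<Prod>i<j. shift_weight q (Suc (n + i))) * x (n + j)"
    by (induction j arbitrary: n)
      (simp_all add: rep_eval_simps rep_eval_mult[OF rep x] prod.lessThan_Suc_shift mult.assoc del: prod.lessThan_Suc)
  show "rep_eval (u2_rep q z w) (gen_star Alpha ^ j) x n = (\<Prod>i<j. shift_weight q (n - i)) * x (n - j)"
    by (induction j arbitrary: n)
      (simp_all add: rep_eval_simps rep_eval_mult[OF rep x] prod.lessThan_Suc_shift mult.assoc del: prod.lessThan_Suc)
qed

text \<open>The matrix entry of the \<open>m\<close>-th power of \<open>\<alpha>\<close> at row \<open>n\<close> and column \<open>k\<close>. Truncated subtraction does no harm: if \<open>n\<close>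
  is smaller than \<open>- m\<close>, then one of the weights is the one at zero.\<close>

definition alpha_coeff :: "int \<Rightarrow> nat \<Rightarrow> nat \<Rightarrow> complex" where
  "alpha_coeff m k n = (if m \<ge> 0 then (\<Prod>i<nat m. shift_weight q (Suc (n + i))) * basis_vec k (n + nat m)
     else (\<Prod>i<nat (- m). shift_weight q (n - i)) * basis_vec k (n - nat (- m)))"

lemma alpha_coeff_nonzero_iff: "alpha_coeff m k n \<noteq> 0 \<longleftrightarrow> int k = int n + m"
proof (cases "m \<ge> 0")
  case True
  then show ?thesis using shift_weight_pos by (auto simp: alpha_coeff_def basis_vec_def)
next
  case False
  have "(\<Prod>i<nat (- m). shift_weight q (n - i)) \<noteq> 0 \<longleftrightarrow> nat (- m) \<le> n"
  proof
    assume "(\<Prod>i<nat (- m). shift_weight q (n - i)) \<noteq> 0"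
    then have "\<forall>i<nat (- m). shift_weight q (n - i) \<noteq> 0" by simp
    then have "\<not> n < nat (- m)" by (metis diff_self_eq_0 shift_weight_0)
    then show "nat (- m) \<le> n" by simp
  next
    assume "nat (- m) \<le> n"
    then show "(\<Prod>i<nat (- m). shift_weight q (n - i)) \<noteq> 0" using shift_weight_pos by auto
  qed
  then show ?thesis using False by (auto simp: alpha_coeff_def basis_vec_def)
qed

definition char_int :: "complex \<Rightarrow> int \<Rightarrow> complex" where
  "char_int z k = (if k \<ge> 0 then z ^ nat k else cnj z ^ nat (- k))"

lemma char_int_mult: "char_int (z * z') k = char_int z k * char_int z' k"
  by (simp add: char_int_def power_mult_distrib)

lemma char_int_cis: "char_int (cis t) k = cis (of_int k * t)"
  by (simp add: char_int_def DeMoivre cis_cnj)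

text \<open>The eigenvalue of \<open>u\<^sup>k \<gamma>\<^sup>a (\<gamma>\<^sup>*)\<^sup>b\<close> at the basis vector \<open>n\<close> in the representation with parameters \<open>z\<close>, \<open>w\<close>. For fixed
  exponents it is multiplicative in \<open>(z, w, n)\<close>, that is, a character of a semigroup.\<close>

definition u2_char :: "int \<times> nat \<times> nat \<Rightarrow> complex \<times> complex \<times> nat \<Rightarrow> complex" where
  "u2_char s g = char_int (fst g) (fst s) * ((fst (snd g) * of_real q ^ snd (snd g)) ^ fst (snd s) *
     (cnj (fst (snd g)) * of_real q ^ snd (snd g)) ^ snd (snd s))"

lemma rep_eval_u2_mono:
  assumes z: "cmod z = 1" and w: "cmod w = 1"
  shows "rep_eval (u2_rep q z w) (u2_mono (k, a, b, m)) (basis_vec l) n = u2_char (k, a, b) (z, w, n) * alpha_coeff m l n"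
proof -
  note rep = star_rep_u2_rep[OF z w]
  note rm = rep_eval_mult[OF rep basis_vec_ell2]
  have g: "rep_eval (u2_rep q z w) (gen Gamma ^ j * p) (basis_vec l) n = (w * of_real q ^ n) ^ j * rep_eval (u2_rep q z w) p (basis_vec l) n"
    "rep_eval (u2_rep q z w) (gen_star Gamma ^ j * p) (basis_vec l) n = (cnj w * of_real q ^ n) ^ j * rep_eval (u2_rep q z w) p (basis_vec l) n"
    "rep_eval (u2_rep q z w) (gen Uu ^ j * p) (basis_vec l) n = z ^ j * rep_eval (u2_rep q z w) p (basis_vec l) n"
    "rep_eval (u2_rep q z w) (gen_star Uu ^ j * p) (basis_vec l) n = cnj z ^ j * rep_eval (u2_rep q z w) p (basis_vec l) n" for j p
    by (induction j; simp add: rm rep_eval_simps mult.assoc)+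
  have a: "rep_eval (u2_rep q z w) (zpow Alpha m) (basis_vec l) n = alpha_coeff m l n"
    by (simp add: zpow_def alpha_coeff_def rep_eval_alpha_power[OF z w basis_vec_ell2])
  have u: "rep_eval (u2_rep q z w) (zpow Uu k * p) (basis_vec l) n = char_int z k * rep_eval (u2_rep q z w) p (basis_vec l) n" for p
    by (simp add: zpow_def char_int_def g)
  show ?thesis by (simp add: u g a u2_char_def mult.assoc)
qed

end

text \<open>Dedekind's argument. Subtracting \<open>\<chi> t g\<close> times the relation at \<open>h\<close> from the relation at \<open>op g h\<close> removes the
  term of \<open>t\<close> and multiplies the coefficient of \<open>s\<close> by \<open>\<chi> s g - \<chi> t g\<close>.\<close>

lemma characters_independent:
  fixes \<chi> :: "'s \<Rightarrow> 'g \<Rightarrow> complex"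
  assumes "finite S"
    and op: "\<And>g h. g \<in> G \<Longrightarrow> h \<in> G \<Longrightarrow> op g h \<in> G"
    and mult: "\<And>s g h. g \<in> G \<Longrightarrow> h \<in> G \<Longrightarrow> \<chi> s (op g h) = \<chi> s g * \<chi> s h"
    and e: "e \<in> G" "\<And>s. \<chi> s e = 1"
    and dist: "\<And>s t. s \<in> S \<Longrightarrow> t \<in> S \<Longrightarrow> s \<noteq> t \<Longrightarrow> \<exists>g\<in>G. \<chi> s g \<noteq> \<chi> t g"
    and sum: "\<And>g. g \<in> G \<Longrightarrow> (\<Sum>s\<in>S. c s * \<chi> s g) = 0"
  shows "s \<in> S \<Longrightarrow> c s = 0"
  using assms(1) dist sum
proof (induction S arbitrary: c s rule: finite_induct)
  case (insert t S)
  have rest: "c s = 0" if s: "s \<in> S" for s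
  proof -
    obtain g where g: "g \<in> G" "\<chi> s g \<noteq> \<chi> t g" using insert.prems(2)[of s t] insert.hyps s by auto
    have "c s * (\<chi> s g - \<chi> t g) = 0"
    proof (rule insert.IH[OF s])
      show "\<exists>g\<in>G. \<chi> s g \<noteq> \<chi> t g" if "s \<in> S" "t \<in> S" "s \<noteq> t" for s t
        using insert.prems(2)[of s t] that by blast
      fix h assume h: "h \<in> G"
      have "(\<Sum>s\<in>S. c s * (\<chi> s g - \<chi> t g) * \<chi> s h) = (\<Sum>s\<in>S. c s * \<chi> s (op g h)) - \<chi> t g * (\<Sum>s\<in>S. c s * \<chi> s h)"
        by (simp add: mult[OF g(1) h] sum_distrib_left sum_subtractf[symmetric] algebra_simps)
      also have "(\<Sum>s\<in>S. c s * \<chi> s (op g h)) = - (c t * \<chi> t (op g h))"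
        using insert.prems(3)[OF op[OF g(1) h]] insert.hyps by (simp add: eq_neg_iff_add_eq_0 add.commute)
      also have "(\<Sum>s\<in>S. c s * \<chi> s h) = - (c t * \<chi> t h)"
        using insert.prems(3)[OF h] insert.hyps by (simp add: eq_neg_iff_add_eq_0 add.commute)
      finally show "(\<Sum>s\<in>S. c s * (\<chi> s g - \<chi> t g) * \<chi> s h) = 0"
        by (simp add: mult[OF g(1) h])
    qed
    then show ?thesis using g(2) by simp
  qed
  have "c t = 0" using insert.prems(3)[OF e(1)] insert.hyps by (simp add: e(2) rest)
  then show ?case using rest insert.prems(1) by auto
qed simp

lemma star_algebra_torus: "star_algebra torus"
  unfolding torus_def by (rule star_algebra_monoid) auto

lemma torus_simps [simp]:
  "carrier torus = UNIV" "monoid.mult torus = (*)" "one torus = 1" "zero torus = 0" "add torus = (+)" "smult torus = cscale"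
  unfolding torus_def by simp_all

lemma star_torus_single: "star torus (Poly_Mapping.single m c) = Poly_Mapping.single (- m) (cnj c)"
  unfolding torus_def by (rule monoid_star_single) auto

context
  fixes q :: real assumes q: "0 < q" "q < 1"
begin

text \<open>The exponent of \<open>u\<close> is seen by \<open>z\<close>, the difference of the exponents of \<open>\<gamma>\<close> and its adjoint by
  \<open>w\<close>, and their sum by the power of \<open>q\<close>. At the chosen root of unity two different integer powers differ by the sign.\<close>

lemma u2_char_distinct:
  assumes "s \<noteq> t"
  shows "\<exists>g\<in>{g. cmod (fst g) = 1 \<and> cmod (fst (snd g)) = 1}. u2_char q s g \<noteq> u2_char q t g"
proof -
  obtain k a b k' a' b' where st: "s = (k, a, b)" "t = (k', a', b')" by (metis prod.exhaust)
  have neq: "cis (of_int i * (pi / of_int (i - j))) \<noteq> cis (of_int j * (pi / of_int (i - j)))" if "i \<noteq> j" for i j :: int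
  proof -
    have "(of_int i * (pi / of_int (i - j)) :: real) = of_int j * (pi / of_int (i - j)) + pi"
      using that by (simp add: field_simps)
    then have "cis (of_int i * (pi / of_int (i - j))) = cis (of_int j * (pi / of_int (i - j))) * cis pi"
      by (simp only: cis_mult)
    moreover have "x = y * cis pi \<Longrightarrow> y \<noteq> 0 \<Longrightarrow> x \<noteq> y" for x y by simp
    ultimately show ?thesis using cis_neq_zero by blast
  qed
  have w: "cis t ^ i * cnj (cis t) ^ j = cis (of_int (int i - int j) * t)" for t i j
    by (simp add: DeMoivre cis_cnj cis_mult algebra_simps)
  consider "k \<noteq> k'" | "k = k'" "int a - int b \<noteq> int a' - int b'" | "k = k'" "int a - int b = int a' - int b'" "a + b \<noteq> a' + b'"
    using assms st by (cases "k = k'"; cases "int a - int b = int a' - int b'") auto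
  then show ?thesis
  proof cases
    case 1
    let ?g = "(cis (pi / of_int (k - k')), 1, 0)"
    have "u2_char q s ?g \<noteq> u2_char q t ?g"
      using neq[OF 1] by (simp add: u2_char_def[OF q] st char_int_cis[OF q])
    then show ?thesis by (intro bexI[of _ ?g]) auto
  next
    case 2
    let ?g = "(1, cis (pi / of_int ((int a - int b) - (int a' - int b'))), 0)"
    have "u2_char q s ?g \<noteq> u2_char q t ?g"
      using neq[OF 2(2)] by (simp add: u2_char_def[OF q] st char_int_def[OF q] w del: of_int_diff)
    then show ?thesis by (intro bexI[of _ ?g]) auto
  next
    case 3
    let ?g = "(1, 1, 1)"
    have inj: "q ^ i = q ^ j \<Longrightarrow> i = j" for i j :: nat
      using power_strict_decreasing[of i j q] power_strict_decreasing[of j i q] q by (metis less_irrefl linorder_neqE_nat)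
    have "(of_real q :: complex) ^ (a + b) \<noteq> of_real q ^ (a' + b')"
      unfolding of_real_power[symmetric] of_real_eq_iff using inj 3(3) by blast
    then have "u2_char q s ?g \<noteq> u2_char q t ?g"
      by (simp add: u2_char_def[OF q] st char_int_def[OF q] power_add)
    then show ?thesis by (intro bexI[of _ ?g]) auto
  qed
qed

text \<open>Modulo the relations \<open>p\<close> is a combination of ordered monomials. A matrix entry sees only the monomials with one
  fixed power \<open>m0\<close> of \<open>\<alpha>\<close>, namely the difference of column and row. Along the corresponding diagonal the entries are
  combinations of characters times a common nonzero factor, so the coefficients vanish.\<close>

lemma U2_separated:
  assumes kills: "\<And>z w. cmod z = 1 \<Longrightarrow> cmod w = 1 \<Longrightarrow> rep_kills (u2_rep q z w) p"
  shows "p \<in> relation_ideal (U2_relations q)"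
proof -
  have q0: "q \<noteq> 0" using q by simp
  obtain r where r: "p - pm_extend u2_mono r \<in> relation_ideal (U2_relations q)"
    using u2_span_all[OF q0, of p] unfolding u2_span_def[OF q0] u2_cong_def[OF q0] by blast
  have zero: "(\<Sum>s\<in>Poly_Mapping.keys r. Poly_Mapping.lookup r s * rep_eval (u2_rep q z w) (u2_mono s) (basis_vec l) n) = 0"
    if zw: "cmod z = 1" "cmod w = 1" for z w l n
  proof -
    have "rep_eval (u2_rep q z w) p (basis_vec l) n - rep_eval (u2_rep q z w) (pm_extend u2_mono r) (basis_vec l) n = 0"
      using u2_rep_relations[OF q zw r] basis_vec_ell2[of l] by (simp add: rep_kills_def rep_eval_simps fun_eq_iff)
    moreover have "rep_eval (u2_rep q z w) p (basis_vec l) n = 0"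
      using kills[OF zw] by (simp add: rep_kills_def)
    ultimately show ?thesis by (simp add: pm_extend_def rep_eval_sum rep_eval_simps)
  qed
  have "Poly_Mapping.lookup r s0 = 0" for s0
  proof (rule ccontr)
    assume ne: "Poly_Mapping.lookup r s0 \<noteq> 0"
    obtain k0 a0 b0 m0 where s0: "s0 = (k0, a0, b0, m0)" by (metis prod.exhaust)
    let ?i = "\<lambda>t. (fst t, fst (snd t), snd (snd t), m0)"
    define S where "S = {t. ?i t \<in> Poly_Mapping.keys r}"
    have inj: "inj ?i" by (auto simp: inj_on_def)
    have fS: "finite S" unfolding S_def using finite_vimageI[OF finite_keys inj, of r] by (simp add: vimage_def)
    let ?G = "{g :: complex \<times> complex \<times> nat. cmod (fst g) = 1 \<and> cmod (fst (snd g)) = 1}"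
    let ?op = "\<lambda>g h. (fst g * fst h, fst (snd g) * fst (snd h), snd (snd g) + snd (snd h))"
    \<comment> \<open>Row indices are shifted by \<open>?n0\<close> so that the column index \<open>n + ?n0 + m0\<close> stays nonnegative.\<close>
    let ?n0 = "nat \<bar>m0\<bar>"
    have mult: "u2_char q t (?op g h) = u2_char q t g * u2_char q t h" for t g h
      by (simp add: u2_char_def[OF q] char_int_mult[OF q] power_add power_mult_distrib mult_ac)
    have "(\<Sum>t\<in>S. Poly_Mapping.lookup r (?i t) * u2_char q t (1, 1, ?n0) * u2_char q t g) = 0" if g: "g \<in> ?G" for g
    proof -
      obtain z w n where gz: "g = (z, w, n)" by (metis prod.exhaust)
      have zw: "cmod z = 1" "cmod w = 1" using g gz by auto
      define l where "l = nat (int (n + ?n0) + m0)"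
      have l: "int l = int (n + ?n0) + m0" by (simp add: l_def)
      let ?c = "alpha_coeff q m0 l (n + ?n0)"
      have c: "?c \<noteq> 0" using alpha_coeff_nonzero_iff[OF q] l by blast
      have "0 = (\<Sum>s\<in>Poly_Mapping.keys r. Poly_Mapping.lookup r s * rep_eval (u2_rep q z w) (u2_mono s) (basis_vec l) (n + ?n0))"
        using zero[OF zw] by simp
      also have "\<dots> = (\<Sum>s\<in>?i ` S. Poly_Mapping.lookup r s * rep_eval (u2_rep q z w) (u2_mono s) (basis_vec l) (n + ?n0))"
      proof (rule sum.mono_neutral_right)
        show "\<forall>s\<in>Poly_Mapping.keys r - ?i ` S. Poly_Mapping.lookup r s * rep_eval (u2_rep q z w) (u2_mono s) (basis_vec l) (n + ?n0) = 0"
        proof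
          fix s assume s: "s \<in> Poly_Mapping.keys r - ?i ` S"
          obtain k a b m where sk: "s = (k, a, b, m)" by (metis prod.exhaust)
          have "m \<noteq> m0"
          proof
            assume "m = m0"
            then have "s = ?i (k, a, b)" "(k, a, b) \<in> S" using s sk by (simp_all add: S_def)
            then show False using s by blast
          qed
          then have "alpha_coeff q m l (n + ?n0) = 0" using alpha_coeff_nonzero_iff[OF q, of m l "n + ?n0"] l by auto
          then show "Poly_Mapping.lookup r s * rep_eval (u2_rep q z w) (u2_mono s) (basis_vec l) (n + ?n0) = 0"
            unfolding sk rep_eval_u2_mono[OF q zw] by simp
        qed
      qed (auto simp: S_def)
      also have "\<dots> = (\<Sum>t\<in>S. Poly_Mapping.lookup r (?i t) * rep_eval (u2_rep q z w) (u2_mono (?i t)) (basis_vec l) (n + ?n0))"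
        by (subst sum.reindex) (use inj in \<open>auto intro: inj_on_subset\<close>)
      also have "\<dots> = (\<Sum>t\<in>S. Poly_Mapping.lookup r (?i t) * u2_char q t (1, 1, ?n0) * u2_char q t g) * ?c"
        unfolding rep_eval_u2_mono[OF q zw] sum_distrib_right
        using mult[of _ "(1, 1, ?n0)" g] by (intro sum.cong) (auto simp: gz add.commute)
      finally show ?thesis using c by simp
    qed
    then have "Poly_Mapping.lookup r (?i (k0, a0, b0)) * u2_char q (k0, a0, b0) (1, 1, ?n0) = 0"
      using characters_independent[of S ?G ?op "u2_char q" "(1, 1, 0)" "\<lambda>t. Poly_Mapping.lookup r (?i t) * u2_char q t (1, 1, ?n0)" "(k0, a0, b0)"]
        fS mult u2_char_distinct ne s0
      by (auto simp: norm_mult u2_char_def[OF q, of _ "(1, 1, 0)"] char_int_def[OF q, of 1] S_def in_keys_iff)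
    moreover have "u2_char q (k0, a0, b0) (1, 1, ?n0) \<noteq> 0"
      using q by (simp add: u2_char_def[OF q] char_int_def[OF q])
    ultimately show False using ne s0 by simp
  qed
  then have "r = 0" by (intro poly_mapping_eqI) simp
  then show ?thesis using r by simp
qed

section \<open>The structure maps\<close>

lemma q_nonzero: "q \<noteq> 0" using q by simp

lemma su_matrix_u2_v: "su_matrix q (U2 q) (u2_v q)"
  unfolding u2_v_matrix by (rule su_matrix_u2_matrix[OF star_algebra_U2 u2_triple_U2 q_nonzero])

text \<open>Pulling the weighted shifts back along \<open>u_ij \<mapsto> v_ij\<close> gives representations of the relations of \<open>SU_q(3)\<close>, so
  the image of an element of the kernel acts as zero in all of them, and hence is zero.\<close>

lemma proj: "star_hom (SU q) (U2 q) (proj q)" and proj_u: "proj q (su_u q i j) = u2_v q i j"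
proof -
  interpret B: star_algebra "U2 q" by (rule star_algebra_U2)
  let ?v = "\<lambda>g. u2_v q (fst g) (snd g)" and ?vf = "\<lambda>g. v_free q (fst g) (snd g)"
  have vc: "?v g \<in> carrier (U2 q)" for g using su_matrixD(1)[OF su_matrix_u2_v] .
  note L = B.star_hom_free_lift[of ?v, OF vc] and Lg = B.free_lift_gen[of ?v, OF vc]
  have rel: "\<forall>r\<in>SU_relations q. free_lift (U2 q) ?v r = \<zero>\<^bsub>U2 q\<^esub>"
    unfolding SU_relations_vanish_iff[OF star_algebra_U2 L] by (simp add: Lg su_matrix_u2_v)
  have cls: "u2_cls q (free_lift free_alg ?vf p) = free_lift (U2 q) ?v p" for p
  proof (rule free_star_hom_eqI[OF star_hom_comp[OF free_lift_free_simps(6) star_hom_u2_cls] L])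
    show "u2_cls q (free_lift free_alg ?vf (gen g)) = free_lift (U2 q) ?v (gen g)" for g
      unfolding free_lift_free_simps Lg by (simp only: u2_v_eq)
  qed
  have ideal: "free_lift free_alg ?vf p \<in> relation_ideal (U2_relations q)" if "free_lift (U2 q) ?v p = \<zero>\<^bsub>U2 q\<^esub>" for p
  proof -
    have "u2_cls q (free_lift free_alg ?vf p) = u2_cls q 0"
      using cls[of p] that u2_cls_zero[OF star_idealD(1)[OF star_ideal_relation_ideal]] by simp
    then show ?thesis by (simp add: u2_cls_eq_iff)
  qed
  have ker: "free_lift (U2 q) ?v p = \<zero>\<^bsub>U2 q\<^esub>" if p: "p \<in> cstar_kernel (SU_relations q)" for p
  proof -
    have "free_lift free_alg ?vf p \<in> relation_ideal (U2_relations q)"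
    proof (rule U2_separated)
      fix z w :: complex assume zw: "cmod z = 1" "cmod w = 1"
      note rep = star_rep_u2_rep[OF q zw]
      have pb: "rep_kills (pullback_rep (u2_rep q z w) ?vf) r \<longleftrightarrow> rep_kills (u2_rep q z w) (free_lift free_alg ?vf r)" for r
        by (simp add: rep_kills_def rep_eval_pullback[OF rep])
      have "\<forall>r\<in>SU_relations q. rep_kills (pullback_rep (u2_rep q z w) ?vf) r"
        unfolding pb using rel ideal u2_rep_relations[OF q zw] by blast
      then have "rep_kills (pullback_rep (u2_rep q z w) ?vf) p"
        using p star_rep_pullback[OF rep] unfolding cstar_kernel_eq by blast
      then show "rep_kills (u2_rep q z w) (free_lift free_alg ?vf p)" unfolding pb .
    qed
    then show ?thesis unfolding cls[symmetric] by (rule u2_cls_zero)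
  qed
  have "\<exists>f. star_hom (SU q) (U2 q) f \<and> (\<forall>p. f (su_cls q p) = free_lift (U2 q) ?v p)"
    by (rule star_hom_quot_lift[OF star_ideal_cstar_kernel[of "SU_relations q"] L star_algebra_U2,
      folded SU_eq[OF q_nonzero] su_cls_def]) (rule ker)
  then obtain f where f: "star_hom (SU q) (U2 q) f" and fd: "\<And>p. f (su_cls q p) = free_lift (U2 q) ?v p" by blast
  have fu: "f (su_u q i j) = u2_v q i j" for i j by (simp add: su_u_eq fd Lg)
  show "star_hom (SU q) (U2 q) (proj q)" "proj q (su_u q i j) = u2_v q i j"
    using SU_star_hom_the[OF q_nonzero f fu, folded proj_def] by blast+
qed

text \<open>The product matrix of two copies of \<open>v\<close> satisfies the relations of \<open>SU_q(3)\<close> and is block diagonal. By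
  \<open>u2_triple_of_block\<close> it comes from a triple, so the universal property applies without verifying the
  relations of \<open>U_q(2)\<close> one by one.\<close>

lemma Delta_U2: "star_hom (U2 q) (tensor (U2 q) (U2 q)) (Delta_U2 q)"
  and Delta_U2_v: "Delta_U2 q (u2_v q i j) = (\<Oplus>\<^bsub>tensor (U2 q) (U2 q)\<^esub>k\<in>UNIV. pure_tensor (U2 q) (U2 q) (u2_v q i k) (u2_v q k j))"
proof -
  note H = star_algebra_U2[of q]
  interpret B: star_algebra "U2 q" by (rule H)
  let ?T = "tensor (U2 q) (U2 q)"
  interpret T: star_algebra ?T by (rule star_algebra_tensor[OF H H])
  let ?W = "\<lambda>i j. \<Oplus>\<^bsub>?T\<^esub>k\<in>UNIV. pure_tensor (U2 q) (U2 q) (u2_v q i k) (u2_v q k j)"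
  have vc [simp]: "u2_v q i j \<in> carrier (U2 q)" for i j using su_matrixD(1)[OF su_matrix_u2_v] .
  have W: "su_matrix q ?T ?W" by (rule su_matrix_tensor[OF H H su_matrix_u2_v su_matrix_u2_v])
  have vz: "u2_v q I1 I2 = \<zero>\<^bsub>U2 q\<^esub>" "u2_v q I1 I3 = \<zero>\<^bsub>U2 q\<^esub>" "u2_v q I2 I1 = \<zero>\<^bsub>U2 q\<^esub>" "u2_v q I3 I1 = \<zero>\<^bsub>U2 q\<^esub>"
    by (simp_all add: u2_v_matrix)
  note p0 = pure_zero_left[OF B.complex_space_axioms B.complex_space_axioms] pure_zero_right[OF B.complex_space_axioms B.complex_space_axioms]
  have Wz: "?W I1 I2 = \<zero>\<^bsub>?T\<^esub>" "?W I1 I3 = \<zero>\<^bsub>?T\<^esub>" "?W I2 I1 = \<zero>\<^bsub>?T\<^esub>" "?W I3 I1 = \<zero>\<^bsub>?T\<^esub>"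
    by (simp_all add: T.finsum_idx vz p0)
  note blk = u2_triple_of_block[OF T.star_algebra_axioms W q_nonzero Wz]
  obtain f where f: "star_hom (U2 q) ?T f" "\<And>i j. f (u2_v q i j) = ?W i j"
    using U2_universal[OF T.star_algebra_axioms blk(1)] unfolding blk(2)[symmetric] by blast
  show "star_hom (U2 q) ?T (Delta_U2 q)" "Delta_U2 q (u2_v q i j) = ?W i j"
    using U2_star_hom_the[OF f, folded Delta_U2_def] by blast+
qed

lemma pi1: "star_hom (U2 q) torus (pi1 q)" and pi1_v: "pi1 q (u2_v q i j) = torus_diag i j"
proof -
  interpret T: star_algebra torus by (rule star_algebra_torus)
  have s0: "star torus 0 = 0" using T.star_zero by simp
  have t: "u2_triple q torus (Poly_Mapping.single (1, 0) 1) (Poly_Mapping.single (0, 1) 1) 0"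
    unfolding u2_triple_def by (simp add: star_torus_single s0 mult_single zero_prod_def[symmetric] mult.commute)
  have m: "u2_matrix q torus (Poly_Mapping.single (1, 0) 1) (Poly_Mapping.single (0, 1) 1) 0 i j = torus_diag i j" for i j
    by (cases i; cases j) (simp_all add: star_torus_single s0 mult_single)
  obtain f where f: "star_hom (U2 q) torus f" "\<And>i j. f (u2_v q i j) = torus_diag i j"
    using U2_universal[OF star_algebra_torus t] unfolding m by blast
  show "star_hom (U2 q) torus (pi1 q)" "pi1 q (u2_v q i j) = torus_diag i j"
    using U2_star_hom_the[OF f, folded pi1_def] by blast+
qed

lemma pi0: "star_hom (SU q) torus (pi0 q)" and pi0_u: "pi0 q (su_u q i j) = torus_diag i j"
proof -
  have f: "star_hom (SU q) torus (\<lambda>x. pi1 q (proj q x))" by (rule star_hom_comp[OF proj pi1])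
  have fu: "pi1 q (proj q (su_u q i j)) = torus_diag i j" for i j by (simp add: proj_u pi1_v)
  show "star_hom (SU q) torus (pi0 q)" "pi0 q (su_u q i j) = torus_diag i j"
    using SU_star_hom_the[OF q_nonzero f fu, folded pi0_def] by blast+
qed

end

section \<open>Subspaces, subalgebras and gradings\<close>

lemma complex_space_subspace:
  assumes V: "complex_space V" and S: "S \<subseteq> carrier V" "\<zero>\<^bsub>V\<^esub> \<in> S"
    and add: "\<And>x y. x \<in> S \<Longrightarrow> y \<in> S \<Longrightarrow> x \<oplus>\<^bsub>V\<^esub> y \<in> S" and smult: "\<And>c x. x \<in> S \<Longrightarrow> c \<odot>\<^bsub>V\<^esub> x \<in> S"
  shows "complex_space (V\<lparr>carrier := S\<rparr>)"
proof -
  interpret V: complex_space V by fact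
  have c: "x \<in> S \<Longrightarrow> x \<in> carrier V" for x using S(1) by blast
  show ?thesis
    by (rule complex_spaceI) (simp_all add: S(2) add smult c V.a_ac V.smult_minus_one V.l_neg V.r_neg V.smult_add_scalar V.smult_add)
qed

lemma ring_subalgebra:
  assumes A: "star_algebra A" and S: "S \<subseteq> carrier A" "\<zero>\<^bsub>A\<^esub> \<in> S" "\<one>\<^bsub>A\<^esub> \<in> S"
    and add: "\<And>x y. x \<in> S \<Longrightarrow> y \<in> S \<Longrightarrow> x \<oplus>\<^bsub>A\<^esub> y \<in> S" and smult: "\<And>c x. x \<in> S \<Longrightarrow> c \<odot>\<^bsub>A\<^esub> x \<in> S"
    and mult: "\<And>x y. x \<in> S \<Longrightarrow> y \<in> S \<Longrightarrow> x \<otimes>\<^bsub>A\<^esub> y \<in> S"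
  shows "ring (A\<lparr>carrier := S\<rparr>)"
proof -
  interpret A: star_algebra A by fact
  interpret S: complex_space "A\<lparr>carrier := S\<rparr>"
    by (rule complex_space_subspace[OF A.complex_space_axioms S(1,2) add smult])
  have c: "x \<in> S \<Longrightarrow> x \<in> carrier A" for x using S(1) by blast
  show ?thesis
  proof (rule ringI)
    show "abelian_group (A\<lparr>carrier := S\<rparr>)" ..
    show "Group.monoid (A\<lparr>carrier := S\<rparr>)" by (rule monoidI) (simp_all add: mult S(3) c A.m_assoc)
  qed (simp_all add: c A.l_distr A.r_distr)
qed

lemma star_algebra_subalgebra:
  assumes A: "star_algebra A" and S: "S \<subseteq> carrier A" "\<zero>\<^bsub>A\<^esub> \<in> S" "\<one>\<^bsub>A\<^esub> \<in> S"
    and add: "\<And>x y. x \<in> S \<Longrightarrow> y \<in> S \<Longrightarrow> x \<oplus>\<^bsub>A\<^esub> y \<in> S" and smult: "\<And>c x. x \<in> S \<Longrightarrow> c \<odot>\<^bsub>A\<^esub> x \<in> S"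
    and mult: "\<And>x y. x \<in> S \<Longrightarrow> y \<in> S \<Longrightarrow> x \<otimes>\<^bsub>A\<^esub> y \<in> S" and star: "\<And>x. x \<in> S \<Longrightarrow> star A x \<in> S"
  shows "star_algebra (A\<lparr>carrier := S\<rparr>)"
proof -
  interpret A: star_algebra A by fact
  have c: "x \<in> S \<Longrightarrow> x \<in> carrier A" for x using S(1) by blast
  show ?thesis
  proof (rule star_algebra.intro)
    show "complex_space (A\<lparr>carrier := S\<rparr>)" by (rule complex_space_subspace[OF A.complex_space_axioms S(1,2) add smult])
    show "ring (A\<lparr>carrier := S\<rparr>)" by (rule ring_subalgebra[OF A S add smult mult])
    show "star_algebra_axioms (A\<lparr>carrier := S\<rparr>)"
      by (rule star_algebra_axioms.intro)
        (simp_all add: c star A.smult_mult_left A.smult_mult_right A.star_add A.star_smult A.star_mult)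
  qed
qed

text \<open>The sum of the weight spaces, generated by adding one homogeneous element at a time, so that inductions
  need no choice of a decomposition.\<close>

inductive_set graded_span :: "('a, 'm) star_alg_scheme \<Rightarrow> ('i \<Rightarrow> 'a set) \<Rightarrow> 'a set" for A wt where
  zero: "\<zero>\<^bsub>A\<^esub> \<in> graded_span A wt"
| add: "a \<in> wt i \<Longrightarrow> b \<in> graded_span A wt \<Longrightarrow> a \<oplus>\<^bsub>A\<^esub> b \<in> graded_span A wt"

text \<open>Weights add under multiplication and change sign under the star, so the span of the weight spaces is a
  star-subalgebra, and it contains everything that is generated by homogeneous elements.\<close>

locale graded = star_algebra A for A :: "('a, 'm) star_alg_scheme" (structure) +
  fixes wt :: "'i::ab_group_add \<Rightarrow> 'a set"
  assumes wt_closed: "a \<in> wt i \<Longrightarrow> a \<in> carrier A"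
    and wt_mult: "a \<in> wt i \<Longrightarrow> b \<in> wt j \<Longrightarrow> a \<otimes> b \<in> wt (i + j)"
    and wt_smult: "a \<in> wt i \<Longrightarrow> c \<odot> a \<in> wt i"
    and wt_star: "a \<in> wt i \<Longrightarrow> star A a \<in> wt (- i)"
    and wt_one: "\<one> \<in> wt 0"
begin

lemma span_closed: "a \<in> graded_span A wt \<Longrightarrow> a \<in> carrier A"
  by (induction rule: graded_span.induct) (simp_all add: wt_closed)

lemma wt_span: "a \<in> wt i \<Longrightarrow> a \<in> graded_span A wt"
  using graded_span.add[OF _ graded_span.zero] by (metis r_zero wt_closed)

lemma span_add: "a \<in> graded_span A wt \<Longrightarrow> b \<in> graded_span A wt \<Longrightarrow> a \<oplus> b \<in> graded_span A wt"
proof (induction rule: graded_span.induct)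
  case (add a i c)
  then show ?case using graded_span.add[OF add(1) add(3)] by (simp add: span_closed wt_closed a_assoc)
qed (simp add: span_closed)

lemma span_smult: "a \<in> graded_span A wt \<Longrightarrow> c \<odot> a \<in> graded_span A wt"
proof (induction rule: graded_span.induct)
  case (add a i b)
  then show ?case using graded_span.add[OF wt_smult[OF add(1)] add(3)] by (simp add: span_closed wt_closed smult_add)
qed (simp add: graded_span.zero)

lemma span_star: "a \<in> graded_span A wt \<Longrightarrow> star A a \<in> graded_span A wt"
proof (induction rule: graded_span.induct)
  case (add a i b)
  then show ?case using graded_span.add[OF wt_star[OF add(1)] add(3)] by (simp add: span_closed wt_closed star_add)
qed (simp add: graded_span.zero)

lemma span_mult: assumes "a \<in> graded_span A wt" "b \<in> graded_span A wt" shows "a \<otimes> b \<in> graded_span A wt"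
proof -
  have 1: "a \<otimes> b \<in> graded_span A wt" if "a \<in> wt i" for a i
    using assms(2)
  proof (induction rule: graded_span.induct)
    case zero
    then show ?case using that by (simp add: graded_span.zero wt_closed)
  next
    case (add b j c)
    then show ?case using graded_span.add[OF wt_mult[OF that add(1)] add(3)] that by (simp add: span_closed wt_closed r_distr)
  qed
  show ?thesis using assms(1)
  proof (induction rule: graded_span.induct)
    case zero
    then show ?case using assms(2) by (simp add: graded_span.zero span_closed)
  next
    case (add a i c)
    then show ?case using span_add[OF 1[OF add(1)] add(3)] assms(2) by (simp add: span_closed wt_closed l_distr)
  qed
qed

end

section \<open>Slices by characters\<close>

text \<open>The map \<open>id \<otimes> \<omega>\<close>, with values in \<open>V \<otimes> \<complex> = V\<close>.\<close>

definition slice :: "('a, 'm) star_alg_scheme \<Rightarrow> ('b, 'n) star_alg_scheme \<Rightarrow> ('b \<Rightarrow> complex) \<Rightarrow> ('a \<times> 'b \<Rightarrow>\<^sub>0 complex) set \<Rightarrow> 'a" where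
  "slice V W \<omega> = tensor_lift V W V (\<lambda>x y. \<omega> y \<odot>\<^bsub>V\<^esub> x)"

lemma slice:
  assumes V: "complex_space V" and W: "complex_space W" and w: "linear_on W complex_alg \<omega>"
  shows slice_linear: "linear_on (tensor V W) V (slice V W \<omega>)"
    and slice_pure: "x \<in> carrier V \<Longrightarrow> y \<in> carrier W \<Longrightarrow> slice V W \<omega> (pure_tensor V W x y) = \<omega> y \<odot>\<^bsub>V\<^esub> x"
proof -
  interpret V: complex_space V by fact
  have "bilinear_on V W V (\<lambda>x y. \<omega> y \<odot>\<^bsub>V\<^esub> x)"
    unfolding bilinear_on_def using linear_on_add[OF w] linear_on_smult[OF w]
    by (intro conjI ballI linear_onI) (simp_all add: V.smult_add_scalar V.smult_add mult.commute)
  note L = tensor_lift[OF V W V this]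
  show "linear_on (tensor V W) V (slice V W \<omega>)"
    "x \<in> carrier V \<Longrightarrow> y \<in> carrier W \<Longrightarrow> slice V W \<omega> (pure_tensor V W x y) = \<omega> y \<odot>\<^bsub>V\<^esub> x"
    unfolding slice_def using L by auto
qed

lemma star_hom_slice:
  assumes V: "star_algebra V" and W: "star_algebra W" and w: "star_hom W complex_alg \<omega>"
  shows "star_hom (tensor V W) V (slice V W \<omega>)"
proof -
  interpret V: star_algebra V by fact
  interpret W: star_algebra W by fact
  note s = slice[OF V.complex_space_axioms W.complex_space_axioms star_hom_linear[OF w]]
  show ?thesis
    by (rule star_hom_tensorI[OF V W V s(1)])
      (simp_all add: s(2) star_hom_mult[OF w] star_hom_one[OF w] star_hom_star[OF w] V.smult_mult_left V.smult_mult_right V.star_smult mult.commute)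
qed

text \<open>The character at the point \<open>(z, 1)\<close> of the torus; \<open>z = 1\<close> gives the counit, and general \<open>z\<close> the circle
  action on the first column.\<close>

definition torus_char :: "complex \<Rightarrow> (int \<times> int \<Rightarrow>\<^sub>0 complex) \<Rightarrow> complex" where
  "torus_char z = lincomb complex_alg (\<lambda>m. z powi fst m)"

lemma torus_char_single: "torus_char z (Poly_Mapping.single m c) = c * z powi fst m"
  unfolding torus_char_def by (subst complex_space.lincomb_single[OF complex_space_complex]) simp_all

lemma star_hom_torus_char:
  assumes z: "cmod z = 1" shows "star_hom torus complex_alg (torus_char z)"
proof -
  interpret C: star_algebra complex_alg by (rule star_algebra_complex)
  interpret T: star_algebra torus by (rule star_algebra_torus)
  have z0: "z \<noteq> 0" using z by auto
  have cz: "cnj z = inverse z"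
    using z z0 by (simp add: complex_norm_square[symmetric] field_simps)
  have add: "torus_char z (p + r) = torus_char z p + torus_char z r" for p r
    unfolding torus_char_def using C.lincomb_add[of "\<lambda>m. z powi fst m" UNIV p r] by simp
  have sc: "torus_char z (cscale c p) = c * torus_char z p" for c p
    unfolding torus_char_def using C.lincomb_cscale[of "\<lambda>m. z powi fst m" p c] by simp
  have null: "torus_char z 0 = 0" unfolding torus_char_def by simp
  have m1: "torus_char z (Poly_Mapping.single m c * r) = torus_char z (Poly_Mapping.single m c) * torus_char z r" for m c r
    by (induction r rule: poly_mapping_induct)
      (simp_all add: null add mult_single torus_char_single distrib_left power_int_add z0)
  have mult: "torus_char z (p * r) = torus_char z p * torus_char z r" for p r
    by (induction p rule: poly_mapping_induct) (simp_all add: null add m1 distrib_right)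
  have star: "torus_char z (star torus p) = cnj (torus_char z p)" for p
  proof (induction p rule: poly_mapping_induct)
    case zero
    then show ?case using T.star_zero by (simp add: null)
  next
    case (single m c)
    have "cnj (z powi k) = z powi (- k)" for k
      by (simp add: power_int_minus power_int_def cz power_inverse)
    then show ?case by (simp add: star_torus_single torus_char_single)
  next
    case (add p r)
    then show ?case using T.star_add[of p r] by (simp add: \<open>\<And>r p. torus_char z (p + r) = torus_char z p + torus_char z r\<close>)
  qed
  have one: "torus_char z 1 = 1"
    unfolding single_one[symmetric] torus_char_single by simp
  show ?thesis by (rule star_homI[OF linear_onI]) (simp_all add: add sc mult star one)
qed

section \<open>The coactions\<close>

locale quantum_flag =
  fixes q :: real assumes q: "0 < q" "q < 1"
begin

abbreviation "A \<equiv> SU q"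
abbreviation "H \<equiv> U2 q"
abbreviation "C \<equiv> CP1 q"
abbreviation "T \<equiv> torus"

lemma sA: "star_algebra A" by (rule star_algebra_SU[OF q_nonzero[OF q]])
lemma sH: "star_algebra H" by (rule star_algebra_U2)
lemma sT: "star_algebra T" by (rule star_algebra_torus)

interpretation A: star_algebra A by (rule sA)
interpretation H: star_algebra H by (rule sH)
interpretation T: star_algebra T by (rule sT)

lemmas cA = A.complex_space_axioms and cH = H.complex_space_axioms and cT = T.complex_space_axioms

lemma u_closed [simp]: "su_u q i j \<in> carrier A"
  by (rule su_matrixD(1)[OF su_matrix_SU[OF q_nonzero[OF q]]])

lemma v_closed [simp]: "u2_v q i j \<in> carrier H"
  by (rule su_matrixD(1)[OF su_matrix_u2_v[OF q]])

lemma rho: "star_hom A (tensor A H) (rho q)"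
  and rho_u: "rho q (su_u q i j) = (\<Oplus>\<^bsub>tensor A H\<^esub>k\<in>UNIV. pure_tensor A H (su_u q i k) (u2_v q k j))"
proof -
  note m = star_hom_tensor_map[OF sA sA sA sH star_hom_id proj[OF q]]
  show "star_hom A (tensor A H) (rho q)"
    unfolding rho_def[abs_def] by (rule star_hom_comp[OF Delta_SU[OF q_nonzero[OF q]] m])
  show "rho q (su_u q i j) = (\<Oplus>\<^bsub>tensor A H\<^esub>k\<in>UNIV. pure_tensor A H (su_u q i k) (u2_v q k j))"
    unfolding rho_def Delta_SU_u[OF q_nonzero[OF q]]
    by (subst linear_sum[OF star_hom_linear[OF m] complex_space_tensor complex_space_tensor])
      (simp_all add: tensor_map_pure[OF cA cA linear_on_id star_hom_linear[OF proj[OF q]]] proj_u[OF q])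
qed

lemma torus_diag_sum:
  assumes "complex_space V" "\<And>k. f k \<in> carrier V"
  shows "(\<Oplus>\<^bsub>tensor V T\<^esub>k\<in>UNIV. pure_tensor V T (f k) (torus_diag k j)) = pure_tensor V T (f j) (torus_diag j j)"
proof -
  interpret VT: complex_space "tensor V T" by (rule complex_space_tensor)
  note z = pure_zero_right[OF assms(1) cT, simplified]
  show ?thesis by (cases j) (simp_all add: VT.finsum_idx z assms(2))
qed

lemma mu: "star_hom A (tensor A T) (mu q)"
  and mu_u: "mu q (su_u q i j) = pure_tensor A T (su_u q i j) (torus_diag j j)"
proof -
  note m = star_hom_tensor_map[OF sA sA sA sT star_hom_id pi0[OF q]]
  show "star_hom A (tensor A T) (mu q)"
    unfolding mu_def[abs_def] by (rule star_hom_comp[OF Delta_SU[OF q_nonzero[OF q]] m])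
  have "mu q (su_u q i j) = (\<Oplus>\<^bsub>tensor A T\<^esub>k\<in>UNIV. pure_tensor A T (su_u q i k) (torus_diag k j))"
    unfolding mu_def Delta_SU_u[OF q_nonzero[OF q]]
    by (subst linear_sum[OF star_hom_linear[OF m] complex_space_tensor complex_space_tensor])
      (simp_all add: tensor_map_pure[OF cA cA linear_on_id star_hom_linear[OF pi0[OF q]]] pi0_u[OF q])
  then show "mu q (su_u q i j) = pure_tensor A T (su_u q i j) (torus_diag j j)"
    by (simp add: torus_diag_sum[OF cA])
qed

lemma nu: "star_hom H (tensor H T) (nu q)"
  and nu_v: "nu q (u2_v q i j) = pure_tensor H T (u2_v q i j) (torus_diag j j)"
proof -
  note m = star_hom_tensor_map[OF sH sH sH sT star_hom_id pi1[OF q]]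
  show "star_hom H (tensor H T) (nu q)"
    unfolding nu_def[abs_def] by (rule star_hom_comp[OF Delta_U2[OF q] m])
  have "nu q (u2_v q i j) = (\<Oplus>\<^bsub>tensor H T\<^esub>k\<in>UNIV. pure_tensor H T (u2_v q i k) (torus_diag k j))"
    unfolding nu_def Delta_U2_v[OF q]
    by (subst linear_sum[OF star_hom_linear[OF m] complex_space_tensor complex_space_tensor])
      (simp_all add: tensor_map_pure[OF cH cH linear_on_id star_hom_linear[OF pi1[OF q]]] pi1_v[OF q])
  then show "nu q (u2_v q i j) = pure_tensor H T (u2_v q i j) (torus_diag j j)"
    by (simp add: torus_diag_sum[OF cH])
qed

text \<open>Both sides are star-homomorphisms, so it is enough to compare them on the entries of the fundamental matrix. The same holds for
  the three compatibility statements that follow.\<close>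

lemma mu_eq_rho:
  assumes "x \<in> carrier A" shows "mu q x = tensor_map A H A T (\<lambda>y. y) (pi1 q) (rho q x)"
proof (rule SU_star_hom_eqI[OF q_nonzero[OF q] mu _ _ assms])
  note m = star_hom_tensor_map[OF sA sH sA sT star_hom_id pi1[OF q]]
  show "star_hom A (tensor A T) (\<lambda>x. tensor_map A H A T (\<lambda>y. y) (pi1 q) (rho q x))" by (rule star_hom_comp[OF rho m])
  show "mu q (su_u q i j) = tensor_map A H A T (\<lambda>y. y) (pi1 q) (rho q (su_u q i j))" for i j
    unfolding rho_u mu_u
    by (subst linear_sum[OF star_hom_linear[OF m] complex_space_tensor complex_space_tensor])
      (simp_all add: tensor_map_pure[OF cA cH linear_on_id star_hom_linear[OF pi1[OF q]]] pi1_v[OF q] torus_diag_sum[OF cA])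
qed

lemma assoc_sum_v:
  assumes V: "complex_space V" and W: "complex_space W" and f: "\<And>k. f k \<in> carrier V" and y: "y \<in> carrier W"
  shows "tensor_assoc V H W (pure_tensor (tensor V H) W (\<Oplus>\<^bsub>tensor V H\<^esub>k\<in>UNIV. pure_tensor V H (f k) (u2_v q k j)) y) =
    (\<Oplus>\<^bsub>tensor V (tensor H W)\<^esub>k\<in>UNIV. pure_tensor V (tensor H W) (f k) (pure_tensor H W (u2_v q k j) y))"
  by (simp add: pure_sum_left[OF complex_space_tensor W y] f
     linear_sum[OF tensor_assoc_linear[OF V cH W] complex_space_tensor complex_space_tensor] y tensor_assoc_pure[OF V cH W])

lemma rho_nu:
  assumes "x \<in> carrier A"
  shows "tensor_map A H A (tensor H T) (\<lambda>y. y) (nu q) (rho q x) = tensor_assoc A H T (tensor_map A T (tensor A H) T (rho q) (\<lambda>y. y) (mu q x))"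
proof (rule SU_star_hom_eqI[OF q_nonzero[OF q] _ _ _ assms])
  note m = star_hom_tensor_map[OF sA sH sA star_algebra_tensor[OF sH sT] star_hom_id nu]
  note r = star_hom_tensor_map[OF sA sT star_algebra_tensor[OF sA sH] sT rho star_hom_id]
  show "star_hom A (tensor A (tensor H T)) (\<lambda>x. tensor_map A H A (tensor H T) (\<lambda>y. y) (nu q) (rho q x))"
    by (rule star_hom_comp[OF rho m])
  show "star_hom A (tensor A (tensor H T)) (\<lambda>x. tensor_assoc A H T (tensor_map A T (tensor A H) T (rho q) (\<lambda>y. y) (mu q x)))"
    by (rule star_hom_comp[OF star_hom_comp[OF mu r] star_hom_tensor_assoc[OF sA sH sT]])
  fix i j
  have "tensor_map A H A (tensor H T) (\<lambda>y. y) (nu q) (rho q (su_u q i j)) =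
    (\<Oplus>\<^bsub>tensor A (tensor H T)\<^esub>k\<in>UNIV. pure_tensor A (tensor H T) (su_u q i k) (pure_tensor H T (u2_v q k j) (torus_diag j j)))"
    unfolding rho_u by (subst linear_sum[OF star_hom_linear[OF m] complex_space_tensor complex_space_tensor])
      (simp_all add: tensor_map_pure[OF cA cH linear_on_id star_hom_linear[OF nu]] nu_v)
  also have "\<dots> = tensor_assoc A H T (tensor_map A T (tensor A H) T (rho q) (\<lambda>y. y) (mu q (su_u q i j)))"
    by (simp add: mu_u tensor_map_pure[OF cA cT star_hom_linear[OF rho] linear_on_id] rho_u assoc_sum_v[OF cA cT])
  finally show "tensor_map A H A (tensor H T) (\<lambda>y. y) (nu q) (rho q (su_u q i j)) = tensor_assoc A H T (tensor_map A T (tensor A H) T (rho q) (\<lambda>y. y) (mu q (su_u q i j)))" .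
qed

lemma Delta_nu:
  assumes "x \<in> carrier H"
  shows "tensor_map H H H (tensor H T) (\<lambda>y. y) (nu q) (Delta_U2 q x) = tensor_assoc H H T (tensor_map H T (tensor H H) T (Delta_U2 q) (\<lambda>y. y) (nu q x))"
proof (rule U2_star_hom_eqI[OF _ _ _ assms])
  note D = Delta_U2[OF q]
  note m = star_hom_tensor_map[OF sH sH sH star_algebra_tensor[OF sH sT] star_hom_id nu]
  note r = star_hom_tensor_map[OF sH sT star_algebra_tensor[OF sH sH] sT D star_hom_id]
  show "star_hom H (tensor H (tensor H T)) (\<lambda>x. tensor_map H H H (tensor H T) (\<lambda>y. y) (nu q) (Delta_U2 q x))"
    by (rule star_hom_comp[OF D m])
  show "star_hom H (tensor H (tensor H T)) (\<lambda>x. tensor_assoc H H T (tensor_map H T (tensor H H) T (Delta_U2 q) (\<lambda>y. y) (nu q x)))"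
    by (rule star_hom_comp[OF star_hom_comp[OF nu r] star_hom_tensor_assoc[OF sH sH sT]])
  fix i j
  have "tensor_map H H H (tensor H T) (\<lambda>y. y) (nu q) (Delta_U2 q (u2_v q i j)) =
    (\<Oplus>\<^bsub>tensor H (tensor H T)\<^esub>k\<in>UNIV. pure_tensor H (tensor H T) (u2_v q i k) (pure_tensor H T (u2_v q k j) (torus_diag j j)))"
    unfolding Delta_U2_v[OF q] by (subst linear_sum[OF star_hom_linear[OF m] complex_space_tensor complex_space_tensor])
      (simp_all add: tensor_map_pure[OF cH cH linear_on_id star_hom_linear[OF nu]] nu_v)
  also have "\<dots> = tensor_assoc H H T (tensor_map H T (tensor H H) T (Delta_U2 q) (\<lambda>y. y) (nu q (u2_v q i j)))"
    by (simp add: nu_v tensor_map_pure[OF cH cT star_hom_linear[OF D] linear_on_id] Delta_U2_v[OF q] assoc_sum_v[OF cH cT])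
  finally show "tensor_map H H H (tensor H T) (\<lambda>y. y) (nu q) (Delta_U2 q (u2_v q i j)) = tensor_assoc H H T (tensor_map H T (tensor H H) T (Delta_U2 q) (\<lambda>y. y) (nu q (u2_v q i j)))" .
qed

lemma rho_coassoc:
  assumes "x \<in> carrier A"
  shows "tensor_map A H A (tensor H H) (\<lambda>y. y) (Delta_U2 q) (rho q x) = tensor_assoc A H H (tensor_map A H (tensor A H) H (rho q) (\<lambda>y. y) (rho q x))"
proof (rule SU_star_hom_eqI[OF q_nonzero[OF q] _ _ _ assms])
  note D = Delta_U2[OF q]
  note m = star_hom_tensor_map[OF sA sH sA star_algebra_tensor[OF sH sH] star_hom_id D]
  note r = star_hom_tensor_map[OF sA sH star_algebra_tensor[OF sA sH] sH rho star_hom_id]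
  note a = star_hom_tensor_assoc[OF sA sH sH]
  show "star_hom A (tensor A (tensor H H)) (\<lambda>x. tensor_map A H A (tensor H H) (\<lambda>y. y) (Delta_U2 q) (rho q x))"
    by (rule star_hom_comp[OF rho m])
  show "star_hom A (tensor A (tensor H H)) (\<lambda>x. tensor_assoc A H H (tensor_map A H (tensor A H) H (rho q) (\<lambda>y. y) (rho q x)))"
    by (rule star_hom_comp[OF star_hom_comp[OF rho r] a])
  fix i j
  let ?T = "tensor A (tensor H H)"
  have "tensor_map A H A (tensor H H) (\<lambda>y. y) (Delta_U2 q) (rho q (su_u q i j)) =
    (\<Oplus>\<^bsub>?T\<^esub>l\<in>UNIV. pure_tensor A (tensor H H) (su_u q i l) (\<Oplus>\<^bsub>tensor H H\<^esub>k\<in>UNIV. pure_tensor H H (u2_v q l k) (u2_v q k j)))"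
    unfolding rho_u by (subst linear_sum[OF star_hom_linear[OF m] complex_space_tensor complex_space_tensor])
      (simp_all add: tensor_map_pure[OF cA cH linear_on_id star_hom_linear[OF D]] Delta_U2_v[OF q])
  also have "\<dots> = (\<Oplus>\<^bsub>?T\<^esub>l\<in>UNIV. \<Oplus>\<^bsub>?T\<^esub>k\<in>UNIV. pure_tensor A (tensor H H) (su_u q i l) (pure_tensor H H (u2_v q l k) (u2_v q k j)))"
    by (simp add: pure_sum_right[OF cA complex_space_tensor])
  also have "\<dots> = (\<Oplus>\<^bsub>?T\<^esub>k\<in>UNIV. \<Oplus>\<^bsub>?T\<^esub>l\<in>UNIV. pure_tensor A (tensor H H) (su_u q i l) (pure_tensor H H (u2_v q l k) (u2_v q k j)))"
    by (rule finsum_idx_swap[OF complex_space_tensor]) simp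
  also have "\<dots> = (\<Oplus>\<^bsub>?T\<^esub>k\<in>UNIV. tensor_assoc A H H (pure_tensor (tensor A H) H (rho q (su_u q i k)) (u2_v q k j)))"
    by (simp add: rho_u assoc_sum_v[OF cA cH])
  also have "\<dots> = tensor_assoc A H H (\<Oplus>\<^bsub>tensor (tensor A H) H\<^esub>k\<in>UNIV. pure_tensor (tensor A H) H (rho q (su_u q i k)) (u2_v q k j))"
    by (rule linear_sum[OF star_hom_linear[OF a] complex_space_tensor complex_space_tensor, symmetric])
      (simp add: star_hom_closed[OF rho])
  also have "(\<Oplus>\<^bsub>tensor (tensor A H) H\<^esub>k\<in>UNIV. pure_tensor (tensor A H) H (rho q (su_u q i k)) (u2_v q k j)) =
      tensor_map A H (tensor A H) H (rho q) (\<lambda>y. y) (rho q (su_u q i j))"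
    unfolding rho_u[of i j] by (subst linear_sum[OF star_hom_linear[OF r] complex_space_tensor complex_space_tensor])
      (simp_all add: tensor_map_pure[OF cA cH star_hom_linear[OF rho] linear_on_id])
  finally show "tensor_map A H A (tensor H H) (\<lambda>y. y) (Delta_U2 q) (rho q (su_u q i j)) = tensor_assoc A H H (tensor_map A H (tensor A H) H (rho q) (\<lambda>y. y) (rho q (su_u q i j)))" .
qed

section \<open>The projection onto the coinvariants\<close>

text \<open>The elements on which the torus acts through a single character; the algebra \<open>C\<close> is the one of weight zero.\<close>

definition wtH :: "int \<times> int \<Rightarrow> uq2_gen free set set" where
  "wtH k = {a \<in> carrier H. nu q a = pure_tensor H T a (Poly_Mapping.single k 1)}"

lemma graded_H: "graded H wtH"
proof (rule graded.intro[OF sH], rule graded_axioms.intro)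
  fix a b i j c
  assume a: "a \<in> wtH i"
  then have ac: "a \<in> carrier H" and an: "nu q a = pure_tensor H T a (Poly_Mapping.single i 1)" by (simp_all add: wtH_def)
  show "a \<in> carrier H" by fact
  show "c \<odot>\<^bsub>H\<^esub> a \<in> wtH i"
    using ac by (simp add: wtH_def star_hom_smult[OF nu] an pure_tensor_simps)
  show "star H a \<in> wtH (- i)"
    using ac by (simp add: wtH_def star_hom_star[OF nu] an pure_tensor_star[OF sH sT] star_torus_single)
  assume b: "b \<in> wtH j"
  then have bc: "b \<in> carrier H" and bn: "nu q b = pure_tensor H T b (Poly_Mapping.single j 1)" by (simp_all add: wtH_def)
  show "a \<otimes>\<^bsub>H\<^esub> b \<in> wtH (i + j)"
    using ac bc by (simp add: wtH_def star_hom_mult[OF nu] an bn pure_tensor_mult[OF sH sT] mult_single)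
next
  show "\<one>\<^bsub>H\<^esub> \<in> wtH 0"
    using star_hom_one[OF nu] tensor_one[OF sH sT] by (simp add: wtH_def)
qed

lemma wtH_span: "x \<in> carrier H \<Longrightarrow> x \<in> graded_span H wtH"
proof -
  interpret G: graded H wtH by (rule graded_H)
  note f = star_hom_u2_cls[of q]
  have v: "u2_v q j j \<in> graded_span H wtH" "u2_v q I3 I2 \<in> graded_span H wtH" for j
  proof -
    have "\<exists>m. torus_diag j j = Poly_Mapping.single m 1" for j by (cases j) auto
    then have "\<exists>m. u2_v q i j \<in> wtH m" for i j by (simp add: wtH_def nu_v) metis
    then show "u2_v q j j \<in> graded_span H wtH" "u2_v q I3 I2 \<in> graded_span H wtH" using G.wt_span by blast+
  qed
  have gen: "u2_cls q (gen g) \<in> graded_span H wtH" for g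
    using v(1)[of I1] v(1)[of I2] v(2) by (cases g) (simp_all add: u2_v_matrix)
  have "u2_cls q p \<in> graded_span H wtH" for p
  proof (induction p rule: free_induct)
    case (const c)
    show ?case using star_hom_const[OF f, of c] G.span_smult[OF G.wt_span[OF G.wt_one], of c] by simp
  next
    case (gen_star g)
    show ?case using star_hom_star[OF f, of "gen g"] G.span_star[OF gen[of g]] by simp
  next
    case (add p r)
    show ?case using star_hom_add[OF f, of p r] G.span_add[OF add] by simp
  next
    case (mult p r)
    show ?case using star_hom_mult[OF f, of p r] G.span_mult[OF mult] by simp
  qed (rule gen)
  then show "x \<in> carrier H \<Longrightarrow> x \<in> graded_span H wtH" unfolding carrier_U2 by auto
qed

lemma linear_lookup: "linear_on T complex_alg (\<lambda>t. Poly_Mapping.lookup t 0)"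
  by (rule linear_onI) (simp_all add: lookup_add)

text \<open>The conditional expectation onto the torus invariants. It is the average over the torus,
  computed algebraically as the constant coefficient in the torus leg.\<close>

definition expect :: "uq2_gen free set \<Rightarrow> uq2_gen free set" where
  "expect a = slice H T (\<lambda>t. Poly_Mapping.lookup t 0) (nu q a)"

lemma linear_expect_H: "linear_on H H expect"
  unfolding expect_def[abs_def] by (rule linear_on_comp[OF star_hom_linear[OF nu] slice_linear[OF cH cT linear_lookup]])

lemma expect_wt: "a \<in> wtH k \<Longrightarrow> expect a = (if k = 0 then a else \<zero>\<^bsub>H\<^esub>)"
  by (simp add: expect_def wtH_def slice_pure[OF cH cT linear_lookup] lookup_single)

lemma C_simps [simp]:
  "monoid.mult C = monoid.mult H" "one C = one H" "zero C = zero H" "add C = add H" "smult C = smult H" "star C = star H"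
  by (simp_all add: CP1_def)

lemma carrier_C: "carrier C = wtH 0"
  by (simp add: CP1_def wtH_def)

lemma C_sub: "x \<in> carrier C \<Longrightarrow> x \<in> carrier H"
  by (simp add: carrier_C wtH_def)

lemma nu_C: "x \<in> carrier C \<Longrightarrow> nu q x = pure_tensor H T x \<one>\<^bsub>T\<^esub>"
  by (simp add: carrier_C wtH_def)

lemma cC: "complex_space C"
proof -
  have eq: "C = H\<lparr>carrier := wtH 0\<rparr>" by (simp add: CP1_def wtH_def)
  note f = nu
  show ?thesis unfolding eq
  proof (rule complex_space_subspace[OF cH])
    show "\<zero>\<^bsub>H\<^esub> \<in> wtH 0"
      using linear_on_zero[OF star_hom_linear[OF nu] cH complex_space_tensor] pure_zero_left[OF cH cT, of "Poly_Mapping.single 0 1"]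
      by (simp add: wtH_def)
    show "x \<oplus>\<^bsub>H\<^esub> y \<in> wtH 0" if "x \<in> wtH 0" "y \<in> wtH 0" for x y
      using that by (simp add: wtH_def star_hom_add[OF nu] pure_tensor_simps)
    show "c \<odot>\<^bsub>H\<^esub> x \<in> wtH 0" if "x \<in> wtH 0" for c x
      using that by (simp add: wtH_def star_hom_smult[OF nu] pure_tensor_simps)
  qed (auto simp: wtH_def)
qed

interpretation C: complex_space C by (rule cC)

lemma expect_C: "x \<in> carrier C \<Longrightarrow> expect x = x"
  using expect_wt[of x 0] by (simp add: carrier_C)

text \<open>\<open>H\<close> is spanned by elements of fixed weight, and those of nonzero weight are sent to zero.\<close>

lemma expect_closed: "x \<in> carrier H \<Longrightarrow> expect x \<in> carrier C"
proof -
  interpret G: graded H wtH by (rule graded_H)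
  have "x \<in> graded_span H wtH \<Longrightarrow> expect x \<in> carrier C" for x
  proof (induction rule: graded_span.induct)
    case zero
    then show ?case using linear_on_zero[OF linear_expect_H cH cH] C.zero_closed by simp
  next
    case (add a i b)
    have "expect a \<in> carrier C" using expect_wt[OF add(1)] add(1) C.zero_closed by (auto simp: carrier_C)
    moreover have "expect (a \<oplus>\<^bsub>H\<^esub> b) = expect a \<oplus>\<^bsub>H\<^esub> expect b"
      using linear_on_add[OF linear_expect_H G.wt_closed[OF add(1)] G.span_closed[OF add(2)]] .
    ultimately show ?case using C.a_closed add(3) by simp
  qed
  then show "x \<in> carrier H \<Longrightarrow> expect x \<in> carrier C" using wtH_span by blast
qed

lemma linear_expect: "linear_on H C expect"
  using expect_closed linear_on_add[OF linear_expect_H] linear_on_smult[OF linear_expect_H] by (intro linear_onI) simp_all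

lemma linear_incl: "linear_on C H (\<lambda>y. y)"
  by (rule linear_onI) (simp_all add: C_sub)

text \<open>\<open>id \<otimes> expect\<close> and \<open>id \<otimes> incl\<close>. The first is a left inverse of the second, so \<open>V \<otimes> C\<close> embeds into
  \<open>V \<otimes> H\<close>; this is how the cotensor condition, an equation in \<open>A \<otimes> (H \<otimes> C)\<close>, is compared with
  equations in \<open>A \<otimes> (H \<otimes> H)\<close>.\<close>

definition tE where "tE V = tensor_map V H V C (\<lambda>y. y) expect"
definition tI where "tI V = tensor_map V C V H (\<lambda>y. y) (\<lambda>y. y)"

lemma tE: assumes "complex_space V"
  shows linear_tE: "linear_on (tensor V H) (tensor V C) (tE V)"
    and tE_pure: "x \<in> carrier V \<Longrightarrow> y \<in> carrier H \<Longrightarrow> tE V (pure_tensor V H x y) = pure_tensor V C x (expect y)"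
  unfolding tE_def using tensor_map[OF assms cH linear_on_id linear_expect] by auto

lemma tI: assumes "complex_space V"
  shows linear_tI: "linear_on (tensor V C) (tensor V H) (tI V)"
    and tI_pure: "x \<in> carrier V \<Longrightarrow> y \<in> carrier C \<Longrightarrow> tI V (pure_tensor V C x y) = pure_tensor V H x y"
  unfolding tI_def using tensor_map[OF assms cC linear_on_id linear_incl] by auto

lemma tE_tI:
  assumes V: "complex_space V" and X: "X \<in> carrier (tensor V C)" shows "tE V (tI V X) = X"
  by (rule linear_on_tensor_eqI[OF linear_on_comp[OF linear_tI[OF V] linear_tE[OF V]] linear_on_id V cC _ X])
    (simp add: tI_pure[OF V] tE_pure[OF V] C_sub expect_C)

text \<open>Taking the constant coefficient in the torus leg of the hypothesis turns its left side into \<open>(id \<otimes> expect) Z\<close>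
  and its right side into \<open>Z\<close>.\<close>

lemma tI_tE:
  assumes V: "complex_space V" and Z: "Z \<in> carrier (tensor V H)"
    and inv: "tensor_map V H V (tensor H T) (\<lambda>y. y) (nu q) Z = tensor_assoc V H T (pure_tensor (tensor V H) T Z \<one>\<^bsub>T\<^esub>)"
  shows "tI V (tE V Z) = Z"
proof -
  let ?s = "slice H T (\<lambda>t. Poly_Mapping.lookup t 0)"
  note sl = slice[OF cH cT linear_lookup]
  note tm = tensor_map[OF V complex_space_tensor linear_on_id sl(1)]
  note nm = tensor_map[OF V cH linear_on_id star_hom_linear[OF nu]]
  note as = tensor_assoc[OF V cH cT]
  let ?h = "tensor_map V (tensor H T) V H (\<lambda>y. y) ?s"
  have "tI V (tE V Z) = ?h (tensor_map V H V (tensor H T) (\<lambda>y. y) (nu q) Z)"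
    by (rule linear_on_tensor_eqI[OF linear_on_comp[OF linear_tE[OF V] linear_tI[OF V]] linear_on_comp[OF nm(1) tm(1)] V cH _ Z])
      (simp add: tE_pure[OF V] tI_pure[OF V] expect_closed nm(2) tm(2) star_hom_closed[OF nu], simp add: expect_def)
  also have "\<dots> = ?h (tensor_assoc V H T (pure_tensor (tensor V H) T Z \<one>\<^bsub>T\<^esub>))" unfolding inv ..
  also have "\<dots> = Z"
    by (rule linear_on_tensor_eqI[OF linear_on_comp[OF linear_on_comp[OF bilinear_onD(1)[OF bilinear_pure_tensor T.one_closed] as(1)] tm(1)] linear_on_id V cH _ Z])
      (simp add: as(2) tm(2) sl(2) del: torus_simps(3), simp)
  finally show ?thesis .
qed

lemma tI_tE_rho:
  assumes f: "f \<in> carrier (flag q)" shows "tI A (tE A (rho q f)) = rho q f"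
proof (rule tI_tE[OF cA])
  have fA: "f \<in> carrier A" and fm: "mu q f = pure_tensor A T f \<one>\<^bsub>T\<^esub>" using f by (simp_all add: flag_def)
  show "rho q f \<in> carrier (tensor A H)" by (rule star_hom_closed[OF rho fA])
  show "tensor_map A H A (tensor H T) (\<lambda>y. y) (nu q) (rho q f) = tensor_assoc A H T (pure_tensor (tensor A H) T (rho q f) \<one>\<^bsub>T\<^esub>)"
    unfolding rho_nu[OF fA] fm using fA by (simp add: tensor_map_pure[OF cA cT star_hom_linear[OF rho] linear_on_id])
qed

lemma tI_tE_Delta:
  assumes a: "a \<in> carrier C" shows "tI H (tE H (Delta_U2 q a)) = Delta_U2 q a"
proof (rule tI_tE[OF cH])
  note D = Delta_U2[OF q]
  show "Delta_U2 q a \<in> carrier (tensor H H)" by (rule star_hom_closed[OF D C_sub[OF a]])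
  show "tensor_map H H H (tensor H T) (\<lambda>y. y) (nu q) (Delta_U2 q a) = tensor_assoc H H T (pure_tensor (tensor H H) T (Delta_U2 q a) \<one>\<^bsub>T\<^esub>)"
    unfolding Delta_nu[OF C_sub[OF a]] nu_C[OF a] using C_sub[OF a] by (simp add: tensor_map_pure[OF cH cT star_hom_linear[OF D] linear_on_id])
qed

lemma coaction_eq: assumes a: "a \<in> carrier C" shows "CP1_coaction q a = tE H (Delta_U2 q a)"
  unfolding CP1_coaction_def tI_def[symmetric]
proof (rule the_equality)
  have "Delta_U2 q a \<in> carrier (tensor H H)" by (rule star_hom_closed[OF Delta_U2[OF q] C_sub[OF a]])
  then show "tE H (Delta_U2 q a) \<in> carrier (tensor H C) \<and> tI H (tE H (Delta_U2 q a)) = Delta_U2 q a"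
    using tI_tE_Delta[OF a] linear_on_closed[OF linear_tE[OF cH]] by blast
  show "X = tE H (Delta_U2 q a)" if "X \<in> carrier (tensor H C) \<and> tI H X = Delta_U2 q a" for X
    using that tE_tI[OF cH, of X] by simp
qed

lemma linear_coaction: "linear_on C (tensor H C) (CP1_coaction q)"
  by (rule linear_on_cong[OF cC coaction_eq[symmetric]], assumption)
    (rule linear_on_comp[OF linear_incl linear_on_comp[OF star_hom_linear[OF Delta_U2[OF q]] linear_tE[OF cH]]])

lemma tI_coaction: "a \<in> carrier C \<Longrightarrow> tI H (CP1_coaction q a) = Delta_U2 q a"
  by (simp add: coaction_eq tI_tE_Delta)

section \<open>The counit and the isomorphism\<close>

text \<open>The counit is obtained from the torus, as evaluation at the neutral element after \<open>\<pi>\<^sub>1\<close>.\<close>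

definition counit :: "uq2_gen free set \<Rightarrow> complex" where
  "counit a = torus_char 1 (pi1 q a)"

lemma counit: "star_hom H complex_alg counit"
  unfolding counit_def[abs_def] by (rule star_hom_comp[OF pi1[OF q] star_hom_torus_char]) simp

lemma counit_v: "counit (u2_v q i j) = of_bool (i = j)"
proof -
  have z: "torus_char 1 0 = 0" using torus_char_single[of 1 0 0] by simp
  show ?thesis unfolding counit_def pi1_v[OF q] by (cases i; cases j) (simp_all add: torus_char_single z)
qed

lemma slice_v:
  assumes V: "complex_space V" and f: "\<And>k. f k \<in> carrier V"
  shows "slice V H counit (\<Oplus>\<^bsub>tensor V H\<^esub>k\<in>UNIV. pure_tensor V H (f k) (u2_v q k j)) = f j"
proof -
  interpret V: complex_space V by fact
  note s = slice[OF V cH star_hom_linear[OF counit]]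
  have "slice V H counit (\<Oplus>\<^bsub>tensor V H\<^esub>k\<in>UNIV. pure_tensor V H (f k) (u2_v q k j)) = (\<Oplus>\<^bsub>V\<^esub>k\<in>UNIV. of_bool (j = k) \<odot>\<^bsub>V\<^esub> f k)"
    by (subst linear_sum[OF s(1) complex_space_tensor V]) (simp_all add: f s(2) counit_v eq_commute[of _ j])
  then show ?thesis by (simp add: V.finsum_delta f)
qed

lemma slice_rho: assumes "x \<in> carrier A" shows "slice A H counit (rho q x) = x"
  by (rule SU_star_hom_eqI[OF q_nonzero[OF q] star_hom_comp[OF rho star_hom_slice[OF sA sH counit]] star_hom_id _ assms])
    (simp add: rho_u slice_v[OF cA])

lemma slice_Delta: assumes "x \<in> carrier H" shows "slice H H counit (Delta_U2 q x) = x"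
  by (rule U2_star_hom_eqI[OF star_hom_comp[OF Delta_U2[OF q] star_hom_slice[OF sH sH counit]] star_hom_id _ assms])
    (simp add: Delta_U2_v[OF q] slice_v[OF cH])

text \<open>Applying \<open>\<epsilon> \<otimes> id\<close> to \<open>\<nu>(x)\<close> gives \<open>\<pi>\<^sub>1(x)\<close> by counitality, and gives \<open>\<epsilon>(x) 1\<close> if \<open>x\<close> is invariant.\<close>

lemma pi1_C: assumes x: "x \<in> carrier C" shows "pi1 q x = cscale (counit x) 1"
proof -
  have b: "bilinear_on H T T (\<lambda>x t. cscale (counit x) t)"
    unfolding bilinear_on_def using linear_on_add[OF star_hom_linear[OF counit]] linear_on_smult[OF star_hom_linear[OF counit]]
    by (intro conjI ballI linear_onI) (simp_all add: cscale_add cscale_add_scalar cscale_cscale mult.commute)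
  note L = tensor_lift[OF cH cT cT b]
  let ?l = "tensor_lift H T T (\<lambda>x t. cscale (counit x) t)"
  have cm: "cscale c p * r = cscale c (p * r)" "p * cscale c r = cscale c (p * r)" for c and p r :: "int \<times> int \<Rightarrow>\<^sub>0 complex"
    using T.smult_mult_left[of p r c] T.smult_mult_right[of p r c] by simp_all
  have sc: "star T (cscale c p) = cscale (cnj c) (star T p)" for c p using T.star_smult[of p c] by simp
  have l: "star_hom (tensor H T) T ?l"
    by (rule star_hom_tensorI[OF sH sT sT L(1)])
      (simp_all add: L(2) star_hom_mult[OF counit] star_hom_one[OF counit] star_hom_star[OF counit] cm sc cscale_cscale mult.commute)
  have "?l (nu q x) = pi1 q x"
  proof (rule U2_star_hom_eqI[OF star_hom_comp[OF nu l] pi1[OF q] _ C_sub[OF x]])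
    show "?l (nu q (u2_v q i j)) = pi1 q (u2_v q i j)" for i j
      by (cases i; cases j) (simp_all add: nu_v L(2) counit_v pi1_v[OF q])
  qed
  then show ?thesis using x by (simp add: nu_C L(2) C_sub)
qed

text \<open>The coaction with its second leg regarded as an element of \<open>C\<close>, and the map \<open>id \<otimes> \<epsilon>\<close>.\<close>

definition flag_map where "flag_map f = tE A (rho q f)"
definition flag_inv where "flag_inv = slice A C counit"

lemma linear_counit_C: "linear_on C complex_alg counit"
  by (rule linear_on_comp[OF linear_incl star_hom_linear[OF counit]])

lemma flag_inv_tI: "X \<in> carrier (tensor A C) \<Longrightarrow> slice A H counit (tI A X) = flag_inv X"
  unfolding flag_inv_def
  by (rule linear_on_tensor_eqI[OF linear_on_comp[OF linear_tI[OF cA] slice_linear[OF cA cH star_hom_linear[OF counit]]] slice_linear[OF cA cC linear_counit_C] cA cC])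
    (simp_all add: tI_pure[OF cA] slice_pure[OF cA cH star_hom_linear[OF counit]] slice_pure[OF cA cC linear_counit_C] C_sub)

lemma flag_map_closed: "f \<in> carrier A \<Longrightarrow> flag_map f \<in> carrier (tensor A C)"
  unfolding flag_map_def by (intro linear_on_closed[OF linear_tE[OF cA]] star_hom_closed[OF rho])

lemma flag_sub: "f \<in> carrier (flag q) \<Longrightarrow> f \<in> carrier A"
  by (simp add: flag_def)

lemma flag_inv_map: "f \<in> carrier (flag q) \<Longrightarrow> flag_inv (flag_map f) = f"
  using flag_inv_tI[OF flag_map_closed[OF flag_sub]] tI_tE_rho slice_rho[OF flag_sub] by (simp add: flag_map_def)

abbreviation "left_side X \<equiv> tensor_assoc A H C (tensor_map A C (tensor A H) C (rho q) (\<lambda>y. y) X)"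
abbreviation "right_side X \<equiv> tensor_map A C A (tensor H C) (\<lambda>x. x) (CP1_coaction q) X"

lemma linear_left_side: "linear_on (tensor A C) (tensor A (tensor H C)) (\<lambda>X. left_side X)"
  by (rule linear_on_comp[OF tensor_map_linear[OF cA cC star_hom_linear[OF rho] linear_on_id] tensor_assoc_linear[OF cA cH cC]])

lemma linear_right_side: "linear_on (tensor A C) (tensor A (tensor H C)) (\<lambda>X. right_side X)"
  by (rule tensor_map_linear[OF cA cC linear_on_id linear_coaction])

lemma sides_pure:
  assumes "x \<in> carrier A" "y \<in> carrier C"
  shows "left_side (pure_tensor A C x y) = tensor_assoc A H C (pure_tensor (tensor A H) C (rho q x) y)"
    "right_side (pure_tensor A C x y) = pure_tensor A (tensor H C) x (CP1_coaction q y)"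
  using assms by (simp_all add: tensor_map_pure[OF cA cC star_hom_linear[OF rho] linear_on_id] tensor_map_pure[OF cA cC linear_on_id linear_coaction])

lemma cotensor_iff: "X \<in> cotensor A (rho q) H C (CP1_coaction q) \<longleftrightarrow> X \<in> carrier (tensor A C) \<and> left_side X = right_side X"
  unfolding cotensor_def by simp

text \<open>The same pair of maps in the last leg of a threefold tensor product.\<close>

definition tI2 where "tI2 = tensor_map A (tensor H C) A (tensor H H) (\<lambda>y. y) (tI H)"
definition tE2 where "tE2 = tensor_map A (tensor H H) A (tensor H C) (\<lambda>y. y) (tE H)"

lemmas tI2 = tensor_map[OF cA complex_space_tensor linear_on_id linear_tI[OF cH], folded tI2_def]
lemmas tE2 = tensor_map[OF cA complex_space_tensor linear_on_id linear_tE[OF cH], folded tE2_def]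

lemma tE2_tI2: assumes X: "X \<in> carrier (tensor A (tensor H C))" shows "tE2 (tI2 X) = X"
  by (rule linear_on_tensor_eqI[OF linear_on_comp[OF tI2(1) tE2(1)] linear_on_id cA complex_space_tensor _ X])
    (simp add: tI2(2) tE2(2) linear_on_closed[OF linear_tI[OF cH]] tE_tI[OF cH])

lemma tI2_left:
  assumes X: "X \<in> carrier (tensor A C)"
  shows "tI2 (left_side X) = tensor_assoc A H H (tensor_map A H (tensor A H) H (rho q) (\<lambda>y. y) (tI A X))"
proof (rule linear_on_tensor_eqI[OF linear_on_comp[OF linear_left_side tI2(1)] _ cA cC _ X])
  note rm = tensor_map[OF cA cH star_hom_linear[OF rho] linear_on_id]
  note aC = tensor_assoc[OF cA cH cC] and aH = tensor_assoc[OF cA cH cH]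
  show "linear_on (tensor A C) (tensor A (tensor H H)) (\<lambda>X. tensor_assoc A H H (tensor_map A H (tensor A H) H (rho q) (\<lambda>y. y) (tI A X)))"
    by (rule linear_on_comp[OF linear_on_comp[OF linear_tI[OF cA] rm(1)] aH(1)])
  fix x y assume xy: "x \<in> carrier A" "y \<in> carrier C"
  have "tI2 (tensor_assoc A H C (pure_tensor (tensor A H) C Z y)) = tensor_assoc A H H (pure_tensor (tensor A H) H Z y)"
    if Z: "Z \<in> carrier (tensor A H)" for Z
    by (rule linear_on_tensor_eqI[OF linear_on_comp[OF linear_on_comp[OF bilinear_onD(1)[OF bilinear_pure_tensor xy(2)] aC(1)] tI2(1)]
       linear_on_comp[OF bilinear_onD(1)[OF bilinear_pure_tensor C_sub[OF xy(2)]] aH(1)] cA cH _ Z])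
      (simp add: aC(2) aH(2) tI2(2) tI_pure[OF cH] xy C_sub)
  then show "tI2 (left_side (pure_tensor A C x y)) = tensor_assoc A H H (tensor_map A H (tensor A H) H (rho q) (\<lambda>y. y) (tI A (pure_tensor A C x y)))"
    using xy by (simp add: sides_pure tI_pure[OF cA] rm(2) C_sub star_hom_closed[OF rho])
qed

lemma tI2_right:
  assumes X: "X \<in> carrier (tensor A C)"
  shows "tI2 (right_side X) = tensor_map A H A (tensor H H) (\<lambda>y. y) (Delta_U2 q) (tI A X)"
  by (rule linear_on_tensor_eqI[OF linear_on_comp[OF linear_right_side tI2(1)] linear_on_comp[OF linear_tI[OF cA]
      tensor_map_linear[OF cA cH linear_on_id star_hom_linear[OF Delta_U2[OF q]]]] cA cC _ X])
    (simp add: sides_pure tI2(2) linear_on_closed[OF linear_coaction] tI_coaction tI_pure[OF cA] C_sub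
      tensor_map_pure[OF cA cH linear_on_id star_hom_linear[OF Delta_U2[OF q]]])

text \<open>After embedding the last leg into \<open>H\<close> the cotensor condition becomes the coassociativity of \<open>\<rho>\<close>, as
  the left coaction on \<open>C\<close> is a restriction of the comultiplication.\<close>

lemma flag_map_cotensor:
  assumes f: "f \<in> carrier (flag q)" shows "flag_map f \<in> cotensor A (rho q) H C (CP1_coaction q)"
proof -
  have X: "flag_map f \<in> carrier (tensor A C)" by (rule flag_map_closed[OF flag_sub[OF f]])
  have "tI2 (left_side (flag_map f)) = tI2 (right_side (flag_map f))"
    unfolding tI2_left[OF X] tI2_right[OF X] unfolding flag_map_def tI_tE_rho[OF f] rho_coassoc[OF flag_sub[OF f]] ..
  then have "tE2 (tI2 (left_side (flag_map f))) = tE2 (tI2 (right_side (flag_map f)))" by simp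
  then have "left_side (flag_map f) = right_side (flag_map f)"
    using tE2_tI2[OF linear_on_closed[OF linear_left_side X]] tE2_tI2[OF linear_on_closed[OF linear_right_side X]] by simp
  then show ?thesis using X unfolding cotensor_iff by simp
qed

text \<open>Apply \<open>id \<otimes> id \<otimes> \<epsilon>\<close> to the cotensor condition: the left side becomes \<open>\<rho>((id \<otimes> \<epsilon>) X)\<close>, and the right side
  becomes \<open>X\<close> by counitality of the comultiplication.\<close>

lemma rho_flag_inv:
  assumes X: "X \<in> cotensor A (rho q) H C (CP1_coaction q)" shows "rho q (flag_inv X) = tI A X"
proof -
  have Xc: "X \<in> carrier (tensor A C)" and eq: "left_side X = right_side X" using X unfolding cotensor_iff by simp_all
  note sC = slice[OF cH cC linear_counit_C] and sl = slice[OF cA cC linear_counit_C]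
  note g = tensor_map[OF cA complex_space_tensor linear_on_id sC(1)]
  let ?g = "tensor_map A (tensor H C) A H (\<lambda>y. y) (slice H C counit)"
  note aC = tensor_assoc[OF cA cH cC]
  have "?g (left_side X) = rho q (flag_inv X)"
    unfolding flag_inv_def
  proof (rule linear_on_tensor_eqI[OF linear_on_comp[OF linear_left_side g(1)] linear_on_comp[OF sl(1) star_hom_linear[OF rho]] cA cC _ Xc])
    fix x y assume xy: "x \<in> carrier A" "y \<in> carrier C"
    interpret AH: complex_space "tensor A H" by (rule complex_space_tensor)
    have lin: "linear_on (tensor A H) (tensor A H) (\<lambda>Z. counit y \<odot>\<^bsub>tensor A H\<^esub> Z)"
      by (rule linear_onI) (simp_all add: AH.smult_add mult.commute)
    have "?g (tensor_assoc A H C (pure_tensor (tensor A H) C Z y)) = counit y \<odot>\<^bsub>tensor A H\<^esub> Z"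
      if Z: "Z \<in> carrier (tensor A H)" for Z
      by (rule linear_on_tensor_eqI[OF linear_on_comp[OF linear_on_comp[OF bilinear_onD(1)[OF bilinear_pure_tensor xy(2)] aC(1)] g(1)] lin cA cH _ Z])
        (simp add: aC(2) g(2) sC(2) xy pure_tensor_simps)
    then show "?g (left_side (pure_tensor A C x y)) = rho q (slice A C counit (pure_tensor A C x y))"
      using xy by (simp add: sides_pure sl(2) star_hom_closed[OF rho] star_hom_smult[OF rho])
  qed
  moreover have "?g (right_side X) = tI A X"
  proof (rule linear_on_tensor_eqI[OF linear_on_comp[OF linear_right_side g(1)] linear_tI[OF cA] cA cC _ Xc])
    fix x y assume xy: "x \<in> carrier A" "y \<in> carrier C"
    note sH' = slice[OF cH cH star_hom_linear[OF counit]]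
    have "slice H C counit Y = slice H H counit (tI H Y)" if Y: "Y \<in> carrier (tensor H C)" for Y
      by (rule linear_on_tensor_eqI[OF sC(1) linear_on_comp[OF linear_tI[OF cH] sH'(1)] cH cC _ Y])
        (simp add: sC(2) tI_pure[OF cH] sH'(2) C_sub)
    then have "slice H C counit (CP1_coaction q y) = y"
      using xy by (simp add: linear_on_closed[OF linear_coaction] tI_coaction slice_Delta C_sub)
    then show "?g (right_side (pure_tensor A C x y)) = tI A (pure_tensor A C x y)"
      using xy by (simp add: sides_pure g(2) linear_on_closed[OF linear_coaction] tI_pure[OF cA])
  qed
  ultimately show ?thesis using eq by simp
qed

text \<open>\<open>\<mu>\<close> is \<open>\<rho>\<close> followed by \<open>\<pi>\<^sub>1\<close> in the second leg; on \<open>X\<close>, whose second leg is in \<open>C\<close>, this has the same effect as \<open>\<epsilon>\<close>.\<close>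

lemma flag_inv_closed:
  assumes X: "X \<in> cotensor A (rho q) H C (CP1_coaction q)" shows "flag_inv X \<in> carrier (flag q)"
proof -
  have Xc: "X \<in> carrier (tensor A C)" using X unfolding cotensor_iff by simp
  note sl = slice[OF cA cC linear_counit_C]
  note p = tensor_map[OF cA cH linear_on_id star_hom_linear[OF pi1[OF q]]]
  have fA: "flag_inv X \<in> carrier A" unfolding flag_inv_def by (rule linear_on_closed[OF sl(1) Xc])
  have "tensor_map A H A T (\<lambda>y. y) (pi1 q) (tI A X) = pure_tensor A T (flag_inv X) \<one>\<^bsub>T\<^esub>"
    unfolding flag_inv_def
    by (rule linear_on_tensor_eqI[OF linear_on_comp[OF linear_tI[OF cA] p(1)] linear_on_comp[OF sl(1) bilinear_onD(1)[OF bilinear_pure_tensor T.one_closed]] cA cC _ Xc])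
      (simp add: tI_pure[OF cA] p(2) sl(2) pi1_C C_sub pure_tensor_simps, use pure_tensor_simps(5)[of _ A 1 T] in simp)
  then have "mu q (flag_inv X) = pure_tensor A T (flag_inv X) \<one>\<^bsub>T\<^esub>"
    unfolding mu_eq_rho[OF fA] rho_flag_inv[OF X] .
  then show ?thesis using fA by (simp add: flag_def)
qed

lemma flag_map_inv:
  assumes X: "X \<in> cotensor A (rho q) H C (CP1_coaction q)" shows "flag_map (flag_inv X) = X"
  using X unfolding flag_map_def rho_flag_inv[OF X] by (intro tE_tI[OF cA]) (simp add: cotensor_iff)

lemma bij_flag_map: "bij_betw flag_map (carrier (flag q)) (carrier (SU_cotensor_CP1 q))"
  by (rule bij_betwI[where g = flag_inv])
    (auto simp: SU_cotensor_CP1_def flag_map_cotensor flag_inv_closed flag_inv_map flag_map_inv)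

end

section \<open>Circle-invariant elements are coinvariant\<close>

lemma star_free_power: "star free_alg (p ^ n) = star free_alg p ^ n"
  by (induction n) (simp_all add: star_free_simps power_commutes)

lemma sum_unit_root_powers:
  assumes z: "z ^ N = 1" "z powi k \<noteq> 1"
  shows "(\<Sum>j<N. (z ^ j :: complex) powi k) = 0"
proof -
  have c: "(z ^ j) powi k = (z powi k) ^ j" for j
    by (simp add: power_int_def power_mult[symmetric] power_inverse mult.commute)
  have "(z powi k) ^ N = 1" using z(1) c[of N] by simp
  then show ?thesis using z(2) by (simp add: c geometric_sum)
qed

context quantum_flag
begin

interpretation A: star_algebra A by (rule sA)
interpretation H: star_algebra H by (rule sH)
interpretation T: star_algebra T by (rule sT)
interpretation C: complex_space C by (rule cC)
interpretation AH: star_algebra "tensor A H" by (rule star_algebra_tensor[OF sA sH])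
interpretation AT: star_algebra "tensor A T" by (rule star_algebra_tensor[OF sA sT])

text \<open>The integer powers of the unitary \<open>u\<close>. They are group-like and implement the circle action.\<close>

definition upow :: "int \<Rightarrow> uq2_gen free set" where "upow k = u2_cls q (zpow Uu k)"

lemma upow_closed [simp]: "upow k \<in> carrier H"
  by (simp add: upow_def carrier_U2)

lemma u2_cls_mult: "u2_cls q (p * r) = u2_cls q p \<otimes>\<^bsub>H\<^esub> u2_cls q r"
  using star_hom_mult[OF star_hom_u2_cls, of p r] by simp

lemma u2_cls_star: "u2_cls q (star free_alg p) = star H (u2_cls q p)"
  using star_hom_star[OF star_hom_u2_cls, of p] by simp

lemma upow_0: "upow 0 = \<one>\<^bsub>H\<^esub>"
  using star_hom_one[OF star_hom_u2_cls, of q] by (simp add: upow_def zpow_def)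

lemma upow_1: "upow 1 = u2_v q I1 I1"
  by (simp add: upow_def zpow_def u2_v_matrix)

lemma upow_star: "star H (upow k) = upow (- k)"
proof -
  have "star free_alg (zpow Uu k) = zpow Uu (- k)"
    by (cases "k = 0") (auto simp: zpow_def star_free_power star_free_simps)
  then show ?thesis by (simp add: upow_def u2_cls_star[symmetric])
qed

lemma upow_step: "upow (k + 1) = u2_v q I1 I1 \<otimes>\<^bsub>H\<^esub> upow k" "upow (k - 1) = star H (u2_v q I1 I1) \<otimes>\<^bsub>H\<^esub> upow k"
proof -
  note r = u2_cong_rels[OF q_nonzero[OF q]]
  have "u2_cls q (gen Uu * zpow Uu k) = u2_cls q (zpow Uu (k + 1))"
    using zpow_step[OF q_nonzero[OF q] r(1)] unfolding u2_cls_eq_iff u2_cong_def[OF q_nonzero[OF q]] .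
  then show "upow (k + 1) = u2_v q I1 I1 \<otimes>\<^bsub>H\<^esub> upow k"
    by (simp add: upow_def u2_cls_mult u2_v_matrix)
  have "u2_cls q (gen_star Uu * zpow Uu k) = u2_cls q (zpow Uu (k - 1))"
    using zpow_step_star[OF q_nonzero[OF q] r(2)] unfolding u2_cls_eq_iff u2_cong_def[OF q_nonzero[OF q]] .
  then show "upow (k - 1) = star H (u2_v q I1 I1) \<otimes>\<^bsub>H\<^esub> upow k"
    by (simp add: upow_def u2_cls_mult u2_v_matrix u2_cls_star[symmetric])
qed

lemma upow_add: "upow k \<otimes>\<^bsub>H\<^esub> upow l = upow (k + l)"
proof (induction k rule: int_induct[of _ 0])
  case base
  then show ?case by (simp add: upow_0)
next
  case (step1 i)
  then show ?case using upow_step(1)[of "i + l"] upow_step(1)[of i] by (simp add: H.m_assoc algebra_simps)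
next
  case (step2 i)
  then show ?case using upow_step(2)[of "i + l"] upow_step(2)[of i] by (simp add: H.m_assoc algebra_simps)
qed

lemma pi1_upow: "pi1 q (upow k) = Poly_Mapping.single (k, 0) 1"
proof (induction k rule: int_induct[of _ 0])
  case base
  then show ?case using star_hom_one[OF pi1[OF q]] by (simp add: upow_0 zero_prod_def[symmetric])
next
  case (step1 i)
  then show ?case
    by (simp add: upow_step(1) star_hom_mult[OF pi1[OF q]] pi1_v[OF q] mult_single, simp add: add.commute)
next
  case (step2 i)
  then show ?case
    by (simp add: upow_step(2) star_hom_mult[OF pi1[OF q]] star_hom_star[OF pi1[OF q]] pi1_v[OF q] star_torus_single mult_single)
qed

text \<open>These are weight spaces for the coaction of \<open>U_q(2)\<close>, not merely for the torus; an element of the right torus weight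
  need not lie in them. The first column of the fundamental matrix does, since the other entries of the
  first column of \<open>v\<close> vanish.\<close>

definition wt :: "int \<Rightarrow> su_gen free set set" where
  "wt k = {b \<in> carrier A. rho q b = pure_tensor A H b (upow k)}"

lemma graded_A: "graded A wt"
proof (rule graded.intro[OF sA], rule graded_axioms.intro)
  fix a b i j c
  assume a: "a \<in> wt i"
  then have ac: "a \<in> carrier A" and an: "rho q a = pure_tensor A H a (upow i)" by (simp_all add: wt_def)
  show "a \<in> carrier A" by fact
  show "c \<odot>\<^bsub>A\<^esub> a \<in> wt i"
    using ac by (simp add: wt_def star_hom_smult[OF rho] an pure_tensor_simps)
  show "star A a \<in> wt (- i)"
    using ac by (simp add: wt_def star_hom_star[OF rho] an pure_tensor_star[OF sA sH] upow_star)
  assume b: "b \<in> wt j"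
  then have bc: "b \<in> carrier A" and bn: "rho q b = pure_tensor A H b (upow j)" by (simp_all add: wt_def)
  show "a \<otimes>\<^bsub>A\<^esub> b \<in> wt (i + j)"
    using ac bc by (simp add: wt_def star_hom_mult[OF rho] an bn pure_tensor_mult[OF sA sH] upow_add)
next
  show "\<one>\<^bsub>A\<^esub> \<in> wt 0"
    using star_hom_one[OF rho] tensor_one[OF sA sH] by (simp add: wt_def upow_0)
qed

interpretation G: graded A wt by (rule graded_A)

lemma wt_add: "a \<in> wt k \<Longrightarrow> b \<in> wt k \<Longrightarrow> a \<oplus>\<^bsub>A\<^esub> b \<in> wt k"
  by (simp add: wt_def star_hom_add[OF rho] pure_tensor_simps)

lemma wt_zero: "\<zero>\<^bsub>A\<^esub> \<in> wt k"
  using linear_on_zero[OF star_hom_linear[OF rho] cA complex_space_tensor] pure_zero_left[OF cA cH upow_closed]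
  by (simp add: wt_def)

lemma u_wt: "su_u q j I1 \<in> wt 1"
proof -
  note z = pure_zero_right[OF cA cH u_closed]
  have "u2_v q I2 I1 = \<zero>\<^bsub>H\<^esub>" "u2_v q I3 I1 = \<zero>\<^bsub>H\<^esub>" by (simp_all add: u2_v_matrix u2_matrix_def)
  then show ?thesis by (simp add: wt_def rho_u AH.finsum_idx z upow_1)
qed

abbreviation "S \<equiv> S5 q"

lemma S5_simps [simp]: "monoid.mult S = monoid.mult A" "one S = one A" "zero S = zero A" "add S = add A"
    "smult S = smult A" "star S = star A"
  by (simp_all add: S5_def)

lemma carrier_S5: "carrier S = alg_gen A ({su_u q j I1 | j. True} \<union> star A ` {su_u q j I1 | j. True})"
  by (simp add: S5_def star_alg_gen_def)

lemma S5_induct [consumes 1, case_names gen gen_star one add mult smult]: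
  assumes "x \<in> carrier S"
    and "\<And>j. P (su_u q j I1)" "\<And>j. P (star A (su_u q j I1))" "P \<one>\<^bsub>A\<^esub>"
    and "\<And>x y. x \<in> carrier S \<Longrightarrow> y \<in> carrier S \<Longrightarrow> P x \<Longrightarrow> P y \<Longrightarrow> P (x \<oplus>\<^bsub>A\<^esub> y)"
    and "\<And>x y. x \<in> carrier S \<Longrightarrow> y \<in> carrier S \<Longrightarrow> P x \<Longrightarrow> P y \<Longrightarrow> P (x \<otimes>\<^bsub>A\<^esub> y)"
    and "\<And>c x. x \<in> carrier S \<Longrightarrow> P x \<Longrightarrow> P (c \<odot>\<^bsub>A\<^esub> x)"
  shows "P x"
  using assms(1) unfolding carrier_S5
  by (induction rule: alg_gen.induct) (use assms(2-) in \<open>auto simp: carrier_S5\<close>)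

lemma S5_intros: "su_u q j I1 \<in> carrier S" "star A (su_u q j I1) \<in> carrier S" "\<one>\<^bsub>A\<^esub> \<in> carrier S"
  "x \<in> carrier S \<Longrightarrow> y \<in> carrier S \<Longrightarrow> x \<oplus>\<^bsub>A\<^esub> y \<in> carrier S"
  "x \<in> carrier S \<Longrightarrow> y \<in> carrier S \<Longrightarrow> x \<otimes>\<^bsub>A\<^esub> y \<in> carrier S"
  "x \<in> carrier S \<Longrightarrow> c \<odot>\<^bsub>A\<^esub> x \<in> carrier S"
  unfolding carrier_S5 by (auto intro: alg_gen.intros)

lemma S5_span: "x \<in> carrier S \<Longrightarrow> x \<in> graded_span A wt"
  by (induction rule: S5_induct)
    (simp_all add: G.wt_span[OF u_wt] G.wt_span[OF G.wt_star[OF u_wt]] G.wt_span[OF G.wt_one] G.span_add G.span_mult G.span_smult)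

lemma S5_sub: "x \<in> carrier S \<Longrightarrow> x \<in> carrier A"
  by (rule G.span_closed[OF S5_span])

lemma S5_zero: "\<zero>\<^bsub>A\<^esub> \<in> carrier S"
  using S5_intros(6)[OF S5_intros(3), of 0] by simp

lemma S5_star: "x \<in> carrier S \<Longrightarrow> star A x \<in> carrier S"
  by (induction rule: S5_induct) (simp_all add: S5_intros A.star_add A.star_mult A.star_smult S5_sub)

lemma star_algebra_S5: "star_algebra S"
proof -
  have "star_algebra (A\<lparr>carrier := carrier S\<rparr>)"
    by (rule star_algebra_subalgebra[OF sA]) (simp_all add: S5_sub S5_zero S5_intros S5_star subsetI)
  then show ?thesis by (simp add: S5_def)
qed

text \<open>The circle action, extended from the quantum sphere to all of \<open>A\<close>.\<close>

definition theta :: "complex \<Rightarrow> su_gen free set \<Rightarrow> su_gen free set" where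
  "theta z x = slice A T (torus_char z) (mu q x)"

lemma theta: assumes "cmod z = 1" shows "star_hom A A (theta z)"
  unfolding theta_def[abs_def] by (rule star_hom_comp[OF mu star_hom_slice[OF sA sT star_hom_torus_char[OF assms]]])

lemma mu_wt: "b \<in> wt k \<Longrightarrow> mu q b = pure_tensor A T b (Poly_Mapping.single (k, 0) 1)"
  by (simp add: wt_def mu_eq_rho tensor_map_pure[OF cA cH linear_on_id star_hom_linear[OF pi1[OF q]]] pi1_upow)

lemma theta_wt: assumes "cmod z = 1" "b \<in> wt k" shows "theta z b = z powi k \<odot>\<^bsub>A\<^esub> b"
  using slice_pure[OF cA cT star_hom_linear[OF star_hom_torus_char[OF assms(1)]]] assms(2)
  by (simp add: theta_def mu_wt G.wt_closed torus_char_single)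

lemma theta_S5: assumes z: "cmod z = 1" shows "x \<in> carrier S \<Longrightarrow> theta z x \<in> carrier S"
  by (induction rule: S5_induct)
    (simp_all add: theta_wt[OF z u_wt] theta_wt[OF z G.wt_star[OF u_wt]] S5_intros star_hom_one[OF theta[OF z]]
      star_hom_add[OF theta[OF z]] star_hom_mult[OF theta[OF z]] star_hom_smult[OF theta[OF z]] S5_sub)

lemma star_hom_theta_S5: assumes z: "cmod z = 1" shows "star_hom S S (theta z)"
  by (rule star_homI[OF linear_onI])
    (simp_all add: theta_S5[OF z] star_hom_one[OF theta[OF z]] star_hom_star[OF theta[OF z]]
      star_hom_add[OF theta[OF z]] star_hom_mult[OF theta[OF z]] star_hom_smult[OF theta[OF z]] S5_sub)

lemma S5_hom_unique:
  assumes g: "star_hom S S g" and h: "star_hom S S h" and e: "\<And>j. g (su_u q j I1) = h (su_u q j I1)"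
  shows "x \<in> carrier S \<Longrightarrow> g x = h x"
proof (induction rule: S5_induct)
  case (gen_star j)
  show ?case using star_hom_star[OF g S5_intros(1)] star_hom_star[OF h S5_intros(1)] e by simp
next
  case one
  show ?case using star_hom_one[OF g] star_hom_one[OF h] by simp
next
  case (add x y)
  then show ?case using star_hom_add[OF g, of x y] star_hom_add[OF h, of x y] by simp
next
  case (mult x y)
  then show ?case using star_hom_mult[OF g, of x y] star_hom_mult[OF h, of x y] by simp
next
  case (smult c x)
  then show ?case using star_hom_smult[OF g, of x c] star_hom_smult[OF h, of x c] by simp
qed (rule e)

lemma circle_action_theta:
  assumes z: "cmod z = 1" and x: "x \<in> carrier S"
  shows "circle_action q z x = theta z x"
proof -
  have t: "theta z (su_u q j I1) = z \<odot>\<^bsub>A\<^esub> su_u q j I1" for j by (simp add: theta_wt[OF z u_wt])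
  have "star_hom S S (circle_action q z) \<and> (\<forall>j. circle_action q z (su_u q j I1) = z \<odot>\<^bsub>S\<^esub> su_u q j I1)"
    unfolding circle_action_def
  proof (rule star_homs_the[OF star_hom_theta_S5[OF z] star_algebra_S5])
    show "\<forall>j. restrict (theta z) (carrier S) (su_u q j I1) = z \<odot>\<^bsub>S\<^esub> su_u q j I1" by (simp add: S5_intros t)
    show "\<forall>x\<in>carrier S. g x = h x"
      if "star_hom S S g" "star_hom S S h" "\<forall>j. g (su_u q j I1) = z \<odot>\<^bsub>S\<^esub> su_u q j I1" "\<forall>j. h (su_u q j I1) = z \<odot>\<^bsub>S\<^esub> su_u q j I1" for g h
      using S5_hom_unique[OF that(1,2)] that(3,4) by simp
  qed
  then show ?thesis using S5_hom_unique[OF _ star_hom_theta_S5[OF z] _ x] t by simp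
qed

text \<open>Up to the factor \<open>1 / n\<close> this is the average over the cyclic group generated by an \<open>n\<close>-th root of unity \<open>z\<close>.\<close>

primrec orbit_sum :: "complex \<Rightarrow> nat \<Rightarrow> su_gen free set \<Rightarrow> su_gen free set" where
  "orbit_sum z 0 b = \<zero>\<^bsub>A\<^esub>"
| "orbit_sum z (Suc n) b = orbit_sum z n b \<oplus>\<^bsub>A\<^esub> theta (z ^ n) b"

lemma orbit_sum_props:
  assumes z: "cmod z = 1"
  shows orbit_sum_closed: "b \<in> carrier A \<Longrightarrow> orbit_sum z n b \<in> carrier A"
    and orbit_sum_add: "a \<in> carrier A \<Longrightarrow> b \<in> carrier A \<Longrightarrow> orbit_sum z n (a \<oplus>\<^bsub>A\<^esub> b) = orbit_sum z n a \<oplus>\<^bsub>A\<^esub> orbit_sum z n b"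
    and orbit_sum_wt: "a \<in> wt k \<Longrightarrow> orbit_sum z n a = (\<Sum>j<n. (z ^ j) powi k) \<odot>\<^bsub>A\<^esub> a"
    and orbit_sum_fixed: "b \<in> carrier A \<Longrightarrow> (\<And>z. cmod z = 1 \<Longrightarrow> theta z b = b) \<Longrightarrow> orbit_sum z n b = of_nat n \<odot>\<^bsub>A\<^esub> b"
proof -
  have zn: "cmod (z ^ n) = 1" for n using z by (simp add: norm_power)
  note t = theta[OF zn]
  show c: "b \<in> carrier A \<Longrightarrow> orbit_sum z n b \<in> carrier A" for b n
    by (induction n) (simp_all add: star_hom_closed[OF t])
  show "a \<in> carrier A \<Longrightarrow> b \<in> carrier A \<Longrightarrow> orbit_sum z n (a \<oplus>\<^bsub>A\<^esub> b) = orbit_sum z n a \<oplus>\<^bsub>A\<^esub> orbit_sum z n b"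
    by (induction n) (simp_all add: star_hom_add[OF t] star_hom_closed[OF t] c A.a_ac)
  show "a \<in> wt k \<Longrightarrow> orbit_sum z n a = (\<Sum>j<n. (z ^ j) powi k) \<odot>\<^bsub>A\<^esub> a"
    by (induction n) (simp_all add: theta_wt[OF zn] G.wt_closed A.smult_add_scalar)
  assume b: "b \<in> carrier A" and fx: "\<And>z. cmod z = 1 \<Longrightarrow> theta z b = b"
  show "orbit_sum z n b = of_nat n \<odot>\<^bsub>A\<^esub> b"
    by (induction n) (simp_all add: fx[OF zn] b A.smult_add_scalar A.a_comm)
qed

abbreviation "unit_root N \<equiv> cis (2 * pi / real N)"

lemma unit_root_props:
  shows "cmod (unit_root N) = 1" "N > 0 \<Longrightarrow> unit_root N ^ N = 1"
    "k \<noteq> 0 \<Longrightarrow> nat \<bar>k\<bar> < N \<Longrightarrow> unit_root N powi k \<noteq> 1"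
proof -
  show "cmod (unit_root N) = 1" by simp
  show "unit_root N ^ N = 1" if "N > 0" using that by (simp add: DeMoivre)
  assume k: "k \<noteq> 0" "nat \<bar>k\<bar> < N"
  show "unit_root N powi k \<noteq> 1"
  proof
    assume "unit_root N powi k = 1"
    then have "cos (of_int k * (2 * pi / real N)) = 1" by (simp add: cis_power_int complex_eq_iff)
    then obtain n :: int where "of_int k * (2 * pi / real N) = of_int n * 2 * pi" unfolding cos_one_2pi_int by auto
    then have "real_of_int k = of_int n * real N" using k by (simp add: field_simps)
    then have "k = n * int N" by (metis of_int_eq_iff of_int_mult of_int_of_nat_eq)
    then show False using k by (simp add: abs_mult nat_mult_distrib)
  qed
qed

text \<open>The component of weight \<open>k \<noteq> 0\<close> is multiplied by a vanishing sum of roots of unity as soon as \<open>N\<close> exceeds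
  \<open>\<bar>k\<bar>\<close>; an element has only finitely many components, so all large \<open>N\<close> work.\<close>

lemma orbit_sum_span:
  assumes "b \<in> graded_span A wt"
  shows "\<exists>N0>0. \<forall>N\<ge>N0. orbit_sum (unit_root N) N b \<in> wt 0"
  using assms
proof (induction rule: graded_span.induct)
  case zero
  have "orbit_sum (unit_root N) N \<zero>\<^bsub>A\<^esub> \<in> wt 0" for N
    by (simp add: orbit_sum_wt[OF unit_root_props(1) wt_zero[of 0]] wt_zero)
  then show ?case by blast
next
  case (add a i b)
  then obtain N0 where N0: "N0 > 0" "\<And>N. N \<ge> N0 \<Longrightarrow> orbit_sum (unit_root N) N b \<in> wt 0" by blast
  have "orbit_sum (unit_root N) N (a \<oplus>\<^bsub>A\<^esub> b) \<in> wt 0" if N: "N \<ge> max N0 (Suc (nat \<bar>i\<bar>))" for N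
  proof -
    have "orbit_sum (unit_root N) N a \<in> wt 0"
    proof (cases "i = 0")
      case True
      then show ?thesis using add(1) by (simp add: orbit_sum_wt[OF unit_root_props(1) add(1)] G.wt_smult)
    next
      case False
      have "(\<Sum>j<N. (unit_root N ^ j) powi i) = 0"
        by (rule sum_unit_root_powers) (use N False unit_root_props(2,3) in auto)
      then show ?thesis using G.wt_closed[OF add(1)] by (simp add: orbit_sum_wt[OF unit_root_props(1) add(1)] wt_zero)
    qed
    then show ?thesis
      using N0(2)[of N] N add by (simp add: orbit_sum_add[OF unit_root_props(1)] G.wt_closed G.span_closed wt_add)
  qed
  then show ?case by (intro exI[of _ "max N0 (Suc (nat \<bar>i\<bar>))"]) auto
qed

text \<open>An element fixed by the circle equals its own average, which lies in \<open>wt 0\<close>, the coinvariants.\<close>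

lemma CP2_D:
  assumes b: "b \<in> carrier (CP2 q)"
  shows CP2_sub: "b \<in> carrier A"
    and rho_CP2: "rho q b = pure_tensor A H b \<one>\<^bsub>H\<^esub>" and mu_CP2: "mu q b = pure_tensor A T b \<one>\<^bsub>T\<^esub>"
proof -
  have bS: "b \<in> carrier S" using b by (simp add: CP2_def)
  show bA: "b \<in> carrier A" by (rule S5_sub[OF bS])
  have fx: "theta z b = b" if "cmod z = 1" for z
    using b circle_action_theta[OF that bS] that by (simp add: CP2_def)
  obtain N where N: "N > 0" "orbit_sum (unit_root N) N b \<in> wt 0"
    using orbit_sum_span[OF S5_span[OF bS]] by blast
  have "orbit_sum (unit_root N) N b = of_nat N \<odot>\<^bsub>A\<^esub> b"
    by (rule orbit_sum_fixed[OF unit_root_props(1) bA]) (rule fx)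
  then have "(1 / of_nat N) \<odot>\<^bsub>A\<^esub> (of_nat N \<odot>\<^bsub>A\<^esub> b) \<in> wt 0"
    using G.wt_smult[OF N(2), of "1 / of_nat N"] by simp
  then have w: "b \<in> wt 0" using N(1) bA by simp
  then show "rho q b = pure_tensor A H b \<one>\<^bsub>H\<^esub>" by (simp add: wt_def upow_0)
  show "mu q b = pure_tensor A T b \<one>\<^bsub>T\<^esub>" using mu_wt[OF w] by (simp add: zero_prod_def[symmetric])
qed

section \<open>The two modules\<close>

lemma carrier_CP2: "carrier (CP2 q) = {b \<in> carrier S. \<forall>z. cmod z = 1 \<longrightarrow> theta z b = b}"
  by (auto simp: CP2_def circle_action_theta)

lemma ring_CP2: "ring (CP2 q)"
proof -
  have z: "theta z \<zero>\<^bsub>A\<^esub> = \<zero>\<^bsub>A\<^esub>" if "cmod z = 1" for z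
    by (rule linear_on_zero[OF star_hom_linear[OF theta[OF that]] cA cA])
  have "ring (A\<lparr>carrier := carrier (CP2 q)\<rparr>)"
    by (rule ring_subalgebra[OF sA])
      (auto simp: carrier_CP2 S5_sub S5_zero S5_intros z star_hom_one[OF theta]
        star_hom_add[OF theta] star_hom_mult[OF theta] star_hom_smult[OF theta])
  then show ?thesis by (simp add: CP2_def)
qed

lemma complex_space_flag: "complex_space (flag q)"
  unfolding flag_def
  by (rule complex_space_subspace[OF cA])
    (simp_all add: subsetI star_hom_add[OF mu] star_hom_smult[OF mu] pure_tensor_simps
      linear_on_zero[OF star_hom_linear[OF mu] cA complex_space_tensor] pure_zero_left[OF cA cT])

lemma complex_space_cotensor: "complex_space (SU_cotensor_CP1 q)"
proof -
  interpret AC: complex_space "tensor A C" by (rule complex_space_tensor)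
  note l = linear_left_side and r = linear_right_side
  note z = linear_on_zero[OF l complex_space_tensor complex_space_tensor] linear_on_zero[OF r complex_space_tensor complex_space_tensor]
  show ?thesis
    unfolding SU_cotensor_CP1_def
    by (rule complex_space_subspace[OF complex_space_tensor subsetI])
      (simp_all add: cotensor_iff z linear_on_add[OF l] linear_on_add[OF r] linear_on_smult[OF l] linear_on_smult[OF r])
qed

lemma flag_act_closed:
  assumes b: "b \<in> carrier (CP2 q)" and f: "f \<in> carrier (flag q)" shows "flag_act q b f \<in> carrier (flag q)"
  using f CP2_sub[OF b]
  by (simp add: flag_def flag_act_def star_hom_mult[OF mu] mu_CP2[OF b] pure_tensor_mult[OF sA sT])

lemma cotensor_act:
  assumes b: "b \<in> carrier A"
  shows linear_cotensor_act: "linear_on (tensor A C) (tensor A C) (cotensor_act q b)"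
    and cotensor_act_pure: "x \<in> carrier A \<Longrightarrow> y \<in> carrier C \<Longrightarrow> cotensor_act q b (pure_tensor A C x y) = pure_tensor A C (b \<otimes>\<^bsub>A\<^esub> x) y"
  unfolding cotensor_act_def using tensor_map[OF cA cC A.linear_on_mult_left[OF b] linear_on_id] by auto

lemma tE_mult_left:
  assumes b: "b \<in> carrier A" and Z: "Z \<in> carrier (tensor A H)"
  shows "tE A (pure_tensor A H b \<one>\<^bsub>H\<^esub> \<otimes>\<^bsub>tensor A H\<^esub> Z) = cotensor_act q b (tE A Z)"
  by (rule linear_on_tensor_eqI[OF linear_on_comp[OF AH.linear_on_mult_left linear_tE[OF cA]] linear_on_comp[OF linear_tE[OF cA] linear_cotensor_act[OF b]] cA cH _ Z])
    (simp_all add: b pure_tensor_mult[OF sA sH] tE_pure[OF cA] cotensor_act_pure expect_closed)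

lemma flag_map_act:
  assumes b: "b \<in> carrier (CP2 q)" and f: "f \<in> carrier (flag q)"
  shows "flag_map (flag_act q b f) = cotensor_act q b (flag_map f)"
  using CP2_sub[OF b] flag_sub[OF f]
  by (simp add: flag_map_def flag_act_def star_hom_mult[OF rho] rho_CP2[OF b] tE_mult_left star_hom_closed[OF rho])

lemma flag_map_add:
  assumes "f \<in> carrier A" "g \<in> carrier A" shows "flag_map (f \<oplus>\<^bsub>A\<^esub> g) = flag_map f \<oplus>\<^bsub>tensor A C\<^esub> flag_map g"
  using assms by (simp add: flag_map_def star_hom_add[OF rho] linear_on_add[OF linear_tE[OF cA]] star_hom_closed[OF rho])

lemma carrier_cotensor: "carrier (SU_cotensor_CP1 q) = cotensor A (rho q) H C (CP1_coaction q)"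
  by (simp add: SU_cotensor_CP1_def)

lemma cotensor_sub: "X \<in> carrier (SU_cotensor_CP1 q) \<Longrightarrow> X \<in> carrier (tensor A C)"
  by (simp add: carrier_cotensor cotensor_iff)

text \<open>Transported from the flag algebra along the bijection, so the cotensor condition is not verified
  again.\<close>

lemma cotensor_act_closed:
  assumes b: "b \<in> carrier (CP2 q)" and X: "X \<in> carrier (SU_cotensor_CP1 q)"
  shows "cotensor_act q b X \<in> carrier (SU_cotensor_CP1 q)"
proof -
  obtain f where f: "f \<in> carrier (flag q)" "X = flag_map f" using bij_flag_map X by (auto simp: bij_betw_def)
  show ?thesis
    unfolding f(2) flag_map_act[OF b f(1), symmetric]
    by (rule bij_betwE[OF bij_flag_map, rule_format, OF flag_act_closed[OF b f(1)]])
qed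

lemma left_module_flag: "left_module (CP2 q) (flag q) (flag_act q)"
proof -
  interpret F: complex_space "flag q" by (rule complex_space_flag)
  have o: "\<one>\<^bsub>CP2 q\<^esub> = \<one>\<^bsub>A\<^esub>" "add (CP2 q) = add A" "monoid.mult (CP2 q) = monoid.mult A" "add (flag q) = add A"
    by (simp_all add: CP2_def flag_def)
  show ?thesis
    by (rule left_module.intro[OF ring_CP2 F.abelian_group_axioms], rule left_module_axioms.intro)
      (simp_all add: flag_act_closed, simp_all add: flag_act_def o CP2_sub flag_sub A.l_distr A.r_distr A.m_assoc)
qed

lemma left_module_cotensor: "left_module (CP2 q) (SU_cotensor_CP1 q) (cotensor_act q)"
proof -
  interpret F: complex_space "SU_cotensor_CP1 q" by (rule complex_space_cotensor)
  interpret AC: complex_space "tensor A C" by (rule complex_space_tensor)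
  have o: "\<one>\<^bsub>CP2 q\<^esub> = \<one>\<^bsub>A\<^esub>" "add (CP2 q) = add A" "monoid.mult (CP2 q) = monoid.mult A"
      "add (SU_cotensor_CP1 q) = add (tensor A C)"
    by (simp_all add: CP2_def SU_cotensor_CP1_def)
  have l: "cotensor_act q (r \<oplus>\<^bsub>A\<^esub> s) X = cotensor_act q r X \<oplus>\<^bsub>tensor A C\<^esub> cotensor_act q s X"
    and m: "cotensor_act q (r \<otimes>\<^bsub>A\<^esub> s) X = cotensor_act q r (cotensor_act q s X)"
    if rs: "r \<in> carrier A" "s \<in> carrier A" and X: "X \<in> carrier (tensor A C)" for r s X
  proof -
    note L = linear_cotensor_act and P = cotensor_act_pure
    have sl: "linear_on (tensor A C) (tensor A C) (\<lambda>X. cotensor_act q r X \<oplus>\<^bsub>tensor A C\<^esub> cotensor_act q s X)"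
      by (rule linear_onI)
        (simp_all add: linear_on_closed[OF L] linear_on_add[OF L] linear_on_smult[OF L] rs AC.smult_add AC.a_ac)
    show "cotensor_act q (r \<oplus>\<^bsub>A\<^esub> s) X = cotensor_act q r X \<oplus>\<^bsub>tensor A C\<^esub> cotensor_act q s X"
      by (rule linear_on_tensor_eqI[OF L sl cA cC _ X]) (simp_all add: P rs A.l_distr pure_tensor_simps)
    show "cotensor_act q (r \<otimes>\<^bsub>A\<^esub> s) X = cotensor_act q r (cotensor_act q s X)"
      by (rule linear_on_tensor_eqI[OF L linear_on_comp[OF L[OF rs(2)] L[OF rs(1)]] cA cC _ X])
        (simp_all add: P rs A.m_assoc)
  qed
  have one: "cotensor_act q \<one>\<^bsub>A\<^esub> X = X" if X: "X \<in> carrier (tensor A C)" for X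
    by (rule linear_on_tensor_eqI[OF linear_cotensor_act linear_on_id cA cC _ X]) (simp_all add: cotensor_act_pure)
  show ?thesis
    by (rule left_module.intro[OF ring_CP2 F.abelian_group_axioms], rule left_module_axioms.intro)
      (simp_all add: cotensor_act_closed, simp_all add: o l m one CP2_sub cotensor_sub linear_on_add[OF linear_cotensor_act])
qed

lemma module_iso_flag_map:
  "left_module_iso (CP2 q) (flag q) (flag_act q) (SU_cotensor_CP1 q) (cotensor_act q) flag_map"
  unfolding left_module_iso_def
  using left_module_flag left_module_cotensor bij_flag_map flag_map_act flag_map_add[OF flag_sub flag_sub]
  by (simp add: flag_def SU_cotensor_CP1_def)

end

theorem theorem3p6:
  fixes q :: real
  assumes "0 < q" and "q < 1"
  shows "\<exists>\<phi>. left_module_iso (CP2 q) (flag q) (flag_act q) (SU_cotensor_CP1 q) (cotensor_act q) \<phi>"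
  using quantum_flag.module_iso_flag_map[OF quantum_flag.intro[OF assms]] by blast

end
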